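(* Let $A$ be an algebra of finite type over a perfect field $k$ and let $E$ be a finitely generated $A$-module with a fixed embedding $E/\tau_A(E)\hookrightarrow F$ into a free $A$-module $F$ of finite rank. Let $R\twoheadrightarrow A$ be a $k$-algebra surjection, where $R$ is a smooth algebra of finite type over $k$. Then the structural map of $A$-algebras $\mathcal{A}_A(E)\twoheadrightarrow\mathcal{A}_{R\twoheadrightarrow A}(E)$ from the absolute Aluffi algebra to the $R$-embedded Aluffi algebra is an isomorphism.
   Context: Torsion and Rees algebra. For a finitely generated module $M$ over a Noetherian ring $B$, $\tau_B(M)$ is the submodule of elements annihilated by some nonzerodivisor of $B$; $\mathcal{S}_B(M)$ is the symmetric algebra; the Rees algebra is $\mathcal{R}_B(M)=\mathcal{S}_B(M)/\tau_B(\mathcal{S}_B(M))$. Deformation. Let $E$ be a finitely generated $A$-module with a fixed embedding $E/\tau_A(E)\hookrightarrow F$, $F$ free of rank $n$. Let $R\twoheadrightarrow A$ be a ring surjection with kernel $J$. Let $\mathbf{F}$ be a free $R$-module of rank $n$ with an $R$-module surjection $\mathbf{F}\twoheadrightarrow F$ whose kernel is $J\mathbf{F}$. The (torsionfree) $J$-deformation $\mathbf{E}$ of $E$ to $R$ is the inverse image of $E/\tau_A(E)\subset F$ in $\mathbf{F}$; it contains $J\mathbf{F}$ and is unique up to congruence, i.e. up to isomorphisms of the ambient free modules compatible with the surjections to $F$. Embedded Aluffi algebra. $\mathcal{A}_{R\twoheadrightarrow A}(E):=\mathcal{S}_A(E/\tau_A(E))\otimes_{\mathcal{S}_R(\mathbf{E})}\mathcal{R}_R(\mathbf{E})$,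 where $\mathcal{S}_R(\mathbf{E})\to\mathcal{S}_A(E/\tau_A(E))$ is induced by the surjection $\mathbf{E}\to E/\tau_A(E)$. Absolute Aluffi algebra. Consider the system of $k$-algebra surjections $R\twoheadrightarrow A$ with $R$ a $k$-algebra of finite type, with transition maps the surjective $k$-algebra homomorphisms $R\to R'$ commuting with the given surjections to $A$. Such an $R\to R'$ induces a natural map $\mathbf{F}\to\mathbf{F}'$ of the ambient free modules, compatible with the surjections to $F$ and mapping $\mathbf{E}$ to $\mathbf{E}'$, and hence an $A$-algebra surjection $\mathcal{A}_{R\twoheadrightarrow A}(E)\to\mathcal{A}_{R'\twoheadrightarrow A}(E)$. These form an inverse system, and $\mathcal{A}_A(E):=\varprojlim_{R\twoheadrightarrow A}\mathcal{A}_{R\twoheadrightarrow A}(E)$. The structural map is the projection of the limit to the member indexed by $R\twoheadrightarrow A$.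
   Formalization: The limit runs only over those surjections R→A for which every surjection onto R from another member induces the asserted map of embedded Aluffi algebras; such maps need not exist for non-reduced R (e.g. A=k[x,y]/m^3, E=m^2A), so the full inverse system can be undefined. *)

theory Defs
  imports "HOL-Algebra.Module" "HOL-Algebra.QuotRing" "HOL-Algebra.Generated_Rings"
    "HOL-Algebra.IntRing" "HOL-Library.Multiset"
begin

section \<open>Algebras\<close>

text \<open>
  An algebra over a commutative ring \<open>K\<close> is a commutative ring \<open>R\<close> together with a structure
  homomorphism \<open>K \<rightarrow> R\<close>, carried along explicitly.
\<close>

definition comm_algebra :: "'k ring \<Rightarrow> 'r ring \<Rightarrow> ('k \<Rightarrow> 'r) \<Rightarrow> bool"
  where "comm_algebra K R \<iota> \<longleftrightarrow> cring R \<and> \<iota> \<in> ring_hom K R"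

definition algebra_hom ::
    "'k ring \<Rightarrow> 'r ring \<Rightarrow> ('k \<Rightarrow> 'r) \<Rightarrow> 's ring \<Rightarrow> ('k \<Rightarrow> 's) \<Rightarrow> ('r \<Rightarrow> 's) set"
  where "algebra_hom K R \<iota> S \<sigma> = {h \<in> ring_hom R S. \<forall>a\<in>carrier K. h (\<iota> a) = \<sigma> a}"

definition algebra_iso ::
    "'k ring \<Rightarrow> 'r ring \<Rightarrow> ('k \<Rightarrow> 'r) \<Rightarrow> 's ring \<Rightarrow> ('k \<Rightarrow> 's) \<Rightarrow> ('r \<Rightarrow> 's) set"
  where "algebra_iso K R \<iota> S \<sigma> = ring_iso R S \<inter> algebra_hom K R \<iota> S \<sigma>"

definition finite_type_algebra :: "'k ring \<Rightarrow> 'r ring \<Rightarrow> ('k \<Rightarrow> 'r) \<Rightarrow> bool"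
  where "finite_type_algebra K R \<iota> \<longleftrightarrow> comm_algebra K R \<iota> \<and>
    (\<exists>U. finite U \<and> U \<subseteq> carrier R \<and> generate_ring R (\<iota> ` carrier K \<union> U) = carrier R)"

definition perfect_field :: "'k ring \<Rightarrow> bool"
  where "perfect_field K \<longleftrightarrow> field K \<and>
    (\<forall>q::nat. Factorial_Ring.prime q \<and> add_pow K q \<one>\<^bsub>K\<^esub> = \<zero>\<^bsub>K\<^esub> \<longrightarrow>
      (\<forall>x\<in>carrier K. \<exists>y\<in>carrier K. y [^]\<^bsub>K\<^esub> q = x))"

text \<open>
  Smoothness over a field: finite type (so finite presentation) plus the infinitesimal lifting
  property.  The test algebras \<open>C\<close> have carriers in the type of \<open>R\<close>.  Writing \<open>R = P / I\<close> with
  \<open>P\<close> a polynomial algebra in finitely many variables, the lifting property against all test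
  algebras follows from the one against \<open>P / I\<^sup>2 \<rightarrow> P / I\<close>, so nothing is lost as soon as
  every algebra of finite type over \<open>K\<close> has an isomorphic copy in that type.
\<close>

definition smooth_algebra :: "'k ring \<Rightarrow> 'r ring \<Rightarrow> ('k \<Rightarrow> 'r) \<Rightarrow> bool"
  where "smooth_algebra K R \<iota> \<longleftrightarrow> finite_type_algebra K R \<iota> \<and>
    (\<forall>(C :: 'r ring) \<gamma> N.
      comm_algebra K C \<gamma> \<and> ideal N C \<and> (\<forall>x\<in>N. \<forall>y\<in>N. x \<otimes>\<^bsub>C\<^esub> y = \<zero>\<^bsub>C\<^esub>) \<longrightarrow>
      (\<forall>g\<in>algebra_hom K R \<iota> (C Quot N) (\<lambda>a. N +>\<^bsub>C\<^esub> \<gamma> a).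
        \<exists>h\<in>algebra_hom K R \<iota> C \<gamma>. \<forall>r\<in>carrier R. N +>\<^bsub>C\<^esub> h r = g r))"


section \<open>Modules\<close>

text \<open>The map on cosets induced by \<open>h\<close>; meaningful if \<open>h\<close> maps equal cosets into equal cosets of \<open>N'\<close>.\<close>

definition coset_map :: "('b, 'm) ring_scheme \<Rightarrow> 'b set \<Rightarrow> ('a \<Rightarrow> 'b) \<Rightarrow> 'a set \<Rightarrow> 'b set"
  where "coset_map M' N' h U = the_elem ((\<lambda>x. N' +>\<^bsub>M'\<^esub> h x) ` U)"

text \<open>
  The record type of modules extends the one of rings.  The multiplicative fields play no role
  for a module and are left unspecified here.
\<close>

definition quotient_module :: "('a, 'b) module \<Rightarrow> 'b set \<Rightarrow> ('a, 'b set) module"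
  where "quotient_module M N =
    \<lparr>carrier = a_rcosets\<^bsub>M\<^esub> N, monoid.mult = undefined, one = undefined,
     ring.zero = N, ring.add = set_add M, smult = (\<lambda>a. coset_map M N (\<lambda>x. a \<odot>\<^bsub>M\<^esub> x))\<rparr>"

definition semilinear_map ::
    "('r \<Rightarrow> 's) \<Rightarrow> 'r ring \<Rightarrow> ('r, 'b) module \<Rightarrow> ('s, 'c) module \<Rightarrow> ('b \<Rightarrow> 'c) \<Rightarrow> bool"
  where "semilinear_map \<phi> R M N f \<longleftrightarrow>
    f \<in> carrier M \<rightarrow> carrier N \<and>
    (\<forall>x\<in>carrier M. \<forall>y\<in>carrier M. f (x \<oplus>\<^bsub>M\<^esub> y) = f x \<oplus>\<^bsub>N\<^esub> f y) \<and>
    (\<forall>r\<in>carrier R. \<forall>x\<in>carrier M. f (r \<odot>\<^bsub>M\<^esub> x) = \<phi> r \<odot>\<^bsub>N\<^esub> f x)"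

abbreviation linear_map :: "'r ring \<Rightarrow> ('r, 'b) module \<Rightarrow> ('r, 'c) module \<Rightarrow> ('b \<Rightarrow> 'c) \<Rightarrow> bool"
  where "linear_map \<equiv> semilinear_map (\<lambda>r. r)"

text \<open>Finite sums of products \<open>j \<odot> x\<close> with \<open>j \<in> J\<close>, \<open>x \<in> U\<close> (for \<open>J\<close> an ideal).\<close>

definition smult_span :: "('r, 'b) module \<Rightarrow> 'r set \<Rightarrow> 'b set \<Rightarrow> 'b set"
  where "smult_span M J U = generate (add_monoid M) {j \<odot>\<^bsub>M\<^esub> x | j x. j \<in> J \<and> x \<in> U}"

definition fin_gen_module :: "'r ring \<Rightarrow> ('r, 'b) module \<Rightarrow> bool"
  where "fin_gen_module R M \<longleftrightarrow> module R M \<and>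
    (\<exists>U. finite U \<and> U \<subseteq> carrier M \<and> smult_span M (carrier R) U = carrier M)"

definition free_module :: "'r ring \<Rightarrow> ('r, 'b) module \<Rightarrow> nat \<Rightarrow> bool"
  where "free_module R M n \<longleftrightarrow> module R M \<and>
    (\<exists>e \<in> {..<n} \<rightarrow> carrier M. \<forall>x\<in>carrier M.
      \<exists>!c. c \<in> {..<n} \<rightarrow>\<^sub>E carrier R \<and> x = (\<Oplus>\<^bsub>M\<^esub>i\<in>{..<n}. c i \<odot>\<^bsub>M\<^esub> e i))"

definition nonzerodivisors :: "'r ring \<Rightarrow> 'r set"
  where "nonzerodivisors R =
    {b \<in> carrier R. \<forall>c\<in>carrier R. b \<otimes>\<^bsub>R\<^esub> c = \<zero>\<^bsub>R\<^esub> \<longrightarrow> c = \<zero>\<^bsub>R\<^esub>}"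

definition torsion :: "'r ring \<Rightarrow> ('r, 'b) module \<Rightarrow> 'b set"
  where "torsion R M = {x \<in> carrier M. \<exists>b\<in>nonzerodivisors R. b \<odot>\<^bsub>M\<^esub> x = \<zero>\<^bsub>M\<^esub>}"

abbreviation torsionfree_quotient :: "'r ring \<Rightarrow> ('r, 'b) module \<Rightarrow> ('r, 'b set) module"
  where "torsionfree_quotient R M \<equiv> quotient_module M (torsion R M)"


section \<open>Monoid algebras, symmetric algebras, Rees algebras, tensor products\<close>

text \<open>Monoid algebra \<open>B[G]\<close>: finitely supported functions with the convolution product.\<close>

definition monoid_algebra :: "'r ring \<Rightarrow> ('g, 'm) monoid_scheme \<Rightarrow> ('g \<Rightarrow> 'r) ring"
  where "monoid_algebra B G =
    \<lparr>carrier = {p. (\<forall>g\<in>carrier G. p g \<in> carrier B) \<and> (\<forall>g. g \<notin> carrier G \<longrightarrow> p g = \<zero>\<^bsub>B\<^esub>) \<and>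
                   finite {g. p g \<noteq> \<zero>\<^bsub>B\<^esub>}},
     monoid.mult = (\<lambda>p q g. \<Oplus>\<^bsub>B\<^esub>c \<in> {(a, b). a \<in> carrier G \<and> b \<in> carrier G \<and>
                p a \<noteq> \<zero>\<^bsub>B\<^esub> \<and> q b \<noteq> \<zero>\<^bsub>B\<^esub> \<and> a \<otimes>\<^bsub>G\<^esub> b = g}. p (fst c) \<otimes>\<^bsub>B\<^esub> q (snd c)),
     one = (\<lambda>g. if g = \<one>\<^bsub>G\<^esub> then \<one>\<^bsub>B\<^esub> else \<zero>\<^bsub>B\<^esub>),
     ring.zero = (\<lambda>g. \<zero>\<^bsub>B\<^esub>),
     ring.add = (\<lambda>p q g. p g \<oplus>\<^bsub>B\<^esub> q g)\<rparr>"

definition monomial :: "'r ring \<Rightarrow> 'r \<Rightarrow> 'g \<Rightarrow> 'g \<Rightarrow> 'r"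
  where "monomial B r g = (\<lambda>g'. if g' = g then r else \<zero>\<^bsub>B\<^esub>)"

definition monoid_algebra_map ::
    "'r ring \<Rightarrow> 's ring \<Rightarrow> ('r \<Rightarrow> 's) \<Rightarrow> ('g \<Rightarrow> 'h) \<Rightarrow> ('g \<Rightarrow> 'r) \<Rightarrow> 'h \<Rightarrow> 's"
  where "monoid_algebra_map B B' \<phi> f p =
    (\<lambda>g'. \<Oplus>\<^bsub>B'\<^esub>g \<in> {g. p g \<noteq> \<zero>\<^bsub>B\<^esub> \<and> f g = g'}. \<phi> (p g))"

definition free_comm_monoid :: "'x set \<Rightarrow> 'x multiset monoid"
  where "free_comm_monoid U = \<lparr>carrier = {w. set_mset w \<subseteq> U}, monoid.mult = (+), one = {#}\<rparr>"

text \<open>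
  The symmetric algebra is the polynomial ring with one variable \<open>{#x#}\<close> for each element \<open>x\<close> of
  \<open>M\<close>, modulo the ideal making \<open>x \<mapsto> {#x#}\<close> linear.
\<close>

abbreviation poly_on :: "'r ring \<Rightarrow> ('r, 'b) module \<Rightarrow> ('b multiset \<Rightarrow> 'r) ring"
  where "poly_on B M \<equiv> monoid_algebra B (free_comm_monoid (carrier M))"

definition sym_ideal :: "'r ring \<Rightarrow> ('r, 'b) module \<Rightarrow> ('b multiset \<Rightarrow> 'r) set"
  where "sym_ideal B M = genideal (poly_on B M)
    ({monomial B \<one>\<^bsub>B\<^esub> {#x \<oplus>\<^bsub>M\<^esub> y#} \<ominus>\<^bsub>poly_on B M\<^esub>
        (monomial B \<one>\<^bsub>B\<^esub> {#x#} \<oplus>\<^bsub>poly_on B M\<^esub> monomial B \<one>\<^bsub>B\<^esub> {#y#}) | x y.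
        x \<in> carrier M \<and> y \<in> carrier M} \<union>
     {monomial B \<one>\<^bsub>B\<^esub> {#b \<odot>\<^bsub>M\<^esub> x#} \<ominus>\<^bsub>poly_on B M\<^esub> monomial B b {#x#} | b x.
        b \<in> carrier B \<and> x \<in> carrier M})"

definition sym_algebra :: "'r ring \<Rightarrow> ('r, 'b) module \<Rightarrow> ('r, ('b multiset \<Rightarrow> 'r) set) module"
  where "sym_algebra B M =
    (let Q = poly_on B M Quot sym_ideal B M in
      \<lparr>carrier = carrier Q, monoid.mult = monoid.mult Q, one = one Q,
       ring.zero = ring.zero Q, ring.add = ring.add Q,
       smult = (\<lambda>b s. (sym_ideal B M +>\<^bsub>poly_on B M\<^esub> monomial B b {#}) \<otimes>\<^bsub>Q\<^esub> s)\<rparr>)"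

text \<open>Functoriality: the ring map \<open>S\<^sub>B(M) \<rightarrow> S\<^sub>B\<^sub>'(M')\<close> induced by a \<open>\<phi>\<close>-semilinear map \<open>f\<close>.\<close>

definition sym_map ::
    "'r ring \<Rightarrow> ('r, 'b) module \<Rightarrow> 's ring \<Rightarrow> ('s, 'c) module \<Rightarrow> ('r \<Rightarrow> 's) \<Rightarrow> ('b \<Rightarrow> 'c) \<Rightarrow>
      ('b multiset \<Rightarrow> 'r) set \<Rightarrow> ('c multiset \<Rightarrow> 's) set"
  where "sym_map B M B' M' \<phi> f =
    coset_map (poly_on B' M') (sym_ideal B' M') (monoid_algebra_map B B' \<phi> (image_mset f))"

definition rees_algebra :: "'r ring \<Rightarrow> ('r, 'b) module \<Rightarrow> ('b multiset \<Rightarrow> 'r) set set ring"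
  where "rees_algebra B M = sym_algebra B M Quot torsion B (sym_algebra B M)"

definition rees_proj ::
    "'r ring \<Rightarrow> ('r, 'b) module \<Rightarrow> ('b multiset \<Rightarrow> 'r) set \<Rightarrow> ('b multiset \<Rightarrow> 'r) set set"
  where "rees_proj B M s = torsion B (sym_algebra B M) +>\<^bsub>sym_algebra B M\<^esub> s"

text \<open>
  The tensor product \<open>B \<otimes>\<^sub>S C\<close> of commutative rings along \<open>f : S \<rightarrow> B\<close> and \<open>g : S \<rightarrow> C\<close>: the free
  abelian group on \<open>B \<times> C\<close> modulo the additive and balancing relations.  It is presented as a
  quotient of the monoid ring \<open>\<int>[B \<times> C]\<close>, whose product is \<open>(b, c) (b', c') = (b b', c c')\<close>; the
  subgroup generated by the relations is already an ideal.
\<close>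

abbreviation pair_ring ::
    "('b, 'm) ring_scheme \<Rightarrow> ('c, 'n) ring_scheme \<Rightarrow> ('b \<times> 'c \<Rightarrow> int) ring"
  where "pair_ring B C \<equiv> monoid_algebra \<Z> (B \<times>\<times> C)"

definition tensor_ideal ::
    "('s, 'l) ring_scheme \<Rightarrow> ('b, 'm) ring_scheme \<Rightarrow> ('s \<Rightarrow> 'b) \<Rightarrow>
      ('c, 'n) ring_scheme \<Rightarrow> ('s \<Rightarrow> 'c) \<Rightarrow> ('b \<times> 'c \<Rightarrow> int) set"
  where "tensor_ideal S B f C g = genideal (pair_ring B C)
    ({monomial \<Z> 1 (b \<oplus>\<^bsub>B\<^esub> b', c) \<ominus>\<^bsub>pair_ring B C\<^esub>
        (monomial \<Z> 1 (b, c) \<oplus>\<^bsub>pair_ring B C\<^esub> monomial \<Z> 1 (b', c)) | b b' c.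
        b \<in> carrier B \<and> b' \<in> carrier B \<and> c \<in> carrier C} \<union>
     {monomial \<Z> 1 (b, c \<oplus>\<^bsub>C\<^esub> c') \<ominus>\<^bsub>pair_ring B C\<^esub>
        (monomial \<Z> 1 (b, c) \<oplus>\<^bsub>pair_ring B C\<^esub> monomial \<Z> 1 (b, c')) | b c c'.
        b \<in> carrier B \<and> c \<in> carrier C \<and> c' \<in> carrier C} \<union>
     {monomial \<Z> 1 (f s \<otimes>\<^bsub>B\<^esub> b, c) \<ominus>\<^bsub>pair_ring B C\<^esub> monomial \<Z> 1 (b, g s \<otimes>\<^bsub>C\<^esub> c) | s b c.
        s \<in> carrier S \<and> b \<in> carrier B \<and> c \<in> carrier C})"

definition tensor_ring ::
    "('s, 'l) ring_scheme \<Rightarrow> ('b, 'm) ring_scheme \<Rightarrow> ('s \<Rightarrow> 'b) \<Rightarrow>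
      ('c, 'n) ring_scheme \<Rightarrow> ('s \<Rightarrow> 'c) \<Rightarrow> ('b \<times> 'c \<Rightarrow> int) set ring"
  where "tensor_ring S B f C g = pair_ring B C Quot tensor_ideal S B f C g"

definition pure_tensor ::
    "('s, 'l) ring_scheme \<Rightarrow> ('b, 'm) ring_scheme \<Rightarrow> ('s \<Rightarrow> 'b) \<Rightarrow>
      ('c, 'n) ring_scheme \<Rightarrow> ('s \<Rightarrow> 'c) \<Rightarrow> 'b \<Rightarrow> 'c \<Rightarrow> ('b \<times> 'c \<Rightarrow> int) set"
  where "pure_tensor S B f C g b c =
    tensor_ideal S B f C g +>\<^bsub>pair_ring B C\<^esub> monomial \<Z> 1 (b, c)"


section \<open>The system of surjections onto \<open>A\<close>\<close>

text \<open>
  A cover is a \<open>k\<close>-algebra \<open>R\<close> of finite type with a surjection \<open>R \<rightarrow> A\<close>.  Since the system of all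
  covers has to be a set, the carriers of the \<open>R\<close> are drawn from one type \<open>'u\<close>; it is required to
  be large enough to contain a copy of every \<open>k\<close>-algebra of finite type, all of which have
  cardinality at most \<open>max |k| \<aleph>\<^sub>0\<close>.
\<close>

record ('k, 'u, 'a) cover =
  cov_ring :: "'u ring"
  cov_str :: "'k \<Rightarrow> 'u"
  cov_proj :: "'u \<Rightarrow> 'a"

definition large_universe :: "'u itself \<Rightarrow> 'k ring \<Rightarrow> bool"
  where "large_universe _ k \<longleftrightarrow>
    infinite (UNIV :: 'u set) \<and> (\<exists>g :: 'k \<Rightarrow> 'u. inj_on g (carrier k))"

definition covers :: "'k ring \<Rightarrow> 'a ring \<Rightarrow> ('k \<Rightarrow> 'a) \<Rightarrow> ('k, 'u, 'a) cover set"
  where "covers k A \<alpha> = {U. finite_type_algebra k (cov_ring U) (cov_str U) \<and>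
    cov_proj U \<in> algebra_hom k (cov_ring U) (cov_str U) A \<alpha> \<and>
    cov_proj U ` carrier (cov_ring U) = carrier A}"

definition cover_maps ::
    "'k ring \<Rightarrow> ('k, 'u, 'a) cover \<Rightarrow> ('k, 'u, 'a) cover \<Rightarrow> ('u \<Rightarrow> 'u) set"
  where "cover_maps k U Y =
    {\<phi> \<in> algebra_hom k (cov_ring U) (cov_str U) (cov_ring Y) (cov_str Y).
      \<phi> ` carrier (cov_ring U) = carrier (cov_ring Y) \<and>
      (\<forall>r\<in>carrier (cov_ring U). cov_proj Y (\<phi> r) = cov_proj U r)}"


section \<open>Deformations and Aluffi algebras\<close>

text \<open>
  The free module \<open>M\<close> over \<open>R\<close> with its surjection \<open>p\<close> onto \<open>F\<close>, whose kernel is \<open>J M\<close> for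
  \<open>J\<close> the kernel of \<open>R \<rightarrow> A\<close>.
\<close>

definition ambient_lift ::
    "'a ring \<Rightarrow> ('a, 'f) module \<Rightarrow> nat \<Rightarrow> ('k, 'u, 'a) cover \<Rightarrow> ('u, 'b) module \<Rightarrow> ('b \<Rightarrow> 'f) \<Rightarrow> bool"
  where "ambient_lift A F n U M p \<longleftrightarrow>
    free_module (cov_ring U) M n \<and>
    semilinear_map (cov_proj U) (cov_ring U) M F p \<and>
    p ` carrier M = carrier F \<and>
    a_kernel M F p = smult_span M (a_kernel (cov_ring U) A (cov_proj U)) (carrier M)"

text \<open>
  In the remaining definitions \<open>L\<close> stands for \<open>E / \<tau>\<^sub>A(E)\<close> and \<open>j\<close> for its embedding into \<open>F\<close>.
  The families \<open>FF\<close>, \<open>p\<close> choose an ambient free module with its surjection onto \<open>F\<close> for each cover.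
\<close>

definition deformation ::
    "('a, 'l) module \<Rightarrow> ('l \<Rightarrow> 'f) \<Rightarrow> ('u, 'b) module \<Rightarrow> ('b \<Rightarrow> 'f) \<Rightarrow> ('u, 'b) module"
  where "deformation L j M p = M\<lparr>carrier := {x \<in> carrier M. p x \<in> j ` carrier L}\<rparr>"

definition deformation_proj :: "('a, 'l) module \<Rightarrow> ('l \<Rightarrow> 'f) \<Rightarrow> ('b \<Rightarrow> 'f) \<Rightarrow> 'b \<Rightarrow> 'l"
  where "deformation_proj L j p x = inv_into (carrier L) j (p x)"

type_synonym ('l, 'a, 'b, 'u) aluffi_elt =
  "(('l multiset \<Rightarrow> 'a) set \<times> ('b multiset \<Rightarrow> 'u) set set \<Rightarrow> int) set"

definition sym_to_base ::
    "'a ring \<Rightarrow> ('a, 'l) module \<Rightarrow> ('l \<Rightarrow> 'f) \<Rightarrow> ('k, 'u, 'a) cover \<Rightarrow> ('u, 'b) module \<Rightarrow> ('b \<Rightarrow> 'f) \<Rightarrow>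
      ('b multiset \<Rightarrow> 'u) set \<Rightarrow> ('l multiset \<Rightarrow> 'a) set"
  where "sym_to_base A L j U M p =
    sym_map (cov_ring U) (deformation L j M p) A L (cov_proj U) (deformation_proj L j p)"

definition embedded_aluffi ::
    "'a ring \<Rightarrow> ('a, 'l) module \<Rightarrow> ('l \<Rightarrow> 'f) \<Rightarrow> ('k, 'u, 'a) cover \<Rightarrow> ('u, 'b) module \<Rightarrow> ('b \<Rightarrow> 'f) \<Rightarrow>
      ('l, 'a, 'b, 'u) aluffi_elt ring"
  where "embedded_aluffi A L j U M p =
    (let R = cov_ring U; E = deformation L j M p in
      tensor_ring (sym_algebra R E) (sym_algebra A L) (sym_to_base A L j U M p)
        (rees_algebra R E) (rees_proj R E))"

definition aluffi_tensor ::
    "'a ring \<Rightarrow> ('a, 'l) module \<Rightarrow> ('l \<Rightarrow> 'f) \<Rightarrow> ('k, 'u, 'a) cover \<Rightarrow> ('u, 'b) module \<Rightarrow> ('b \<Rightarrow> 'f) \<Rightarrow>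
      ('l multiset \<Rightarrow> 'a) set \<Rightarrow> ('b multiset \<Rightarrow> 'u) set set \<Rightarrow> ('l, 'a, 'b, 'u) aluffi_elt"
  where "aluffi_tensor A L j U M p =
    (let R = cov_ring U; E = deformation L j M p in
      pure_tensor (sym_algebra R E) (sym_algebra A L) (sym_to_base A L j U M p)
        (rees_algebra R E) (rees_proj R E))"

definition embedded_aluffi_str ::
    "'a ring \<Rightarrow> ('a, 'l) module \<Rightarrow> ('l \<Rightarrow> 'f) \<Rightarrow> ('k, 'u, 'a) cover \<Rightarrow> ('u, 'b) module \<Rightarrow> ('b \<Rightarrow> 'f) \<Rightarrow>
      'a \<Rightarrow> ('l, 'a, 'b, 'u) aluffi_elt"
  where "embedded_aluffi_str A L j U M p a =
    aluffi_tensor A L j U M p (a \<odot>\<^bsub>sym_algebra A L\<^esub> \<one>\<^bsub>sym_algebra A L\<^esub>)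
      \<one>\<^bsub>rees_algebra (cov_ring U) (deformation L j M p)\<^esub>"

definition natural_lifts ::
    "('k, 'u, 'a) cover \<Rightarrow> ('u, 'b) module \<Rightarrow> ('b \<Rightarrow> 'f) \<Rightarrow> ('u, 'b) module \<Rightarrow> ('b \<Rightarrow> 'f) \<Rightarrow>
      ('u \<Rightarrow> 'u) \<Rightarrow> ('b \<Rightarrow> 'b) set"
  where "natural_lifts U M p M' p' \<phi> =
    {f. semilinear_map \<phi> (cov_ring U) M M' f \<and> (\<forall>x\<in>carrier M. p' (f x) = p x)}"

text \<open>
  The map of embedded Aluffi algebras induced by \<open>\<phi> : R \<rightarrow> R'\<close> and \<open>f\<close>.  It sends
  \<open>x \<otimes> [s]\<close> to \<open>x \<otimes> [S(f) s]\<close>, hence is unique on the carrier if it exists, and is automatically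
  surjective since every element of an embedded Aluffi algebra is of the form \<open>x \<otimes> 1\<close>.
\<close>

definition induced_maps ::
    "'a ring \<Rightarrow> ('a, 'l) module \<Rightarrow> ('l \<Rightarrow> 'f) \<Rightarrow>
      (('k, 'u, 'a) cover \<Rightarrow> ('u, 'b) module) \<Rightarrow> (('k, 'u, 'a) cover \<Rightarrow> 'b \<Rightarrow> 'f) \<Rightarrow>
      ('k, 'u, 'a) cover \<Rightarrow> ('k, 'u, 'a) cover \<Rightarrow> ('u \<Rightarrow> 'u) \<Rightarrow> ('b \<Rightarrow> 'b) \<Rightarrow>
      (('l, 'a, 'b, 'u) aluffi_elt \<Rightarrow> ('l, 'a, 'b, 'u) aluffi_elt) set"
  where "induced_maps A L j FF p U Y \<phi> f =
    (let R = cov_ring U; E = deformation L j (FF U) (p U);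
         R' = cov_ring Y; E' = deformation L j (FF Y) (p Y) in
      {T \<in> algebra_hom A (embedded_aluffi A L j U (FF U) (p U)) (embedded_aluffi_str A L j U (FF U) (p U))
                        (embedded_aluffi A L j Y (FF Y) (p Y)) (embedded_aluffi_str A L j Y (FF Y) (p Y)).
        \<forall>x\<in>carrier (sym_algebra A L). \<forall>s\<in>carrier (sym_algebra R E).
          T (aluffi_tensor A L j U (FF U) (p U) x (rees_proj R E s)) =
          aluffi_tensor A L j Y (FF Y) (p Y) x (rees_proj R' E' (sym_map R E R' E' \<phi> f s))})"

text \<open>
  The index set of the inverse system: the covers \<open>R\<close> such that every surjection \<open>R'' \<rightarrow> R\<close> of
  covers does induce maps of embedded Aluffi algebras.  With the Rees algebra defined as
  \<open>S(E) / \<tau>(S(E))\<close> this is not automatic for non-reduced \<open>R\<close>, because nonzerodivisors of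
  \<open>R''\<close> can become zerodivisors in \<open>R\<close>.  For instance let \<open>A = k[x,y] / (x,y)\<^sup>3\<close> and let \<open>E \<subseteq> A\<close>
  be the square of the maximal ideal, with generators \<open>u = x\<^sup>2\<close>, \<open>v = x y\<close>, \<open>w = y\<^sup>2\<close>.  The
  element \<open>u w - v\<^sup>2\<close> is killed by \<open>x\<close> in the symmetric algebra over \<open>k[x,y]\<close>, so it vanishes
  in the Aluffi algebra for \<open>k[x,y] \<rightarrow> A\<close>, but it is nonzero in the one for \<open>A \<rightarrow> A\<close>.
  All reduced covers satisfy the condition, in particular the polynomial rings, which dominate
  every cover.
\<close>

definition aluffi_system ::
    "'k ring \<Rightarrow> 'a ring \<Rightarrow> ('k \<Rightarrow> 'a) \<Rightarrow> ('a, 'l) module \<Rightarrow> ('l \<Rightarrow> 'f) \<Rightarrow>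
      (('k, 'u, 'a) cover \<Rightarrow> ('u, 'b) module) \<Rightarrow> (('k, 'u, 'a) cover \<Rightarrow> 'b \<Rightarrow> 'f) \<Rightarrow>
      ('k, 'u, 'a) cover set"
  where "aluffi_system k A \<alpha> L j FF p = {U \<in> covers k A \<alpha>. \<forall>Y\<in>covers k A \<alpha>.
    \<forall>\<phi>\<in>cover_maps k Y U. \<forall>f\<in>natural_lifts Y (FF Y) (p Y) (FF U) (p U) \<phi>.
      induced_maps A L j FF p Y U \<phi> f \<noteq> {}}"

definition transition_maps ::
    "'k ring \<Rightarrow> 'a ring \<Rightarrow> ('a, 'l) module \<Rightarrow> ('l \<Rightarrow> 'f) \<Rightarrow>
      (('k, 'u, 'a) cover \<Rightarrow> ('u, 'b) module) \<Rightarrow> (('k, 'u, 'a) cover \<Rightarrow> 'b \<Rightarrow> 'f) \<Rightarrow>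
      ('k, 'u, 'a) cover \<Rightarrow> ('k, 'u, 'a) cover \<Rightarrow>
      (('l, 'a, 'b, 'u) aluffi_elt \<Rightarrow> ('l, 'a, 'b, 'u) aluffi_elt) set"
  where "transition_maps k A L j FF p U Y =
    (\<Union>\<phi>\<in>cover_maps k U Y. \<Union>f\<in>natural_lifts U (FF U) (p U) (FF Y) (p Y) \<phi>.
      induced_maps A L j FF p U Y \<phi> f)"

definition inverse_limit ::
    "'i set \<Rightarrow> ('i \<Rightarrow> 'c ring) \<Rightarrow> ('i \<Rightarrow> 'i \<Rightarrow> ('c \<Rightarrow> 'c) set) \<Rightarrow> ('i \<Rightarrow> 'c) ring"
  where "inverse_limit I G T =
    \<lparr>carrier = {x \<in> (\<Pi>\<^sub>E i\<in>I. carrier (G i)). \<forall>i\<in>I. \<forall>i'\<in>I. \<forall>t\<in>T i i'. t (x i) = x i'},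
     monoid.mult = (\<lambda>x y. \<lambda>i\<in>I. x i \<otimes>\<^bsub>G i\<^esub> y i),
     one = (\<lambda>i\<in>I. \<one>\<^bsub>G i\<^esub>),
     ring.zero = (\<lambda>i\<in>I. \<zero>\<^bsub>G i\<^esub>),
     ring.add = (\<lambda>x y. \<lambda>i\<in>I. x i \<oplus>\<^bsub>G i\<^esub> y i)\<rparr>"

definition absolute_aluffi ::
    "'k ring \<Rightarrow> 'a ring \<Rightarrow> ('k \<Rightarrow> 'a) \<Rightarrow> ('a, 'l) module \<Rightarrow> ('l \<Rightarrow> 'f) \<Rightarrow>
      (('k, 'u, 'a) cover \<Rightarrow> ('u, 'b) module) \<Rightarrow> (('k, 'u, 'a) cover \<Rightarrow> 'b \<Rightarrow> 'f) \<Rightarrow>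
      (('k, 'u, 'a) cover \<Rightarrow> ('l, 'a, 'b, 'u) aluffi_elt) ring"
  where "absolute_aluffi k A \<alpha> L j FF p =
    inverse_limit (aluffi_system k A \<alpha> L j FF p)
      (\<lambda>U. embedded_aluffi A L j U (FF U) (p U)) (transition_maps k A L j FF p)"

definition absolute_aluffi_str ::
    "'k ring \<Rightarrow> 'a ring \<Rightarrow> ('k \<Rightarrow> 'a) \<Rightarrow> ('a, 'l) module \<Rightarrow> ('l \<Rightarrow> 'f) \<Rightarrow>
      (('k, 'u, 'a) cover \<Rightarrow> ('u, 'b) module) \<Rightarrow> (('k, 'u, 'a) cover \<Rightarrow> 'b \<Rightarrow> 'f) \<Rightarrow>
      'a \<Rightarrow> ('k, 'u, 'a) cover \<Rightarrow> ('l, 'a, 'b, 'u) aluffi_elt"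
  where "absolute_aluffi_str k A \<alpha> L j FF p a =
    (\<lambda>U\<in>aluffi_system k A \<alpha> L j FF p. embedded_aluffi_str A L j U (FF U) (p U) a)"

end

theory Submission
  imports Defs "HOL-Decision_Procs.Algebra_Aux" "HOL-Algebra.Ring_Divisibility" "HOL-Algebra.Weak_Morphisms"
    "HOL-Algebra.Ideal_Product" "HOL-Library.Multiset_Order"
begin

text \<open>
  Every embedded Aluffi algebra is a quotient of \<open>S\<^sub>A(L)\<close>; for a cover \<open>V\<close> the kernel \<open>K(V)\<close> is the
  image of the torsion of \<open>S\<^sub>V(E\<^sub>V)\<close>.  It is contained in the image \<open>K'(V)\<close> of the kernel of
  \<open>S\<^sub>V(E\<^sub>V) \<rightarrow> S\<^sub>V(F\<^sub>V)\<close>, which is functorial in \<open>V\<close>, and \<open>K(V) = K'(V)\<close> if all annihilators of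
  elements of \<open>V\<close> are generated by idempotents: then multiples of finitely many elements of \<open>E\<^sub>V\<close>
  by a nonzerodivisor are fixed points of a retraction \<open>F\<^sub>V \<rightarrow> E\<^sub>V\<close>.

  Any two covers are dominated by a polynomial ring \<open>P\<close>, and the limit is governed by the kernels
  \<open>K(P)\<close>.  It remains to see that \<open>K(U) \<subseteq> K'(P)\<close> for smooth \<open>U = P / I\<close>.  Infinitesimal lifting
  provides, for every \<open>m\<close>, a map \<open>U \<rightarrow> P\<close> which is a ring homomorphism modulo \<open>I\<^sup>m\<close>.  It carries an
  element of \<open>S\<^sub>U(E\<^sub>U)\<close> which vanishes in \<open>S\<^sub>U(F\<^sub>U)\<close> to one of \<open>S\<^sub>P(E\<^sub>P)\<close> whose image in \<open>S\<^sub>P(F\<^sub>P)\<close> has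
  coefficients in \<open>I\<^sup>m\<close>, and \<open>I\<^sup>d S\<^sup>d(F\<^sub>P)\<close> comes from elements of \<open>S\<^sub>P(E\<^sub>P)\<close> mapping to \<open>0\<close> in \<open>S\<^sub>A(L)\<close>,
  because \<open>I F\<^sub>P \<subseteq> E\<^sub>P\<close>.

  That a smooth algebra has the annihilator property is also deduced from these maps: if
  \<open>x y = 0\<close> in \<open>U\<close> and \<open>M\<close> is a maximal ideal, then lifts of \<open>x\<close> and \<open>y\<close> have a product of high
  order at the corresponding point, so one of them has high order there, and a Krull intersection
  argument yields an annihilator outside \<open>M\<close>.
\<close>

section \<open>Monoid algebras\<close>

text \<open>Torsion is not functorial in the cover: a nonzerodivisor may become a zerodivisor, or
  zero, in a quotient. This is the reason for \<open>K'(V)\<close>, which mentions no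
  nonzerodivisors, and for the covers with idempotent-generated annihilators, on which the two
  kernels agree. For smooth \<open>U\<close> the annihilator property is also what places
  \<open>U\<close> in the index set. A smooth \<open>U\<close> need not map to the other covers, so
  the components of a family at \<open>U\<close> and at \<open>V\<close> are compared through a
  polynomial ring \<open>P\<close> above both. There
  \<open>K(U) \<subseteq> K'(U) \<subseteq> K'(P) = K(P)\<close>, hence the map from the algebra of
  \<open>P\<close> to that of \<open>U\<close> is injective, and the component at \<open>U\<close>
  determines the one at \<open>P\<close> and with it the one at \<open>V\<close>. A homomorphism
  \<open>U \<rightarrow> P\<close> splitting the quotient map need not exist. Approximate ones
  suffice because an element of a symmetric algebra is represented in bounded degree: if the degree
  is at most \<open>m\<close>, an error with coefficients in \<open>I^(m+1)\<close> can be removed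
  without changing the image in \<open>S\<^sub>A(L)\<close>.\<close>

locale comm_monoid_algebra = B: cring B + G: comm_monoid G
  for B :: "'r ring" and G :: "('g, 'm) monoid_scheme"
begin

abbreviation MA where "MA \<equiv> monoid_algebra B G"

lemma carrier_MA:
  "carrier MA = {p. (\<forall>g\<in>carrier G. p g \<in> carrier B) \<and>
    (\<forall>g. g \<notin> carrier G \<longrightarrow> p g = \<zero>\<^bsub>B\<^esub>) \<and> finite {g. p g \<noteq> \<zero>\<^bsub>B\<^esub>}}"
  by (simp only: monoid_algebra_def partial_object.select_convs)

lemma MA_simps:
  "\<zero>\<^bsub>MA\<^esub> = (\<lambda>g. \<zero>\<^bsub>B\<^esub>)" "p \<oplus>\<^bsub>MA\<^esub> q = (\<lambda>g. p g \<oplus>\<^bsub>B\<^esub> q g)"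
  "\<one>\<^bsub>MA\<^esub> = monomial B \<one>\<^bsub>B\<^esub> \<one>\<^bsub>G\<^esub>"
  by (simp_all add: monoid_algebra_def monomial_def)

lemma carrierI:
  assumes "\<And>g. g \<in> carrier G \<Longrightarrow> p g \<in> carrier B" "finite S" "S \<subseteq> carrier G"
    "\<And>g. g \<notin> S \<Longrightarrow> p g = \<zero>\<^bsub>B\<^esub>"
  shows "p \<in> carrier MA"
proof -
  have "{g. p g \<noteq> \<zero>\<^bsub>B\<^esub>} \<subseteq> S" using assms by auto
  then show ?thesis using assms by (auto simp: carrier_MA intro: finite_subset)
qed

lemma coeff_closed [simp]: "p \<in> carrier MA \<Longrightarrow> p g \<in> carrier B"
  unfolding carrier_MA by (cases "g \<in> carrier G") force+

lemma finite_supp: "p \<in> carrier MA \<Longrightarrow> finite {g. p g \<noteq> \<zero>\<^bsub>B\<^esub>}"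
  unfolding carrier_MA by blast

lemma supp_subset: "p \<in> carrier MA \<Longrightarrow> {g. p g \<noteq> \<zero>\<^bsub>B\<^esub>} \<subseteq> carrier G"
  unfolding carrier_MA by blast

text \<open>The defining sum ranges over the exact supports, which vary with the factors. Enlarging
  them to fixed finite sets only adds zero terms, so that several products can be compared over one
  index set.\<close>

lemma mult_formula:
  assumes p: "p \<in> carrier MA" and q: "q \<in> carrier MA"
    and S: "finite S" "{g. p g \<noteq> \<zero>\<^bsub>B\<^esub>} \<subseteq> S" "S \<subseteq> carrier G"
    and T: "finite T" "{g. q g \<noteq> \<zero>\<^bsub>B\<^esub>} \<subseteq> T" "T \<subseteq> carrier G"
  shows "(p \<otimes>\<^bsub>MA\<^esub> q) g =
    (\<Oplus>\<^bsub>B\<^esub>c\<in>{c\<in>S \<times> T. fst c \<otimes>\<^bsub>G\<^esub> snd c = g}. p (fst c) \<otimes>\<^bsub>B\<^esub> q (snd c))"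
proof -
  have "(p \<otimes>\<^bsub>MA\<^esub> q) g = (\<Oplus>\<^bsub>B\<^esub>c \<in> {(a, b). a \<in> carrier G \<and> b \<in> carrier G \<and>
       p a \<noteq> \<zero>\<^bsub>B\<^esub> \<and> q b \<noteq> \<zero>\<^bsub>B\<^esub> \<and> a \<otimes>\<^bsub>G\<^esub> b = g}. p (fst c) \<otimes>\<^bsub>B\<^esub> q (snd c))"
    by (simp only: monoid_algebra_def monoid.select_convs)
  also have "\<dots> = (\<Oplus>\<^bsub>B\<^esub>c\<in>{c\<in>S \<times> T. fst c \<otimes>\<^bsub>G\<^esub> snd c = g}. p (fst c) \<otimes>\<^bsub>B\<^esub> q (snd c))"
  proof (rule B.add.finprod_mono_neutral_cong_left)
    show "finite {c\<in>S \<times> T. fst c \<otimes>\<^bsub>G\<^esub> snd c = g}" using S T by auto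
    show "{(a, b). a \<in> carrier G \<and> b \<in> carrier G \<and> p a \<noteq> \<zero>\<^bsub>B\<^esub> \<and> q b \<noteq> \<zero>\<^bsub>B\<^esub> \<and> a \<otimes>\<^bsub>G\<^esub> b = g}
       \<subseteq> {c\<in>S \<times> T. fst c \<otimes>\<^bsub>G\<^esub> snd c = g}" using S T by auto
    fix i assume "i \<in> {c\<in>S \<times> T. fst c \<otimes>\<^bsub>G\<^esub> snd c = g} - {(a, b). a \<in> carrier G \<and> b \<in> carrier G \<and> p a \<noteq> \<zero>\<^bsub>B\<^esub> \<and> q b \<noteq> \<zero>\<^bsub>B\<^esub> \<and> a \<otimes>\<^bsub>G\<^esub> b = g}"
    then have "p (fst i) = \<zero>\<^bsub>B\<^esub> \<or> q (snd i) = \<zero>\<^bsub>B\<^esub>" using S T by auto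
    then show "p (fst i) \<otimes>\<^bsub>B\<^esub> q (snd i) = \<zero>\<^bsub>B\<^esub>" using p q by auto
  qed (use p q in auto)
  finally show ?thesis .
qed

lemma monomial_closed [simp]:
  "r \<in> carrier B \<Longrightarrow> g \<in> carrier G \<Longrightarrow> monomial B r g \<in> carrier MA"
  by (rule carrierI[where S = "{g}"]) (auto simp: monomial_def)

lemma monomial_zero: "monomial B \<zero>\<^bsub>B\<^esub> g = \<zero>\<^bsub>MA\<^esub>"
  by (auto simp: monomial_def MA_simps)

lemma monomial_add:
  assumes "r \<in> carrier B" "s \<in> carrier B"
  shows "monomial B (r \<oplus>\<^bsub>B\<^esub> s) g = monomial B r g \<oplus>\<^bsub>MA\<^esub> monomial B s g"
  using assms by (auto simp: monomial_def MA_simps)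

lemma add_closed:
  assumes "p \<in> carrier MA" "q \<in> carrier MA" shows "p \<oplus>\<^bsub>MA\<^esub> q \<in> carrier MA"
proof (rule carrierI[where S = "{g. p g \<noteq> \<zero>\<^bsub>B\<^esub>} \<union> {g. q g \<noteq> \<zero>\<^bsub>B\<^esub>}"])
  show "{g. p g \<noteq> \<zero>\<^bsub>B\<^esub>} \<union> {g. q g \<noteq> \<zero>\<^bsub>B\<^esub>} \<subseteq> carrier G"
    using supp_subset assms by blast
  show "finite ({g. p g \<noteq> \<zero>\<^bsub>B\<^esub>} \<union> {g. q g \<noteq> \<zero>\<^bsub>B\<^esub>})"
    using finite_supp assms by blast
qed (use assms in \<open>auto simp: MA_simps\<close>)

lemma abelian_group_MA: "abelian_group MA"
proof (rule abelian_groupI)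
  show "\<zero>\<^bsub>MA\<^esub> \<in> carrier MA" by (rule carrierI[where S = "{}"]) (auto simp: MA_simps)
  fix p assume p: "p \<in> carrier MA"
  show "\<exists>q\<in>carrier MA. q \<oplus>\<^bsub>MA\<^esub> p = \<zero>\<^bsub>MA\<^esub>"
  proof
    show "(\<lambda>g. \<ominus>\<^bsub>B\<^esub> p g) \<in> carrier MA"
      by (rule carrierI[where S = "{g. p g \<noteq> \<zero>\<^bsub>B\<^esub>}"]) (use p finite_supp supp_subset in auto)
    show "(\<lambda>g. \<ominus>\<^bsub>B\<^esub> p g) \<oplus>\<^bsub>MA\<^esub> p = \<zero>\<^bsub>MA\<^esub>"
      using p by (auto simp: MA_simps B.l_neg)
  qed
qed (auto simp: add_closed, auto simp: MA_simps B.a_ac)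

lemma mult_closed:
  assumes p: "p \<in> carrier MA" and q: "q \<in> carrier MA" shows "p \<otimes>\<^bsub>MA\<^esub> q \<in> carrier MA"
proof -
  let ?S = "{g. p g \<noteq> \<zero>\<^bsub>B\<^esub>}" and ?T = "{g. q g \<noteq> \<zero>\<^bsub>B\<^esub>}"
  note S = finite_supp[OF p] supp_subset[OF p] and T = finite_supp[OF q] supp_subset[OF q]
  show ?thesis
  proof (rule carrierI[where S = "(\<lambda>c. fst c \<otimes>\<^bsub>G\<^esub> snd c) ` (?S \<times> ?T)"])
    fix g
    show "(p \<otimes>\<^bsub>MA\<^esub> q) g \<in> carrier B"
      by (subst mult_formula[OF p q S(1) order_refl S(2) T(1) order_refl T(2)])
        (use p q in \<open>auto intro!: B.finsum_closed\<close>)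
    assume "g \<notin> (\<lambda>c. fst c \<otimes>\<^bsub>G\<^esub> snd c) ` (?S \<times> ?T)"
    then have e: "{c\<in>?S \<times> ?T. fst c \<otimes>\<^bsub>G\<^esub> snd c = g} = {}" by (auto simp: image_iff)
    show "(p \<otimes>\<^bsub>MA\<^esub> q) g = \<zero>\<^bsub>B\<^esub>"
      by (subst mult_formula[OF p q S(1) order_refl S(2) T(1) order_refl T(2)])
         (simp only: e B.finsum_empty)
  qed (use S T in \<open>auto intro!: G.m_closed\<close>)
qed

lemma mult_r_distr:
  assumes p: "p \<in> carrier MA" and q: "q \<in> carrier MA" and r: "r \<in> carrier MA"
  shows "p \<otimes>\<^bsub>MA\<^esub> (q \<oplus>\<^bsub>MA\<^esub> r) = p \<otimes>\<^bsub>MA\<^esub> q \<oplus>\<^bsub>MA\<^esub> p \<otimes>\<^bsub>MA\<^esub> r"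
proof
  fix g
  let ?S = "{g. p g \<noteq> \<zero>\<^bsub>B\<^esub>}" and ?T = "{g. q g \<noteq> \<zero>\<^bsub>B\<^esub>} \<union> {g. r g \<noteq> \<zero>\<^bsub>B\<^esub>}"
  have S: "finite ?S" "?S \<subseteq> ?S" "?S \<subseteq> carrier G" using finite_supp[OF p] supp_subset[OF p] by auto
  have T: "finite ?T" "?T \<subseteq> carrier G"
    using finite_supp[OF q] supp_subset[OF q] finite_supp[OF r] supp_subset[OF r] by auto
  have "{g. (q \<oplus>\<^bsub>MA\<^esub> r) g \<noteq> \<zero>\<^bsub>B\<^esub>} \<subseteq> ?T" by (auto simp: MA_simps)
  note * = mult_formula[OF p add_closed[OF q r] S T(1) this T(2)]
    mult_formula[OF p q S T(1) _ T(2)] mult_formula[OF p r S T(1) _ T(2)]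
  have "(p \<otimes>\<^bsub>MA\<^esub> (q \<oplus>\<^bsub>MA\<^esub> r)) g = (p \<otimes>\<^bsub>MA\<^esub> q) g \<oplus>\<^bsub>B\<^esub> (p \<otimes>\<^bsub>MA\<^esub> r) g"
    apply (subst *(1), subst *(2), blast, subst *(3), blast)
    apply (subst B.finsum_addf[symmetric])
    using p q r by (auto simp: MA_simps B.r_distr intro!: B.finsum_cong')
  then show "(p \<otimes>\<^bsub>MA\<^esub> (q \<oplus>\<^bsub>MA\<^esub> r)) g = (p \<otimes>\<^bsub>MA\<^esub> q \<oplus>\<^bsub>MA\<^esub> p \<otimes>\<^bsub>MA\<^esub> r) g"
    by (simp add: MA_simps)
qed

lemma mult_comm:
  assumes p: "p \<in> carrier MA" and q: "q \<in> carrier MA"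
  shows "p \<otimes>\<^bsub>MA\<^esub> q = q \<otimes>\<^bsub>MA\<^esub> p"
proof
  fix g
  let ?S = "{g. p g \<noteq> \<zero>\<^bsub>B\<^esub>}" and ?T = "{g. q g \<noteq> \<zero>\<^bsub>B\<^esub>}"
  note S = finite_supp[OF p] order_refl supp_subset[OF p]
    and T = finite_supp[OF q] order_refl supp_subset[OF q]
  have im: "{c\<in>?S \<times> ?T. fst c \<otimes>\<^bsub>G\<^esub> snd c = g} = prod.swap ` {c\<in>?T \<times> ?S. fst c \<otimes>\<^bsub>G\<^esub> snd c = g}"
    using S(3) T(3) G.m_comm by (auto simp: image_iff) blast+
  show "(p \<otimes>\<^bsub>MA\<^esub> q) g = (q \<otimes>\<^bsub>MA\<^esub> p) g"
    apply (subst mult_formula[OF p q S T], subst mult_formula[OF q p T S])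
    apply (subst im, subst B.add.finprod_reindex)
    using p q by (auto simp: B.m_comm intro!: B.finsum_cong')
qed

lemma monomial_mult:
  assumes "r \<in> carrier B" "s \<in> carrier B" "a \<in> carrier G" "b \<in> carrier G"
  shows "monomial B r a \<otimes>\<^bsub>MA\<^esub> monomial B s b = monomial B (r \<otimes>\<^bsub>B\<^esub> s) (a \<otimes>\<^bsub>G\<^esub> b)"
proof
  fix g
  have 1: "(monomial B r a \<otimes>\<^bsub>MA\<^esub> monomial B s b) g = (\<Oplus>\<^bsub>B\<^esub>c\<in>{c\<in>{a} \<times> {b}. fst c \<otimes>\<^bsub>G\<^esub> snd c = g}.
     monomial B r a (fst c) \<otimes>\<^bsub>B\<^esub> monomial B s b (snd c))"
    by (rule mult_formula) (use assms in \<open>simp_all\<close>, auto simp: monomial_def)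
  have 2: "{c\<in>{a} \<times> {b}. fst c \<otimes>\<^bsub>G\<^esub> snd c = g} = (if a \<otimes>\<^bsub>G\<^esub> b = g then {(a, b)} else {})" by auto
  show "(monomial B r a \<otimes>\<^bsub>MA\<^esub> monomial B s b) g = monomial B (r \<otimes>\<^bsub>B\<^esub> s) (a \<otimes>\<^bsub>G\<^esub> b) g"
    unfolding 1 2 using assms by (auto simp: monomial_def)
qed

text \<open>Deleting one point of the support leaves an element of the algebra, so finiteness of the
  support drives the induction; statements additive in an element thereby reduce to
  monomials.\<close>

lemma MA_induct [consumes 1, case_names zero add]:
  assumes "p \<in> carrier MA" and zero: "P \<zero>\<^bsub>MA\<^esub>"
    and add: "\<And>r g q. \<lbrakk>r \<in> carrier B; g \<in> carrier G; q \<in> carrier MA; P q\<rbrakk> \<Longrightarrow> P (monomial B r g \<oplus>\<^bsub>MA\<^esub> q)"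
  shows "P p"
proof -
  have "finite S \<Longrightarrow> S \<subseteq> carrier G \<Longrightarrow> p \<in> carrier MA \<Longrightarrow> (\<And>g. g \<notin> S \<Longrightarrow> p g = \<zero>\<^bsub>B\<^esub>) \<Longrightarrow> P p" for S p
  proof (induction S arbitrary: p rule: finite_induct)
    case empty
    then have "p = \<zero>\<^bsub>MA\<^esub>" by (auto simp: MA_simps)
    then show ?case using zero by simp
  next
    case (insert x S)
    let ?q = "p(x := \<zero>\<^bsub>B\<^esub>)"
    have q: "?q \<in> carrier MA"
      by (rule carrierI[where S = S]) (use insert.hyps insert.prems in auto)
    have "P ?q" by (rule insert.IH) (use insert.prems in \<open>simp_all add: q del: fun_upd_apply\<close>, auto)
    then have "P (monomial B (p x) x \<oplus>\<^bsub>MA\<^esub> ?q)" by (intro add) (use insert.prems q in auto)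
    moreover have "monomial B (p x) x \<oplus>\<^bsub>MA\<^esub> ?q = p"
      using insert.prems by (auto simp: MA_simps monomial_def)
    ultimately show ?case by simp
  qed
  from this[OF finite_supp[OF assms(1)] supp_subset[OF assms(1)] assms(1)] show ?thesis by auto
qed

lemma mult_l_distr:
  assumes "p \<in> carrier MA" "q \<in> carrier MA" "r \<in> carrier MA"
  shows "(q \<oplus>\<^bsub>MA\<^esub> r) \<otimes>\<^bsub>MA\<^esub> p = q \<otimes>\<^bsub>MA\<^esub> p \<oplus>\<^bsub>MA\<^esub> r \<otimes>\<^bsub>MA\<^esub> p"
  using assms by (simp add: mult_comm[of _ p] mult_r_distr add_closed)

text \<open>The ring laws are still being established, so the zero laws are drawn from
  distributivity and cancellation in the additive group.\<close>

lemma mult_zero: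
  assumes p: "p \<in> carrier MA"
  shows "p \<otimes>\<^bsub>MA\<^esub> \<zero>\<^bsub>MA\<^esub> = \<zero>\<^bsub>MA\<^esub>"  "\<zero>\<^bsub>MA\<^esub> \<otimes>\<^bsub>MA\<^esub> p = \<zero>\<^bsub>MA\<^esub>"
proof -
  interpret M: abelian_group MA by (rule abelian_group_MA)
  have "p \<otimes>\<^bsub>MA\<^esub> \<zero>\<^bsub>MA\<^esub> = p \<otimes>\<^bsub>MA\<^esub> \<zero>\<^bsub>MA\<^esub> \<oplus>\<^bsub>MA\<^esub> p \<otimes>\<^bsub>MA\<^esub> \<zero>\<^bsub>MA\<^esub>"
    using mult_r_distr[OF p M.zero_closed M.zero_closed] by simp
  then show "p \<otimes>\<^bsub>MA\<^esub> \<zero>\<^bsub>MA\<^esub> = \<zero>\<^bsub>MA\<^esub>"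
    using mult_closed[OF p M.zero_closed] by (metis M.add.l_cancel_one' M.zero_closed)
  then show "\<zero>\<^bsub>MA\<^esub> \<otimes>\<^bsub>MA\<^esub> p = \<zero>\<^bsub>MA\<^esub>" using mult_comm p by simp
qed

text \<open>Both sides are additive in each factor. Peeling monomials off the third, then the
  second, then the first factor leaves associativity in \<open>B\<close> and in
  \<open>G\<close>.\<close>

lemma mult_assoc:
  assumes p: "p \<in> carrier MA" and q: "q \<in> carrier MA" and r: "r \<in> carrier MA"
  shows "(p \<otimes>\<^bsub>MA\<^esub> q) \<otimes>\<^bsub>MA\<^esub> r = p \<otimes>\<^bsub>MA\<^esub> (q \<otimes>\<^bsub>MA\<^esub> r)"
proof -
  interpret M: abelian_group MA by (rule abelian_group_MA)
  have A: "(monomial B x a \<otimes>\<^bsub>MA\<^esub> monomial B y b) \<otimes>\<^bsub>MA\<^esub> r = monomial B x a \<otimes>\<^bsub>MA\<^esub> (monomial B y b \<otimes>\<^bsub>MA\<^esub> r)"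
    if xy: "x \<in> carrier B" "a \<in> carrier G" "y \<in> carrier B" "b \<in> carrier G" for x a y b
    using r
  proof (induction rule: MA_induct)
    case (add s c t)
    then show ?case using xy
      by (simp add: mult_r_distr mult_closed monomial_mult B.m_assoc G.m_assoc add_closed)
  qed (use xy in \<open>simp add: mult_zero mult_closed\<close>)
  have B: "(monomial B x a \<otimes>\<^bsub>MA\<^esub> q) \<otimes>\<^bsub>MA\<^esub> r = monomial B x a \<otimes>\<^bsub>MA\<^esub> (q \<otimes>\<^bsub>MA\<^esub> r)"
    if xy: "x \<in> carrier B" "a \<in> carrier G" for x a
    using q
  proof (induction rule: MA_induct)
    case (add s c t)
    then show ?case using xy r
      by (simp add: mult_r_distr mult_l_distr mult_closed A add_closed)
  qed (use xy r in \<open>simp add: mult_zero mult_closed\<close>)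
  show ?thesis using p
  proof (induction rule: MA_induct)
    case (add s c t)
    then show ?case using q r
      by (simp add: mult_r_distr mult_l_distr mult_closed B add_closed)
  qed (use q r in \<open>simp add: mult_zero mult_closed\<close>)
qed

lemma mult_one:
  assumes p: "p \<in> carrier MA" shows "\<one>\<^bsub>MA\<^esub> \<otimes>\<^bsub>MA\<^esub> p = p"
  using p
proof (induction rule: MA_induct)
  case zero
  show ?case by (simp add: mult_zero MA_simps(3))
next
  case (add s c t)
  then show ?case by (simp add: MA_simps(3) mult_r_distr monomial_mult)
qed

lemma cring_MA: "cring MA"
proof (rule cringI)
  show "abelian_group MA" by (rule abelian_group_MA)
  show "comm_monoid MA"
  proof (rule comm_monoidI)
    show "\<one>\<^bsub>MA\<^esub> \<in> carrier MA" by (simp add: MA_simps(3))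
  qed (auto simp: mult_closed mult_assoc mult_one intro: mult_comm)
qed (rule mult_l_distr)

sublocale MA: cring MA by (rule cring_MA)

lemma minus_apply: "p \<in> carrier MA \<Longrightarrow> (\<ominus>\<^bsub>MA\<^esub> p) g = \<ominus>\<^bsub>B\<^esub> p g"
  using fun_cong[OF MA.l_neg, of p g] by (simp add: MA_simps B.minus_equality)

lemma diff_apply: "p \<in> carrier MA \<Longrightarrow> q \<in> carrier MA \<Longrightarrow> (p \<ominus>\<^bsub>MA\<^esub> q) g = p g \<ominus>\<^bsub>B\<^esub> q g"
  by (simp add: a_minus_def MA_simps minus_apply)

lemma finsum_apply:
  assumes "finite S" "F \<in> S \<rightarrow> carrier MA"
  shows "(finsum MA F S) g = (\<Oplus>\<^bsub>B\<^esub>x\<in>S. F x g)"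
  using assms
proof (induction rule: finite_induct)
  case empty
  then show ?case by (simp add: MA_simps)
next
  case (insert x S)
  then have "finsum MA F (insert x S) = F x \<oplus>\<^bsub>MA\<^esub> finsum MA F S" by auto
  moreover have "(\<Oplus>\<^bsub>B\<^esub>x\<in>insert x S. F x g) = F x g \<oplus>\<^bsub>B\<^esub> (\<Oplus>\<^bsub>B\<^esub>x\<in>S. F x g)"
    by (rule B.finsum_insert) (use insert in \<open>auto simp: Pi_def\<close>)
  ultimately show ?case using insert by (simp add: MA_simps)
qed

lemma MA_expand:
  assumes p: "p \<in> carrier MA" and S: "finite S" "{g. p g \<noteq> \<zero>\<^bsub>B\<^esub>} \<subseteq> S" "S \<subseteq> carrier G"
  shows "p = (\<Oplus>\<^bsub>MA\<^esub>g\<in>S. monomial B (p g) g)"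
proof
  fix g
  have "(\<Oplus>\<^bsub>MA\<^esub>g\<in>S. monomial B (p g) g) g = (\<Oplus>\<^bsub>B\<^esub>x\<in>S. monomial B (p x) x g)"
    by (rule finsum_apply) (use p S in auto)
  also have "\<dots> = p g"
  proof (cases "g \<in> S")
    case True
    have "(\<Oplus>\<^bsub>B\<^esub>x\<in>S. monomial B (p x) x g) = (\<Oplus>\<^bsub>B\<^esub>x\<in>S. if g = x then p x else \<zero>\<^bsub>B\<^esub>)"
      by (simp add: monomial_def)
    also have "\<dots> = p g" by (rule B.finsum_singleton) (use p S True in auto)
    finally show ?thesis .
  next
    case False
    then have "(\<Oplus>\<^bsub>B\<^esub>x\<in>S. monomial B (p x) x g) = (\<Oplus>\<^bsub>B\<^esub>x\<in>S. \<zero>\<^bsub>B\<^esub>)"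
      by (intro B.finsum_cong') (auto simp: monomial_def)
    moreover have "p g = \<zero>\<^bsub>B\<^esub>" using False S by auto
    ultimately show ?thesis by simp
  qed
  finally show "p g = (\<Oplus>\<^bsub>MA\<^esub>g\<in>S. monomial B (p g) g) g" by simp
qed

lemma monomial_split:
  "r \<in> carrier B \<Longrightarrow> g \<in> carrier G \<Longrightarrow>
    monomial B r g = monomial B r \<one>\<^bsub>G\<^esub> \<otimes>\<^bsub>MA\<^esub> monomial B \<one>\<^bsub>B\<^esub> g"
  by (simp add: monomial_mult)

lemma const_ring_hom: "(\<lambda>r. monomial B r \<one>\<^bsub>G\<^esub>) \<in> ring_hom B MA"
  by (rule ring_hom_memI) (auto simp: monomial_mult monomial_add MA_simps(3))

lemma hom_eqI:
  assumes C: "cring C" and f: "f \<in> ring_hom MA C" and g: "g \<in> ring_hom MA C"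
    and eq: "\<And>r x. r \<in> carrier B \<Longrightarrow> x \<in> carrier G \<Longrightarrow> f (monomial B r x) = g (monomial B r x)"
    and p: "p \<in> carrier MA"
  shows "f p = g p"
proof -
  interpret C: cring C by fact
  interpret f: ring_hom_ring MA C f by unfold_locales (use f in auto)
  interpret g: ring_hom_ring MA C g by unfold_locales (use g in auto)
  show ?thesis using p by (induction rule: MA_induct) (auto simp: eq)
qed

end

section \<open>Evaluation homomorphisms and functoriality of monoid algebras\<close>

text \<open>The homomorphism out of \<open>B[G]\<close> given by \<open>h\<close> on coefficients
  and a multiplicative \<open>\<mu>\<close> on \<open>G\<close>. The target is a record scheme, so
  that module records such as symmetric algebras qualify as well.\<close>

definition monoid_algebra_eval ::
    "'r ring \<Rightarrow> ('c, 'm) ring_scheme \<Rightarrow> ('r \<Rightarrow> 'c) \<Rightarrow> ('g \<Rightarrow> 'c) \<Rightarrow> ('g \<Rightarrow> 'r) \<Rightarrow> 'c"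
  where "monoid_algebra_eval B C h \<mu> p = (\<Oplus>\<^bsub>C\<^esub>g\<in>{g. p g \<noteq> \<zero>\<^bsub>B\<^esub>}. h (p g) \<otimes>\<^bsub>C\<^esub> \<mu> g)"

context comm_monoid_algebra
begin

context
  fixes C :: "('c, 'l) ring_scheme" and h :: "'r \<Rightarrow> 'c" and \<mu> :: "'g \<Rightarrow> 'c"
  assumes C: "cring C" and h: "h \<in> ring_hom B C" and \<mu>: "\<mu> \<in> carrier G \<rightarrow> carrier C"
    and \<mu>_mult: "\<And>a b. a \<in> carrier G \<Longrightarrow> b \<in> carrier G \<Longrightarrow> \<mu> (a \<otimes>\<^bsub>G\<^esub> b) = \<mu> a \<otimes>\<^bsub>C\<^esub> \<mu> b"
    and \<mu>_one: "\<mu> \<one>\<^bsub>G\<^esub> = \<one>\<^bsub>C\<^esub>"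
begin

private abbreviation "ev \<equiv> monoid_algebra_eval B C h \<mu>"

lemma eval_superset:
  assumes "p \<in> carrier MA" "finite S" "{g. p g \<noteq> \<zero>\<^bsub>B\<^esub>} \<subseteq> S" "S \<subseteq> carrier G"
  shows "ev p = (\<Oplus>\<^bsub>C\<^esub>g\<in>S. h (p g) \<otimes>\<^bsub>C\<^esub> \<mu> g)"
proof -
  interpret C: cring C by (rule C)
  interpret h: ring_hom_ring B C h by unfold_locales (rule h)
  have \<mu>c: "g \<in> S \<Longrightarrow> \<mu> g \<in> carrier C" for g using \<mu> assms(4) by auto
  show ?thesis
    unfolding monoid_algebra_eval_def
    by (rule C.add.finprod_mono_neutral_cong_left) (use assms \<mu>c in auto)
qed

lemma eval_monomial:
  assumes "r \<in> carrier B" "g \<in> carrier G" shows "ev (monomial B r g) = h r \<otimes>\<^bsub>C\<^esub> \<mu> g"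
proof -
  interpret C: cring C by (rule C)
  interpret h: ring_hom_ring B C h by unfold_locales (rule h)
  have "ev (monomial B r g) = (\<Oplus>\<^bsub>C\<^esub>x\<in>{g}. h (monomial B r g x) \<otimes>\<^bsub>C\<^esub> \<mu> x)"
    by (rule eval_superset) (use assms in \<open>simp_all\<close>, auto simp: monomial_def)
  then show ?thesis using assms \<mu> by (auto simp: monomial_def Pi_def)
qed

lemma eval_ring_hom: "ev \<in> ring_hom MA C"
proof -
  interpret C: cring C by (rule C)
  interpret h: ring_hom_ring B C h by unfold_locales (rule h)
  have \<mu>c: "g \<in> carrier G \<Longrightarrow> \<mu> g \<in> carrier C" for g using \<mu> by auto
  have cl: "ev p \<in> carrier C" if p: "p \<in> carrier MA" for p
    unfolding monoid_algebra_eval_def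
    by (rule C.finsum_closed) (use \<mu>c p supp_subset[OF p] in \<open>auto simp: Pi_def\<close>)
  have add: "ev (p \<oplus>\<^bsub>MA\<^esub> q) = ev p \<oplus>\<^bsub>C\<^esub> ev q" if p: "p \<in> carrier MA" and q: "q \<in> carrier MA" for p q
  proof -
    let ?S = "{g. p g \<noteq> \<zero>\<^bsub>B\<^esub>} \<union> {g. q g \<noteq> \<zero>\<^bsub>B\<^esub>}"
    have S: "finite ?S" "?S \<subseteq> carrier G"
      using finite_supp[OF q] supp_subset[OF q] finite_supp[OF p] supp_subset[OF p] by auto
    have "{g. (p \<oplus>\<^bsub>MA\<^esub> q) g \<noteq> \<zero>\<^bsub>B\<^esub>} \<subseteq> ?S" by (auto simp: MA_simps)
    note * = eval_superset[OF _ S(1) this S(2)] eval_superset[OF p S(1) _ S(2)] eval_superset[OF q S(1) _ S(2)]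
    have \<mu>S: "g \<in> ?S \<Longrightarrow> \<mu> g \<in> carrier C" for g using \<mu>c S by blast
    have "ev (p \<oplus>\<^bsub>MA\<^esub> q) = (\<Oplus>\<^bsub>C\<^esub>g\<in>?S. h ((p \<oplus>\<^bsub>MA\<^esub> q) g) \<otimes>\<^bsub>C\<^esub> \<mu> g)" by (rule *(1)) (use p q in auto)
    also have "\<dots> = (\<Oplus>\<^bsub>C\<^esub>g\<in>?S. h (p g) \<otimes>\<^bsub>C\<^esub> \<mu> g \<oplus>\<^bsub>C\<^esub> h (q g) \<otimes>\<^bsub>C\<^esub> \<mu> g)"
      by (rule C.finsum_cong') (use p q \<mu>S in \<open>auto simp: MA_simps C.l_distr\<close>)
    also have "\<dots> = ev p \<oplus>\<^bsub>C\<^esub> ev q"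
      by (subst *(2), blast, subst *(3), blast, rule C.finsum_addf) (use p q \<mu>S in auto)
    finally show ?thesis .
  qed
  have zero: "ev \<zero>\<^bsub>MA\<^esub> = \<zero>\<^bsub>C\<^esub>" by (simp add: monoid_algebra_eval_def MA_simps)
  have mm: "ev (monomial B r a \<otimes>\<^bsub>MA\<^esub> q) = ev (monomial B r a) \<otimes>\<^bsub>C\<^esub> ev q"
    if ra: "r \<in> carrier B" "a \<in> carrier G" and q: "q \<in> carrier MA" for r a q
    using q
  proof (induction rule: MA_induct)
    case zero
    show ?case using ra by (simp add: \<open>ev \<zero>\<^bsub>MA\<^esub> = \<zero>\<^bsub>C\<^esub>\<close> cl)
  next
    case (add s c t)
    have *: "h r \<otimes>\<^bsub>C\<^esub> h s \<otimes>\<^bsub>C\<^esub> (\<mu> a \<otimes>\<^bsub>C\<^esub> \<mu> c) = h r \<otimes>\<^bsub>C\<^esub> \<mu> a \<otimes>\<^bsub>C\<^esub> (h s \<otimes>\<^bsub>C\<^esub> \<mu> c)"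
      using ra add \<mu>c by (simp add: C.m_ac)
    from add show ?case using ra \<mu>c
      by (simp add: MA.r_distr \<open>\<And>p q. p \<in> carrier MA \<Longrightarrow> q \<in> carrier MA \<Longrightarrow> ev (p \<oplus>\<^bsub>MA\<^esub> q) = ev p \<oplus>\<^bsub>C\<^esub> ev q\<close>
        monomial_mult eval_monomial \<mu>_mult C.r_distr cl *)
  qed
  have mult: "ev (p \<otimes>\<^bsub>MA\<^esub> q) = ev p \<otimes>\<^bsub>C\<^esub> ev q" if p: "p \<in> carrier MA" and q: "q \<in> carrier MA" for p q
    using p
  proof (induction rule: MA_induct)
    case zero
    show ?case using q by (simp add: \<open>ev \<zero>\<^bsub>MA\<^esub> = \<zero>\<^bsub>C\<^esub>\<close> cl)
  next
    case (add s c t)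
    then show ?case using q
      by (simp add: MA.l_distr \<open>\<And>p q. p \<in> carrier MA \<Longrightarrow> q \<in> carrier MA \<Longrightarrow> ev (p \<oplus>\<^bsub>MA\<^esub> q) = ev p \<oplus>\<^bsub>C\<^esub> ev q\<close>
        mm C.l_distr cl)
  qed
  show ?thesis
    by (rule ring_hom_memI) (auto simp: cl add mult MA_simps(3) eval_monomial \<mu>_one)
qed

end

end

text \<open>Reading off one coefficient of the evaluated sum leaves exactly the fibre of
  \<open>f\<close> over \<open>g'\<close>. The pushforward thus inherits its homomorphism laws from
  evaluation instead of needing a computation with fibres.\<close>

lemma monoid_algebra_map_eq_eval:
  assumes B: "comm_monoid_algebra B G" and B': "comm_monoid_algebra B' G'"
    and \<phi>: "\<phi> \<in> ring_hom B B'" and f: "f \<in> carrier G \<rightarrow> carrier G'" and p: "p \<in> carrier (monoid_algebra B G)"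
  shows "monoid_algebra_map B B' \<phi> f p =
    monoid_algebra_eval B (monoid_algebra B' G') (\<lambda>r. monomial B' (\<phi> r) \<one>\<^bsub>G'\<^esub>) (\<lambda>g. monomial B' \<one>\<^bsub>B'\<^esub> (f g)) p"
proof
  interpret M: comm_monoid_algebra B G by fact
  interpret N: comm_monoid_algebra B' G' by fact
  interpret h: ring_hom_ring B B' \<phi> by unfold_locales (rule \<phi>)
  fix g'
  let ?S = "{g. p g \<noteq> \<zero>\<^bsub>B\<^esub>}"
  note S = M.finite_supp[OF p] M.supp_subset[OF p]
  have fc: "g \<in> ?S \<Longrightarrow> f g \<in> carrier G'" for g using f S by auto
  have "monoid_algebra_eval B N.MA (\<lambda>r. monomial B' (\<phi> r) \<one>\<^bsub>G'\<^esub>) (\<lambda>g. monomial B' \<one>\<^bsub>B'\<^esub> (f g)) p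
      = (\<Oplus>\<^bsub>N.MA\<^esub>g\<in>?S. monomial B' (\<phi> (p g)) (f g))"
    unfolding monoid_algebra_eval_def
    by (rule N.MA.finsum_cong') (use p fc in \<open>auto simp: N.monomial_mult\<close>)
  then have "monoid_algebra_eval B N.MA (\<lambda>r. monomial B' (\<phi> r) \<one>\<^bsub>G'\<^esub>) (\<lambda>g. monomial B' \<one>\<^bsub>B'\<^esub> (f g)) p g'
      = (\<Oplus>\<^bsub>N.MA\<^esub>g\<in>?S. monomial B' (\<phi> (p g)) (f g)) g'" by simp
  also have "\<dots> = (\<Oplus>\<^bsub>B'\<^esub>g\<in>?S. monomial B' (\<phi> (p g)) (f g) g')"
    by (rule N.finsum_apply) (use S p fc in auto)
  also have "\<dots> = (\<Oplus>\<^bsub>B'\<^esub>g \<in> {g. p g \<noteq> \<zero>\<^bsub>B\<^esub> \<and> f g = g'}. \<phi> (p g))"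
    by (rule N.B.add.finprod_mono_neutral_cong_right) (use S p in \<open>auto simp: monomial_def\<close>)
  finally show "monoid_algebra_map B B' \<phi> f p g' =
    monoid_algebra_eval B N.MA (\<lambda>r. monomial B' (\<phi> r) \<one>\<^bsub>G'\<^esub>) (\<lambda>g. monomial B' \<one>\<^bsub>B'\<^esub> (f g)) p g'"
    by (simp add: monoid_algebra_map_def)
qed

lemma monoid_algebra_map:
  assumes B: "comm_monoid_algebra B G" and B': "comm_monoid_algebra B' G'"
    and \<phi>: "\<phi> \<in> ring_hom B B'" and f: "f \<in> hom G G'" and f1: "f \<one>\<^bsub>G\<^esub> = \<one>\<^bsub>G'\<^esub>"
  shows "monoid_algebra_map B B' \<phi> f \<in> ring_hom (monoid_algebra B G) (monoid_algebra B' G')"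
    and "r \<in> carrier B \<Longrightarrow> g \<in> carrier G \<Longrightarrow>
      monoid_algebra_map B B' \<phi> f (monomial B r g) = monomial B' (\<phi> r) (f g)"
proof -
  interpret M: comm_monoid_algebra B G by fact
  interpret N: comm_monoid_algebra B' G' by fact
  interpret h: ring_hom_ring B B' \<phi> by unfold_locales (rule \<phi>)
  let ?h = "\<lambda>r. monomial B' (\<phi> r) \<one>\<^bsub>G'\<^esub>" and ?m = "\<lambda>g. monomial B' \<one>\<^bsub>B'\<^esub> (f g)"
  have fc: "f \<in> carrier G \<rightarrow> carrier G'" using f by (auto simp: hom_def)
  note eq = monoid_algebra_map_eq_eval[OF B B' \<phi> fc]
  have h: "?h \<in> ring_hom B N.MA"
    by (rule ring_hom_memI) (auto simp: N.monomial_mult N.monomial_add N.MA_simps(3))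
  have m: "?m \<in> carrier G \<rightarrow> carrier N.MA" using fc by (auto simp: Pi_iff)
  have mm: "?m (a \<otimes>\<^bsub>G\<^esub> b) = ?m a \<otimes>\<^bsub>N.MA\<^esub> ?m b" if "a \<in> carrier G" "b \<in> carrier G" for a b
    using that f fc by (auto simp: hom_def N.monomial_mult Pi_def)
  have m1: "?m \<one>\<^bsub>G\<^esub> = \<one>\<^bsub>N.MA\<^esub>" by (simp add: f1 N.MA_simps(3))
  have "monoid_algebra_eval B N.MA ?h ?m \<in> ring_hom M.MA N.MA"
    by (rule M.eval_ring_hom[OF N.cring_MA h m mm m1])
  then show "monoid_algebra_map B B' \<phi> f \<in> ring_hom M.MA N.MA"
    using eq by (simp add: ring_hom_def Pi_def)
  show "monoid_algebra_map B B' \<phi> f (monomial B r g) = monomial B' (\<phi> r) (f g)"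
    if "r \<in> carrier B" "g \<in> carrier G"
    using that funcset_mem[OF fc] by (auto simp: eq M.eval_monomial[OF N.cring_MA h m mm m1] N.monomial_mult)
qed

section \<open>Quotients and symmetric algebras\<close>

context ideal
begin

lemma quot_eq_iff:
  assumes "x \<in> carrier R" "y \<in> carrier R"
  shows "I +> x = I +> y \<longleftrightarrow> x \<ominus> y \<in> I"
proof -
  have "x \<in> I +> y \<longleftrightarrow> x \<ominus> y \<in> I"
    using a_rcos_module_minus[OF ring_axioms assms(2,1)] by simp
  moreover have "x \<in> I +> y \<longleftrightarrow> I +> x = I +> y"
    using a_repr_independence' a_rcos_self assms by metis
  ultimately show ?thesis by simp
qed

lemma quot_zero: "\<zero>\<^bsub>R Quot I\<^esub> = I" by (simp add: FactRing_def)

lemma quot_eq_zero_iff: "x \<in> carrier R \<Longrightarrow> I +> x = I \<longleftrightarrow> x \<in> I"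
  using quot_eq_iff[of x \<zero>] quot_eq_iff[of \<zero> \<zero>] by (metis a_coset_add_zero a_subset minus_zero r_zero a_minus_def zero_closed)

lemma quot_surj: "X \<in> carrier (R Quot I) \<Longrightarrow> \<exists>x\<in>carrier R. X = I +> x"
  by (auto simp: FactRing_def A_RCOSETS_def')

lemma quot_lift:
  assumes C: "ring C" and f: "f \<in> ring_hom R C" and ker: "\<And>x. x \<in> I \<Longrightarrow> f x = \<zero>\<^bsub>C\<^esub>"
  shows "\<exists>F\<in>ring_hom (R Quot I) C. \<forall>x\<in>carrier R. F (I +> x) = f x"
proof -
  interpret C: ring C by fact
  interpret f: ring_hom_ring R C f by unfold_locales (rule f)
  interpret q: ring_hom_ring R "R Quot I" "(+>) I" by (rule rcos_ring_hom_ring)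
  define F where "F X = f (SOME x. x \<in> carrier R \<and> X = I +> x)" for X
  have F: "F (I +> x) = f x" if x: "x \<in> carrier R" for x
  proof -
    let ?y = "SOME y. y \<in> carrier R \<and> I +> x = I +> y"
    have y: "?y \<in> carrier R \<and> I +> x = I +> ?y" by (rule someI[of _ x]) (use x in simp)
    then have "x \<ominus> ?y \<in> I" using quot_eq_iff x by blast
    then have "f (x \<ominus> ?y) = \<zero>\<^bsub>C\<^esub>" by (rule ker)
    moreover have "f (x \<ominus> ?y) = f x \<ominus>\<^bsub>C\<^esub> f ?y" using x y by (simp add: a_minus_def)
    ultimately have "f x = f ?y" using x y by simp
    then show ?thesis by (simp add: F_def)
  qed
  have "F \<in> ring_hom (R Quot I) C"
  proof (rule ring_hom_memI)
    fix X assume "X \<in> carrier (R Quot I)"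
    then obtain x where x: "x \<in> carrier R" "X = I +> x" using quot_surj by blast
    then show "F X \<in> carrier C" by (simp add: F)
    fix Y assume "Y \<in> carrier (R Quot I)"
    then obtain y where y: "y \<in> carrier R" "Y = I +> y" using quot_surj by blast
    show "F (X \<otimes>\<^bsub>R Quot I\<^esub> Y) = F X \<otimes>\<^bsub>C\<^esub> F Y"
      using x y by (simp flip: q.hom_mult add: F)
    show "F (X \<oplus>\<^bsub>R Quot I\<^esub> Y) = F X \<oplus>\<^bsub>C\<^esub> F Y"
      using x y by (simp flip: q.hom_add add: F)
  next
    show "F \<one>\<^bsub>R Quot I\<^esub> = \<one>\<^bsub>C\<^esub>" by (simp flip: q.hom_one add: F)
  qed
  then show ?thesis using F by blast
qed

text \<open>The operator \<open>the_elem\<close> is applied to the image of a whole coset; constancy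
  of \<open>h\<close> modulo \<open>N'\<close> along the coset makes this image a singleton.\<close>

lemma coset_map_eq:
  assumes "x \<in> carrier R" "\<And>y. y \<in> carrier R \<Longrightarrow> I +> y = I +> x \<Longrightarrow> N' +>\<^bsub>M'\<^esub> h y = N' +>\<^bsub>M'\<^esub> h x"
  shows "coset_map M' N' h (I +> x) = N' +>\<^bsub>M'\<^esub> h x"
proof -
  have "(\<lambda>y. N' +>\<^bsub>M'\<^esub> h y) ` (I +> x) = {N' +>\<^bsub>M'\<^esub> h x}"
  proof
    show "(\<lambda>y. N' +>\<^bsub>M'\<^esub> h y) ` (I +> x) \<subseteq> {N' +>\<^bsub>M'\<^esub> h x}"
      using assms a_repr_independence' a_elemrcos_carrier by (metis image_subsetI singletonI)
    show "{N' +>\<^bsub>M'\<^esub> h x} \<subseteq> (\<lambda>y. N' +>\<^bsub>M'\<^esub> h y) ` (I +> x)"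
      using a_rcos_self assms(1) by blast
  qed
  then show ?thesis by (simp add: coset_map_def)
qed

end

section \<open>Free commutative monoids and products over multisets\<close>

lemma free_comm_monoid_simps [simp]:
  "w \<in> carrier (free_comm_monoid U) \<longleftrightarrow> set_mset w \<subseteq> U"
  "v \<otimes>\<^bsub>free_comm_monoid U\<^esub> w = v + w" "\<one>\<^bsub>free_comm_monoid U\<^esub> = {#}"
  by (auto simp: free_comm_monoid_def)

lemma comm_monoid_free_comm_monoid [simp]: "comm_monoid (free_comm_monoid U)"
  by (rule comm_monoidI) auto

text \<open>Multiplicities are turned into exponents, so that the carrier-based
  \<open>finprod\<close> applies and products over different multisets can be compared over a common
  finite set.\<close>

definition mset_prod :: "('c, 'm) monoid_scheme \<Rightarrow> ('x \<Rightarrow> 'c) \<Rightarrow> 'x multiset \<Rightarrow> 'c"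
  where "mset_prod C g w = (\<Otimes>\<^bsub>C\<^esub>x\<in>set_mset w. g x [^]\<^bsub>C\<^esub> count w x)"

context comm_monoid
begin

context
  fixes g :: "'x \<Rightarrow> 'a" and U :: "'x set"
  assumes g: "g \<in> U \<rightarrow> carrier G"
begin

lemma mset_prod_superset:
  assumes "finite S" "set_mset w \<subseteq> S" "S \<subseteq> U"
  shows "mset_prod G g w = (\<Otimes>\<^bsub>G\<^esub>x\<in>S. g x [^] count w x)"
  unfolding mset_prod_def
  by (rule finprod_mono_neutral_cong_left) (use assms g in \<open>auto simp: not_in_iff\<close>)

lemma mset_prod_closed [simp]: "set_mset w \<subseteq> U \<Longrightarrow> mset_prod G g w \<in> carrier G"
  unfolding mset_prod_def by (rule finprod_closed) (use g in auto)

lemma mset_prod_union: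
  assumes "set_mset v \<subseteq> U" "set_mset w \<subseteq> U"
  shows "mset_prod G g (v + w) = mset_prod G g v \<otimes> mset_prod G g w"
proof -
  let ?S = "set_mset v \<union> set_mset w"
  have S: "finite ?S" "?S \<subseteq> U" using assms by auto
  have gS: "x \<in> ?S \<Longrightarrow> g x \<in> carrier G" for x using g S by auto
  have "mset_prod G g (v + w) = (\<Otimes>\<^bsub>G\<^esub>x\<in>?S. g x [^] count (v + w) x)"
    by (rule mset_prod_superset[OF S(1) _ S(2)]) simp
  also have "\<dots> = (\<Otimes>\<^bsub>G\<^esub>x\<in>?S. g x [^] count v x \<otimes> g x [^] count w x)"
    by (rule finprod_cong') (use gS in \<open>auto simp: nat_pow_mult simp del: Un_iff\<close>)
  also have "\<dots> = (\<Otimes>\<^bsub>G\<^esub>x\<in>?S. g x [^] count v x) \<otimes> (\<Otimes>\<^bsub>G\<^esub>x\<in>?S. g x [^] count w x)"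
    by (rule finprod_multf) (use gS in \<open>auto simp del: Un_iff\<close>)
  also have "\<dots> = mset_prod G g v \<otimes> mset_prod G g w"
    using mset_prod_superset[OF S(1) _ S(2)] by simp
  finally show ?thesis .
qed

lemma mset_prod_single [simp]: "x \<in> U \<Longrightarrow> mset_prod G g {#x#} = g x"
  using g finprod_insert[of "{}" x "\<lambda>y. g y [^] count {#x#} y"]
  by (auto simp: mset_prod_def Pi_iff simp del: finprod_insert)

lemma mset_prod_add_mset:
  "x \<in> U \<Longrightarrow> set_mset w \<subseteq> U \<Longrightarrow> mset_prod G g (add_mset x w) = g x \<otimes> mset_prod G g w"
  using mset_prod_union[of "{#x#}" w] by simp

end

lemma mset_prod_empty [simp]: "mset_prod G g {#} = \<one>"
  by (simp add: mset_prod_def)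

end

section \<open>The symmetric algebra and its universal property\<close>

definition sym_const :: "'r ring \<Rightarrow> ('r, 'b) module \<Rightarrow> 'r \<Rightarrow> ('b multiset \<Rightarrow> 'r) set"
  where "sym_const B M b = sym_ideal B M +>\<^bsub>poly_on B M\<^esub> monomial B b {#}"

definition sym_gen :: "'r ring \<Rightarrow> ('r, 'b) module \<Rightarrow> 'b \<Rightarrow> ('b multiset \<Rightarrow> 'r) set"
  where "sym_gen B M x = sym_ideal B M +>\<^bsub>poly_on B M\<^esub> monomial B \<one>\<^bsub>B\<^esub> {#x#}"

locale symmetric_algebra = module B M for B :: "'r ring" and M :: "('r, 'b) module"
begin

sublocale P: comm_monoid_algebra B "free_comm_monoid (carrier M)"
  by (intro comm_monoid_algebra.intro comm_monoid_free_comm_monoid R.cring_axioms)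

abbreviation "P \<equiv> poly_on B M"
abbreviation "I \<equiv> sym_ideal B M"
abbreviation "S \<equiv> sym_algebra B M"
abbreviation "cst \<equiv> sym_const B M"
abbreviation "gen \<equiv> sym_gen B M"

definition sym_rels :: "('b multiset \<Rightarrow> 'r) set"
  where "sym_rels = {monomial B \<one>\<^bsub>B\<^esub> {#x \<oplus>\<^bsub>M\<^esub> y#} \<ominus>\<^bsub>P\<^esub>
        (monomial B \<one>\<^bsub>B\<^esub> {#x#} \<oplus>\<^bsub>P\<^esub> monomial B \<one>\<^bsub>B\<^esub> {#y#}) | x y.
        x \<in> carrier M \<and> y \<in> carrier M} \<union>
     {monomial B \<one>\<^bsub>B\<^esub> {#b \<odot>\<^bsub>M\<^esub> x#} \<ominus>\<^bsub>P\<^esub> monomial B b {#x#} | b x.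
        b \<in> carrier B \<and> x \<in> carrier M}"

lemma sym_rels_subset: "sym_rels \<subseteq> carrier P"
  by (auto simp: sym_rels_def)

lemma sym_ideal_eq: "I = genideal P sym_rels"
  by (simp add: sym_ideal_def sym_rels_def)

sublocale I: ideal I P
  unfolding sym_ideal_eq by (rule P.MA.genideal_ideal[OF sym_rels_subset])

lemma sym_rels_in_ideal: "sym_rels \<subseteq> I"
  unfolding sym_ideal_eq by (rule P.MA.genideal_self[OF sym_rels_subset])

lemma S_simps:
  "carrier S = carrier (P Quot I)" "x \<otimes>\<^bsub>S\<^esub> y = x \<otimes>\<^bsub>P Quot I\<^esub> y" "x \<oplus>\<^bsub>S\<^esub> y = x \<oplus>\<^bsub>P Quot I\<^esub> y"
  "\<one>\<^bsub>S\<^esub> = \<one>\<^bsub>P Quot I\<^esub>" "\<zero>\<^bsub>S\<^esub> = I"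
  by (simp_all add: sym_algebra_def Let_def FactRing_def)

lemma S_smult: "b \<odot>\<^bsub>S\<^esub> s = cst b \<otimes>\<^bsub>S\<^esub> s"
  by (simp add: sym_algebra_def Let_def sym_const_def)

lemma cring_S: "cring S"
proof -
  interpret Q: cring "P Quot I" by (rule I.quotient_is_cring) (rule P.cring_MA)
  have "\<zero>\<^bsub>S\<^esub> = \<zero>\<^bsub>P Quot I\<^esub>" by (simp add: S_simps I.quot_zero)
  note S = S_simps(1-4) this
  show ?thesis
  proof (rule cringI)
    show "abelian_group S"
    proof (rule abelian_groupI)
      fix x assume "x \<in> carrier S"
      then show "\<exists>y\<in>carrier S. y \<oplus>\<^bsub>S\<^esub> x = \<zero>\<^bsub>S\<^esub>"
        by (intro bexI[of _ "\<ominus>\<^bsub>P Quot I\<^esub> x"]) (auto simp: S Q.l_neg)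
    qed (auto simp: S Q.a_ac)
    show "comm_monoid S"
      by (rule comm_monoidI) (simp_all add: S Q.m_ac)
  qed (auto simp: S Q.l_distr)
qed

sublocale S: cring S by (rule cring_S)

lemma cls_hom: "(+>\<^bsub>P\<^esub>) I \<in> ring_hom P S"
  using I.rcos_ring_hom by (simp add: ring_hom_def S_simps)

sublocale cls: ring_hom_ring P S "(+>\<^bsub>P\<^esub>) I"
  by unfold_locales (rule cls_hom)

lemma cls_surj: "s \<in> carrier S \<Longrightarrow> \<exists>p\<in>carrier P. s = I +>\<^bsub>P\<^esub> p"
  using I.quot_surj by (simp add: S_simps)

lemma cls_eq_zero_iff: "p \<in> carrier P \<Longrightarrow> I +>\<^bsub>P\<^esub> p = \<zero>\<^bsub>S\<^esub> \<longleftrightarrow> p \<in> I"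
  by (simp add: S_simps I.quot_eq_zero_iff)

lemma cst_hom: "cst \<in> ring_hom B S"
proof -
  have "cst = (+>\<^bsub>P\<^esub>) I \<circ> (\<lambda>b. monomial B b {#})" by (auto simp: sym_const_def)
  then show ?thesis using ring_hom_trans[OF P.const_ring_hom cls_hom] by simp
qed

sublocale cst: ring_hom_ring B S cst
  by unfold_locales (rule cst_hom)

lemma gen_closed [simp]: "x \<in> carrier M \<Longrightarrow> gen x \<in> carrier S"
  unfolding sym_gen_def by (rule cls.hom_closed) simp

lemma gen_add:
  assumes "x \<in> carrier M" "y \<in> carrier M" shows "gen (x \<oplus>\<^bsub>M\<^esub> y) = gen x \<oplus>\<^bsub>S\<^esub> gen y"
proof -
  have "monomial B \<one>\<^bsub>B\<^esub> {#x \<oplus>\<^bsub>M\<^esub> y#} \<ominus>\<^bsub>P\<^esub>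
        (monomial B \<one>\<^bsub>B\<^esub> {#x#} \<oplus>\<^bsub>P\<^esub> monomial B \<one>\<^bsub>B\<^esub> {#y#}) \<in> I"
    using sym_rels_in_ideal assms unfolding sym_rels_def by blast
  then have "gen (x \<oplus>\<^bsub>M\<^esub> y) = I +>\<^bsub>P\<^esub> (monomial B \<one>\<^bsub>B\<^esub> {#x#} \<oplus>\<^bsub>P\<^esub> monomial B \<one>\<^bsub>B\<^esub> {#y#})"
    using assms unfolding sym_gen_def by (subst I.quot_eq_iff) auto
  then show ?thesis using assms by (simp add: sym_gen_def)
qed

lemma cls_monomial:
  assumes b: "b \<in> carrier B" and w: "set_mset w \<subseteq> carrier M"
  shows "I +>\<^bsub>P\<^esub> monomial B b w = cst b \<otimes>\<^bsub>S\<^esub> mset_prod S gen w"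
proof -
  have g: "gen \<in> carrier M \<rightarrow> carrier S" by simp
  have 1: "set_mset w \<subseteq> carrier M \<Longrightarrow> I +>\<^bsub>P\<^esub> monomial B \<one>\<^bsub>B\<^esub> w = mset_prod S gen w" for w
  proof (induction w)
    case empty
    then show ?case using cls.hom_one P.MA_simps(3) by simp
  next
    case (add x w)
    have "monomial B \<one>\<^bsub>B\<^esub> (add_mset x w) = monomial B \<one>\<^bsub>B\<^esub> {#x#} \<otimes>\<^bsub>P\<^esub> monomial B \<one>\<^bsub>B\<^esub> w"
      using add by (simp add: P.monomial_mult)
    then show ?case using add by (simp add: S.mset_prod_add_mset[OF g] sym_gen_def[of B M x])
  qed
  have "monomial B b w = monomial B b {#} \<otimes>\<^bsub>P\<^esub> monomial B \<one>\<^bsub>B\<^esub> w"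
    using b w by (simp add: P.monomial_mult)
  then show ?thesis using b w by (simp add: 1 sym_const_def)
qed

lemma gen_smult:
  assumes "b \<in> carrier B" "x \<in> carrier M" shows "gen (b \<odot>\<^bsub>M\<^esub> x) = cst b \<otimes>\<^bsub>S\<^esub> gen x"
proof -
  have g: "gen \<in> carrier M \<rightarrow> carrier S" by simp
  have "monomial B \<one>\<^bsub>B\<^esub> {#b \<odot>\<^bsub>M\<^esub> x#} \<ominus>\<^bsub>P\<^esub> monomial B b {#x#} \<in> I"
    using sym_rels_in_ideal assms unfolding sym_rels_def by blast
  then have "gen (b \<odot>\<^bsub>M\<^esub> x) = I +>\<^bsub>P\<^esub> monomial B b {#x#}"
    using assms unfolding sym_gen_def by (subst I.quot_eq_iff) auto
  then show ?thesis using assms by (simp add: cls_monomial S.mset_prod_single[OF g])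
qed

lemma gen_zero: "gen \<zero>\<^bsub>M\<^esub> = \<zero>\<^bsub>S\<^esub>"
  using gen_smult[of "\<zero>\<^bsub>B\<^esub>" "\<zero>\<^bsub>M\<^esub>"] by simp

lemma mset_prod_gen_closed [simp]: "set_mset w \<subseteq> carrier M \<Longrightarrow> mset_prod S gen w \<in> carrier S"
  by (rule S.mset_prod_closed[of _ "carrier M"]) auto

lemma sym_induct [consumes 1, case_names const gen add mult]:
  assumes "s \<in> carrier S"
    and const: "\<And>b. b \<in> carrier B \<Longrightarrow> Q (cst b)" and gen: "\<And>x. x \<in> carrier M \<Longrightarrow> Q (gen x)"
    and add: "\<And>s t. \<lbrakk>s \<in> carrier S; t \<in> carrier S; Q s; Q t\<rbrakk> \<Longrightarrow> Q (s \<oplus>\<^bsub>S\<^esub> t)"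
    and mult: "\<And>s t. \<lbrakk>s \<in> carrier S; t \<in> carrier S; Q s; Q t\<rbrakk> \<Longrightarrow> Q (s \<otimes>\<^bsub>S\<^esub> t)"
  shows "Q s"
proof -
  have g: "gen \<in> carrier M \<rightarrow> carrier S" by simp
  have m: "set_mset w \<subseteq> carrier M \<Longrightarrow> Q (mset_prod S gen w)" for w
  proof (induction w)
    case empty
    then show ?case using const[OF R.one_closed] by simp
  next
    case (add x w)
    then show ?case by (simp add: S.mset_prod_add_mset[OF g] mult gen)
  qed
  obtain p where p: "p \<in> carrier P" "s = I +>\<^bsub>P\<^esub> p" using cls_surj assms(1) by blast
  have "Q (I +>\<^bsub>P\<^esub> p)" using p(1)
  proof (induction rule: P.MA_induct)
    case zero
    then show ?case using const[OF R.zero_closed] by simp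
  next
    case (add r g q)
    then show ?case using cls.hom_closed[of q] by (auto simp: cls_monomial intro!: assms(4) mult const m)
  qed
  then show ?thesis using p by simp
qed

lemma sym_hom_eqI:
  assumes C: "ring C" and f: "f \<in> ring_hom S C" and g: "g \<in> ring_hom S C"
    and "\<And>b. b \<in> carrier B \<Longrightarrow> f (cst b) = g (cst b)" and "\<And>x. x \<in> carrier M \<Longrightarrow> f (gen x) = g (gen x)"
    and s: "s \<in> carrier S"
  shows "f s = g s"
proof -
  interpret C: ring C by fact
  interpret f: ring_hom_ring S C f by unfold_locales (use f in auto)
  interpret g: ring_hom_ring S C g by unfold_locales (use g in auto)
  show ?thesis using s by (induction rule: sym_induct) (auto simp: assms)
qed

text \<open>Evaluation of polynomials at \<open>g\<close> kills the two families of defining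
  relations, the first by additivity of \<open>g\<close> and the second by its compatibility with
  \<open>h\<close>, and therefore factors through the quotient.\<close>

lemma sym_lift:
  fixes C :: "('c, 'l) ring_scheme"
  assumes C: "cring C" and h: "h \<in> ring_hom B C" and g: "g \<in> carrier M \<rightarrow> carrier C"
    and g_add: "\<And>x y. x \<in> carrier M \<Longrightarrow> y \<in> carrier M \<Longrightarrow> g (x \<oplus>\<^bsub>M\<^esub> y) = g x \<oplus>\<^bsub>C\<^esub> g y"
    and g_smult: "\<And>b x. b \<in> carrier B \<Longrightarrow> x \<in> carrier M \<Longrightarrow> g (b \<odot>\<^bsub>M\<^esub> x) = h b \<otimes>\<^bsub>C\<^esub> g x"
  shows "\<exists>F\<in>ring_hom S C. (\<forall>b\<in>carrier B. F (cst b) = h b) \<and> (\<forall>x\<in>carrier M. F (gen x) = g x) \<and>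
    (\<forall>p\<in>carrier P. F (I +>\<^bsub>P\<^esub> p) = monoid_algebra_eval B C h (mset_prod C g) p)"
proof -
  interpret C: cring C by fact
  interpret h: ring_hom_ring B C h by unfold_locales (rule h)
  let ?ev = "monoid_algebra_eval B C h (mset_prod C g)"
  have m: "mset_prod C g \<in> carrier (free_comm_monoid (carrier M)) \<rightarrow> carrier C"
    "\<And>a b. a \<in> carrier (free_comm_monoid (carrier M)) \<Longrightarrow> b \<in> carrier (free_comm_monoid (carrier M)) \<Longrightarrow>
       mset_prod C g (a \<otimes>\<^bsub>free_comm_monoid (carrier M)\<^esub> b) = mset_prod C g a \<otimes>\<^bsub>C\<^esub> mset_prod C g b"
    "mset_prod C g \<one>\<^bsub>free_comm_monoid (carrier M)\<^esub> = \<one>\<^bsub>C\<^esub>"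
    by (auto simp: C.mset_prod_union[OF g] C.mset_prod_closed[OF g])
  have ev: "?ev \<in> ring_hom P C" by (rule P.eval_ring_hom[OF C h m])
  note evm = P.eval_monomial[OF C h m]
  interpret ev: ring_hom_ring P C ?ev by unfold_locales (rule ev)
  have gc: "x \<in> carrier M \<Longrightarrow> g x \<in> carrier C" for x using g by auto
  have ev1: "?ev (monomial B b {#x#}) = h b \<otimes>\<^bsub>C\<^esub> g x" if "b \<in> carrier B" "x \<in> carrier M" for b x
    using that by (subst evm) (auto simp: C.mset_prod_single[OF g])
  have ev0: "?ev (p \<ominus>\<^bsub>P\<^esub> q) = \<zero>\<^bsub>C\<^esub>" if "p \<in> carrier P" "q \<in> carrier P" "?ev p = ?ev q" for p q
    using that by (simp add: a_minus_def C.r_neg)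
  have "?ev p = \<zero>\<^bsub>C\<^esub>" if "p \<in> sym_rels" for p
  proof -
    from that show ?thesis unfolding sym_rels_def Un_iff mem_Collect_eq
    proof (elim disjE exE conjE)
      fix x y assume xy: "x \<in> carrier M" "y \<in> carrier M" and p: "p = monomial B \<one>\<^bsub>B\<^esub> {#x \<oplus>\<^bsub>M\<^esub> y#} \<ominus>\<^bsub>P\<^esub>
        (monomial B \<one>\<^bsub>B\<^esub> {#x#} \<oplus>\<^bsub>P\<^esub> monomial B \<one>\<^bsub>B\<^esub> {#y#})"
      show ?thesis unfolding p by (rule ev0) (use xy in \<open>simp_all add: ev1 gc g_add\<close>)
    next
      fix b x assume bx: "b \<in> carrier B" "x \<in> carrier M"
        and p: "p = monomial B \<one>\<^bsub>B\<^esub> {#b \<odot>\<^bsub>M\<^esub> x#} \<ominus>\<^bsub>P\<^esub> monomial B b {#x#}"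
      show ?thesis unfolding p by (rule ev0) (use bx in \<open>simp_all add: ev1 gc g_smult\<close>)
    qed
  qed
  then have "sym_rels \<subseteq> a_kernel P C ?ev"
    using sym_rels_subset unfolding a_kernel_def' by blast
  then have ker: "I \<subseteq> a_kernel P C ?ev"
    unfolding sym_ideal_eq by (intro P.MA.genideal_minimal ev.kernel_is_ideal)
  then have "\<And>x. x \<in> I \<Longrightarrow> ?ev x = \<zero>\<^bsub>C\<^esub>" unfolding a_kernel_def' by blast
  from I.quot_lift[OF C.ring_axioms ev this] obtain F where
    F: "F \<in> ring_hom (P Quot I) C" "\<And>p. p \<in> carrier P \<Longrightarrow> F (I +>\<^bsub>P\<^esub> p) = ?ev p" by blast
  have "F \<in> ring_hom S C" using F(1) by (simp add: ring_hom_def S_simps)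
  moreover have "F (cst b) = h b" if "b \<in> carrier B" for b
    using that evm[of b "{#}"] by (simp add: sym_const_def F(2))
  moreover have "F (gen x) = g x" if "x \<in> carrier M" for x
    using that by (simp add: sym_gen_def F(2) ev1 gc)
  ultimately show ?thesis using F(2) by blast
qed

subsection \<open>The grading\<close>

text \<open>Projection onto a set of degrees. A set rather than a single degree covers truncation to
  \<open>{..m}\<close> as well as extraction of one component \<open>{d}\<close>.\<close>

definition deg_part :: "nat set \<Rightarrow> ('b multiset \<Rightarrow> 'r) \<Rightarrow> 'b multiset \<Rightarrow> 'r"
  where "deg_part T p = (\<lambda>w. if size w \<in> T then p w else \<zero>\<^bsub>B\<^esub>)"

lemma deg_part_closed [simp]: "p \<in> carrier P \<Longrightarrow> deg_part T p \<in> carrier P"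
  by (rule P.carrierI[where S = "{w. p w \<noteq> \<zero>\<^bsub>B\<^esub>}"])
    (auto simp: deg_part_def P.finite_supp dest: subsetD[OF P.supp_subset])

lemma deg_part_zero [simp]: "deg_part T \<zero>\<^bsub>P\<^esub> = \<zero>\<^bsub>P\<^esub>"
  by (auto simp: deg_part_def P.MA_simps)

lemma deg_part_add:
  "p \<in> carrier P \<Longrightarrow> q \<in> carrier P \<Longrightarrow> deg_part T (p \<oplus>\<^bsub>P\<^esub> q) = deg_part T p \<oplus>\<^bsub>P\<^esub> deg_part T q"
  by (auto simp: deg_part_def P.MA_simps)

lemma deg_part_minus:
  assumes p: "p \<in> carrier P" and q: "q \<in> carrier P"
  shows "deg_part T (p \<ominus>\<^bsub>P\<^esub> q) = deg_part T p \<ominus>\<^bsub>P\<^esub> deg_part T q"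
proof
  fix g
  have "deg_part T (p \<ominus>\<^bsub>P\<^esub> q) g = (if size g \<in> T then p g \<ominus>\<^bsub>B\<^esub> q g else \<zero>\<^bsub>B\<^esub>)"
    by (simp add: deg_part_def P.diff_apply[OF p q])
  moreover have "(deg_part T p \<ominus>\<^bsub>P\<^esub> deg_part T q) g = deg_part T p g \<ominus>\<^bsub>B\<^esub> deg_part T q g"
    by (rule P.diff_apply) (use p q in simp_all)
  ultimately show "deg_part T (p \<ominus>\<^bsub>P\<^esub> q) g = (deg_part T p \<ominus>\<^bsub>P\<^esub> deg_part T q) g"
    by (simp add: deg_part_def a_minus_def)
qed

lemma deg_part_monomial: "deg_part T (monomial B r w) = (if size w \<in> T then monomial B r w else \<zero>\<^bsub>P\<^esub>)"
  by (auto simp: deg_part_def monomial_def P.MA_simps)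

lemma deg_part_monomial_mult:
  assumes r: "r \<in> carrier B" and v: "set_mset v \<subseteq> carrier M" and p: "p \<in> carrier P"
  shows "deg_part T (monomial B r v \<otimes>\<^bsub>P\<^esub> p) = monomial B r v \<otimes>\<^bsub>P\<^esub> deg_part {d. size v + d \<in> T} p"
  using p
proof (induction rule: P.MA_induct)
  case zero
  then show ?case using r v by simp
next
  case (add s w q)
  then show ?case using r v
    by (simp add: P.MA.r_distr deg_part_add P.monomial_mult deg_part_monomial)
qed

text \<open>All defining relations are homogeneous of degree one. The elements all of whose parts
  lie in \<open>I\<close> form an ideal, which therefore contains the relations and hence
  \<open>I\<close>.\<close>

lemma deg_part_sym_ideal:
  assumes "p \<in> I" shows "deg_part T p \<in> I"
proof -
  \<comment> \<open>Multiplication by a monomial shifts the set of degrees by its size; quantifying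
    over all \<open>T\<close> makes \<open>J\<close> stable under that shift.\<close>
  define J where "J = {p \<in> carrier P. \<forall>T. deg_part T p \<in> I}"
  have mult: "q \<otimes>\<^bsub>P\<^esub> p \<in> J" if p: "p \<in> J" and q: "q \<in> carrier P" for p q
    using q
  proof (induction rule: P.MA_induct)
    case zero
    then show ?case using p by (auto simp: J_def)
  next
    case (add r v t)
    then show ?case using p
      by (auto simp: J_def P.MA.l_distr deg_part_add deg_part_monomial_mult intro!: I.a_closed I.I_l_closed)
  qed
  have "ideal J P"
  proof (rule idealI[OF P.MA.ring_axioms])
    show "subgroup J (add_monoid P)"
    proof (rule P.MA.add.subgroupI)
      show "J \<subseteq> carrier P" by (auto simp: J_def)
      show "J \<noteq> {}" using I.zero_closed by (auto simp: J_def intro!: exI[of _ "\<zero>\<^bsub>P\<^esub>"])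
      fix a assume a: "a \<in> J"
      have "\<ominus>\<^bsub>P\<^esub> \<one>\<^bsub>P\<^esub> \<otimes>\<^bsub>P\<^esub> a \<in> J" using a by (rule mult) simp
      then show "\<ominus>\<^bsub>P\<^esub> a \<in> J" using a by (simp add: J_def P.MA.l_minus)
      fix b assume "b \<in> J"
      then show "a \<oplus>\<^bsub>P\<^esub> b \<in> J" using a by (auto simp: J_def deg_part_add)
    qed
    fix a x assume "a \<in> J" "x \<in> carrier P"
    then show "x \<otimes>\<^bsub>P\<^esub> a \<in> J" "a \<otimes>\<^bsub>P\<^esub> x \<in> J"
      using mult P.MA.m_comm by (auto simp: J_def)
  qed
  moreover have "sym_rels \<subseteq> J"
  proof
    fix p assume p: "p \<in> sym_rels"
    have "deg_part T p = p \<or> deg_part T p = \<zero>\<^bsub>P\<^esub>" for T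
      using p unfolding sym_rels_def
      by (auto simp: deg_part_minus deg_part_add deg_part_monomial)
    then have "\<forall>T. deg_part T p \<in> I" using p sym_rels_in_ideal I.zero_closed by (metis subsetD)
    then show "p \<in> J" using p sym_rels_subset unfolding J_def by blast
  qed
  ultimately have "I \<subseteq> J" unfolding sym_ideal_eq by (intro P.MA.genideal_minimal)
  then show ?thesis using assms by (auto simp: J_def)
qed

end

section \<open>Functoriality of symmetric algebras\<close>

lemma semilinear_mapD:
  assumes "semilinear_map \<phi> R M N f"
  shows "x \<in> carrier M \<Longrightarrow> f x \<in> carrier N"
    and "x \<in> carrier M \<Longrightarrow> y \<in> carrier M \<Longrightarrow> f (x \<oplus>\<^bsub>M\<^esub> y) = f x \<oplus>\<^bsub>N\<^esub> f y"
    and "r \<in> carrier R \<Longrightarrow> x \<in> carrier M \<Longrightarrow> f (r \<odot>\<^bsub>M\<^esub> x) = \<phi> r \<odot>\<^bsub>N\<^esub> f x"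
  using assms by (auto simp: semilinear_map_def)

text \<open>The map is defined on cosets through a pushforward of polynomials, which hides that it
  is well defined. The universal property supplies a homomorphism \<open>F\<close>; it agrees with
  the pushforward on representatives, so \<open>sym_map\<close> equals \<open>F\<close> on the
  carrier and inherits its properties.\<close>

lemma sym_map:
  assumes B: "symmetric_algebra B M" and B': "symmetric_algebra B' M'"
    and \<phi>: "\<phi> \<in> ring_hom B B'" and f: "semilinear_map \<phi> B M M' f"
  shows "sym_map B M B' M' \<phi> f \<in> ring_hom (sym_algebra B M) (sym_algebra B' M')"
    and "b \<in> carrier B \<Longrightarrow> sym_map B M B' M' \<phi> f (sym_const B M b) = sym_const B' M' (\<phi> b)"
    and "x \<in> carrier M \<Longrightarrow> sym_map B M B' M' \<phi> f (sym_gen B M x) = sym_gen B' M' (f x)"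
    and "p \<in> carrier (poly_on B M) \<Longrightarrow> sym_map B M B' M' \<phi> f (sym_ideal B M +>\<^bsub>poly_on B M\<^esub> p) =
      sym_ideal B' M' +>\<^bsub>poly_on B' M'\<^esub> monoid_algebra_map B B' \<phi> (image_mset f) p"
proof -
  interpret X: symmetric_algebra B M by fact
  interpret Y: symmetric_algebra B' M' by fact
  interpret \<phi>: ring_hom_ring B B' \<phi> by unfold_locales (rule \<phi>)
  note f = semilinear_mapD[OF f]
  let ?h = "\<lambda>b. Y.cst (\<phi> b)" and ?g = "\<lambda>x. Y.gen (f x)"
  let ?ev = "monoid_algebra_eval B Y.S ?h (mset_prod Y.S ?g)"
  have h: "?h \<in> ring_hom B Y.S" using ring_hom_trans[OF \<phi> Y.cst_hom] by (simp add: comp_def)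
  have g: "?g \<in> carrier M \<rightarrow> carrier Y.S" using f by auto
  obtain F where F: "F \<in> ring_hom X.S Y.S" "\<And>b. b \<in> carrier B \<Longrightarrow> F (X.cst b) = ?h b"
    "\<And>x. x \<in> carrier M \<Longrightarrow> F (X.gen x) = ?g x" "\<And>p. p \<in> carrier X.P \<Longrightarrow> F (X.I +>\<^bsub>X.P\<^esub> p) = ?ev p"
    using X.sym_lift[OF Y.cring_S h g] f Y.gen_add Y.gen_smult by auto
  let ?m = "monoid_algebra_map B B' \<phi> (image_mset f)"
  have hom: "image_mset f \<in> hom (free_comm_monoid (carrier M)) (free_comm_monoid (carrier M'))"
    by (auto simp: hom_def free_comm_monoid_def intro!: f(1))
  note m = monoid_algebra_map[OF X.P.comm_monoid_algebra_axioms Y.P.comm_monoid_algebra_axioms \<phi> hom]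
  have m1: "?m \<in> ring_hom X.P Y.P" by (rule m) simp
  have fw: "set_mset w \<subseteq> carrier M \<Longrightarrow> set_mset (image_mset f w) \<subseteq> carrier M'" for w
    using f(1) by (simp add: image_subset_iff subset_eq)
  have mp: "mset_prod Y.S Y.gen (image_mset f w) = mset_prod Y.S ?g w" if "set_mset w \<subseteq> carrier M" for w
    using that
  proof (induction w)
    case (add x w)
    have "Y.gen \<in> carrier M' \<rightarrow> carrier Y.S" by simp
    then show ?case using add f
      by (simp add: Y.S.mset_prod_add_mset[OF g] Y.S.mset_prod_add_mset[of _ "carrier M'"] image_subset_iff subset_eq)
  qed simp
  have Fm: "F (X.I +>\<^bsub>X.P\<^esub> p) = Y.I +>\<^bsub>Y.P\<^esub> ?m p" if p: "p \<in> carrier X.P" for p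
  proof -
    have "(F \<circ> (+>\<^bsub>X.P\<^esub>) X.I) p = ((+>\<^bsub>Y.P\<^esub>) Y.I \<circ> ?m) p"
    proof (rule X.P.hom_eqI[OF Y.cring_S])
      show "F \<circ> (+>\<^bsub>X.P\<^esub>) X.I \<in> ring_hom X.P Y.S" by (rule ring_hom_trans[OF X.cls_hom F(1)])
      show "(+>\<^bsub>Y.P\<^esub>) Y.I \<circ> ?m \<in> ring_hom X.P Y.S" by (rule ring_hom_trans[OF m1 Y.cls_hom])
      fix r w assume rw: "r \<in> carrier B" "w \<in> carrier (free_comm_monoid (carrier M))"
      have ww: "set_mset w \<subseteq> carrier M" using rw by simp
      have "F (X.I +>\<^bsub>X.P\<^esub> monomial B r w) = Y.cst (\<phi> r) \<otimes>\<^bsub>Y.S\<^esub> F (mset_prod X.S X.gen w)"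
        using rw F(1) by (simp add: X.cls_monomial ring_hom_mult[OF F(1)] F(2))
      also have "F (mset_prod X.S X.gen w) = mset_prod Y.S ?g w"
        using ww
      proof (induction w)
        case empty
        then show ?case using ring_hom_one[OF F(1)] by simp
      next
        case (add x w)
        have "X.gen \<in> carrier M \<rightarrow> carrier X.S" by simp
        then show ?case using add
          by (simp add: X.S.mset_prod_add_mset[of _ "carrier M"] Y.S.mset_prod_add_mset[OF g] ring_hom_mult[OF F(1)] F(3))
      qed
      also have "Y.cst (\<phi> r) \<otimes>\<^bsub>Y.S\<^esub> mset_prod Y.S ?g w = Y.I +>\<^bsub>Y.P\<^esub> ?m (monomial B r w)"
        using rw fw[OF ww] ww by (simp add: m(2) Y.cls_monomial mp)
      finally show "(F \<circ> (+>\<^bsub>X.P\<^esub>) X.I) (monomial B r w) = ((+>\<^bsub>Y.P\<^esub>) Y.I \<circ> ?m) (monomial B r w)"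
        by simp
    qed (rule p)
    then show ?thesis by simp
  qed
  have sm: "sym_map B M B' M' \<phi> f s = F s" if s: "s \<in> carrier X.S" for s
  proof -
    obtain p where p: "p \<in> carrier X.P" "s = X.I +>\<^bsub>X.P\<^esub> p" using X.cls_surj s by blast
    have "sym_map B M B' M' \<phi> f (X.I +>\<^bsub>X.P\<^esub> p) = Y.I +>\<^bsub>Y.P\<^esub> ?m p"
      unfolding sym_map_def by (rule X.I.coset_map_eq[OF p(1)]) (use p Fm in metis)
    then show ?thesis using p Fm by simp
  qed
  show "sym_map B M B' M' \<phi> f \<in> ring_hom X.S Y.S"
    using F(1) sm by (simp add: ring_hom_def Pi_def)
  show "b \<in> carrier B \<Longrightarrow> sym_map B M B' M' \<phi> f (X.cst b) = Y.cst (\<phi> b)"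
    using sm[OF X.cst.hom_closed] F(2) by simp
  show "x \<in> carrier M \<Longrightarrow> sym_map B M B' M' \<phi> f (X.gen x) = Y.gen (f x)"
    using sm F(3) by simp
  show "p \<in> carrier X.P \<Longrightarrow> sym_map B M B' M' \<phi> f (X.I +>\<^bsub>X.P\<^esub> p) = Y.I +>\<^bsub>Y.P\<^esub> ?m p"
    using sm[OF X.cls.hom_closed] Fm by simp
qed

section \<open>Noetherian rings\<close>

context cring
begin

text \<open>Ideals of a subset \<open>K\<close>, expressed inside the ambient ring: adjoining one
  generator after the other then only enlarges \<open>K\<close> and never changes the ring
  record.\<close>

definition subideal :: "'a set \<Rightarrow> 'a set \<Rightarrow> bool"
  where "subideal K c \<longleftrightarrow> c \<subseteq> K \<and> \<zero> \<in> c \<and> (\<forall>a\<in>c. \<forall>b\<in>c. a \<oplus> b \<in> c) \<and> (\<forall>r\<in>K. \<forall>a\<in>c. r \<otimes> a \<in> c)"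

text \<open>Finite generation is expressed by minimality of \<open>c\<close> among the subideals
  containing \<open>A\<close>, which avoids writing out linear combinations.\<close>

definition noetherian_subring :: "'a set \<Rightarrow> bool"
  where "noetherian_subring K \<longleftrightarrow> subring K R \<and>
    (\<forall>c. subideal K c \<longrightarrow> (\<exists>A. finite A \<and> A \<subseteq> c \<and> (\<forall>d. subideal K d \<and> A \<subseteq> d \<longrightarrow> c \<subseteq> d)))"

text \<open>The elements expressible as polynomials in \<open>x\<close> over \<open>K\<close> of
  degree less than \<open>d\<close>; the bound is strict. Nothing makes \<open>x\<close>
  transcendental, so one element may have several such expressions.\<close>

primrec polys :: "'a set \<Rightarrow> 'a \<Rightarrow> nat \<Rightarrow> 'a set" where
  "polys K x 0 = {\<zero>}"
| "polys K x (Suc d) = {c \<otimes> x [^] d \<oplus> t | c t. c \<in> K \<and> t \<in> polys K x d}"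

lemma subidealD:
  assumes "subideal K c"
  shows "a \<in> c \<Longrightarrow> a \<in> K" "\<zero> \<in> c" "a \<in> c \<Longrightarrow> b \<in> c \<Longrightarrow> a \<oplus> b \<in> c" "r \<in> K \<Longrightarrow> a \<in> c \<Longrightarrow> r \<otimes> a \<in> c"
  using assms by (auto simp: subideal_def)

context
  fixes K x assumes K: "subring K R" and x: "x \<in> carrier R"
begin

lemma sub_closed: "c \<in> K \<Longrightarrow> c \<in> carrier R" using subringE(1)[OF K] by blast

lemma polys_closed: "t \<in> polys K x d \<Longrightarrow> t \<in> carrier R"
  by (induction d arbitrary: t) (auto simp: sub_closed x)

lemma zero_in_polys: "\<zero> \<in> polys K x d"
proof (induction d)
  case (Suc d)
  then show ?case using subringE(2)[OF K] x by (auto intro!: exI[of _ "\<zero>"])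
qed simp

lemma polys_SucI: "c \<in> K \<Longrightarrow> t \<in> polys K x d \<Longrightarrow> c \<otimes> x [^] d \<oplus> t \<in> polys K x (Suc d)"
  by auto

lemma polys_mono_Suc: "t \<in> polys K x d \<Longrightarrow> t \<in> polys K x (Suc d)"
  using polys_SucI[OF subringE(2)[OF K], of t d] x polys_closed by (simp del: polys.simps)

lemma polys_mono: "d \<le> e \<Longrightarrow> t \<in> polys K x d \<Longrightarrow> t \<in> polys K x e"
  by (induction rule: dec_induct) (auto simp: polys_mono_Suc simp del: polys.simps)

lemma polys_add: "s \<in> polys K x d \<Longrightarrow> t \<in> polys K x d \<Longrightarrow> s \<oplus> t \<in> polys K x d"
proof (induction d arbitrary: s t)
  case (Suc d)
  then obtain a s' b t' where *: "s = a \<otimes> x [^] d \<oplus> s'" "a \<in> K" "s' \<in> polys K x d"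
     "t = b \<otimes> x [^] d \<oplus> t'" "b \<in> K" "t' \<in> polys K x d" by auto
  have "s \<oplus> t = (a \<oplus> b) \<otimes> x [^] d \<oplus> (s' \<oplus> t')"
    using * x by (simp add: sub_closed polys_closed l_distr a_ac)
  then show ?case using * Suc.IH subringE(7)[OF K] polys_SucI by (simp del: polys.simps)
qed simp

lemma polys_smult: "r \<in> K \<Longrightarrow> t \<in> polys K x d \<Longrightarrow> r \<otimes> t \<in> polys K x d"
proof (induction d arbitrary: t)
  case (Suc d)
  then obtain b t' where *: "t = b \<otimes> x [^] d \<oplus> t'" "b \<in> K" "t' \<in> polys K x d" by auto
  have "r \<otimes> t = (r \<otimes> b) \<otimes> x [^] d \<oplus> (r \<otimes> t')"
    using * x Suc.prems by (simp add: sub_closed polys_closed r_distr m_assoc)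
  then show ?case using * Suc.IH Suc.prems(1) subringE(6)[OF K] polys_SucI by (simp del: polys.simps)
qed (auto simp: sub_closed)

lemma polys_x: "t \<in> polys K x d \<Longrightarrow> t \<otimes> x \<in> polys K x (Suc d)"
proof (induction d arbitrary: t)
  case 0
  then show ?case using x zero_in_polys[of "Suc 0"] by simp
next
  case (Suc d)
  then obtain b t' where *: "t = b \<otimes> x [^] d \<oplus> t'" "b \<in> K" "t' \<in> polys K x d" by auto
  have "t \<otimes> x = b \<otimes> x [^] Suc d \<oplus> t' \<otimes> x"
    using * x by (simp add: sub_closed polys_closed l_distr m_assoc)
  then show ?case unfolding polys.simps(2)[of K x "Suc d"] using * Suc.IH[OF *(3)] by blast
qed

lemma polys_minus: "t \<in> polys K x d \<Longrightarrow> \<ominus> t \<in> polys K x d"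
  using polys_smult[of "\<ominus> \<one>" t d] subringE(3,5)[OF K] polys_closed[of t d] by (simp add: l_minus)

lemma polys_pow: "t \<in> polys K x d \<Longrightarrow> t \<otimes> x [^] n \<in> polys K x (d + n)"
proof (induction n)
  case 0
  then show ?case using polys_closed by simp
next
  case (Suc n)
  have "t \<otimes> x [^] Suc n = (t \<otimes> x [^] n) \<otimes> x" using x polys_closed[OF Suc.prems] by (simp add: m_assoc)
  then show ?case using polys_x Suc by simp
qed

lemma polys_mult: "s \<in> polys K x d \<Longrightarrow> t \<in> polys K x e \<Longrightarrow> s \<otimes> t \<in> polys K x (d + e)"
proof (induction d arbitrary: s)
  case 0
  then show ?case using polys_closed zero_in_polys by simp
next
  case (Suc d)
  then obtain a s' where *: "s = a \<otimes> x [^] d \<oplus> s'" "a \<in> K" "s' \<in> polys K x d" by auto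
  have "s \<otimes> t = a \<otimes> (t \<otimes> x [^] d) \<oplus> s' \<otimes> t"
    unfolding *(1) using *(2,3) x polys_closed[OF Suc.prems(2)] polys_closed[OF *(3)]
    by (simp add: sub_closed l_distr r_distr m_ac)
  moreover have "a \<otimes> (t \<otimes> x [^] d) \<in> polys K x (Suc d + e)"
    by (rule polys_mono[of "e + d"]) (use polys_smult polys_pow Suc.prems * in auto)
  moreover have "s' \<otimes> t \<in> polys K x (Suc d + e)"
    by (rule polys_mono[of "d + e"]) (use Suc * in auto)
  ultimately show ?case using polys_add by (simp del: polys.simps)
qed

lemma const_in_polys: "c \<in> K \<Longrightarrow> c \<in> polys K x (Suc 0)"
  by (auto simp: sub_closed intro!: exI[of _ c])

lemma subring_polys: "subring (\<Union>d. polys K x d) R"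
proof (rule subringI)
  show "(\<Union>d. polys K x d) \<subseteq> carrier R" using polys_closed by blast
  show "\<one> \<in> (\<Union>d. polys K x d)" using const_in_polys subringE(3)[OF K] by blast
  fix s t assume "s \<in> (\<Union>d. polys K x d)" "t \<in> (\<Union>d. polys K x d)"
  then obtain d e where de: "s \<in> polys K x d" "t \<in> polys K x e" by blast
  show "\<ominus> s \<in> (\<Union>d. polys K x d)" using de polys_minus by blast
  show "s \<otimes> t \<in> (\<Union>d. polys K x d)" using de polys_mult by blast
  have "s \<in> polys K x (max d e)" "t \<in> polys K x (max d e)"
    using de polys_mono max.cobounded1 max.cobounded2 by metis+
  then show "s \<oplus> t \<in> (\<Union>d. polys K x d)" using polys_add by blast
qed

lemma gen_subset_polys: "K \<union> {x} \<subseteq> (\<Union>d. polys K x d)"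
proof -
  have "x \<in> polys K x (Suc 0 + 1)"
    using polys_pow[OF const_in_polys[OF subringE(3)[OF K]], of 1] x by simp
  then show ?thesis using const_in_polys by blast
qed

text \<open>The ideal of coefficients at \<open>x [^] d\<close> in expressions of elements of
  \<open>c\<close>. For lack of transcendence of \<open>x\<close> it refers to expressions and not
  to a degree of the element.\<close>

definition leading :: "'a set \<Rightarrow> nat \<Rightarrow> 'a set"
  where "leading c d = {a \<in> K. \<exists>t\<in>polys K x d. a \<otimes> x [^] d \<oplus> t \<in> c}"

lemma subideal_leading:
  assumes c: "subideal (\<Union>d. polys K x d) c" shows "subideal K (leading c d)"
proof -
  note c = subidealD[OF c]
  have "\<zero> \<in> leading c d" using subringE(2)[OF K] zero_in_polys c(2) x by (auto simp: leading_def intro!: bexI[of _ \<zero>])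
  moreover have "a \<oplus> b \<in> leading c d" if "a \<in> leading c d" "b \<in> leading c d" for a b
  proof -
    from that obtain s t where st: "a \<in> K" "b \<in> K" "s \<in> polys K x d" "t \<in> polys K x d"
      "a \<otimes> x [^] d \<oplus> s \<in> c" "b \<otimes> x [^] d \<oplus> t \<in> c" by (auto simp: leading_def)
    have "(a \<oplus> b) \<otimes> x [^] d \<oplus> (s \<oplus> t) = (a \<otimes> x [^] d \<oplus> s) \<oplus> (b \<otimes> x [^] d \<oplus> t)"
      using st x by (simp add: sub_closed polys_closed l_distr a_ac)
    then have "(a \<oplus> b) \<otimes> x [^] d \<oplus> (s \<oplus> t) \<in> c" using c(3) st by simp
    then show ?thesis using st polys_add subringE(7)[OF K] by (auto simp: leading_def)
  qed
  moreover have "r \<otimes> a \<in> leading c d" if r: "r \<in> K" and "a \<in> leading c d" for r a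
  proof -
    from that obtain s where st: "a \<in> K" "s \<in> polys K x d" "a \<otimes> x [^] d \<oplus> s \<in> c" by (auto simp: leading_def)
    have "r \<otimes> a \<otimes> x [^] d \<oplus> r \<otimes> s = r \<otimes> (a \<otimes> x [^] d \<oplus> s)"
      using st x r by (simp add: sub_closed polys_closed r_distr m_assoc)
    moreover have "r \<in> (\<Union>d. polys K x d)" using r gen_subset_polys by blast
    ultimately have "r \<otimes> a \<otimes> x [^] d \<oplus> r \<otimes> s \<in> c" using c(4)[OF _ st(3)] by simp
    then show ?thesis using st r polys_smult subringE(6)[OF K] by (auto simp: leading_def)
  qed
  ultimately show ?thesis by (auto simp: subideal_def) (auto simp: leading_def)
qed

lemma leading_mono_Suc:
  assumes c: "subideal (\<Union>d. polys K x d) c" shows "leading c d \<subseteq> leading c (Suc d)"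
proof
  note c = subidealD[OF c]
  fix a assume "a \<in> leading c d"
  then obtain s where s: "a \<in> K" "s \<in> polys K x d" "a \<otimes> x [^] d \<oplus> s \<in> c" by (auto simp: leading_def)
  have "a \<otimes> x [^] Suc d \<oplus> s \<otimes> x = x \<otimes> (a \<otimes> x [^] d \<oplus> s)"
    using s x by (simp add: sub_closed polys_closed r_distr m_ac)
  moreover have "x \<in> (\<Union>d. polys K x d)" using gen_subset_polys by blast
  ultimately have "a \<otimes> x [^] Suc d \<oplus> s \<otimes> x \<in> c" using c(4)[OF _ s(3)] by simp
  then show "a \<in> leading c (Suc d)" using s polys_x[OF s(2)] by (auto simp: leading_def simp del: polys.simps nat_pow_Suc)
qed

lemma leading_mono:
  assumes "subideal (\<Union>d. polys K x d) c" "d \<le> e" shows "leading c d \<subseteq> leading c e"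
  using assms(2) by (induction rule: dec_induct) (use leading_mono_Suc[OF assms(1)] in auto)

text \<open>Induction on the degree bound: an element of \<open>c\<close> shares its top coefficient
  with some element of \<open>c'\<close>, and the difference lies in \<open>c\<close> and has
  smaller degree bound.\<close>

lemma subideal_eqI:
  assumes c: "subideal (\<Union>d. polys K x d) c" and c': "subideal (\<Union>d. polys K x d) c'" and sub: "c' \<subseteq> c"
    and lead: "\<And>d. leading c d \<subseteq> leading c' d"
  shows "c \<subseteq> c'"
proof -
  have "s \<in> polys K x d \<Longrightarrow> s \<in> c \<Longrightarrow> s \<in> c'" for s d
  proof (induction d arbitrary: s)
    case 0
    then show ?case using subidealD(2)[OF c'] by simp
  next
    case (Suc d)
    then obtain a t where *: "s = a \<otimes> x [^] d \<oplus> t" "a \<in> K" "t \<in> polys K x d" by auto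
    then have "a \<in> leading c d" using Suc by (auto simp: leading_def)
    then obtain t' where t': "t' \<in> polys K x d" "a \<otimes> x [^] d \<oplus> t' \<in> c'"
      using lead by (auto simp: leading_def)
    have m1: "\<ominus> \<one> \<in> (\<Union>d. polys K x d)" using subringE(3,5)[OF subring_polys] by blast
    have tc: "t \<in> carrier R" "t' \<in> carrier R" "a \<in> carrier R" using * t' by (auto simp: sub_closed polys_closed)
    have "s \<oplus> \<ominus> \<one> \<otimes> (a \<otimes> x [^] d \<oplus> t') \<in> c"
      using subidealD[OF c] Suc.prems t' m1 sub by blast
    moreover have "s \<oplus> \<ominus> \<one> \<otimes> (a \<otimes> x [^] d \<oplus> t') = t \<oplus> \<ominus> t'"
    proof -
      have "a \<otimes> x [^] d \<oplus> t \<oplus> (\<ominus> (a \<otimes> x [^] d) \<oplus> \<ominus> t') = (a \<otimes> x [^] d \<oplus> \<ominus> (a \<otimes> x [^] d)) \<oplus> (t \<oplus> \<ominus> t')"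
        using tc x by (simp add: a_ac)
      then show ?thesis using * tc x by (simp add: r_neg l_minus minus_add)
    qed
    moreover have "t \<oplus> \<ominus> t' \<in> polys K x d" using *(3) t'(1) polys_add polys_minus by blast
    ultimately have "t \<oplus> \<ominus> t' \<in> c'" using Suc.IH by simp
    then have "(t \<oplus> \<ominus> t') \<oplus> (a \<otimes> x [^] d \<oplus> t') \<in> c'" using subidealD(3)[OF c'] t' by blast
    moreover have "(t \<oplus> \<ominus> t') \<oplus> (a \<otimes> x [^] d \<oplus> t') = s"
    proof -
      have "(t \<oplus> \<ominus> t') \<oplus> (a \<otimes> x [^] d \<oplus> t') = (a \<otimes> x [^] d \<oplus> t) \<oplus> (t' \<oplus> \<ominus> t')"
        using tc x by (simp add: a_ac)
      then show ?thesis using * tc x by (simp add: r_neg)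
    qed
    ultimately show ?case by simp
  qed
  then show ?thesis using subidealD(1)[OF c] by blast
qed

end

definition subideal_gen :: "'a set \<Rightarrow> 'a set \<Rightarrow> 'a set"
  where "subideal_gen K A = \<Inter>{d. subideal K d \<and> A \<subseteq> d}"

lemma subideal_gen:
  assumes "subring K R" "A \<subseteq> K"
  shows "subideal K (subideal_gen K A)" "A \<subseteq> subideal_gen K A" "subideal K d \<Longrightarrow> A \<subseteq> d \<Longrightarrow> subideal_gen K A \<subseteq> d"
proof -
  have "subideal K K" using subringE[OF assms(1)] by (auto simp: subideal_def)
  then show "subideal K (subideal_gen K A)" "A \<subseteq> subideal_gen K A" "subideal K d \<Longrightarrow> A \<subseteq> d \<Longrightarrow> subideal_gen K A \<subseteq> d"
    using assms(2) by (auto simp: subideal_gen_def subideal_def)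
qed

text \<open>The leading ideals increase with the degree and their union is finitely generated, so
  they are constant from some degree \<open>D\<close> on. Lifts of generators of the leading ideals
  up to \<open>D\<close> then generate \<open>c\<close>.\<close>

theorem hilbert_basis:
  assumes K: "noetherian_subring K" and x: "x \<in> carrier R"
  shows "noetherian_subring (\<Union>d. polys K x d)"
proof -
  have Ks: "subring K R" using K by (simp add: noetherian_subring_def)
  let ?S = "\<Union>d. polys K x d"
  have "\<exists>A. finite A \<and> A \<subseteq> c \<and> (\<forall>d. subideal ?S d \<and> A \<subseteq> d \<longrightarrow> c \<subseteq> d)" if c: "subideal ?S c" for c
  proof -
    let ?L = "leading K x c"
    note L = subideal_leading[OF Ks x c] and Lm = leading_mono[OF Ks x c]
    have UL: "subideal K (\<Union>d. ?L d)"
    proof -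
      have "a \<oplus> b \<in> (\<Union>d. ?L d)" if ab: "a \<in> ?L d" "b \<in> ?L e" for a b d e
      proof -
        have "a \<in> ?L (max d e)" "b \<in> ?L (max d e)" using ab Lm[of d "max d e"] Lm[of e "max d e"] by auto
        then show ?thesis using subidealD(3)[OF L] by blast
      qed
      then show ?thesis
        unfolding subideal_def by (auto dest: subidealD(1)[OF L] subidealD(4)[OF L] intro: subidealD(2)[OF L] simp del: nat_pow_Suc)
    qed
    obtain A where A: "finite A" "A \<subseteq> (\<Union>d. ?L d)" "\<And>d. subideal K d \<Longrightarrow> A \<subseteq> d \<Longrightarrow> (\<Union>d. ?L d) \<subseteq> d"
      using K UL unfolding noetherian_subring_def by meson
    obtain D where D: "A \<subseteq> ?L D"
    proof -
      from A(2) have "\<forall>a\<in>A. \<exists>d. a \<in> ?L d" by blast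
      then obtain f where f: "\<And>a. a \<in> A \<Longrightarrow> a \<in> ?L (f a)" by metis
      have "a \<in> ?L (Max (f ` A))" if "a \<in> A" for a
        using f[OF that] Lm[of "f a" "Max (f ` A)"] A(1) that by auto
      then show ?thesis using that by blast
    qed
    have stab: "?L d \<subseteq> ?L D" for d using A(3)[OF L D] by blast
    have "\<forall>d. \<exists>G. finite G \<and> G \<subseteq> ?L d \<and> (\<forall>e. subideal K e \<and> G \<subseteq> e \<longrightarrow> ?L d \<subseteq> e)"
      using K L unfolding noetherian_subring_def by blast
    then obtain G where G: "\<And>d. finite (G d)" "\<And>d. G d \<subseteq> ?L d"
      "\<And>d e. subideal K e \<Longrightarrow> G d \<subseteq> e \<Longrightarrow> ?L d \<subseteq> e" by metis
    have "\<forall>d. \<forall>a\<in>G d. \<exists>t\<in>polys K x d. a \<otimes> x [^] d \<oplus> t \<in> c"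
      using G(2) unfolding leading_def[OF Ks x] by blast
    then obtain f where f: "\<And>d a. a \<in> G d \<Longrightarrow> f d a \<in> polys K x d" "\<And>d a. a \<in> G d \<Longrightarrow> a \<otimes> x [^] d \<oplus> f d a \<in> c"
      by metis
    \<comment> \<open>Degrees above \<open>D\<close> need no generators of their own: multiplication
      by \<open>x\<close> carries leading coefficients of degree \<open>D\<close> upwards, and by
      \<open>stab\<close> no new ones occur there.\<close>
    define B where "B = (\<Union>d\<in>{..D}. (\<lambda>a. a \<otimes> x [^] d \<oplus> f d a) ` G d)"
    have B: "finite B" "B \<subseteq> c" using G(1) f(2) by (auto simp: B_def)
    have "c \<subseteq> e" if e: "subideal ?S e" "B \<subseteq> e" for e
    proof -
      let ?c' = "subideal_gen ?S B"
      have "B \<subseteq> ?S" using B(2) subidealD(1)[OF c] by blast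
      note c' = subideal_gen[OF subring_polys[OF Ks x] this]
      have "?L d \<subseteq> leading K x ?c' d" if "d \<le> D" for d
      proof (rule G(3)[OF subideal_leading[OF Ks x c'(1)]])
        show "G d \<subseteq> leading K x ?c' d"
          using f(1) c'(2) G(2)[of d] that unfolding leading_def[OF Ks x] B_def by blast
      qed
      then have "?L d \<subseteq> leading K x ?c' d" for d
        using stab[of d] leading_mono[OF Ks x c'(1), of D d] by (meson dual_order.trans nat_le_linear order_refl)
      then have "c \<subseteq> ?c'"
        using subideal_eqI[OF Ks x c c'(1) c'(3)[OF c B(2)]] by blast
      then show ?thesis using c'(3)[OF e] by blast
    qed
    then show ?thesis using B by blast
  qed
  then show ?thesis using subring_polys[OF Ks x] by (simp add: noetherian_subring_def)
qed

text \<open>Serves as the introduction rule for ideals in most of what follows: closure under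
  negation need not be checked, since it is multiplication by minus one.\<close>

lemma subideal_carrier_iff: "subideal (carrier R) c \<longleftrightarrow> ideal c R"
proof
  assume c: "subideal (carrier R) c"
  note c' = subidealD[OF c]
  show "ideal c R"
  proof (rule idealI[OF ring_axioms])
    show "subgroup c (add_monoid R)"
    proof (rule add.subgroupI)
      fix a assume a: "a \<in> c"
      have "\<ominus> \<one> \<otimes> a \<in> c" using c'(4) a by simp
      then show "\<ominus> a \<in> c" using c'(1) a by (simp add: l_minus)
    qed (use c' in auto)
    fix a x assume ax: "a \<in> c" "x \<in> carrier R"
    then show "x \<otimes> a \<in> c" by (intro c'(4))
    then show "a \<otimes> x \<in> c" using m_comm[OF c'(1)[OF ax(1)] ax(2)] by simp
  qed
next
  assume "ideal c R"
  then interpret ideal c R .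
  show "subideal (carrier R) c" by (auto simp: subideal_def intro: I_l_closed)
qed

lemma noetherian_subring_carrier: "noetherian_subring (carrier R) \<Longrightarrow> noetherian_ring R"
proof (rule noetherian_ringI)
  fix I assume N: "noetherian_subring (carrier R)" and I: "ideal I R"
  obtain A where A: "finite A" "A \<subseteq> I" "\<And>d. ideal d R \<Longrightarrow> A \<subseteq> d \<Longrightarrow> I \<subseteq> d"
    using N I unfolding noetherian_subring_def subideal_carrier_iff by meson
  have Ac: "A \<subseteq> carrier R" using A(2) ideal.Icarr[OF I] by blast
  have "I = Idl A"
    using A genideal_ideal[OF Ac] genideal_self[OF Ac] genideal_minimal[OF I A(2)] by auto
  then show "\<exists>A\<subseteq>carrier R. finite A \<and> I = Idl A" using A Ac by blast
qed

lemma noetherian_of_generators: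
  assumes K: "noetherian_subring K" and U: "finite U" "U \<subseteq> carrier R"
    and gen: "generate_ring R (K \<union> U) = carrier R"
  shows "noetherian_ring R"
proof -
  have "\<exists>S. noetherian_subring S \<and> K \<union> U \<subseteq> S" using U
  proof (induction U rule: finite_induct)
    case empty
    then show ?case using K by auto
  next
    case (insert x U)
    then obtain S where S: "noetherian_subring S" "K \<union> U \<subseteq> S" by auto
    have "subring S R" using S by (simp add: noetherian_subring_def)
    then have "K \<union> insert x U \<subseteq> (\<Union>d. polys S x d)"
      using gen_subset_polys[of S x] S insert.prems by blast
    then show ?case using hilbert_basis[OF S(1)] insert.prems by blast
  qed
  then obtain S where S: "noetherian_subring S" "K \<union> U \<subseteq> S" by blast
  then have "subring S R" by (simp add: noetherian_subring_def)
  then have "generate_ring R (K \<union> U) \<subseteq> S"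
    using generate_ring_min_subring1[of "K \<union> U" S] S(2) subringE(1) by blast
  then have "S = carrier R" using gen subringE(1)[OF \<open>subring S R\<close>] by blast
  then show ?thesis using S noetherian_subring_carrier by simp
qed

text \<open>The image need not be a field, as \<open>R\<close> may be the zero ring. A subideal that
  contains the image of a nonzero scalar is generated by that image; otherwise it is zero.\<close>

lemma noetherian_subring_field_image:
  assumes k: "field k" and h: "h \<in> ring_hom k R"
  shows "noetherian_subring (h ` carrier k)"
proof -
  interpret k: field k by fact
  interpret h: ring_hom_ring k R h by unfold_locales (rule h)
  have "subring (h ` carrier k) R" by (rule h.img_is_subring[OF k.carrier_is_subring])
  moreover have "\<exists>A. finite A \<and> A \<subseteq> c \<and> (\<forall>d. subideal (h ` carrier k) d \<and> A \<subseteq> d \<longrightarrow> c \<subseteq> d)"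
    if c: "subideal (h ` carrier k) c" for c
  proof (cases "\<exists>a\<in>carrier k. a \<noteq> \<zero>\<^bsub>k\<^esub> \<and> h a \<in> c")
    case True
    then obtain a where a: "a \<in> carrier k" "a \<noteq> \<zero>\<^bsub>k\<^esub>" "h a \<in> c" by blast
    have "c \<subseteq> d" if d: "subideal (h ` carrier k) d" "{h a} \<subseteq> d" for d
    proof
      fix y assume "y \<in> c"
      then obtain b where b: "b \<in> carrier k" "y = h b" using subidealD(1)[OF c] by blast
      have "y = h (b \<otimes>\<^bsub>k\<^esub> inv\<^bsub>k\<^esub> a) \<otimes> h a"
        using a b by (simp flip: h.hom_mult add: k.m_assoc k.field_Units)
      moreover have "b \<otimes>\<^bsub>k\<^esub> inv\<^bsub>k\<^esub> a \<in> carrier k" using a b k.field_Units by simp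
      ultimately show "y \<in> d" using subidealD(4)[OF d(1)] d(2) by simp
    qed
    then show ?thesis using a by (intro exI[of _ "{h a}"]) auto
  next
    case False
    have "c \<subseteq> {\<zero>}"
    proof
      fix y assume y: "y \<in> c"
      then obtain a where a: "a \<in> carrier k" "y = h a" using subidealD(1)[OF c] by blast
      then have "a = \<zero>\<^bsub>k\<^esub>" using False y by blast
      then show "y \<in> {\<zero>}" using a by simp
    qed
    then show ?thesis by (intro exI[of _ "{}"]) (auto simp: subideal_def)
  qed
  ultimately show ?thesis by (simp add: noetherian_subring_def)
qed

end

lemma finite_type_noetherian:
  assumes k: "field k" and R: "finite_type_algebra k R \<iota>"
  shows "noetherian_ring R"
proof -
  interpret cring R using R by (simp add: finite_type_algebra_def comm_algebra_def)
  have "\<iota> \<in> ring_hom k R" using R by (simp add: finite_type_algebra_def comm_algebra_def)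
  from noetherian_subring_field_image[OF k this] R show ?thesis
    unfolding finite_type_algebra_def by (metis noetherian_of_generators)
qed

section \<open>Maximal members of families of ideals, and Krull's intersection theorem\<close>

lemma (in noetherian_ring) maximal_ideal_in_family:
  assumes "F \<noteq> {}" "\<And>I. I \<in> F \<Longrightarrow> ideal I R"
  shows "\<exists>M\<in>F. \<forall>X\<in>F. M \<subseteq> X \<longrightarrow> X = M"
proof (rule subset_Zorn_nonempty[OF assms(1)])
  fix C assume C: "C \<noteq> {}" "subset.chain F C"
  then have "subset.chain {I. ideal I R} C" using assms(2) by (auto simp: pred_on.chain_def)
  then have "\<Union>C \<in> C" using ideal_chain_is_trivial C by blast
  then show "\<Union>C \<in> F" using C by (auto simp: pred_on.chain_def)
qed

text \<open>Herstein's argument for Krull's intersection theorem: \<open>b\<close> is an ideal maximal among those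
  meeting \<open>a + R x\<close> in \<open>a + m x\<close>.\<close>

lemma krull_intersection:
  fixes R (structure)
  assumes R: "cring R" and N: "noetherian_ring R" and a: "ideal a R" and m: "ideal m R" and x: "x \<in> carrier R"
  shows "\<exists>b. ideal b R \<and> a \<subseteq> b \<and> (\<forall>t\<in>m. \<exists>i::nat. t [^] i \<in> b) \<and>
    (x \<in> b \<longrightarrow> (\<exists>w\<in>m. x \<ominus> w \<otimes> x \<in> a))"
proof -
  interpret cring R by fact
  interpret N: noetherian_ring R by fact
  interpret a: ideal a R by fact
  interpret m: ideal m R by fact
  let ?ax = "{y \<oplus> r \<otimes> x | y r. y \<in> a \<and> r \<in> carrier R}"
  let ?mx = "{y \<oplus> w \<otimes> x | y w. y \<in> a \<and> w \<in> m}"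
  define F where "F = {b. ideal b R \<and> ?mx \<subseteq> b \<and> b \<inter> ?ax \<subseteq> ?mx}"
  have "subideal (carrier R) ?mx"
    unfolding subideal_def
  proof (intro conjI ballI)
    show "?mx \<subseteq> carrier R" using x by auto
    have "\<zero> = \<zero> \<oplus> \<zero> \<otimes> x" using x by simp
    then show "\<zero> \<in> ?mx" using a.zero_closed m.zero_closed by blast
    fix u assume "u \<in> ?mx"
    then obtain y w where u: "u = y \<oplus> w \<otimes> x" "y \<in> a" "w \<in> m" by blast
    {
      fix v assume "v \<in> ?mx"
      then obtain y' w' where v: "v = y' \<oplus> w' \<otimes> x" "y' \<in> a" "w' \<in> m" by blast
      have "u \<oplus> v = (y \<oplus> y') \<oplus> (w \<oplus> w') \<otimes> x" using u v x by (simp add: l_distr a_ac)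
      then show "u \<oplus> v \<in> ?mx" using u v by blast
    next
      fix r assume r: "r \<in> carrier R"
      have "r \<otimes> u = r \<otimes> y \<oplus> (r \<otimes> w) \<otimes> x" using u x r by (simp add: r_distr m_assoc)
      then show "r \<otimes> u \<in> ?mx" using u r a.I_l_closed m.I_l_closed by blast
    }
  qed
  then have "?mx \<in> F" by (auto simp: F_def subideal_carrier_iff)
  moreover have "\<And>I. I \<in> F \<Longrightarrow> ideal I R" by (simp add: F_def)
  ultimately obtain b where b: "b \<in> F" and max: "\<And>X. X \<in> F \<Longrightarrow> b \<subseteq> X \<Longrightarrow> X = b"
    using N.maximal_ideal_in_family[of F] by blast
  interpret b: ideal b R using b by (simp add: F_def)
  have mxb: "?mx \<subseteq> b" and bax: "b \<inter> ?ax \<subseteq> ?mx" using b by (auto simp: F_def)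
  have "a \<subseteq> b"
  proof
    fix y assume y: "y \<in> a"
    have "y = y \<oplus> \<zero> \<otimes> x" using x y by simp
    then show "y \<in> b" using mxb y m.zero_closed by blast
  qed
  moreover have "\<exists>i::nat. t [^] i \<in> b" if t: "t \<in> m" for t
  proof -
    have tc: "t \<in> carrier R" using t by simp
    \<comment> \<open>The colon ideals \<open>(b : t^i)\<close> form an increasing chain and hence
      become stationary.\<close>
    define q where "q i = {c \<in> carrier R. t [^] i \<otimes> c \<in> b}" for i :: nat
    have q: "ideal (q i) R" for i
      unfolding subideal_carrier_iff[symmetric] subideal_def q_def
      using tc by (auto simp: r_distr m_lcomm intro: b.I_l_closed b.a_closed)
    have qS: "q i \<subseteq> q (Suc i)" for i
    proof
      fix c assume c: "c \<in> q i"
      have "t [^] Suc i \<otimes> c = t \<otimes> (t [^] i \<otimes> c)" using c tc by (simp add: q_def m_ac)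
      then show "c \<in> q (Suc i)" using c tc by (auto simp: q_def intro: b.I_l_closed)
    qed
    have qm: "i \<le> k \<Longrightarrow> q i \<subseteq> q k" for i k using qS by (rule lift_Suc_mono_le)
    have "subset.chain {I. ideal I R} (range q)"
      unfolding pred_on.chain_def using q qm nat_le_linear by blast
    then have "\<Union>(range q) \<in> range q" by (intro N.ideal_chain_is_trivial) auto
    then obtain i where i: "\<And>k. q k \<subseteq> q i" by auto
    \<comment> \<open>Adding the multiples of \<open>t^i\<close>, for the exponent \<open>i\<close>
      at which the colon ideals stop growing, does not leave the family \<open>F\<close>. Maximality
      of \<open>b\<close> then forces \<open>t^i\<close> into \<open>b\<close>.\<close>
    let ?b = "{y \<oplus> r \<otimes> t [^] i | y r. y \<in> b \<and> r \<in> carrier R}"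
    have "subideal (carrier R) ?b"
      unfolding subideal_def
    proof (intro conjI ballI)
      show "?b \<subseteq> carrier R" using tc by auto
      have "\<zero> = \<zero> \<oplus> \<zero> \<otimes> t [^] i" using tc by simp
      then show "\<zero> \<in> ?b" using b.zero_closed by blast
      fix u assume "u \<in> ?b"
      then obtain y w where u: "u = y \<oplus> w \<otimes> t [^] i" "y \<in> b" "w \<in> carrier R" by blast
      {
        fix v assume "v \<in> ?b"
        then obtain y' w' where v: "v = y' \<oplus> w' \<otimes> t [^] i" "y' \<in> b" "w' \<in> carrier R" by blast
        have "u \<oplus> v = (y \<oplus> y') \<oplus> (w \<oplus> w') \<otimes> t [^] i" using u v tc by (simp add: l_distr a_ac)
        then show "u \<oplus> v \<in> ?b" using u v by blast
      next
        fix r assume r: "r \<in> carrier R"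
        have "r \<otimes> u = r \<otimes> y \<oplus> (r \<otimes> w) \<otimes> t [^] i" using u tc r by (simp add: r_distr m_assoc)
        then show "r \<otimes> u \<in> ?b" using u r b.I_l_closed by blast
      }
    qed
    then have "ideal ?b R" by (simp add: subideal_carrier_iff)
    moreover have bb: "b \<subseteq> ?b"
    proof
      fix y assume y: "y \<in> b"
      have "y = y \<oplus> \<zero> \<otimes> t [^] i" using tc y by simp
      then show "y \<in> ?b" using y by blast
    qed
    \<comment> \<open>For \<open>u = y + c t^i\<close> in both sets, \<open>t u\<close> lies in
      \<open>a + m x\<close> and hence in \<open>b\<close>. So \<open>t^(i+1) c\<close> is in
      \<open>b\<close>, by stationarity \<open>t^i c\<close> is in \<open>b\<close>, and then so is
      \<open>u\<close>.\<close>
    moreover have "?b \<inter> ?ax \<subseteq> ?mx"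
    proof
      fix u assume u: "u \<in> ?b \<inter> ?ax"
      then obtain y c z r where 1: "u = y \<oplus> c \<otimes> t [^] i" "y \<in> b" "c \<in> carrier R"
        and 2: "u = z \<oplus> r \<otimes> x" "z \<in> a" "r \<in> carrier R" by blast
      have "t \<otimes> u = t \<otimes> z \<oplus> (r \<otimes> t) \<otimes> x" using 2 tc x by (simp add: r_distr m_ac)
      moreover have "t \<otimes> z \<in> a" "r \<otimes> t \<in> m" using a.I_l_closed[OF 2(2) tc] m.I_l_closed[OF t 2(3)] .
      ultimately have "t \<otimes> u \<in> ?mx" by blast
      then have tu: "t \<otimes> u \<in> b" using mxb by blast
      have "t [^] Suc i \<otimes> c = t \<otimes> u \<ominus> t \<otimes> y"
      proof -
        have yc: "y \<in> carrier R" using 1 by simp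
        have "t \<otimes> u = t \<otimes> y \<oplus> t [^] Suc i \<otimes> c"
          unfolding 1(1) using 1(3) yc tc by (simp add: r_distr m_ac)
        then have "t \<otimes> u \<ominus> t \<otimes> y = (t [^] Suc i \<otimes> c) \<oplus> (t \<otimes> y \<oplus> \<ominus> (t \<otimes> y))"
          using 1(3) yc tc by (simp add: a_minus_def a_ac del: nat_pow_Suc)
        then show ?thesis using 1(3) yc tc by (simp add: r_neg del: nat_pow_Suc)
      qed
      moreover have "t \<otimes> u \<ominus> t \<otimes> y \<in> b"
        unfolding a_minus_def using tu b.I_l_closed[OF 1(2) tc] by (intro b.a_closed b.a_inv_closed)
      ultimately have "t [^] Suc i \<otimes> c \<in> b" by (simp only:)
      then have "c \<in> q (Suc i)" using 1 by (simp add: q_def)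
      then have "t [^] i \<otimes> c \<in> b" using i unfolding q_def by blast
      then have "u \<in> b" using 1 tc by (simp add: m_comm b.a_closed)
      then show "u \<in> ?mx" using bax u by blast
    qed
    ultimately have "?b \<in> F" using mxb by (auto simp: F_def)
    then have "?b = b" using max bb by blast
    moreover have "\<zero> \<oplus> \<one> \<otimes> t [^] i \<in> ?b" using b.zero_closed by blast
    ultimately have "\<zero> \<oplus> \<one> \<otimes> t [^] i \<in> b" by simp
    then show ?thesis using tc by auto
  qed
  moreover have "\<exists>w\<in>m. x \<ominus> w \<otimes> x \<in> a" if xb: "x \<in> b"
  proof -
    have "x = \<zero> \<oplus> \<one> \<otimes> x" using x by simp
    then have "x \<in> ?ax" using a.zero_closed by blast
    \<comment> \<open>The meeting condition on \<open>b\<close> is applied to \<open>x\<close>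
      itself, which lies in \<open>a + R x\<close>.\<close>
    then obtain y w where yw: "x = y \<oplus> w \<otimes> x" "y \<in> a" "w \<in> m" using bax xb by blast
    have "x \<ominus> w \<otimes> x = y"
    proof -
      have "(y \<oplus> w \<otimes> x) \<ominus> w \<otimes> x = y" using yw(2,3) x by (simp add: a_minus_def a_assoc r_neg)
      then show ?thesis using yw(1) by simp
    qed
    then show ?thesis using yw by auto
  qed
  ultimately show ?thesis using b.ideal_axioms by blast
qed

section \<open>Rings in which annihilators are generated by idempotents\<close>

text \<open>The commutative rings whose principal ideals are projective. The element
  \<open>e\<close> lies in the annihilator of \<open>x\<close> and acts on it as the identity, hence
  it is an idempotent generating it.\<close>

definition pp_ring :: "'r ring \<Rightarrow> bool"
  where "pp_ring R \<longleftrightarrow> cring R \<and>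
    (\<forall>x\<in>carrier R. \<exists>e\<in>carrier R. e \<otimes>\<^bsub>R\<^esub> x = \<zero>\<^bsub>R\<^esub> \<and> (\<forall>z\<in>carrier R. x \<otimes>\<^bsub>R\<^esub> z = \<zero>\<^bsub>R\<^esub> \<longrightarrow> e \<otimes>\<^bsub>R\<^esub> z = z))"

lemma pp_ring_domain:
  fixes R (structure) assumes "domain R" shows "pp_ring R"
proof -
  interpret domain R by fact
  have "\<exists>e\<in>carrier R. e \<otimes> x = \<zero> \<and> (\<forall>z\<in>carrier R. x \<otimes> z = \<zero> \<longrightarrow> e \<otimes> z = z)" if "x \<in> carrier R" for x
    using that by (cases "x = \<zero>") (auto simp: integral_iff intro: bexI[of _ \<one>] bexI[of _ \<zero>])
  then show ?thesis by (simp add: pp_ring_def is_cring)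
qed

text \<open>The annihilator of \<open>x\<close> has finitely many generators \<open>y\<close>. For
  each of them comaximality provides an element that fixes \<open>x\<close> and kills
  \<open>y\<close>. The product \<open>b\<close> of these elements fixes \<open>x\<close> and kills
  the whole annihilator, so \<open>1 - b\<close> is the required idempotent.\<close>

lemma pp_ringI_noetherian:
  fixes R :: "'r ring" (structure)
  assumes R: "cring R" and N: "noetherian_ring R"
    and comax: "\<And>x y. x \<in> carrier R \<Longrightarrow> y \<in> carrier R \<Longrightarrow> x \<otimes> y = \<zero> \<Longrightarrow>
      \<exists>a\<in>carrier R. \<exists>b\<in>carrier R. a \<otimes> x = \<zero> \<and> b \<otimes> y = \<zero> \<and> a \<oplus> b = \<one>"
  shows "pp_ring R"
proof -
  interpret cring R by fact
  interpret N: noetherian_ring R by fact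
  have ann: "ideal {z\<in>carrier R. x \<otimes> z = \<zero>} R" if "x \<in> carrier R" for x
    unfolding subideal_carrier_iff[symmetric] subideal_def using that by (auto simp: r_distr m_lcomm)
  have "\<exists>e\<in>carrier R. e \<otimes> x = \<zero> \<and> (\<forall>z\<in>carrier R. x \<otimes> z = \<zero> \<longrightarrow> e \<otimes> z = z)" if x: "x \<in> carrier R" for x
  proof -
    obtain A where A: "A \<subseteq> carrier R" "finite A" "{z\<in>carrier R. x \<otimes> z = \<zero>} = Idl A"
      using N.finetely_gen[OF ann[OF x]] by blast
    have "\<exists>b\<in>carrier R. b \<otimes> x = x \<and> (\<forall>y\<in>A. b \<otimes> y = \<zero>)"
      using A(2) genideal_self[OF A(1), folded A(3)]
    proof (induction A rule: finite_induct)
      case empty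
      then show ?case using x by (auto intro: bexI[of _ \<one>])
    next
      case (insert y A)
      then obtain b where b: "b \<in> carrier R" "b \<otimes> x = x" "\<And>y. y \<in> A \<Longrightarrow> b \<otimes> y = \<zero>" by auto
      obtain a' b' where ab: "a' \<in> carrier R" "b' \<in> carrier R" "a' \<otimes> x = \<zero>" "b' \<otimes> y = \<zero>" "a' \<oplus> b' = \<one>"
        using comax[of x y] x insert.prems by auto
      have "b' \<otimes> x = (a' \<oplus> b') \<otimes> x" using ab(1-4) x by (simp add: l_distr)
      then have b'x: "b' \<otimes> x = x" using ab(5) x by simp
      have "(b \<otimes> b') \<otimes> x = x" using b ab x b'x by (simp add: m_assoc)
      moreover have "(b \<otimes> b') \<otimes> z = \<zero>" if "z \<in> insert y A" for z
      proof -
        have z: "z \<in> carrier R" using that insert.prems by auto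
        have "(b \<otimes> b') \<otimes> z = b \<otimes> (b' \<otimes> z)" "(b \<otimes> b') \<otimes> z = b' \<otimes> (b \<otimes> z)"
          using b(1) ab(2) z by (simp_all add: m_ac)
        then show ?thesis using that b ab by auto
      qed
      ultimately show ?case using b ab by blast
    qed
    then obtain b where b: "b \<in> carrier R" "b \<otimes> x = x" "\<And>y. y \<in> A \<Longrightarrow> b \<otimes> y = \<zero>" by blast
    have "Idl A \<subseteq> {z\<in>carrier R. b \<otimes> z = \<zero>}"
      by (rule genideal_minimal[OF ann[OF b(1)]]) (use b A in auto)
    then have bz: "b \<otimes> z = \<zero>" if "z \<in> carrier R" "x \<otimes> z = \<zero>" for z using that A(3) by blast
    show ?thesis
      by (rule bexI[of _ "\<one> \<ominus> b"]) (use b x bz in \<open>auto simp: a_minus_def l_distr l_minus r_neg\<close>)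
  qed
  then show ?thesis using R by (simp add: pp_ring_def)
qed

section \<open>Polynomial rings\<close>

locale polynomial_ring = B: cring B for B :: "'r ring" and V :: "'x set"
begin

sublocale P: comm_monoid_algebra B "free_comm_monoid V"
  by (intro comm_monoid_algebra.intro comm_monoid_free_comm_monoid B.cring_axioms)

abbreviation "Pol \<equiv> monoid_algebra B (free_comm_monoid V)"
abbreviation con :: "'r \<Rightarrow> 'x multiset \<Rightarrow> 'r" where "con c \<equiv> monomial B c {#}"
abbreviation var :: "'x \<Rightarrow> 'x multiset \<Rightarrow> 'r" where "var i \<equiv> monomial B \<one>\<^bsub>B\<^esub> {#i#}"

context
  fixes C :: "('c, 'l) ring_scheme" and h :: "'r \<Rightarrow> 'c" and g :: "'x \<Rightarrow> 'c"
  assumes C: "cring C" and h: "h \<in> ring_hom B C" and g: "g \<in> V \<rightarrow> carrier C"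
begin

lemma poly_eval_hom: "monoid_algebra_eval B C h (mset_prod C g) \<in> ring_hom Pol C"
  and poly_eval_con: "c \<in> carrier B \<Longrightarrow> monoid_algebra_eval B C h (mset_prod C g) (con c) = h c"
  and poly_eval_var: "i \<in> V \<Longrightarrow> monoid_algebra_eval B C h (mset_prod C g) (var i) = g i"
proof -
  interpret C: cring C by (rule C)
  interpret h: ring_hom_ring B C h by unfold_locales (rule h)
  have m: "mset_prod C g \<in> carrier (free_comm_monoid V) \<rightarrow> carrier C"
    "\<And>a b. a \<in> carrier (free_comm_monoid V) \<Longrightarrow> b \<in> carrier (free_comm_monoid V) \<Longrightarrow>
       mset_prod C g (a \<otimes>\<^bsub>free_comm_monoid V\<^esub> b) = mset_prod C g a \<otimes>\<^bsub>C\<^esub> mset_prod C g b"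
    "mset_prod C g \<one>\<^bsub>free_comm_monoid V\<^esub> = \<one>\<^bsub>C\<^esub>"
    by (auto simp: C.mset_prod_union[OF g] C.mset_prod_closed[OF g])
  show "monoid_algebra_eval B C h (mset_prod C g) \<in> ring_hom Pol C" by (rule P.eval_ring_hom[OF C h m])
  show "c \<in> carrier B \<Longrightarrow> monoid_algebra_eval B C h (mset_prod C g) (con c) = h c"
    using P.eval_monomial[OF C h m, of c "{#}"] by simp
  show "i \<in> V \<Longrightarrow> monoid_algebra_eval B C h (mset_prod C g) (var i) = g i"
    using P.eval_monomial[OF C h m, of "\<one>\<^bsub>B\<^esub>" "{#i#}"] g by (auto simp: C.mset_prod_single[OF g] Pi_iff)
qed

end

lemma con_closed [simp]: "c \<in> carrier B \<Longrightarrow> con c \<in> carrier Pol" by simp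

lemma con_hom: "(\<lambda>c. con c) \<in> ring_hom B Pol"
  using P.const_ring_hom by simp

lemma monomial_split:
  "r \<in> carrier B \<Longrightarrow> set_mset w \<subseteq> V \<Longrightarrow> monomial B r w = con r \<otimes>\<^bsub>Pol\<^esub> monomial B \<one>\<^bsub>B\<^esub> w"
  using P.monomial_split[of r w] by simp

lemma monomial_add_mset:
  "i \<in> V \<Longrightarrow> set_mset w \<subseteq> V \<Longrightarrow> monomial B \<one>\<^bsub>B\<^esub> (add_mset i w) = var i \<otimes>\<^bsub>Pol\<^esub> monomial B \<one>\<^bsub>B\<^esub> w"
  by (simp add: P.monomial_mult)

lemma poly_hom_eqI:
  assumes C: "cring C" and f: "f \<in> ring_hom Pol C" and g: "g \<in> ring_hom Pol C"
    and con: "\<And>c. c \<in> carrier B \<Longrightarrow> f (con c) = g (con c)" and var: "\<And>i. i \<in> V \<Longrightarrow> f (var i) = g (var i)"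
    and p: "p \<in> carrier Pol"
  shows "f p = g p"
proof (rule P.hom_eqI[OF C f g _ p])
  fix r w assume r: "r \<in> carrier B" and "w \<in> carrier (free_comm_monoid V)"
  then have w: "set_mset w \<subseteq> V" by simp
  have 1: "f (monomial B \<one>\<^bsub>B\<^esub> w) = g (monomial B \<one>\<^bsub>B\<^esub> w)" using w
  proof (induction w)
    case empty
    then show ?case by (simp add: con)
  next
    case (add i w)
    have "var i \<in> carrier Pol" "monomial B \<one>\<^bsub>B\<^esub> w \<in> carrier Pol" using add by auto
    moreover have "monomial B \<one>\<^bsub>B\<^esub> (add_mset i w) = var i \<otimes>\<^bsub>Pol\<^esub> monomial B \<one>\<^bsub>B\<^esub> w"
      using add.prems by (intro monomial_add_mset) auto
    ultimately show ?case using add var ring_hom_mult[OF f] ring_hom_mult[OF g] by simp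
  qed
  show "f (monomial B r w) = g (monomial B r w)"
    using r w 1 con ring_hom_mult[OF f] ring_hom_mult[OF g] by (simp add: monomial_split[of r w])
qed

lemma generate_ring_Pol:
  "generate_ring Pol ((\<lambda>c. con c) ` carrier B \<union> (\<lambda>i. var i) ` V) = carrier Pol" (is "generate_ring Pol ?G = _")
proof -
  have G: "?G \<subseteq> carrier Pol" by auto
  have m: "set_mset w \<subseteq> V \<Longrightarrow> monomial B \<one>\<^bsub>B\<^esub> w \<in> generate_ring Pol ?G" for w
  proof (induction w)
    case empty
    then show ?case by (intro generate_ring.incl) auto
  next
    case (add i w)
    have "var i \<otimes>\<^bsub>Pol\<^esub> monomial B \<one>\<^bsub>B\<^esub> w \<in> generate_ring Pol ?G"
      using add by (intro generate_ring.eng_mult) (auto intro: generate_ring.incl)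
    then show ?case using add.prems monomial_add_mset[of i w] by simp
  qed
  have "p \<in> generate_ring Pol ?G" if "p \<in> carrier Pol" for p
    using that
  proof (induction rule: P.MA_induct)
    case zero
    have "\<zero>\<^bsub>Pol\<^esub> = con \<zero>\<^bsub>B\<^esub>" by (simp add: P.monomial_zero)
    then show ?case by (auto intro!: generate_ring.incl)
  next
    case (add r w q)
    then have "monomial B r w \<in> generate_ring Pol ?G"
      using monomial_split[of r w] m[of w] generate_ring.eng_mult[of "con r" Pol ?G "monomial B \<one>\<^bsub>B\<^esub> w"]
      by (auto simp del: P.monomial_closed intro: generate_ring.incl)
    then show ?case using add by (intro generate_ring.eng_add)
  qed
  then show ?thesis using P.MA.generate_ring_in_carrier[OF G] by blast
qed

end

text \<open>Minimal monomials with respect to size, ties broken by the multiset order, multiply.\<close>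

locale polynomial_domain = B: domain B for B :: "'r ring" and V :: "'x::linorder set"
begin

sublocale polynomial_ring B V by unfold_locales

lemma minimal_coeff:
  assumes p: "p \<in> carrier Pol" and a: "p a0 \<noteq> \<zero>\<^bsub>B\<^esub>"
  obtains a where "p a \<noteq> \<zero>\<^bsub>B\<^esub>" "size a \<le> size a0"
    "\<And>b. p b \<noteq> \<zero>\<^bsub>B\<^esub> \<Longrightarrow> size a < size b \<or> size a = size b \<and> a \<le> b"
proof -
  let ?S = "{g. p g \<noteq> \<zero>\<^bsub>B\<^esub>}"
  have S: "finite ?S" "a0 \<in> ?S" using P.finite_supp[OF p] a by auto
  define n where "n = Min (size ` ?S)"
  have n: "\<And>b. p b \<noteq> \<zero>\<^bsub>B\<^esub> \<Longrightarrow> n \<le> size b" using S by (simp add: n_def)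
  have "n \<in> size ` ?S" unfolding n_def using S by (intro Min_in) auto
  then have A: "finite {b\<in>?S. size b = n}" "{b\<in>?S. size b = n} \<noteq> {}" using S(1) by auto
  let ?a = "Min {b\<in>?S. size b = n}"
  have "?a \<in> {b\<in>?S. size b = n}" by (rule Min_in[OF A])
  moreover have "\<And>b. b \<in> {b\<in>?S. size b = n} \<Longrightarrow> ?a \<le> b" by (rule Min_le[OF A(1)])
  ultimately have "p ?a \<noteq> \<zero>\<^bsub>B\<^esub>" "size ?a = n" "\<And>b. p b \<noteq> \<zero>\<^bsub>B\<^esub> \<Longrightarrow> size b = n \<Longrightarrow> ?a \<le> b" by auto
  then show ?thesis using n a by (intro that[of ?a]) (auto simp: le_less)
qed

text \<open>More than absence of zero divisors: the bound on the size of a surviving monomial says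
  that the order of a product at the origin is at most the sum of the orders. This is what later
  forces one of two factors to have high order.\<close>

lemma mult_low_coeff:
  assumes p: "p \<in> carrier Pol" "p a0 \<noteq> \<zero>\<^bsub>B\<^esub>" and q: "q \<in> carrier Pol" "q b0 \<noteq> \<zero>\<^bsub>B\<^esub>"
  shows "\<exists>c. size c \<le> size a0 + size b0 \<and> (p \<otimes>\<^bsub>Pol\<^esub> q) c \<noteq> \<zero>\<^bsub>B\<^esub>"
proof -
  obtain a where a: "p a \<noteq> \<zero>\<^bsub>B\<^esub>" "size a \<le> size a0"
    "\<And>b. p b \<noteq> \<zero>\<^bsub>B\<^esub> \<Longrightarrow> size a < size b \<or> size a = size b \<and> a \<le> b" using minimal_coeff[OF p] by metis
  obtain b where b: "q b \<noteq> \<zero>\<^bsub>B\<^esub>" "size b \<le> size b0"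
    "\<And>c. q c \<noteq> \<zero>\<^bsub>B\<^esub> \<Longrightarrow> size b < size c \<or> size b = size c \<and> b \<le> c" using minimal_coeff[OF q] by metis
  let ?S = "{g. p g \<noteq> \<zero>\<^bsub>B\<^esub>}" and ?T = "{g. q g \<noteq> \<zero>\<^bsub>B\<^esub>}"
  note S = P.finite_supp[OF p(1)] order_refl P.supp_subset[OF p(1)]
    and T = P.finite_supp[OF q(1)] order_refl P.supp_subset[OF q(1)]
  \<comment> \<open>Both sizes are minimal and their sum is prescribed, so they agree with those of
    \<open>a\<close> and \<open>b\<close>. Then \<open>a\<close> and \<open>b\<close> are also least
    in the multiset order, and strict monotonicity of addition excludes any other pair.\<close>
  have "{c\<in>?S \<times> ?T. fst c \<otimes>\<^bsub>free_comm_monoid V\<^esub> snd c = a + b} = {(a, b)}"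
  proof -
    have "a' = a \<and> b' = b" if "p a' \<noteq> \<zero>\<^bsub>B\<^esub>" "q b' \<noteq> \<zero>\<^bsub>B\<^esub>" and e: "a' + b' = a + b" for a' b'
    proof -
      have s: "size a' + size b' = size a + size b" using e by (metis size_union)
      then have "a \<le> a'" "b \<le> b'" using a(3)[OF that(1)] b(3)[OF that(2)] by auto
      then show ?thesis using e by (metis add_left_cancel add_mono_thms_linordered_field(5) add_less_le_mono add_le_less_mono order_le_less less_irrefl)
    qed
    then show ?thesis using a(1) b(1) by auto
  qed
  then have "(p \<otimes>\<^bsub>Pol\<^esub> q) (a + b) = p a \<otimes>\<^bsub>B\<^esub> q b"
    using P.mult_formula[OF p(1) q(1) S T, of "a + b"] p q by simp
  then have "(p \<otimes>\<^bsub>Pol\<^esub> q) (a + b) \<noteq> \<zero>\<^bsub>B\<^esub>" using a b p q by (simp add: B.integral_iff)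
  then show ?thesis using a b by (intro exI[of _ "a + b"]) auto
qed

lemma domain_Pol: "domain Pol"
proof (rule domainI[OF P.cring_MA])
  have "\<one>\<^bsub>Pol\<^esub> {#} \<noteq> \<zero>\<^bsub>Pol\<^esub> {#}" by (simp add: P.MA_simps monomial_def)
  then show "\<one>\<^bsub>Pol\<^esub> \<noteq> \<zero>\<^bsub>Pol\<^esub>" by metis
  fix p q assume pq: "p \<otimes>\<^bsub>Pol\<^esub> q = \<zero>\<^bsub>Pol\<^esub>" "p \<in> carrier Pol" "q \<in> carrier Pol"
  show "p = \<zero>\<^bsub>Pol\<^esub> \<or> q = \<zero>\<^bsub>Pol\<^esub>"
  proof (rule ccontr)
    assume "\<not> ?thesis"
    then obtain a b where "p a \<noteq> \<zero>\<^bsub>B\<^esub>" "q b \<noteq> \<zero>\<^bsub>B\<^esub>" by (auto simp: P.MA_simps fun_eq_iff)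
    then show False using mult_low_coeff[of p a q b] pq by (auto simp: P.MA_simps)
  qed
qed

end

section \<open>Powers of ideals, and the descent of linear relations from an extension field\<close>

primrec ideal_power :: "('a, 'b) ring_scheme \<Rightarrow> 'a set \<Rightarrow> nat \<Rightarrow> 'a set" where
  "ideal_power R I 0 = carrier R"
| "ideal_power R I (Suc m) = I \<cdot>\<^bsub>R\<^esub> ideal_power R I m"

lemma (in ring) ideal_power_ideal: "ideal I R \<Longrightarrow> ideal (ideal_power R I m) R"
  by (induction m) (auto intro: ideal_prod_is_ideal oneideal)

lemma (in ring) ideal_power_antimono_Suc: "ideal I R \<Longrightarrow> ideal_power R I (Suc m) \<subseteq> ideal_power R I m"
  using ideal_prod_inter[of I "ideal_power R I m"] ideal_power_ideal by auto

text \<open>The relations witnessed by \<open>\<chi>\<close> over the extension field \<open>K\<close> already hold for a single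
  element: eliminate the entries of the list one after the other.\<close>

fun combination :: "('l, 'm) ring_scheme \<Rightarrow> ('d \<Rightarrow> 'l) \<Rightarrow> ('l \<times> 'd) list \<Rightarrow> 'l" where
  "combination K F [] = \<zero>\<^bsub>K\<^esub>"
| "combination K F ((\<beta>, d) # L) = \<beta> \<otimes>\<^bsub>K\<^esub> F d \<oplus>\<^bsub>K\<^esub> combination K F L"

lemma (in cring) combination_closed:
  "(\<And>d. d \<in> D \<Longrightarrow> F d \<in> carrier R) \<Longrightarrow> set L \<subseteq> carrier R \<times> D \<Longrightarrow> combination R F L \<in> carrier R"
  by (induction L) auto

lemma (in cring) combination_append:
  assumes F: "\<And>d. d \<in> D \<Longrightarrow> F d \<in> carrier R" and L: "set L \<subseteq> carrier R \<times> D" "set M \<subseteq> carrier R \<times> D"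
  shows "combination R F (L @ M) = combination R F L \<oplus>\<^bsub>R\<^esub> combination R F M"
  using L(1)
proof (induction L)
  case Nil
  then show ?case using combination_closed[OF F L(2)] by simp
next
  case (Cons x L)
  then show ?case using F combination_closed[OF F L(2)] combination_closed[OF F, where L = L]
    by (cases x) (auto simp: a_assoc)
qed

lemma (in cring) elimination_identity:
  assumes "b \<in> carrier R" "h \<in> carrier R" "x \<in> carrier R" "c \<in> carrier R" "g \<in> carrier R" "s \<in> carrier R" "t \<in> carrier R"
  shows "b \<otimes> (h \<ominus> x \<otimes> c \<otimes> g) \<oplus> (s \<ominus> t \<otimes> (c \<otimes> g)) = (b \<otimes> h \<oplus> s) \<ominus> (b \<otimes> x \<oplus> t) \<otimes> (c \<otimes> g)"
  using assms by (simp add: a_minus_def l_distr r_distr l_minus r_minus minus_add m_ac a_ac)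

lemma (in cring) minus_mult_minus_identity:
  assumes "p \<in> carrier R" "e \<in> carrier R" "q \<in> carrier R" "x \<in> carrier R" "g \<in> carrier R" "h \<in> carrier R"
  shows "(p \<ominus> e \<otimes> q) \<otimes> x \<ominus> (g \<ominus> e \<otimes> h) = (p \<otimes> x \<ominus> g) \<ominus> e \<otimes> (q \<otimes> x \<ominus> h)"
  using assms by (simp add: a_minus_def l_distr r_distr l_minus r_minus minus_add m_ac a_ac)

text \<open>An elementary form of flatness of \<open>K\<close> over \<open>k\<close>: the common
  kernel of the \<open>k\<close>-linear forms \<open>\<chi> w\<close>, extended to \<open>K\<close>,
  is spanned by the kernel over \<open>k\<close>. If \<open>F\<close> is nonzero on the former it is
  nonzero on the latter. The linear structure of \<open>D\<close> enters only through the operation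
  \<open>comb\<close>.\<close>

lemma descend_relation:
  fixes k :: "'k ring" and K :: "'l ring"
  assumes k: "field k" and K: "field K" and \<kappa>: "\<kappa> \<in> ring_hom k K"
    and \<chi>: "\<And>w d. d \<in> D \<Longrightarrow> \<chi> w d \<in> carrier k" and F: "\<And>d. d \<in> D \<Longrightarrow> F d \<in> carrier K"
    and comb: "\<And>d c d0. d \<in> D \<Longrightarrow> d0 \<in> D \<Longrightarrow> c \<in> carrier k \<Longrightarrow> comb d c d0 \<in> D"
    and \<chi>_comb: "\<And>w d c d0. d \<in> D \<Longrightarrow> d0 \<in> D \<Longrightarrow> c \<in> carrier k \<Longrightarrow> \<chi> w (comb d c d0) = \<chi> w d \<ominus>\<^bsub>k\<^esub> c \<otimes>\<^bsub>k\<^esub> \<chi> w d0"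
    and F_comb: "\<And>d c d0. d \<in> D \<Longrightarrow> d0 \<in> D \<Longrightarrow> c \<in> carrier k \<Longrightarrow> F (comb d c d0) = F d \<ominus>\<^bsub>K\<^esub> \<kappa> c \<otimes>\<^bsub>K\<^esub> F d0"
    and L: "set L \<subseteq> carrier K \<times> D"
    and rel: "\<And>w. combination K (\<lambda>d. \<kappa> (\<chi> w d)) L = \<zero>\<^bsub>K\<^esub>" and nz: "combination K F L \<noteq> \<zero>\<^bsub>K\<^esub>"
  shows "\<exists>d\<in>D. (\<forall>w. \<chi> w d = \<zero>\<^bsub>k\<^esub>) \<and> F d \<noteq> \<zero>\<^bsub>K\<^esub>"
  using L rel nz
proof (induction "length L" arbitrary: L)
  case 0
  then show ?case by simp
next
  case (Suc n)
  interpret k: field k by fact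
  interpret K: field K by fact
  interpret \<kappa>: ring_hom_ring k K \<kappa> by unfold_locales (rule \<kappa>)
  obtain \<beta> d L' where L: "L = (\<beta>, d) # L'" using Suc(2) by (cases L) auto
  have \<beta>: "\<beta> \<in> carrier K" "d \<in> D" and L': "set L' \<subseteq> carrier K \<times> D" "n = length L'" using Suc.prems Suc(2) L by auto
  have cc: "combination K (\<lambda>d. \<kappa> (\<chi> w d)) L' \<in> carrier K" for w by (rule K.combination_closed[OF _ L'(1)]) (use \<chi> in auto)
  have cF: "combination K F L' \<in> carrier K" by (rule K.combination_closed[OF _ L'(1)]) (use F in auto)
  show ?case
  proof (cases "\<forall>w. \<chi> w d = \<zero>\<^bsub>k\<^esub>")
    case True
    show ?thesis
    proof (cases "F d = \<zero>\<^bsub>K\<^esub>")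
      case Fd: True
      show ?thesis
        by (rule Suc(1)[OF L'(2,1)]) (use Suc.prems True Fd L \<beta> cc cF in auto)
    qed (use True \<beta> in auto)
  next
    case False
    then obtain w0 where w0: "\<chi> w0 d \<noteq> \<zero>\<^bsub>k\<^esub>" by blast
    let ?c = "\<chi> w0 d"
    have c: "?c \<in> carrier k" "inv\<^bsub>k\<^esub> ?c \<in> carrier k" "?c \<otimes>\<^bsub>k\<^esub> inv\<^bsub>k\<^esub> ?c = \<one>\<^bsub>k\<^esub>" using \<chi> \<beta> w0 k.field_Units by auto
    \<comment> \<open>Gaussian elimination with pivot \<open>d\<close>: the multiple of
      \<open>d\<close> that is subtracted from an entry makes its value under
      \<open>\<chi> w0\<close> vanish.\<close>
    let ?f = "\<lambda>x. (fst x, comb (snd x) (\<chi> w0 (snd x) \<otimes>\<^bsub>k\<^esub> inv\<^bsub>k\<^esub> ?c) d)"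
    have map: "combination K H (map ?f M) = combination K H M \<ominus>\<^bsub>K\<^esub>
        combination K (\<lambda>d. \<kappa> (\<chi> w0 d)) M \<otimes>\<^bsub>K\<^esub> (\<kappa> (inv\<^bsub>k\<^esub> ?c) \<otimes>\<^bsub>K\<^esub> H d)"
      if H: "\<And>d. d \<in> D \<Longrightarrow> H d \<in> carrier K" and M: "set M \<subseteq> carrier K \<times> D"
        and Hc: "\<And>d c d0. d \<in> D \<Longrightarrow> d0 \<in> D \<Longrightarrow> c \<in> carrier k \<Longrightarrow> H (comb d c d0) = H d \<ominus>\<^bsub>K\<^esub> \<kappa> c \<otimes>\<^bsub>K\<^esub> H d0" for H M
      using M
    proof (induction M)
      case Nil
      then show ?case using H[OF \<beta>(2)] c by (simp add: a_minus_def)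
    next
      case (Cons x M)
      obtain b e where x: "x = (b, e)" by (cases x)
      have xx: "b \<in> carrier K" "e \<in> D" "set M \<subseteq> carrier K \<times> D" using Cons.prems x by auto
      have q: "combination K H M \<in> carrier K" "combination K (\<lambda>d. \<kappa> (\<chi> w0 d)) M \<in> carrier K" "H e \<in> carrier K" "H d \<in> carrier K"
        "\<kappa> (\<chi> w0 e) \<in> carrier K" "\<kappa> (inv\<^bsub>k\<^esub> ?c) \<in> carrier K"
        using K.combination_closed[OF _ xx(3)] H xx \<beta> \<chi> c by (auto simp del: K.combination_closed)
      have "H (comb e (\<chi> w0 e \<otimes>\<^bsub>k\<^esub> inv\<^bsub>k\<^esub> ?c) d) = H e \<ominus>\<^bsub>K\<^esub> \<kappa> (\<chi> w0 e) \<otimes>\<^bsub>K\<^esub> \<kappa> (inv\<^bsub>k\<^esub> ?c) \<otimes>\<^bsub>K\<^esub> H d"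
        using Hc xx \<beta> \<chi> c by simp
      then have "combination K H (map ?f (x # M)) = b \<otimes>\<^bsub>K\<^esub> (H e \<ominus>\<^bsub>K\<^esub> \<kappa> (\<chi> w0 e) \<otimes>\<^bsub>K\<^esub> \<kappa> (inv\<^bsub>k\<^esub> ?c) \<otimes>\<^bsub>K\<^esub> H d) \<oplus>\<^bsub>K\<^esub>
         (combination K H M \<ominus>\<^bsub>K\<^esub> combination K (\<lambda>d. \<kappa> (\<chi> w0 d)) M \<otimes>\<^bsub>K\<^esub> (\<kappa> (inv\<^bsub>k\<^esub> ?c) \<otimes>\<^bsub>K\<^esub> H d))"
        using Cons.IH xx(3) x by simp
      also have "\<dots> = (b \<otimes>\<^bsub>K\<^esub> H e \<oplus>\<^bsub>K\<^esub> combination K H M) \<ominus>\<^bsub>K\<^esub>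
         (b \<otimes>\<^bsub>K\<^esub> \<kappa> (\<chi> w0 e) \<oplus>\<^bsub>K\<^esub> combination K (\<lambda>d. \<kappa> (\<chi> w0 d)) M) \<otimes>\<^bsub>K\<^esub> (\<kappa> (inv\<^bsub>k\<^esub> ?c) \<otimes>\<^bsub>K\<^esub> H d)"
        by (rule K.elimination_identity) (use q xx(1) in simp_all)
      finally show ?case using x by simp
    qed
    have e0: "combination K (\<lambda>d. \<kappa> (\<chi> w0 d)) L' = \<ominus>\<^bsub>K\<^esub> (\<beta> \<otimes>\<^bsub>K\<^esub> \<kappa> ?c)"
      using Suc.prems(2)[of w0] L \<beta> cc[of w0] c
      by (intro K.minus_equality[symmetric]) (simp_all add: K.a_comm)
    \<comment> \<open>By the relation at \<open>w0\<close> the subtracted multiples of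
      \<open>d\<close> add up to minus the head term of \<open>L\<close>. So the modified tail has
      the same value as all of \<open>L\<close>, with one entry fewer.\<close>
    have map': "combination K H (map ?f L') = combination K H L"
      if H: "\<And>d. d \<in> D \<Longrightarrow> H d \<in> carrier K"
        and Hc: "\<And>d c d0. d \<in> D \<Longrightarrow> d0 \<in> D \<Longrightarrow> c \<in> carrier k \<Longrightarrow> H (comb d c d0) = H d \<ominus>\<^bsub>K\<^esub> \<kappa> c \<otimes>\<^bsub>K\<^esub> H d0" for H
    proof -
      have cH: "combination K H L' \<in> carrier K" by (rule K.combination_closed[OF _ L'(1)]) (use H in auto)
      have Hd: "H d \<in> carrier K" using H \<beta> by simp
      have kc: "\<kappa> ?c \<in> carrier K" "\<kappa> (inv\<^bsub>k\<^esub> ?c) \<in> carrier K" using c by auto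
      have k1: "\<kappa> ?c \<otimes>\<^bsub>K\<^esub> \<kappa> (inv\<^bsub>k\<^esub> ?c) = \<one>\<^bsub>K\<^esub>" using c by (simp flip: \<kappa>.hom_mult)
      have "(\<beta> \<otimes>\<^bsub>K\<^esub> \<kappa> ?c) \<otimes>\<^bsub>K\<^esub> (\<kappa> (inv\<^bsub>k\<^esub> ?c) \<otimes>\<^bsub>K\<^esub> H d) = (\<kappa> ?c \<otimes>\<^bsub>K\<^esub> \<kappa> (inv\<^bsub>k\<^esub> ?c)) \<otimes>\<^bsub>K\<^esub> (\<beta> \<otimes>\<^bsub>K\<^esub> H d)"
        using \<beta> kc Hd by (simp add: K.m_ac)
      then have k2: "(\<beta> \<otimes>\<^bsub>K\<^esub> \<kappa> ?c) \<otimes>\<^bsub>K\<^esub> (\<kappa> (inv\<^bsub>k\<^esub> ?c) \<otimes>\<^bsub>K\<^esub> H d) = \<beta> \<otimes>\<^bsub>K\<^esub> H d" using k1 \<beta> Hd by simp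
      have "combination K H (map ?f L') = combination K H L' \<ominus>\<^bsub>K\<^esub>
          combination K (\<lambda>d. \<kappa> (\<chi> w0 d)) L' \<otimes>\<^bsub>K\<^esub> (\<kappa> (inv\<^bsub>k\<^esub> ?c) \<otimes>\<^bsub>K\<^esub> H d)"
        by (rule map[OF _ L'(1)]) (fact H, fact Hc)
      also have "\<dots> = \<beta> \<otimes>\<^bsub>K\<^esub> H d \<oplus>\<^bsub>K\<^esub> combination K H L'"
        unfolding e0 using \<beta> kc Hd cH by (simp add: K.l_minus k2 a_minus_def K.a_comm)
      finally show ?thesis by (simp add: L)
    qed
    have kc: "\<kappa> (\<chi> w (comb d' c d0)) = \<kappa> (\<chi> w d') \<ominus>\<^bsub>K\<^esub> \<kappa> c \<otimes>\<^bsub>K\<^esub> \<kappa> (\<chi> w d0)"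
      if "d' \<in> D" "d0 \<in> D" "c \<in> carrier k" for w d' c d0
      using that \<chi> by (simp add: \<chi>_comb a_minus_def)
    show ?thesis
    proof (rule Suc(1)[of "map ?f L'"])
      show "n = length (map ?f L')" using L' by simp
      show "set (map ?f L') \<subseteq> carrier K \<times> D" using L'(1) comb \<beta>(2) \<chi> c by auto
      show "combination K (\<lambda>d. \<kappa> (\<chi> w d)) (map ?f L') = \<zero>\<^bsub>K\<^esub>" for w
        using map'[of "\<lambda>d. \<kappa> (\<chi> w d)"] \<chi> kc Suc.prems(2) by simp
      show "combination K F (map ?f L') \<noteq> \<zero>\<^bsub>K\<^esub>"
        using map'[OF F F_comb] Suc.prems(3) by simp
    qed
  qed
qed

lemma mem_a_kernel: "x \<in> a_kernel R S h \<longleftrightarrow> x \<in> carrier R \<and> h x = \<zero>\<^bsub>S\<^esub>"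
  unfolding a_kernel_def' by blast

lemma (in ideal) finsum_in_ideal:
  assumes "finite S" "\<And>x. x \<in> S \<Longrightarrow> F x \<in> I" shows "finsum R F S \<in> I"
  using assms
proof (induction rule: finite_induct)
  case (insert x S)
  then have "finsum R F (insert x S) = F x \<oplus> finsum R F S"
    by (intro finsum_insert) (auto simp: Icarr)
  then show ?case using insert by (auto intro: a_closed)
qed (simp add: zero_closed)

section \<open>The filtration of polynomial rings by order of vanishing\<close>

context polynomial_ring
begin

lemma con_mult_apply:
  assumes b: "b \<in> carrier B" and f: "f \<in> carrier Pol" shows "(con b \<otimes>\<^bsub>Pol\<^esub> f) w = b \<otimes>\<^bsub>B\<^esub> f w"
  using f
proof (induction rule: P.MA_induct)
  case zero
  then show ?case using b P.MA.r_null[of "con b"] by (simp add: P.MA_simps)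
next
  case (add r v q)
  have "con b \<otimes>\<^bsub>Pol\<^esub> (monomial B r v \<oplus>\<^bsub>Pol\<^esub> q) = monomial B (b \<otimes>\<^bsub>B\<^esub> r) v \<oplus>\<^bsub>Pol\<^esub> con b \<otimes>\<^bsub>Pol\<^esub> q"
    using add b by (simp add: P.MA.r_distr P.monomial_mult)
  moreover have "(monomial B (b \<otimes>\<^bsub>B\<^esub> r) v \<oplus>\<^bsub>Pol\<^esub> con b \<otimes>\<^bsub>Pol\<^esub> q) w = monomial B (b \<otimes>\<^bsub>B\<^esub> r) v w \<oplus>\<^bsub>B\<^esub> b \<otimes>\<^bsub>B\<^esub> q w"
    using add by (simp only: P.MA_simps)
  ultimately show ?case using add b by (simp add: P.MA_simps(2) monomial_def B.r_distr)
qed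

lemma var_pow: "i \<in> V \<Longrightarrow> var i [^]\<^bsub>Pol\<^esub> n = monomial B \<one>\<^bsub>B\<^esub> (replicate_mset n i)"
proof (induction n)
  case 0
  then show ?case using P.MA_simps(3) by simp
next
  case (Suc n)
  have s: "set_mset (replicate_mset n i) \<subseteq> V" using Suc.prems by (cases n) auto
  have "var i [^]\<^bsub>Pol\<^esub> Suc n = monomial B \<one>\<^bsub>B\<^esub> (replicate_mset n i) \<otimes>\<^bsub>Pol\<^esub> var i" using Suc by simp
  then show ?case using Suc.prems s by (simp add: P.monomial_mult)
qed

text \<open>The \<open>j\<close>-th power of the ideal generated by the variables, described by
  coefficients: the polynomials of order at least \<open>j\<close> at the origin.\<close>

definition low :: "nat \<Rightarrow> ('x multiset \<Rightarrow> 'r) set"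
  where "low j = {f \<in> carrier Pol. \<forall>w. size w < j \<longrightarrow> f w = \<zero>\<^bsub>B\<^esub>}"

lemma low_mult:
  assumes f: "f \<in> low i" and g: "g \<in> low j" shows "f \<otimes>\<^bsub>Pol\<^esub> g \<in> low (i + j)"
proof -
  have fc: "f \<in> carrier Pol" and gc: "g \<in> carrier Pol" using f g by (auto simp: low_def)
  let ?S = "{w. f w \<noteq> \<zero>\<^bsub>B\<^esub>}" and ?T = "{w. g w \<noteq> \<zero>\<^bsub>B\<^esub>}"
  have "(f \<otimes>\<^bsub>Pol\<^esub> g) w = \<zero>\<^bsub>B\<^esub>" if w: "size w < i + j" for w
  proof -
    have "{c\<in>?S \<times> ?T. fst c \<otimes>\<^bsub>free_comm_monoid V\<^esub> snd c = w} = {}"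
    proof -
      have "a + b \<noteq> w" if "f a \<noteq> \<zero>\<^bsub>B\<^esub>" "g b \<noteq> \<zero>\<^bsub>B\<^esub>" for a b
      proof -
        have "i \<le> size a" "j \<le> size b" using that f g by (auto simp: low_def not_less[symmetric])
        then show ?thesis using w by auto
      qed
      then show ?thesis by auto
    qed
    then show ?thesis
      using P.mult_formula[OF fc gc P.finite_supp[OF fc] order_refl P.supp_subset[OF fc] P.finite_supp[OF gc] order_refl P.supp_subset[OF gc], of w]
      by (simp only: B.finsum_empty)
  qed
  then show ?thesis using fc gc by (simp add: low_def)
qed

lemma low_antimono: "i \<le> j \<Longrightarrow> low j \<subseteq> low i" by (auto simp: low_def)

lemma low_0: "low 0 = carrier Pol" by (auto simp: low_def)

lemma ideal_low: "ideal (low j) Pol"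
  unfolding P.MA.subideal_carrier_iff[symmetric] P.MA.subideal_def
proof (intro conjI ballI)
  show "\<zero>\<^bsub>Pol\<^esub> \<in> low j" using P.MA.zero_closed by (simp add: low_def P.MA_simps)
  fix a assume a: "a \<in> low j"
  show "r \<otimes>\<^bsub>Pol\<^esub> a \<in> low j" if "r \<in> carrier Pol" for r using low_mult[of r 0 a j] that a low_0 by simp
  fix b assume b: "b \<in> low j"
  have "a \<oplus>\<^bsub>Pol\<^esub> b \<in> carrier Pol" using a b by (simp add: low_def)
  then show "a \<oplus>\<^bsub>Pol\<^esub> b \<in> low j" using a b by (simp add: low_def P.MA_simps)
qed (auto simp: low_def)

text \<open>Pigeonhole: once the size of a monomial exceeds the sum of the exponents
  \<open>n i\<close>, some variable occurs at least \<open>n i\<close> times, so the monomial is a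
  multiple of a power known to lie in \<open>b\<close>.\<close>

lemma low_subset_ideal:
  assumes V: "finite V" and b: "ideal b Pol" and nil: "\<And>t. t \<in> low 1 \<Longrightarrow> \<exists>i::nat. t [^]\<^bsub>Pol\<^esub> i \<in> b"
  shows "\<exists>j. low j \<subseteq> b"
proof -
  interpret b: ideal b Pol by fact
  have "var i \<in> low 1" if "i \<in> V" for i using that by (simp add: low_def) (simp add: monomial_def)
  then have "\<forall>i\<in>V. \<exists>n::nat. var i [^]\<^bsub>Pol\<^esub> n \<in> b" using nil by blast
  then obtain n :: "'x \<Rightarrow> nat" where n: "\<And>i. i \<in> V \<Longrightarrow> var i [^]\<^bsub>Pol\<^esub> n i \<in> b" by metis
  let ?j = "Suc (\<Sum>i\<in>V. n i)"
  have mon: "monomial B r w \<in> b" if r: "r \<in> carrier B" and w: "set_mset w \<subseteq> V" "size w \<ge> ?j" for r w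
  proof -
    have "\<exists>i\<in>V. n i \<le> count w i"
    proof (rule ccontr)
      assume "\<not> ?thesis"
      then have "(\<Sum>i\<in>V. count w i) \<le> (\<Sum>i\<in>V. n i)" by (intro sum_mono) force
      moreover have "size w = (\<Sum>i\<in>V. count w i)"
        unfolding size_multiset_overloaded_eq by (rule sum.mono_neutral_left) (use V w in \<open>auto simp: not_in_iff\<close>)
      ultimately show False using w by simp
    qed
    then obtain i where i: "i \<in> V" "n i \<le> count w i" by blast
    then have le: "replicate_mset (n i) i \<subseteq># w" by (simp add: count_le_replicate_mset_subset_eq)
    let ?v = "w - replicate_mset (n i) i"
    have v: "set_mset ?v \<subseteq> V" using w by (meson in_diffD subset_iff)
    have "set_mset (replicate_mset (n i) i) \<subseteq> V" using i by (cases "n i") auto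
    then have "monomial B r ?v \<otimes>\<^bsub>Pol\<^esub> var i [^]\<^bsub>Pol\<^esub> n i = monomial B r w"
      using r v le i by (simp add: var_pow P.monomial_mult)
    then show ?thesis using b.I_l_closed[OF n[OF i(1)], of "monomial B r ?v"] r v by simp
  qed
  have "f \<in> b" if f: "f \<in> low ?j" for f
  proof -
    have fc: "f \<in> carrier Pol" using f by (simp add: low_def)
    have sum: "(\<Oplus>\<^bsub>Pol\<^esub>w\<in>{w. f w \<noteq> \<zero>\<^bsub>B\<^esub>}. monomial B (f w) w) \<in> b"
    proof (rule b.finsum_in_ideal[OF P.finite_supp[OF fc]])
      fix w assume w: "w \<in> {w. f w \<noteq> \<zero>\<^bsub>B\<^esub>}"
      then have "w \<in> carrier (free_comm_monoid V)" using P.supp_subset[OF fc] by blast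
      then have 1: "set_mset w \<subseteq> V" by simp
      have 2: "?j \<le> size w"
      proof (rule ccontr)
        assume "\<not> ?j \<le> size w"
        then have "size w < ?j" by (rule not_le_imp_less)
        then have "f w = \<zero>\<^bsub>B\<^esub>" using f unfolding low_def by blast
        then show False using w by blast
      qed
      show "monomial B (f w) w \<in> b" by (rule mon[OF P.coeff_closed[OF fc] 1 2])
    qed
    show ?thesis
      by (rule ssubst[where P = "\<lambda>p. p \<in> b", OF P.MA_expand[OF fc P.finite_supp[OF fc] order_refl P.supp_subset[OF fc]] sum])
  qed
  then show ?thesis by blast
qed

end

text \<open>In the application \<open>K\<close> is the residue field of a maximal ideal, possibly
  larger than \<open>k\<close>, and \<open>a\<close> lists the residue classes of the variables.
  Over \<open>K\<close> the point is rational, so orders of vanishing at it can be read off from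
  coefficients.\<close>

locale polynomial_point = k: field k + K: field K for k :: "'k ring" and K :: "'l ring" +
  fixes \<kappa> :: "'k \<Rightarrow> 'l" and N :: nat and a :: "nat \<Rightarrow> 'l"
  assumes \<kappa>: "\<kappa> \<in> ring_hom k K" and a: "a \<in> {..<N} \<rightarrow> carrier K"
begin

sublocale P: polynomial_domain k "{..<N}" by unfold_locales
sublocale T: polynomial_domain K "{..<N}" by unfold_locales

text \<open>Expansion around \<open>a\<close> moves the point to the origin, where order of
  vanishing is membership in \<open>low\<close>. The inverse translation \<open>shift\<close> brings
  the result back to the extension of scalars \<open>incl\<close>, where it can be compared with
  polynomials over \<open>k\<close>.\<close>

definition "taylor = monoid_algebra_eval k T.Pol (\<lambda>c. T.con (\<kappa> c)) (mset_prod T.Pol (\<lambda>i. T.con (a i) \<oplus>\<^bsub>T.Pol\<^esub> T.var i))"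
definition "incl = monoid_algebra_eval k T.Pol (\<lambda>c. T.con (\<kappa> c)) (mset_prod T.Pol (\<lambda>i. T.var i))"
definition "shift = monoid_algebra_eval K T.Pol (\<lambda>c. T.con c) (mset_prod T.Pol (\<lambda>i. T.var i \<ominus>\<^bsub>T.Pol\<^esub> T.con (a i)))"
definition "ev0 = monoid_algebra_eval K K (\<lambda>c. c) (mset_prod K (\<lambda>i::nat. \<zero>\<^bsub>K\<^esub>))"
definition "eva = monoid_algebra_eval K K (\<lambda>c. c) (mset_prod K a)"
definition "point = monoid_algebra_eval k K \<kappa> (mset_prod K a)"

lemma con\<kappa>: "(\<lambda>c. T.con (\<kappa> c)) \<in> ring_hom k T.Pol"
  using ring_hom_trans[OF \<kappa> T.con_hom] by (simp add: comp_def)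

lemma a_closed [simp]: "i < N \<Longrightarrow> a i \<in> carrier K" using a by auto
lemma \<kappa>_closed [simp]: "c \<in> carrier k \<Longrightarrow> \<kappa> c \<in> carrier K" using \<kappa> by (rule ring_hom_closed)

lemma id_hom: "(\<lambda>c. c) \<in> ring_hom K K" by (auto intro: ring_hom_memI)

lemmas T_con_hom = T.con_hom

lemma g1: "(\<lambda>i. T.con (a i) \<oplus>\<^bsub>T.Pol\<^esub> T.var i) \<in> {..<N} \<rightarrow> carrier T.Pol" by auto
lemma g2: "(\<lambda>i. T.var i) \<in> {..<N} \<rightarrow> carrier T.Pol" by auto
lemma g3: "(\<lambda>i. T.var i \<ominus>\<^bsub>T.Pol\<^esub> T.con (a i)) \<in> {..<N} \<rightarrow> carrier T.Pol" by auto
lemma g4: "(\<lambda>i::nat. \<zero>\<^bsub>K\<^esub>) \<in> {..<N} \<rightarrow> carrier K" by auto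

lemmas taylor = P.poly_eval_hom[OF T.P.cring_MA con\<kappa> g1, folded taylor_def]
  P.poly_eval_con[OF T.P.cring_MA con\<kappa> g1, folded taylor_def] P.poly_eval_var[OF T.P.cring_MA con\<kappa> g1, folded taylor_def]
lemmas incl = P.poly_eval_hom[OF T.P.cring_MA con\<kappa> g2, folded incl_def]
  P.poly_eval_con[OF T.P.cring_MA con\<kappa> g2, folded incl_def] P.poly_eval_var[OF T.P.cring_MA con\<kappa> g2, folded incl_def]
lemmas shift = T.poly_eval_hom[OF T.P.cring_MA T_con_hom g3, folded shift_def]
  T.poly_eval_con[OF T.P.cring_MA T_con_hom g3, folded shift_def] T.poly_eval_var[OF T.P.cring_MA T_con_hom g3, folded shift_def]
lemmas ev0 = T.poly_eval_hom[OF K.cring_axioms id_hom g4, folded ev0_def]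
  T.poly_eval_con[OF K.cring_axioms id_hom g4, folded ev0_def] T.poly_eval_var[OF K.cring_axioms id_hom g4, folded ev0_def]
lemmas eva = T.poly_eval_hom[OF K.cring_axioms id_hom a, folded eva_def]
  T.poly_eval_con[OF K.cring_axioms id_hom a, folded eva_def] T.poly_eval_var[OF K.cring_axioms id_hom a, folded eva_def]
lemmas point = P.poly_eval_hom[OF K.cring_axioms \<kappa> a, folded point_def]
  P.poly_eval_con[OF K.cring_axioms \<kappa> a, folded point_def] P.poly_eval_var[OF K.cring_axioms \<kappa> a, folded point_def]

sublocale taylor: ring_hom_ring P.Pol T.Pol taylor by unfold_locales (rule taylor)
sublocale incl: ring_hom_ring P.Pol T.Pol incl by unfold_locales (rule incl)
sublocale shift: ring_hom_ring T.Pol T.Pol shift by unfold_locales (rule shift)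
sublocale ev0: ring_hom_ring T.Pol K ev0 by unfold_locales (rule ev0)
sublocale eva: ring_hom_ring T.Pol K eva by unfold_locales (rule eva)
sublocale point: ring_hom_ring P.Pol K point by unfold_locales (rule point)

lemma shift_taylor: assumes "p \<in> carrier P.Pol" shows "shift (taylor p) = incl p"
proof -
  have "(shift \<circ> taylor) p = incl p"
  proof (rule P.poly_hom_eqI[OF T.P.cring_MA ring_hom_trans[OF taylor(1) shift(1)] incl(1) _ _ assms])
    show "(shift \<circ> taylor) (P.con c) = incl (P.con c)" if "c \<in> carrier k" for c
      using that by (simp add: taylor shift incl)
    show "(shift \<circ> taylor) (P.var i) = incl (P.var i)" if i: "i \<in> {..<N}" for i
    proof -
      have c: "T.con (a i) \<in> carrier T.Pol" "T.var i \<in> carrier T.Pol" using i by auto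
      have "shift (T.con (a i) \<oplus>\<^bsub>T.Pol\<^esub> T.var i) = T.con (a i) \<oplus>\<^bsub>T.Pol\<^esub> (T.var i \<ominus>\<^bsub>T.Pol\<^esub> T.con (a i))"
        using i c by (simp add: shift)
      also have "\<dots> = T.var i" using c by (simp add: a_minus_def T.P.MA.a_lcomm[of "T.con (a i)"] T.P.MA.r_neg)
      finally show ?thesis using i by (simp add: taylor incl)
    qed
  qed
  then show ?thesis by simp
qed

lemma eva_shift: assumes "f \<in> carrier T.Pol" shows "eva (shift f) = ev0 f"
proof -
  have "(eva \<circ> shift) f = ev0 f"
  proof (rule T.poly_hom_eqI[OF K.cring_axioms ring_hom_trans[OF shift(1) eva(1)] ev0(1) _ _ assms])
    show "(eva \<circ> shift) (T.con c) = ev0 (T.con c)" if "c \<in> carrier K" for c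
      using that shift(2)[OF that] eva(2)[OF that] ev0(2)[OF that] by simp
    show "(eva \<circ> shift) (T.var i) = ev0 (T.var i)" if i: "i \<in> {..<N}" for i
    proof -
      have c: "T.con (a i) \<in> carrier T.Pol" "T.var i \<in> carrier T.Pol" using i by auto
      have "eva (T.var i \<ominus>\<^bsub>T.Pol\<^esub> T.con (a i)) = \<zero>\<^bsub>K\<^esub>"
        using i c by (simp add: a_minus_def eva K.r_neg)
      then show ?thesis using i by (simp add: shift ev0)
    qed
  qed
  then show ?thesis by simp
qed

lemma eva_incl: assumes "p \<in> carrier P.Pol" shows "eva (incl p) = point p"
proof -
  have "(eva \<circ> incl) p = point p"
    by (rule P.poly_hom_eqI[OF K.cring_axioms ring_hom_trans[OF incl(1) eva(1)] point(1) _ _ assms])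
      (auto simp: incl eva point)
  then show ?thesis by simp
qed

lemma ev0_taylor: assumes "p \<in> carrier P.Pol" shows "ev0 (taylor p) = point p"
proof -
  have "(ev0 \<circ> taylor) p = point p"
    by (rule P.poly_hom_eqI[OF K.cring_axioms ring_hom_trans[OF taylor(1) ev0(1)] point(1) _ _ assms])
      (auto simp: taylor ev0 point)
  then show ?thesis by simp
qed

lemma ev0_apply: assumes f: "f \<in> carrier T.Pol" shows "ev0 f = f {#}"
  using f
proof (induction rule: T.P.MA_induct)
  case zero
  then show ?case using ev0.hom_zero by (simp only: T.P.MA_simps)
next
  case (add r w q)
  have "ev0 (monomial K r w) = monomial K r w {#}"
  proof (cases w)
    case empty
    have "T.con r {#} = r" by (simp add: monomial_def)
    then show ?thesis using empty ev0(2)[OF \<open>r \<in> _\<close>] by simp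
  next
    case (add i v)
    have iv: "i < N" "set_mset v \<subseteq> {..<N}" using \<open>w \<in> _\<close> add by auto
    have "monomial K r w = T.var i \<otimes>\<^bsub>T.Pol\<^esub> monomial K r v"
      using iv \<open>r \<in> _\<close> add by (simp add: T.P.monomial_mult)
    moreover have "T.var i \<in> carrier T.Pol" "monomial K r v \<in> carrier T.Pol" using iv \<open>r \<in> _\<close> by auto
    ultimately have "ev0 (monomial K r w) = \<zero>\<^bsub>K\<^esub>" using iv by (simp add: ev0)
    then show ?thesis using add by (simp add: monomial_def)
  qed
  moreover have "ev0 (monomial K r w \<oplus>\<^bsub>T.Pol\<^esub> q) = ev0 (monomial K r w) \<oplus>\<^bsub>K\<^esub> ev0 q"
    using add by (intro ev0.hom_add) simp_all
  moreover have "(monomial K r w \<oplus>\<^bsub>T.Pol\<^esub> q) {#} = monomial K r w {#} \<oplus>\<^bsub>K\<^esub> q {#}"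
    by (simp only: T.P.MA_simps)
  ultimately show ?case using add by metis
qed

lemma low_1_iff: "f \<in> T.low 1 \<longleftrightarrow> f \<in> carrier T.Pol \<and> ev0 f = \<zero>\<^bsub>K\<^esub>"
  by (auto simp: T.low_def ev0_apply)

lemma incl_monomial: "set_mset w \<subseteq> {..<N} \<Longrightarrow> incl (monomial k \<one>\<^bsub>k\<^esub> w) = monomial K \<one>\<^bsub>K\<^esub> w"
proof (induction w)
  case empty
  then show ?case using ring_hom_one[OF \<kappa>] by (simp add: incl)
next
  case (add i w)
  have c: "P.var i \<in> carrier P.Pol" "monomial k \<one>\<^bsub>k\<^esub> w \<in> carrier P.Pol" using add.prems by auto
  have "monomial k \<one>\<^bsub>k\<^esub> (add_mset i w) = P.var i \<otimes>\<^bsub>P.Pol\<^esub> monomial k \<one>\<^bsub>k\<^esub> w"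
    using add.prems by (intro P.monomial_add_mset) auto
  moreover have "monomial K \<one>\<^bsub>K\<^esub> (add_mset i w) = T.var i \<otimes>\<^bsub>T.Pol\<^esub> monomial K \<one>\<^bsub>K\<^esub> w"
    using add.prems by (intro T.monomial_add_mset) auto
  ultimately show ?case using add c by (simp add: incl)
qed

lemma incl_apply: assumes p: "p \<in> carrier P.Pol" shows "incl p w = \<kappa> (p w)"
  using p
proof (induction rule: P.P.MA_induct)
  case zero
  have "incl \<zero>\<^bsub>P.Pol\<^esub> = \<zero>\<^bsub>T.Pol\<^esub>" by (rule incl.hom_zero)
  then show ?case using ring_hom_zero[OF \<kappa> k.ring_axioms K.ring_axioms] by (simp add: T.P.MA_simps P.P.MA_simps)
next
  case (add r v q)
  have v: "set_mset v \<subseteq> {..<N}" using add by simp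
  have c: "P.con r \<in> carrier P.Pol" "monomial k \<one>\<^bsub>k\<^esub> v \<in> carrier P.Pol" using add by auto
  have "incl (monomial k r v) = monomial K (\<kappa> r) v"
    using add c v by (simp add: P.monomial_split[of r v] T.monomial_split[of "\<kappa> r" v] incl incl_monomial)
  then have "incl (monomial k r v \<oplus>\<^bsub>P.Pol\<^esub> q) w = monomial K (\<kappa> r) v w \<oplus>\<^bsub>K\<^esub> \<kappa> (q w)"
    using add by (simp add: T.P.MA_simps(2))
  also have "monomial K (\<kappa> r) v w = \<kappa> (monomial k r v w)"
    using ring_hom_zero[OF \<kappa> k.ring_axioms K.ring_axioms] by (simp add: monomial_def)
  finally show ?case using add ring_hom_add[OF \<kappa>, of "monomial k r v w" "q w"]
    by (simp add: P.P.MA_simps(2))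
qed

text \<open>A \<open>K\<close>-linear combination of polynomials defined over \<open>k\<close>, kept
  as a list of terms: it is the list, not its value, from which a relation over \<open>K\<close> is
  eliminated down to one over \<open>k\<close>.\<close>

definition span :: "('d \<Rightarrow> nat multiset \<Rightarrow> 'k) \<Rightarrow> ('l \<times> 'd) list \<Rightarrow> nat multiset \<Rightarrow> 'l"
  where "span G L = combination T.Pol (\<lambda>d. incl (G d)) (map (\<lambda>(\<beta>, d). (T.con \<beta>, d)) L)"

lemma span_simps: "span G [] = \<zero>\<^bsub>T.Pol\<^esub>"
  "span G ((\<beta>, d) # L) = T.con \<beta> \<otimes>\<^bsub>T.Pol\<^esub> incl (G d) \<oplus>\<^bsub>T.Pol\<^esub> span G L"
  by (simp_all add: span_def)

context
  fixes G :: "'d \<Rightarrow> nat multiset \<Rightarrow> 'k" and D assumes G: "\<And>d. d \<in> D \<Longrightarrow> G d \<in> carrier P.Pol"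
begin

lemma span_closed: "set L \<subseteq> carrier K \<times> D \<Longrightarrow> span G L \<in> carrier T.Pol"
  by (induction L) (auto simp: span_simps G)

lemma span_append: "set L \<subseteq> carrier K \<times> D \<Longrightarrow> set M \<subseteq> carrier K \<times> D \<Longrightarrow> span G (L @ M) = span G L \<oplus>\<^bsub>T.Pol\<^esub> span G M"
  by (induction L) (auto simp: span_simps G T.P.MA.a_assoc span_closed)

lemma span_apply: "set L \<subseteq> carrier K \<times> D \<Longrightarrow> span G L w = combination K (\<lambda>d. \<kappa> (G d w)) L"
proof (induction L)
  case Nil
  then show ?case by (simp add: span_simps T.P.MA_simps)
next
  case (Cons x L)
  then show ?case
    by (cases x) (auto simp: span_simps G T.con_mult_apply incl_apply T.P.MA_simps(2)[of "_ \<otimes>\<^bsub>T.Pol\<^esub> _"])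
qed

lemma eva_span: "set L \<subseteq> carrier K \<times> D \<Longrightarrow> eva (span G L) = combination K (\<lambda>d. point (G d)) L"
  by (induction L) (auto simp: span_simps G eva eva_incl span_closed)

lemma span_mult:
  assumes q: "q \<in> carrier P.Pol"
  shows "set L \<subseteq> carrier K \<times> D \<Longrightarrow> span (\<lambda>d. G d \<otimes>\<^bsub>P.Pol\<^esub> q) L = span G L \<otimes>\<^bsub>T.Pol\<^esub> incl q"
proof (induction L)
  case Nil
  then show ?case using q by (simp add: span_simps)
next
  case (Cons x L)
  then show ?case using q
    by (cases x) (auto simp: span_simps G T.P.MA.l_distr span_closed T.P.MA.m_assoc)
qed

lemma span_con:
  assumes b: "b \<in> carrier K"
  shows "set L \<subseteq> carrier K \<times> D \<Longrightarrow> span G (map (\<lambda>(\<beta>, d). (b \<otimes>\<^bsub>K\<^esub> \<beta>, d)) L) = T.con b \<otimes>\<^bsub>T.Pol\<^esub> span G L"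
proof (induction L)
  case Nil
  then show ?case using b by (simp add: span_simps)
next
  case (Cons x L)
  obtain \<beta> d where x: "x = (\<beta>, d)" by (cases x)
  have c: "\<beta> \<in> carrier K" "d \<in> D" "T.con b \<in> carrier T.Pol" "T.con \<beta> \<in> carrier T.Pol" using Cons.prems x b by auto
  have "T.con (b \<otimes>\<^bsub>K\<^esub> \<beta>) = T.con b \<otimes>\<^bsub>T.Pol\<^esub> T.con \<beta>" using b c by (simp add: T.P.monomial_mult)
  then show ?case using Cons b c x
    by (auto simp: span_simps G T.P.MA.r_distr span_closed T.P.MA.m_assoc)
qed

end

lemma span_map: "span G (map (\<lambda>(\<beta>, d). (\<beta>, h d)) L) = span (\<lambda>d. G (h d)) L"
  by (induction L) (auto simp: span_simps)

lemma ex_span: assumes "f \<in> carrier T.Pol" shows "\<exists>L. set L \<subseteq> carrier K \<times> carrier P.Pol \<and> f = span (\<lambda>d. d) L"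
  using assms
proof (induction rule: T.P.MA_induct)
  case zero
  then show ?case by (intro exI[of _ "[]"]) (auto simp: span_simps)
next
  case (add r w q)
  then obtain L where L: "set L \<subseteq> carrier K \<times> carrier P.Pol" "q = span (\<lambda>d. d) L" by blast
  have w: "set_mset w \<subseteq> {..<N}" using add by simp
  have "monomial K r w = T.con r \<otimes>\<^bsub>T.Pol\<^esub> incl (monomial k \<one>\<^bsub>k\<^esub> w)"
    using T.monomial_split[of r w] add w by (simp add: incl_monomial)
  then show ?case using L add by (intro exI[of _ "(r, monomial k \<one>\<^bsub>k\<^esub> w) # L"]) (auto simp: span_simps)
qed

text \<open>The \<open>K\<close>-span of \<open>I\<close> is already the extended ideal: a monomial
  over \<open>K\<close> is a scalar times a monomial over \<open>k\<close>, and the latter is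
  absorbed by \<open>I\<close>.\<close>

lemma ideal_span:
  assumes I: "ideal I P.Pol" shows "ideal {span (\<lambda>d. d) L | L. set L \<subseteq> carrier K \<times> I} T.Pol" (is "ideal ?J _")
  unfolding T.P.MA.subideal_carrier_iff[symmetric] T.P.MA.subideal_def
proof (intro conjI ballI)
  interpret I: ideal I P.Pol by fact
  have closed: "span (\<lambda>d. d) L \<in> carrier T.Pol" if "set L \<subseteq> carrier K \<times> I" for L
    by (rule span_closed[OF _ that]) simp
  have append: "span (\<lambda>d. d) (L @ M) = span (\<lambda>d. d) L \<oplus>\<^bsub>T.Pol\<^esub> span (\<lambda>d. d) M"
    if "set L \<subseteq> carrier K \<times> I" "set M \<subseteq> carrier K \<times> I" for L M
    by (rule span_append[OF _ that]) simp
  have mult: "span (\<lambda>d. d \<otimes>\<^bsub>P.Pol\<^esub> q) L = span (\<lambda>d. d) L \<otimes>\<^bsub>T.Pol\<^esub> incl q"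
    if "q \<in> carrier P.Pol" "set L \<subseteq> carrier K \<times> I" for q L
    by (rule span_mult[OF _ that]) simp
  have scon: "span (\<lambda>d. d) (map (\<lambda>(\<beta>, d). (b \<otimes>\<^bsub>K\<^esub> \<beta>, d)) L) = T.con b \<otimes>\<^bsub>T.Pol\<^esub> span (\<lambda>d. d) L"
    if "b \<in> carrier K" "set L \<subseteq> carrier K \<times> I" for b L
    by (rule span_con[OF _ that]) simp
  show "?J \<subseteq> carrier T.Pol" using closed by auto
  show z: "\<zero>\<^bsub>T.Pol\<^esub> \<in> ?J" by (auto simp: span_simps intro!: exI[of _ "[]"])
  have add: "f \<oplus>\<^bsub>T.Pol\<^esub> g \<in> ?J" if "f \<in> ?J" "g \<in> ?J" for f g
  proof -
    from that obtain L M where "set L \<subseteq> carrier K \<times> I" "set M \<subseteq> carrier K \<times> I" "f = span (\<lambda>d. d) L" "g = span (\<lambda>d. d) M" by blast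
    then show ?thesis using append by (auto intro!: exI[of _ "L @ M"])
  qed
  then show "f \<oplus>\<^bsub>T.Pol\<^esub> g \<in> ?J" if "f \<in> ?J" "g \<in> ?J" for f g using that .
  fix r f assume r: "r \<in> carrier T.Pol" and f: "f \<in> ?J"
  then obtain L where L: "set L \<subseteq> carrier K \<times> I" "f = span (\<lambda>d. d) L" by blast
  show "r \<otimes>\<^bsub>T.Pol\<^esub> f \<in> ?J" using r
  proof (induction rule: T.P.MA_induct)
    case zero
    then show ?case using closed[OF L(1)] L z by simp
  next
    case (add b w q)
    have w: "set_mset w \<subseteq> {..<N}" using add by simp
    let ?m = "monomial k \<one>\<^bsub>k\<^esub> w"
    have m: "?m \<in> carrier P.Pol" using w by simp
    let ?L = "map (\<lambda>(\<beta>, d). (b \<otimes>\<^bsub>K\<^esub> \<beta>, d)) (map (\<lambda>(\<beta>, d). (\<beta>, d \<otimes>\<^bsub>P.Pol\<^esub> ?m)) L)"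
    have L': "set (map (\<lambda>(\<beta>, d). (\<beta>, d \<otimes>\<^bsub>P.Pol\<^esub> ?m)) L) \<subseteq> carrier K \<times> I"
      using L(1) m I.I_r_closed by auto
    have "span (\<lambda>d. d) ?L = T.con b \<otimes>\<^bsub>T.Pol\<^esub> (f \<otimes>\<^bsub>T.Pol\<^esub> monomial K \<one>\<^bsub>K\<^esub> w)"
      using scon[OF add(1) L'] mult[OF m L(1)] L(2) w by (simp add: span_map incl_monomial)
    also have "\<dots> = monomial K b w \<otimes>\<^bsub>T.Pol\<^esub> f"
      using T.monomial_split[of b w] add w closed[OF L(1)] L(2) by (simp add: T.P.MA.m_ac)
    finally have "monomial K b w \<otimes>\<^bsub>T.Pol\<^esub> f = span (\<lambda>d. d) ?L" ..
    moreover have "set ?L \<subseteq> carrier K \<times> I" using L' add(1) by auto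
    ultimately have "monomial K b w \<otimes>\<^bsub>T.Pol\<^esub> f \<in> ?J" by blast
    then have "monomial K b w \<otimes>\<^bsub>T.Pol\<^esub> f \<oplus>\<^bsub>T.Pol\<^esub> q \<otimes>\<^bsub>T.Pol\<^esub> f \<in> ?J" using add.IH \<open>\<And>f g. f \<in> ?J \<Longrightarrow> g \<in> ?J \<Longrightarrow> f \<oplus>\<^bsub>T.Pol\<^esub> g \<in> ?J\<close> by blast
    then show ?case using add closed[OF L(1)] L(2) w by (simp add: T.P.MA.l_distr)
  qed
qed

lemma noetherian_T: "noetherian_ring T.Pol"
proof (rule T.P.MA.noetherian_of_generators)
  show "T.P.MA.noetherian_subring ((\<lambda>c. T.con c) ` carrier K)"
    by (rule T.P.MA.noetherian_subring_field_image[OF K.field_axioms T_con_hom])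
  show "finite ((\<lambda>i. T.var i) ` {..<N})" by simp
  show "(\<lambda>i. T.var i) ` {..<N} \<subseteq> carrier T.Pol" by auto
qed (rule T.generate_ring_Pol)

text \<open>Krull's intersection theorem for the filtration of \<open>k[X]\<close> by the order of vanishing at
  the \<open>K\<close>-rational point \<open>a\<close>.\<close>

lemma order_intersection:
  assumes I: "ideal I P.Pol" and I0: "\<And>g. g \<in> I \<Longrightarrow> point g = \<zero>\<^bsub>K\<^esub>" and X: "X \<in> carrier P.Pol"
    and ord: "\<And>j. \<exists>p\<in>carrier P.Pol. X \<ominus>\<^bsub>P.Pol\<^esub> p \<in> I \<and> taylor p \<in> T.low j"
  shows "\<exists>W\<in>carrier P.Pol. W \<otimes>\<^bsub>P.Pol\<^esub> X \<in> I \<and> point W \<noteq> \<zero>\<^bsub>K\<^esub>"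
proof -
  interpret I: ideal I P.Pol by fact
  let ?J = "{span (\<lambda>d. d) L | L. set L \<subseteq> carrier K \<times> I}"
  let ?a = "genideal T.Pol (taylor ` I)"
  have tI: "taylor ` I \<subseteq> carrier T.Pol" by auto
  have aI: "ideal ?a T.Pol" by (rule T.P.MA.genideal_ideal[OF tI])
  have tX: "taylor X \<in> carrier T.Pol" using X by simp
  obtain b where b: "ideal b T.Pol" "?a \<subseteq> b" "\<And>t. t \<in> T.low 1 \<Longrightarrow> \<exists>i::nat. t [^]\<^bsub>T.Pol\<^esub> i \<in> b"
    "taylor X \<in> b \<Longrightarrow> \<exists>w\<in>T.low 1. taylor X \<ominus>\<^bsub>T.Pol\<^esub> w \<otimes>\<^bsub>T.Pol\<^esub> taylor X \<in> ?a"
    using krull_intersection[OF T.P.cring_MA noetherian_T aI T.ideal_low[of 1] tX] by metis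
  interpret b: ideal b T.Pol by (rule b)
  obtain j where j: "T.low j \<subseteq> b" using T.low_subset_ideal[OF _ b(1) b(3)] by auto
  obtain p where p: "p \<in> carrier P.Pol" "X \<ominus>\<^bsub>P.Pol\<^esub> p \<in> I" "taylor p \<in> T.low j" using ord by blast
  have "taylor (X \<ominus>\<^bsub>P.Pol\<^esub> p) \<in> b" using p(2) T.P.MA.genideal_self[OF tI] b(2) by blast
  then have "taylor (X \<ominus>\<^bsub>P.Pol\<^esub> p) \<oplus>\<^bsub>T.Pol\<^esub> taylor p \<in> b" using p(3) j by (intro b.a_closed) auto
  moreover have "taylor (X \<ominus>\<^bsub>P.Pol\<^esub> p) \<oplus>\<^bsub>T.Pol\<^esub> taylor p = taylor X"
    using X p(1) by (simp add: a_minus_def T.P.MA.a_assoc T.P.MA.l_neg)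
  ultimately obtain w where w: "w \<in> T.low 1" "taylor X \<ominus>\<^bsub>T.Pol\<^esub> w \<otimes>\<^bsub>T.Pol\<^esub> taylor X \<in> ?a" using b(4) by auto
  have wc: "w \<in> carrier T.Pol" "ev0 w = \<zero>\<^bsub>K\<^esub>" using w low_1_iff by auto
  have J: "ideal ?J T.Pol" by (rule ideal_span[OF I])
  have "?a \<subseteq> {f \<in> carrier T.Pol. shift f \<in> ?J}"
  proof (rule T.P.MA.genideal_minimal[OF shift.ideal_vimage[OF J]])
    have "shift (taylor g) \<in> ?J" if g: "g \<in> I" for g
    proof -
      have "shift (taylor g) = span (\<lambda>d. d) [(\<one>\<^bsub>K\<^esub>, g)]"
        using g shift_taylor T.P.MA.l_one[of "incl g"] by (simp add: span_simps T.P.MA_simps(3))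
      then show ?thesis using g by (intro CollectI exI[of _ "[(\<one>\<^bsub>K\<^esub>, g)]"]) auto
    qed
    then show "taylor ` I \<subseteq> {f \<in> carrier T.Pol. shift f \<in> ?J}" using tI by blast
  qed
  then have "shift (taylor X \<ominus>\<^bsub>T.Pol\<^esub> w \<otimes>\<^bsub>T.Pol\<^esub> taylor X) \<in> ?J" using w by blast
  then obtain L2 where L2: "set L2 \<subseteq> carrier K \<times> I" "shift (taylor X \<ominus>\<^bsub>T.Pol\<^esub> w \<otimes>\<^bsub>T.Pol\<^esub> taylor X) = span (\<lambda>d. d) L2" by blast
  \<comment> \<open>By Krull's theorem \<open>1 - w\<close> multiplies the expansion of
    \<open>X\<close> into the ideal generated by the expansions of \<open>I\<close>, with
    \<open>w\<close> vanishing at the origin. After translation back, \<open>v\<close> has value one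
    at \<open>a\<close> and \<open>v X\<close> lies in the extension of \<open>I\<close>.\<close>
  let ?v = "\<one>\<^bsub>T.Pol\<^esub> \<ominus>\<^bsub>T.Pol\<^esub> shift w"
  have vc: "?v \<in> carrier T.Pol" using wc by simp
  obtain L1 where L1: "set L1 \<subseteq> carrier K \<times> carrier P.Pol" "?v = span (\<lambda>d. d) L1" using ex_span[OF vc] by blast
  have vX: "?v \<otimes>\<^bsub>T.Pol\<^esub> incl X = span (\<lambda>d. d) L2"
    using L2(2) X wc by (simp add: shift_taylor a_minus_def T.P.MA.l_distr T.P.MA.l_minus)
  have ev: "eva ?v = \<one>\<^bsub>K\<^esub>" using wc by (simp add: a_minus_def eva_shift)
  \<comment> \<open>A pair \<open>(W, g)\<close> stands for the equation \<open>W X = g\<close> with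
    \<open>g\<close> in \<open>I\<close>: the forms \<open>\<chi>\<close> are the coefficients of
    \<open>W X - g\<close>, and \<open>F\<close> is the value of \<open>W\<close> at the point. The
    solution \<open>v\<close> over \<open>K\<close> is now descended to one over
    \<open>k\<close>.\<close>
  define D where "D = carrier P.Pol \<times> I"
  define \<chi> where "\<chi> = (\<lambda>w (d :: (nat multiset \<Rightarrow> 'k) \<times> (nat multiset \<Rightarrow> 'k)). (fst d \<otimes>\<^bsub>P.Pol\<^esub> X \<ominus>\<^bsub>P.Pol\<^esub> snd d) w)"
  define F where "F = (\<lambda>(d :: (nat multiset \<Rightarrow> 'k) \<times> (nat multiset \<Rightarrow> 'k)). point (fst d))"
  define comb where "comb = (\<lambda>d c d0. (fst d \<ominus>\<^bsub>P.Pol\<^esub> P.con c \<otimes>\<^bsub>P.Pol\<^esub> fst d0, snd d \<ominus>\<^bsub>P.Pol\<^esub> P.con c \<otimes>\<^bsub>P.Pol\<^esub> snd d0))"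
  have Dc: "fst d \<in> carrier P.Pol" "snd d \<in> I" "snd d \<in> carrier P.Pol" if "d \<in> D" for d
    using that by (auto simp: D_def)
  \<comment> \<open>The first list carries \<open>v\<close> in the left component, the second
    carries \<open>v X\<close> in the right one, so that their combination has all coefficients zero
    while \<open>F\<close> takes the value one on it.\<close>
  let ?L1 = "map (\<lambda>(\<beta>, d). (\<beta>, (d, \<zero>\<^bsub>P.Pol\<^esub>))) L1" and ?L2 = "map (\<lambda>(\<beta>, d). (\<beta>, (\<zero>\<^bsub>P.Pol\<^esub>, d))) L2"
  let ?G = "\<lambda>d. fst d \<otimes>\<^bsub>P.Pol\<^esub> X \<ominus>\<^bsub>P.Pol\<^esub> snd d"
  have L12: "set ?L1 \<subseteq> carrier K \<times> D" "set ?L2 \<subseteq> carrier K \<times> D" using L1 L2 by (auto simp: D_def I.zero_closed)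
  have Gc: "d \<in> D \<Longrightarrow> ?G d \<in> carrier P.Pol" for d using Dc X by simp
  have s1: "span ?G ?L1 = ?v \<otimes>\<^bsub>T.Pol\<^esub> incl X"
  proof -
    have "span ?G ?L1 = span (\<lambda>d. d \<otimes>\<^bsub>P.Pol\<^esub> X) L1"
      unfolding span_map fst_conv snd_conv using L1(1) X
      by (induction L1) (auto simp: span_simps a_minus_def)
    then show ?thesis using span_mult[of "carrier P.Pol" "\<lambda>d. d", OF _ X L1(1)] L1(2) by simp
  qed
  have s2: "span ?G ?L2 = \<ominus>\<^bsub>T.Pol\<^esub> span (\<lambda>d. d) L2"
    unfolding span_map fst_conv snd_conv using L2(1) X
  proof (induction L2)
    case Nil
    then show ?case by (simp add: span_simps)
  next
    case (Cons x L)
    have "set L \<subseteq> carrier K \<times> I" using Cons.prems by auto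
    then have "span (\<lambda>d. d) L \<in> carrier T.Pol" by (intro span_closed[of I]) auto
    then show ?case using Cons by (cases x) (auto simp: span_simps a_minus_def T.P.MA.r_minus T.P.MA.minus_add)
  qed
  have "span ?G (?L1 @ ?L2) = \<zero>\<^bsub>T.Pol\<^esub>"
  proof -
    have "span (\<lambda>d. d) L2 \<in> carrier T.Pol" by (rule span_closed[OF _ L2(1)]) auto
    then show ?thesis using span_append[of D ?G, OF Gc L12] s1 s2 vX by (simp add: T.P.MA.r_neg)
  qed
  then have rel: "combination K (\<lambda>d. \<kappa> (\<chi> w d)) (?L1 @ ?L2) = \<zero>\<^bsub>K\<^esub>" for w
    using span_apply[of D ?G "?L1 @ ?L2" w, OF Gc] L12 by (simp add: \<chi>_def T.P.MA_simps)
  have "combination K F ?L2 = \<zero>\<^bsub>K\<^esub>" using L2(1) by (induction L2) (auto simp: F_def)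
  moreover have "combination K F ?L1 = \<one>\<^bsub>K\<^esub>"
  proof -
    have "combination K F ?L1 = combination K (\<lambda>d. point d) L1" by (induction L1) (auto simp: F_def)
    then show ?thesis using eva_span[of "carrier P.Pol" "\<lambda>d. d", OF _ L1(1)] ev L1(2) by simp
  qed
  ultimately have nz: "combination K F (?L1 @ ?L2) \<noteq> \<zero>\<^bsub>K\<^esub>"
    using K.combination_append[of D F, OF _ L12] Dc by (simp add: F_def)
  have "\<exists>d\<in>D. (\<forall>w. \<chi> w d = \<zero>\<^bsub>k\<^esub>) \<and> F d \<noteq> \<zero>\<^bsub>K\<^esub>"
  proof (rule descend_relation[OF k.field_axioms K.field_axioms \<kappa>, where comb = comb])
    show "set (?L1 @ ?L2) \<subseteq> carrier K \<times> D" using L12 by simp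
    show "combination K (\<lambda>d. \<kappa> (\<chi> w d)) (?L1 @ ?L2) = \<zero>\<^bsub>K\<^esub>" for w by (rule rel)
    show "combination K F (?L1 @ ?L2) \<noteq> \<zero>\<^bsub>K\<^esub>" by (rule nz)
    show "\<chi> w d \<in> carrier k" if "d \<in> D" for w d unfolding \<chi>_def using Gc[OF that] by (rule P.P.coeff_closed)
    show "F d \<in> carrier K" if "d \<in> D" for d using Dc[OF that] by (simp add: F_def)
    fix d d0 c assume dc: "d \<in> D" "d0 \<in> D" "c \<in> carrier k"
    have c: "P.con c \<in> carrier P.Pol" using dc by simp
    note d = Dc[OF dc(1)] and d0 = Dc[OF dc(2)]
    show "comb d c d0 \<in> D" using d d0 c I.I_l_closed[OF d0(2) c]
      by (auto simp: comb_def D_def a_minus_def intro!: I.a_closed)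
    show "F (comb d c d0) = F d \<ominus>\<^bsub>K\<^esub> \<kappa> c \<otimes>\<^bsub>K\<^esub> F d0"
      using d d0 c dc by (simp add: F_def comb_def a_minus_def point)
    fix w
    have id: "(p \<ominus>\<^bsub>P.Pol\<^esub> e \<otimes>\<^bsub>P.Pol\<^esub> p0) \<otimes>\<^bsub>P.Pol\<^esub> X \<ominus>\<^bsub>P.Pol\<^esub> (g \<ominus>\<^bsub>P.Pol\<^esub> e \<otimes>\<^bsub>P.Pol\<^esub> g0)
        = (p \<otimes>\<^bsub>P.Pol\<^esub> X \<ominus>\<^bsub>P.Pol\<^esub> g) \<ominus>\<^bsub>P.Pol\<^esub> e \<otimes>\<^bsub>P.Pol\<^esub> (p0 \<otimes>\<^bsub>P.Pol\<^esub> X \<ominus>\<^bsub>P.Pol\<^esub> g0)"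
      if "p \<in> carrier P.Pol" "e \<in> carrier P.Pol" "p0 \<in> carrier P.Pol" "g \<in> carrier P.Pol" "g0 \<in> carrier P.Pol" for p e p0 g g0
      by (rule P.P.MA.minus_mult_minus_identity) (use that X in simp_all)
    have "\<chi> w (comb d c d0) = (?G d \<ominus>\<^bsub>P.Pol\<^esub> P.con c \<otimes>\<^bsub>P.Pol\<^esub> ?G d0) w"
      using id[OF d(1) c d0(1) d(3) d0(3)] by (simp add: \<chi>_def comb_def)
    also have "\<dots> = ?G d w \<ominus>\<^bsub>k\<^esub> (P.con c \<otimes>\<^bsub>P.Pol\<^esub> ?G d0) w"
      by (rule P.P.diff_apply) (use Gc dc c in auto)
    finally show "\<chi> w (comb d c d0) = \<chi> w d \<ominus>\<^bsub>k\<^esub> c \<otimes>\<^bsub>k\<^esub> \<chi> w d0"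
      using P.con_mult_apply[OF dc(3) Gc[OF dc(2)]] by (simp add: \<chi>_def)
  qed
  then obtain d where d: "d \<in> D" "\<And>w. \<chi> w d = \<zero>\<^bsub>k\<^esub>" "F d \<noteq> \<zero>\<^bsub>K\<^esub>" by blast
  have "?G d = \<zero>\<^bsub>P.Pol\<^esub>" using d(2) by (auto simp: \<chi>_def P.P.MA_simps)
  then have "fst d \<otimes>\<^bsub>P.Pol\<^esub> X = snd d" using Dc[OF d(1)] X by simp
  then show ?thesis using Dc[OF d(1)] d(3) by (intro bexI[of _ "fst d"]) (auto simp: F_def)
qed

end

text \<open>If \<open>Ann(x) + Ann(y)\<close> were proper it would lie in a maximal ideal
  \<open>M\<close>, whereas the argument at \<open>M\<close> yields an annihilator of
  \<open>x\<close> or of \<open>y\<close> outside \<open>M\<close>. The section is multiplicative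
  modulo \<open>I^m\<close> and sends zero into \<open>I^m\<close>; together these conditions put
  the product of the lifts of \<open>x\<close> and \<open>y\<close> into \<open>I^m\<close>.\<close>

lemma coprime_annihilators:
  fixes k :: "'k ring" and U :: "'u ring" and N :: nat
  defines "P \<equiv> monoid_algebra k (free_comm_monoid {..<N})"
  assumes k: "field k" and U: "cring U" and NU: "noetherian_ring U"
    and \<phi>: "\<phi> \<in> ring_hom P U" and surj: "\<phi> ` carrier P = carrier U"
    and sec: "\<And>m. \<exists>s\<in>carrier U \<rightarrow> carrier P. (\<forall>r\<in>carrier U. \<phi> (s r) = r) \<and>
      s \<zero>\<^bsub>U\<^esub> \<in> ideal_power P (a_kernel P U \<phi>) m \<and>
      (\<forall>r\<in>carrier U. \<forall>t\<in>carrier U. s (r \<otimes>\<^bsub>U\<^esub> t) \<ominus>\<^bsub>P\<^esub> s r \<otimes>\<^bsub>P\<^esub> s t \<in> ideal_power P (a_kernel P U \<phi>) m)"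
    and x: "x \<in> carrier U" and y: "y \<in> carrier U" and xy: "x \<otimes>\<^bsub>U\<^esub> y = \<zero>\<^bsub>U\<^esub>"
  shows "\<exists>a\<in>carrier U. \<exists>b\<in>carrier U. a \<otimes>\<^bsub>U\<^esub> x = \<zero>\<^bsub>U\<^esub> \<and> b \<otimes>\<^bsub>U\<^esub> y = \<zero>\<^bsub>U\<^esub> \<and> a \<oplus>\<^bsub>U\<^esub> b = \<one>\<^bsub>U\<^esub>"
proof (rule ccontr)
  assume neg: "\<not> ?thesis"
  interpret U: cring U by fact
  interpret NU: noetherian_ring U by fact
  interpret k: field k by fact
  interpret PP: polynomial_domain k "{..<N}" by unfold_locales
  interpret \<phi>: ring_hom_ring P U \<phi> unfolding P_def
    by unfold_locales (use \<phi> in \<open>simp add: P_def\<close>)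
  let ?J = "{a \<oplus>\<^bsub>U\<^esub> b | a b. a \<in> carrier U \<and> b \<in> carrier U \<and> a \<otimes>\<^bsub>U\<^esub> x = \<zero>\<^bsub>U\<^esub> \<and> b \<otimes>\<^bsub>U\<^esub> y = \<zero>\<^bsub>U\<^esub>}"
  have "U.subideal (carrier U) ?J"
    unfolding U.subideal_def
  proof (intro conjI ballI)
    have "\<zero>\<^bsub>U\<^esub> = \<zero>\<^bsub>U\<^esub> \<oplus>\<^bsub>U\<^esub> \<zero>\<^bsub>U\<^esub>" by simp
    moreover have "\<zero>\<^bsub>U\<^esub> \<otimes>\<^bsub>U\<^esub> x = \<zero>\<^bsub>U\<^esub>" "\<zero>\<^bsub>U\<^esub> \<otimes>\<^bsub>U\<^esub> y = \<zero>\<^bsub>U\<^esub>" using x y by auto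
    ultimately show "\<zero>\<^bsub>U\<^esub> \<in> ?J" using U.zero_closed by blast
    fix u assume "u \<in> ?J"
    then obtain a b where u: "u = a \<oplus>\<^bsub>U\<^esub> b" "a \<in> carrier U" "b \<in> carrier U" "a \<otimes>\<^bsub>U\<^esub> x = \<zero>\<^bsub>U\<^esub>" "b \<otimes>\<^bsub>U\<^esub> y = \<zero>\<^bsub>U\<^esub>" by blast
    {
      fix v assume "v \<in> ?J"
      then obtain a' b' where v: "v = a' \<oplus>\<^bsub>U\<^esub> b'" "a' \<in> carrier U" "b' \<in> carrier U" "a' \<otimes>\<^bsub>U\<^esub> x = \<zero>\<^bsub>U\<^esub>" "b' \<otimes>\<^bsub>U\<^esub> y = \<zero>\<^bsub>U\<^esub>" by blast
      have "u \<oplus>\<^bsub>U\<^esub> v = (a \<oplus>\<^bsub>U\<^esub> a') \<oplus>\<^bsub>U\<^esub> (b \<oplus>\<^bsub>U\<^esub> b')" using u v by (simp add: U.a_ac)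
      moreover have "(a \<oplus>\<^bsub>U\<^esub> a') \<otimes>\<^bsub>U\<^esub> x = \<zero>\<^bsub>U\<^esub>" "(b \<oplus>\<^bsub>U\<^esub> b') \<otimes>\<^bsub>U\<^esub> y = \<zero>\<^bsub>U\<^esub>" using u v x y by (auto simp: U.l_distr)
      ultimately show "u \<oplus>\<^bsub>U\<^esub> v \<in> ?J" using u v by blast
    next
      fix r assume r: "r \<in> carrier U"
      have "r \<otimes>\<^bsub>U\<^esub> u = r \<otimes>\<^bsub>U\<^esub> a \<oplus>\<^bsub>U\<^esub> r \<otimes>\<^bsub>U\<^esub> b" using u r by (simp add: U.r_distr)
      moreover have "(r \<otimes>\<^bsub>U\<^esub> a) \<otimes>\<^bsub>U\<^esub> x = \<zero>\<^bsub>U\<^esub>" "(r \<otimes>\<^bsub>U\<^esub> b) \<otimes>\<^bsub>U\<^esub> y = \<zero>\<^bsub>U\<^esub>" using u r x y by (auto simp: U.m_assoc)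
      ultimately show "r \<otimes>\<^bsub>U\<^esub> u \<in> ?J" using u r by blast
    }
  qed auto
  then have J: "ideal ?J U" by (simp add: U.subideal_carrier_iff)
  have J1: "\<one>\<^bsub>U\<^esub> \<notin> ?J"
  proof
    assume "\<one>\<^bsub>U\<^esub> \<in> ?J"
    then obtain a b where "\<one>\<^bsub>U\<^esub> = a \<oplus>\<^bsub>U\<^esub> b" "a \<in> carrier U" "b \<in> carrier U" "a \<otimes>\<^bsub>U\<^esub> x = \<zero>\<^bsub>U\<^esub>" "b \<otimes>\<^bsub>U\<^esub> y = \<zero>\<^bsub>U\<^esub>" by blast
    then show False using neg by metis
  qed
  obtain J where J_def: "J = ?J" by simp
  have J: "ideal J U" "\<one>\<^bsub>U\<^esub> \<notin> J" using J J1 unfolding J_def by simp_all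
  let ?F = "{M. ideal M U \<and> J \<subseteq> M \<and> \<one>\<^bsub>U\<^esub> \<notin> M}"
  have "J \<in> ?F" using J by simp
  then obtain M where M: "M \<in> ?F" "\<And>X. X \<in> ?F \<Longrightarrow> M \<subseteq> X \<Longrightarrow> X = M"
    using NU.maximal_ideal_in_family[of ?F] by (metis (mono_tags, lifting) empty_iff mem_Collect_eq)
  have "maximalideal M U"
  proof (rule maximalidealI)
    show "ideal M U" using M by simp
    show "carrier U \<noteq> M" using M by auto
    fix J' assume J': "ideal J' U" "M \<subseteq> J'" "J' \<subseteq> carrier U"
    show "J' = M \<or> J' = carrier U"
    proof (cases "\<one>\<^bsub>U\<^esub> \<in> J'")
      case True
      then show ?thesis using ideal.one_imp_carrier[OF J'(1)] by simp
    qed (use M J' in auto)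
  qed
  then interpret M: maximalideal M U .
  let ?K = "U Quot M"
  have K: "field ?K" by (rule M.quotient_is_field) (rule U.cring_axioms)
  interpret K: field ?K by (rule K)
  let ?q = "(+>\<^bsub>U\<^esub>) M"
  interpret q: ring_hom_ring U ?K ?q by (rule M.rcos_ring_hom_ring)
  define \<kappa> where "\<kappa> c = ?q (\<phi> (PP.con c))" for c
  define a where "a i = ?q (\<phi> (PP.var i))" for i
  interpret pt: polynomial_point k ?K \<kappa> N a
  proof
    have "\<kappa> = ?q \<circ> (\<phi> \<circ> (\<lambda>c. PP.con c))" by (auto simp: \<kappa>_def)
    then show "\<kappa> \<in> ring_hom k ?K"
      using ring_hom_trans[OF ring_hom_trans[OF PP.con_hom \<phi>[unfolded P_def]] M.rcos_ring_hom] by simp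
    show "a \<in> {..<N} \<rightarrow> carrier ?K"
      using q.hom_closed \<phi>.hom_closed by (auto simp: a_def P_def simp del: q.hom_closed)
  qed
  let ?I = "a_kernel P U \<phi>"
  have Ik: "ideal ?I P" by (rule \<phi>.kernel_is_ideal)
  have point: "pt.point p = ?q (\<phi> p)" if p: "p \<in> carrier P" for p
  proof -
    have "pt.point p = (?q \<circ> \<phi>) p"
      by (rule PP.poly_hom_eqI[OF K.cring_axioms pt.point(1) ring_hom_trans[OF \<phi>[unfolded P_def] M.rcos_ring_hom]])
        (use p pt.point(2,3) in \<open>auto simp: P_def \<kappa>_def a_def\<close>)
    then show ?thesis by simp
  qed
  have pI: "pt.point g = \<zero>\<^bsub>?K\<^esub>" if "g \<in> ?I" for g
  proof -
    have g: "g \<in> carrier P" "\<phi> g = \<zero>\<^bsub>U\<^esub>" using that unfolding mem_a_kernel by blast+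
    show ?thesis unfolding point[OF g(1)] g(2) by (rule q.hom_zero)
  qed
  \<comment> \<open>Elements of \<open>I\<close> vanish at the point, so their expansions have order
    at least one, and lower bounds for orders add up under multiplication.\<close>
  have tI: "g \<in> ideal_power P ?I m \<Longrightarrow> pt.taylor g \<in> pt.T.low m" for g m
  proof (induction m arbitrary: g)
    case 0
    then show ?case by (simp add: pt.T.low_0 P_def)
  next
    case (Suc m)
    have c1: "i \<in> ?I \<Longrightarrow> i \<in> carrier P" for i using ideal.Icarr[OF Ik] .
    have c2: "i \<in> ideal_power P ?I m \<Longrightarrow> i \<in> carrier P" for i
      using ideal.Icarr[OF PP.P.MA.ideal_power_ideal[OF Ik[unfolded P_def]]] by (simp add: P_def)
    have "g \<in> ?I \<cdot>\<^bsub>P\<^esub> ideal_power P ?I m" using Suc.prems by simp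
    then have "g \<in> carrier P \<and> pt.taylor g \<in> pt.T.low (Suc m)"
    proof (induction rule: ideal_prod.induct)
      case (prod i j)
      have "pt.taylor i \<in> pt.T.low 1"
        unfolding pt.low_1_iff using c1[OF prod(1)] pI[OF prod(1)] pt.ev0_taylor by (simp add: P_def)
      from pt.T.low_mult[OF this Suc.IH[OF prod(2)]] show ?case
        using c1[OF prod(1)] c2[OF prod(2)] by (simp add: P_def)
    next
      case (sum s t)
      then show ?case
        using additive_subgroup.a_closed[OF ideal.axioms(1)[OF pt.T.ideal_low]] by (simp add: P_def)
    qed
    then show ?case by simp
  qed
  have "\<forall>m. \<exists>s. s \<in> carrier U \<rightarrow> carrier P \<and> (\<forall>r\<in>carrier U. \<phi> (s r) = r) \<and>
      s \<zero>\<^bsub>U\<^esub> \<in> ideal_power P ?I m \<and>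
      (\<forall>r\<in>carrier U. \<forall>t\<in>carrier U. s (r \<otimes>\<^bsub>U\<^esub> t) \<ominus>\<^bsub>P\<^esub> s r \<otimes>\<^bsub>P\<^esub> s t \<in> ideal_power P ?I m)"
    using sec by blast
  from choice[OF this] obtain s where s: "s m \<in> carrier U \<rightarrow> carrier P \<and> (\<forall>r\<in>carrier U. \<phi> (s m r) = r) \<and>
      s m \<zero>\<^bsub>U\<^esub> \<in> ideal_power P ?I m \<and>
      (\<forall>r\<in>carrier U. \<forall>t\<in>carrier U. s m (r \<otimes>\<^bsub>U\<^esub> t) \<ominus>\<^bsub>P\<^esub> s m r \<otimes>\<^bsub>P\<^esub> s m t \<in> ideal_power P ?I m)" for m
    by blast
  have sc: "s m r \<in> carrier P" "\<phi> (s m r) = r" if "r \<in> carrier U" for m r using s[of m] that by auto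
  have prod: "pt.taylor (s m x) \<otimes>\<^bsub>pt.T.Pol\<^esub> pt.taylor (s m y) \<in> pt.T.low m" for m
  proof -
    interpret Im: ideal "ideal_power P ?I m" P
      unfolding P_def by (rule PP.P.MA.ideal_power_ideal[OF Ik[unfolded P_def]])
    have B: "s m \<zero>\<^bsub>U\<^esub> \<ominus>\<^bsub>P\<^esub> s m x \<otimes>\<^bsub>P\<^esub> s m y \<in> ideal_power P ?I m" using s[of m] x y xy by metis
    have A: "s m \<zero>\<^bsub>U\<^esub> \<in> ideal_power P ?I m" using s by blast
    have "s m \<zero>\<^bsub>U\<^esub> \<ominus>\<^bsub>P\<^esub> (s m \<zero>\<^bsub>U\<^esub> \<ominus>\<^bsub>P\<^esub> s m x \<otimes>\<^bsub>P\<^esub> s m y) \<in> ideal_power P ?I m"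
      using Im.a_closed[OF A Im.a_inv_closed[OF B]] by (simp only: a_minus_def)
    moreover have "s m \<zero>\<^bsub>U\<^esub> \<ominus>\<^bsub>P\<^esub> (s m \<zero>\<^bsub>U\<^esub> \<ominus>\<^bsub>P\<^esub> s m x \<otimes>\<^bsub>P\<^esub> s m y) = s m x \<otimes>\<^bsub>P\<^esub> s m y"
    proof -
      have id: "z \<ominus>\<^bsub>P\<^esub> (z \<ominus>\<^bsub>P\<^esub> u) = u" if "z \<in> carrier P" "u \<in> carrier P" for z u
        using that by (simp add: a_minus_def \<phi>.R.minus_add \<phi>.R.r_neg2)
      show ?thesis by (rule id) (use sc x y in auto)
    qed
    ultimately have "pt.taylor (s m x \<otimes>\<^bsub>P\<^esub> s m y) \<in> pt.T.low m" using tI by simp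
    then show ?thesis using sc[OF x] sc[OF y] by (simp add: P_def)
  qed
  \<comment> \<open>If both orders were less than \<open>j\<close>, the product would have order
    less than \<open>2 * j\<close>, although it lies in \<open>low (2 * j)\<close>.\<close>
  have alt: "pt.taylor (s (2 * j) x) \<in> pt.T.low j \<or> pt.taylor (s (2 * j) y) \<in> pt.T.low j" for j
  proof (rule ccontr)
    assume n: "\<not> ?thesis"
    have tc: "pt.taylor (s (2 * j) x) \<in> carrier pt.T.Pol" "pt.taylor (s (2 * j) y) \<in> carrier pt.T.Pol"
      using sc x y by (auto simp: P_def)
    from n tc obtain u v where uv: "size u < j" "pt.taylor (s (2 * j) x) u \<noteq> \<zero>\<^bsub>?K\<^esub>"
      "size v < j" "pt.taylor (s (2 * j) y) v \<noteq> \<zero>\<^bsub>?K\<^esub>" by (auto simp: pt.T.low_def)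
    obtain c where "size c \<le> size u + size v"
      "(pt.taylor (s (2 * j) x) \<otimes>\<^bsub>pt.T.Pol\<^esub> pt.taylor (s (2 * j) y)) c \<noteq> \<zero>\<^bsub>?K\<^esub>"
      using pt.T.mult_low_coeff[OF tc(1) uv(2) tc(2) uv(4)] by blast
    then show False using prod[of "2 * j"] uv by (auto simp: pt.T.low_def)
  qed
  have main: "\<exists>W\<in>carrier U. W \<otimes>\<^bsub>U\<^esub> z = \<zero>\<^bsub>U\<^esub> \<and> W \<notin> M"
    if z: "z \<in> carrier U" and ord: "\<And>j. \<exists>m. pt.taylor (s m z) \<in> pt.T.low j" for z
  proof -
    have "z \<in> \<phi> ` carrier P" using surj z by simp
    then obtain X where X: "X \<in> carrier P" "\<phi> X = z" by (elim imageE) simp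
    have "\<exists>W\<in>carrier P. W \<otimes>\<^bsub>P\<^esub> X \<in> ?I \<and> pt.point W \<noteq> \<zero>\<^bsub>?K\<^esub>"
      unfolding P_def
    proof (rule pt.order_intersection[OF Ik[unfolded P_def] _ X(1)[unfolded P_def]])
      show "pt.point g = \<zero>\<^bsub>?K\<^esub>" if "g \<in> a_kernel PP.Pol U \<phi>" for g using pI that by (simp add: P_def)
      fix j
      obtain m where m: "pt.taylor (s m z) \<in> pt.T.low j" using ord by blast
      have "\<phi> (X \<ominus>\<^bsub>P\<^esub> s m z) = \<zero>\<^bsub>U\<^esub>" using X sc[OF z] z by (simp add: a_minus_def U.r_neg)
      moreover have "X \<ominus>\<^bsub>P\<^esub> s m z \<in> carrier P" by (intro \<phi>.R.minus_closed X(1) sc(1)[OF z])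
      ultimately have "X \<ominus>\<^bsub>P\<^esub> s m z \<in> ?I" by (intro mem_a_kernel[THEN iffD2] conjI)
      then show "\<exists>p\<in>carrier PP.Pol. X \<ominus>\<^bsub>PP.Pol\<^esub> p \<in> a_kernel PP.Pol U \<phi> \<and> pt.taylor p \<in> pt.T.low j"
        using m sc(1)[OF z, of m] unfolding P_def by (intro bexI[of _ "s m z"] conjI)
    qed
    then obtain W where W: "W \<in> carrier P" "W \<otimes>\<^bsub>P\<^esub> X \<in> ?I" "pt.point W \<noteq> \<zero>\<^bsub>?K\<^esub>" by blast
    have Wc: "\<phi> W \<in> carrier U" by (rule \<phi>.hom_closed[OF W(1)])
    have "\<phi> (W \<otimes>\<^bsub>P\<^esub> X) = \<zero>\<^bsub>U\<^esub>" using W(2) unfolding mem_a_kernel by (rule conjunct2)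
    then have "\<phi> W \<otimes>\<^bsub>U\<^esub> z = \<zero>\<^bsub>U\<^esub>" unfolding \<phi>.hom_mult[OF W(1) X(1)] X(2) .
    moreover have "\<phi> W \<notin> M"
    proof
      assume "\<phi> W \<in> M"
      then have "M +>\<^bsub>U\<^esub> \<phi> W = \<zero>\<^bsub>?K\<^esub>" using M.quot_eq_zero_iff[OF Wc] by (simp only: M.quot_zero)
      then show False using W(3) point[OF W(1)] by (simp only:)
    qed
    ultimately show ?thesis using Wc by (intro bexI[of _ "\<phi> W"] conjI)
  qed
  \<comment> \<open>Which of the two lifts has high order may depend on \<open>j\<close>; since
    \<open>low\<close> is decreasing, one of \<open>x\<close> and \<open>y\<close> serves for every
    \<open>j\<close>.\<close>
  have "(\<forall>j. \<exists>m. pt.taylor (s m x) \<in> pt.T.low j) \<or> (\<forall>j. \<exists>m. pt.taylor (s m y) \<in> pt.T.low j)"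
  proof (rule ccontr)
    assume "\<not> ?thesis"
    then obtain i j where ij: "\<And>m. pt.taylor (s m x) \<notin> pt.T.low i" "\<And>m. pt.taylor (s m y) \<notin> pt.T.low j" by blast
    then show False using alt[of "max i j"] pt.T.low_antimono[of i "max i j"] pt.T.low_antimono[of j "max i j"] by auto
  qed
  then show False
  proof
    assume "\<forall>j. \<exists>m. pt.taylor (s m x) \<in> pt.T.low j"
    from main[OF x spec[OF this]] obtain W where W: "W \<in> carrier U" "W \<otimes>\<^bsub>U\<^esub> x = \<zero>\<^bsub>U\<^esub>" "W \<notin> M"
      by (elim bexE conjE) (rule that)
    have "W \<oplus>\<^bsub>U\<^esub> \<zero>\<^bsub>U\<^esub> \<in> J" unfolding J_def using W y U.l_null U.zero_closed by blast
    then show False using W(1,3) M(1) by (auto simp only: U.r_zero)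
  next
    assume "\<forall>j. \<exists>m. pt.taylor (s m y) \<in> pt.T.low j"
    from main[OF y spec[OF this]] obtain W where W: "W \<in> carrier U" "W \<otimes>\<^bsub>U\<^esub> y = \<zero>\<^bsub>U\<^esub>" "W \<notin> M"
      by (elim bexE conjE) (rule that)
    have "\<zero>\<^bsub>U\<^esub> \<oplus>\<^bsub>U\<^esub> W \<in> J" unfolding J_def using W x U.l_null U.zero_closed by blast
    then show False using W(1,3) M(1) by (auto simp only: U.l_zero)
  qed
qed

section \<open>Free modules and torsion of symmetric algebras\<close>

text \<open>Linear forms are spelled out because the target of \<open>linear_map\<close> has to be a
  module record.\<close>

definition functional :: "'r ring \<Rightarrow> ('r, 'b) module \<Rightarrow> ('b \<Rightarrow> 'r) \<Rightarrow> bool"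
  where "functional R M f \<longleftrightarrow> f \<in> carrier M \<rightarrow> carrier R \<and>
    (\<forall>x\<in>carrier M. \<forall>y\<in>carrier M. f (x \<oplus>\<^bsub>M\<^esub> y) = f x \<oplus>\<^bsub>R\<^esub> f y) \<and>
    (\<forall>r\<in>carrier R. \<forall>x\<in>carrier M. f (r \<odot>\<^bsub>M\<^esub> x) = r \<otimes>\<^bsub>R\<^esub> f x)"

lemma functionalD:
  assumes "functional R M f"
  shows "x \<in> carrier M \<Longrightarrow> f x \<in> carrier R"
    and "x \<in> carrier M \<Longrightarrow> y \<in> carrier M \<Longrightarrow> f (x \<oplus>\<^bsub>M\<^esub> y) = f x \<oplus>\<^bsub>R\<^esub> f y"
    and "r \<in> carrier R \<Longrightarrow> x \<in> carrier M \<Longrightarrow> f (r \<odot>\<^bsub>M\<^esub> x) = r \<otimes>\<^bsub>R\<^esub> f x"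
  using assms by (auto simp: functional_def)

text \<open>Coordinates are linear because they are unique: the sums and multiples of coordinates
  also represent the sums and multiples of elements.\<close>

lemma free_module_coordinates:
  assumes "free_module R M n"
  obtains e c where "module R M" "\<And>i. i < n \<Longrightarrow> e i \<in> carrier M" "\<And>i. i < n \<Longrightarrow> functional R M (c i)"
    "\<And>x. x \<in> carrier M \<Longrightarrow> x = (\<Oplus>\<^bsub>M\<^esub>i\<in>{..<n}. c i x \<odot>\<^bsub>M\<^esub> e i)"
proof -
  have M: "module R M" using assms by (simp add: free_module_def)
  interpret module R M by fact
  obtain e where e: "e \<in> {..<n} \<rightarrow> carrier M"
    and ex1': "\<forall>x\<in>carrier M. \<exists>!c. c \<in> {..<n} \<rightarrow>\<^sub>E carrier R \<and> x = (\<Oplus>\<^bsub>M\<^esub>i\<in>{..<n}. c i \<odot>\<^bsub>M\<^esub> e i)"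
    using assms unfolding free_module_def by (elim conjE bexE) (rule that)
  note ex1 = bspec[OF ex1']
  have ei: "i < n \<Longrightarrow> e i \<in> carrier M" for i using e by auto
  define d where "d x = (THE c. c \<in> {..<n} \<rightarrow>\<^sub>E carrier R \<and> x = (\<Oplus>\<^bsub>M\<^esub>i\<in>{..<n}. c i \<odot>\<^bsub>M\<^esub> e i))" for x
  have d: "d x \<in> {..<n} \<rightarrow>\<^sub>E carrier R \<and> x = (\<Oplus>\<^bsub>M\<^esub>i\<in>{..<n}. d x i \<odot>\<^bsub>M\<^esub> e i)" if "x \<in> carrier M" for x
    unfolding d_def by (rule theI'[OF ex1[OF that]])
  have dc: "d x i \<in> carrier R" if "x \<in> carrier M" "i < n" for x i using d[OF that(1)] that(2) by auto
  have uniq: "d x i = b i" if x: "x \<in> carrier M" and b: "\<And>i. i < n \<Longrightarrow> b i \<in> carrier R"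
    and xb: "x = (\<Oplus>\<^bsub>M\<^esub>i\<in>{..<n}. b i \<odot>\<^bsub>M\<^esub> e i)" and i: "i < n" for x b i
  proof -
    have "(\<Oplus>\<^bsub>M\<^esub>i\<in>{..<n}. restrict b {..<n} i \<odot>\<^bsub>M\<^esub> e i) = (\<Oplus>\<^bsub>M\<^esub>i\<in>{..<n}. b i \<odot>\<^bsub>M\<^esub> e i)"
      by (rule M.finsum_cong') (use b ei in auto)
    then have "restrict b {..<n} \<in> {..<n} \<rightarrow>\<^sub>E carrier R \<and> x = (\<Oplus>\<^bsub>M\<^esub>i\<in>{..<n}. restrict b {..<n} i \<odot>\<^bsub>M\<^esub> e i)"
      using b xb by auto
    then have "d x = restrict b {..<n}" using ex1[OF x] d[OF x] by blast
    then show ?thesis using i by simp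
  qed
  have "functional R M (\<lambda>x. d x i)" if i: "i < n" for i
    unfolding functional_def
  proof (intro conjI ballI)
    show "(\<lambda>x. d x i) \<in> carrier M \<rightarrow> carrier R" using dc i by auto
    fix x assume x: "x \<in> carrier M"
    show "d (r \<odot>\<^bsub>M\<^esub> x) i = r \<otimes>\<^bsub>R\<^esub> d x i" if r: "r \<in> carrier R" for r
    proof (rule uniq[where b = "\<lambda>i. r \<otimes>\<^bsub>R\<^esub> d x i"])
      have "r \<odot>\<^bsub>M\<^esub> x = r \<odot>\<^bsub>M\<^esub> (\<Oplus>\<^bsub>M\<^esub>i\<in>{..<n}. d x i \<odot>\<^bsub>M\<^esub> e i)"
        by (rule arg_cong[OF conjunct2[OF d[OF x]]])
      also have "\<dots> = (\<Oplus>\<^bsub>M\<^esub>i\<in>{..<n}. r \<odot>\<^bsub>M\<^esub> (d x i \<odot>\<^bsub>M\<^esub> e i))"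
        by (rule finsum_smult_ldistr) (use r dc[OF x] ei in auto)
      also have "\<dots> = (\<Oplus>\<^bsub>M\<^esub>i\<in>{..<n}. (r \<otimes>\<^bsub>R\<^esub> d x i) \<odot>\<^bsub>M\<^esub> e i)"
        by (rule M.finsum_cong') (use r dc[OF x] ei in \<open>auto simp: smult_assoc1\<close>)
      finally show "r \<odot>\<^bsub>M\<^esub> x = (\<Oplus>\<^bsub>M\<^esub>i\<in>{..<n}. (r \<otimes>\<^bsub>R\<^esub> d x i) \<odot>\<^bsub>M\<^esub> e i)" .
    qed (use x r i dc in auto)
    fix y assume y: "y \<in> carrier M"
    show "d (x \<oplus>\<^bsub>M\<^esub> y) i = d x i \<oplus>\<^bsub>R\<^esub> d y i"
    proof (rule uniq[where b = "\<lambda>i. d x i \<oplus>\<^bsub>R\<^esub> d y i"])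
      have "x \<oplus>\<^bsub>M\<^esub> y = (\<Oplus>\<^bsub>M\<^esub>i\<in>{..<n}. d x i \<odot>\<^bsub>M\<^esub> e i) \<oplus>\<^bsub>M\<^esub> (\<Oplus>\<^bsub>M\<^esub>i\<in>{..<n}. d y i \<odot>\<^bsub>M\<^esub> e i)"
        by (rule arg_cong2[OF conjunct2[OF d[OF x]] conjunct2[OF d[OF y]]])
      also have "\<dots> = (\<Oplus>\<^bsub>M\<^esub>i\<in>{..<n}. d x i \<odot>\<^bsub>M\<^esub> e i \<oplus>\<^bsub>M\<^esub> d y i \<odot>\<^bsub>M\<^esub> e i)"
        by (rule M.finsum_addf[symmetric]) (use dc x y ei in auto)
      also have "\<dots> = (\<Oplus>\<^bsub>M\<^esub>i\<in>{..<n}. (d x i \<oplus>\<^bsub>R\<^esub> d y i) \<odot>\<^bsub>M\<^esub> e i)"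
        by (rule M.finsum_cong') (use dc x y ei in \<open>auto simp: smult_l_distr\<close>)
      finally show "x \<oplus>\<^bsub>M\<^esub> y = (\<Oplus>\<^bsub>M\<^esub>i\<in>{..<n}. (d x i \<oplus>\<^bsub>R\<^esub> d y i) \<odot>\<^bsub>M\<^esub> e i)" .
    qed (use x y i dc in auto)
  qed
  then show ?thesis using that[of e "\<lambda>i x. d x i"] M ei d by blast
qed

context
  fixes R :: "'r ring" (structure)
  assumes R: "cring R"
begin

lemma nonzerodivisor_mult:
  "a \<in> nonzerodivisors R \<Longrightarrow> b \<in> nonzerodivisors R \<Longrightarrow> a \<otimes> b \<in> nonzerodivisors R"
proof -
  interpret cring R by (rule R)
  assume ab: "a \<in> nonzerodivisors R" "b \<in> nonzerodivisors R"
  have c: "a \<in> carrier R" "b \<in> carrier R" using ab by (simp_all add: nonzerodivisors_def)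
  have D: "z = \<zero>" if "y \<in> nonzerodivisors R" "z \<in> carrier R" "y \<otimes> z = \<zero>" for y z
    using that unfolding nonzerodivisors_def by blast
  have "z = \<zero>" if z: "z \<in> carrier R" and "a \<otimes> b \<otimes> z = \<zero>" for z
    using D[OF ab(2) z] D[OF ab(1) m_closed[OF c(2) z]] m_assoc[OF c z] that(2) by metis
  then show ?thesis using m_closed[OF c] unfolding nonzerodivisors_def by blast
qed

lemma nonzerodivisor_one: "\<one> \<in> nonzerodivisors R"
proof -
  interpret cring R by (rule R)
  show ?thesis by (auto simp: nonzerodivisors_def)
qed

lemma nonzerodivisor_pow: "a \<in> nonzerodivisors R \<Longrightarrow> a [^] (m::nat) \<in> nonzerodivisors R"
proof (induction m)
  case 0
  interpret cring R by (rule R)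
  show ?case using nonzerodivisor_one by simp
next
  case (Suc m)
  interpret cring R by (rule R)
  show ?case using Suc nonzerodivisor_mult by simp
qed

end

section \<open>Retractions onto submodules of free modules, up to a nonzerodivisor\<close>

text \<open>Over a domain either some coordinate of \<open>y\<close> is nonzero and
  \<open>c = 0\<close> will do, or \<open>y = 0\<close> and \<open>f = 0\<close>,
  \<open>c = 1\<close> will do. In general both cases occur on different factors of the ring; the
  idempotent \<open>c\<close>, built one coordinate at a time, cuts out the part where
  \<open>y\<close> vanishes.\<close>

lemma pp_ring_separating_functional:
  fixes R :: "'r ring"
  assumes pp: "pp_ring R" and F: "free_module R M n" and y: "y \<in> carrier M"
  shows "\<exists>f c. functional R M f \<and> c \<in> carrier R \<and> c \<odot>\<^bsub>M\<^esub> y = \<zero>\<^bsub>M\<^esub> \<and> f y \<oplus>\<^bsub>R\<^esub> c \<in> nonzerodivisors R"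
proof -
  obtain e g where M: "module R M" and e: "\<And>i. i < n \<Longrightarrow> e i \<in> carrier M" and g: "\<And>i. i < n \<Longrightarrow> functional R M (g i)"
    and xg: "\<And>x. x \<in> carrier M \<Longrightarrow> x = (\<Oplus>\<^bsub>M\<^esub>i\<in>{..<n}. g i x \<odot>\<^bsub>M\<^esub> e i)"
    using free_module_coordinates[OF F] by blast
  interpret module R M by fact
  have "m \<le> n \<Longrightarrow> \<exists>f c. functional R M f \<and> c \<in> carrier R \<and> c \<otimes>\<^bsub>R\<^esub> c = c \<and> c \<otimes>\<^bsub>R\<^esub> f y = \<zero>\<^bsub>R\<^esub> \<and>
     (\<forall>i<m. c \<otimes>\<^bsub>R\<^esub> g i y = \<zero>\<^bsub>R\<^esub>) \<and> f y \<oplus>\<^bsub>R\<^esub> c \<in> nonzerodivisors R" for m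
  proof (induction m)
    case 0
    have "functional R M (\<lambda>_. \<zero>\<^bsub>R\<^esub>)" by (auto simp: functional_def)
    then show ?case using nonzerodivisor_one[OF R.cring_axioms] by (intro exI[of _ "\<lambda>_. \<zero>\<^bsub>R\<^esub>"] exI[of _ "\<one>\<^bsub>R\<^esub>"]) auto
  next
    case (Suc m)
    then obtain f c where f: "functional R M f" and c: "c \<in> carrier R" "c \<otimes>\<^bsub>R\<^esub> c = c" "c \<otimes>\<^bsub>R\<^esub> f y = \<zero>\<^bsub>R\<^esub>"
      "\<And>i. i < m \<Longrightarrow> c \<otimes>\<^bsub>R\<^esub> g i y = \<zero>\<^bsub>R\<^esub>" "f y \<oplus>\<^bsub>R\<^esub> c \<in> nonzerodivisors R" by auto
    have gm: "functional R M (g m)" using g Suc.prems by simp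
    let ?a = "g m y" and ?f = "f y"
    have a: "?a \<in> carrier R" "?f \<in> carrier R" using functionalD(1)[OF gm y] functionalD(1)[OF f y] .
    from bspec[OF conjunct2[OF pp[unfolded pp_ring_def]] R.m_closed[OF c(1) a(1)]]
    obtain d where d: "d \<in> carrier R" "d \<otimes>\<^bsub>R\<^esub> (c \<otimes>\<^bsub>R\<^esub> ?a) = \<zero>\<^bsub>R\<^esub>"
      and d': "\<forall>z\<in>carrier R. c \<otimes>\<^bsub>R\<^esub> ?a \<otimes>\<^bsub>R\<^esub> z = \<zero>\<^bsub>R\<^esub> \<longrightarrow> d \<otimes>\<^bsub>R\<^esub> z = z"
      by (elim bexE conjE) (rule that)
    have d3: "d \<otimes>\<^bsub>R\<^esub> z = z" if "z \<in> carrier R" "c \<otimes>\<^bsub>R\<^esub> ?a \<otimes>\<^bsub>R\<^esub> z = \<zero>\<^bsub>R\<^esub>" for z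
      using d' that by blast
    have dd: "d \<otimes>\<^bsub>R\<^esub> d = d" by (rule d3) (use d c a in \<open>simp_all add: R.m_comm\<close>)
    let ?c = "c \<otimes>\<^bsub>R\<^esub> d"
    \<comment> \<open>On the part cut out by \<open>c\<close> the coordinates treated so far vanish,
      so the next coordinate can be added there without interfering with \<open>f\<close>. What
      remains is the part cut out by \<open>c d\<close>, where that coordinate vanishes too.\<close>
    let ?f' = "\<lambda>x. f x \<oplus>\<^bsub>R\<^esub> c \<otimes>\<^bsub>R\<^esub> g m x"
    have f': "functional R M ?f'"
      using functionalD[OF f] functionalD[OF gm] c(1)
      by (auto simp: functional_def R.r_distr R.a_ac R.m_ac)
    have cc: "?c \<otimes>\<^bsub>R\<^esub> ?c = ?c"
    proof -
      have "?c \<otimes>\<^bsub>R\<^esub> ?c = (c \<otimes>\<^bsub>R\<^esub> c) \<otimes>\<^bsub>R\<^esub> (d \<otimes>\<^bsub>R\<^esub> d)" using c(1) d(1) by (simp add: R.m_ac)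
      then show ?thesis by (simp add: c(2) dd)
    qed
    have ca: "?c \<otimes>\<^bsub>R\<^esub> ?a = \<zero>\<^bsub>R\<^esub>" using d(2) c(1) d(1) a by (simp add: R.m_ac)
    have cf: "?c \<otimes>\<^bsub>R\<^esub> ?f' y = \<zero>\<^bsub>R\<^esub>"
    proof -
      have "?c \<otimes>\<^bsub>R\<^esub> ?f' y = d \<otimes>\<^bsub>R\<^esub> (c \<otimes>\<^bsub>R\<^esub> ?f) \<oplus>\<^bsub>R\<^esub> c \<otimes>\<^bsub>R\<^esub> (?c \<otimes>\<^bsub>R\<^esub> ?a)"
        using c(1) d(1) a by (simp add: R.r_distr R.m_ac)
      then show ?thesis using c ca d(1) by simp
    qed
    have ci: "?c \<otimes>\<^bsub>R\<^esub> g i y = \<zero>\<^bsub>R\<^esub>" if i: "i < Suc m" for i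
    proof (cases "i = m")
      case False
      then have im: "i < m" using i by simp
      have "g i y \<in> carrier R" using functionalD(1)[OF g y] im Suc.prems by simp
      then have "?c \<otimes>\<^bsub>R\<^esub> g i y = d \<otimes>\<^bsub>R\<^esub> (c \<otimes>\<^bsub>R\<^esub> g i y)" using c(1) d(1) by (simp add: R.m_ac)
      then show ?thesis using c(4)[OF im] d(1) by simp
    qed (use ca in simp)
    \<comment> \<open>Multiplying the equation by \<open>c\<close> gives
      \<open>c a z + c d z = 0\<close>, and then by \<open>d\<close> gives \<open>c d z = 0\<close>.
      So \<open>c a z = 0\<close>, hence \<open>d z = z\<close> by the choice of \<open>d\<close>,
      hence \<open>c z = 0\<close>, and the nonzerodivisor of the previous stage kills
      \<open>z\<close>.\<close>
    have "z = \<zero>\<^bsub>R\<^esub>" if z: "z \<in> carrier R" and 0: "(?f' y \<oplus>\<^bsub>R\<^esub> ?c) \<otimes>\<^bsub>R\<^esub> z = \<zero>\<^bsub>R\<^esub>" for z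
    proof -
      have "c \<otimes>\<^bsub>R\<^esub> ((?f' y \<oplus>\<^bsub>R\<^esub> ?c) \<otimes>\<^bsub>R\<^esub> z) =
        (c \<otimes>\<^bsub>R\<^esub> ?f) \<otimes>\<^bsub>R\<^esub> z \<oplus>\<^bsub>R\<^esub> (c \<otimes>\<^bsub>R\<^esub> c) \<otimes>\<^bsub>R\<^esub> (?a \<otimes>\<^bsub>R\<^esub> z) \<oplus>\<^bsub>R\<^esub> (c \<otimes>\<^bsub>R\<^esub> c) \<otimes>\<^bsub>R\<^esub> (d \<otimes>\<^bsub>R\<^esub> z)"
        using c(1) d(1) a z by (simp add: R.l_distr R.r_distr R.m_assoc R.a_assoc)
      then have 1: "c \<otimes>\<^bsub>R\<^esub> (?a \<otimes>\<^bsub>R\<^esub> z) \<oplus>\<^bsub>R\<^esub> c \<otimes>\<^bsub>R\<^esub> (d \<otimes>\<^bsub>R\<^esub> z) = \<zero>\<^bsub>R\<^esub>"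
        using 0 c d(1) a z by simp
      have "d \<otimes>\<^bsub>R\<^esub> (c \<otimes>\<^bsub>R\<^esub> (?a \<otimes>\<^bsub>R\<^esub> z) \<oplus>\<^bsub>R\<^esub> c \<otimes>\<^bsub>R\<^esub> (d \<otimes>\<^bsub>R\<^esub> z)) =
        (d \<otimes>\<^bsub>R\<^esub> (c \<otimes>\<^bsub>R\<^esub> ?a)) \<otimes>\<^bsub>R\<^esub> z \<oplus>\<^bsub>R\<^esub> c \<otimes>\<^bsub>R\<^esub> ((d \<otimes>\<^bsub>R\<^esub> d) \<otimes>\<^bsub>R\<^esub> z)"
        using c(1) d(1) a z by (simp add: R.r_distr R.m_ac)
      then have 2: "c \<otimes>\<^bsub>R\<^esub> (d \<otimes>\<^bsub>R\<^esub> z) = \<zero>\<^bsub>R\<^esub>"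
        using 1 d(1,2) c(1) a z dd by simp
      then have "c \<otimes>\<^bsub>R\<^esub> ?a \<otimes>\<^bsub>R\<^esub> z = \<zero>\<^bsub>R\<^esub>" using 1 c(1) d(1) a z by (simp add: R.m_assoc)
      then have "d \<otimes>\<^bsub>R\<^esub> z = z" by (rule d3[OF z])
      then have cz: "c \<otimes>\<^bsub>R\<^esub> z = \<zero>\<^bsub>R\<^esub>" using 2 by simp
      have "(?f' y \<oplus>\<^bsub>R\<^esub> ?c) \<otimes>\<^bsub>R\<^esub> z = ?f \<otimes>\<^bsub>R\<^esub> z \<oplus>\<^bsub>R\<^esub> (?a \<otimes>\<^bsub>R\<^esub> (c \<otimes>\<^bsub>R\<^esub> z) \<oplus>\<^bsub>R\<^esub> d \<otimes>\<^bsub>R\<^esub> (c \<otimes>\<^bsub>R\<^esub> z))"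
        using c(1) d(1) a z by (simp add: R.l_distr R.r_distr R.a_assoc R.m_ac)
      then have "?f \<otimes>\<^bsub>R\<^esub> z = \<zero>\<^bsub>R\<^esub>" using 0 cz a d(1) z by simp
      then have "(?f \<oplus>\<^bsub>R\<^esub> c) \<otimes>\<^bsub>R\<^esub> z = \<zero>\<^bsub>R\<^esub>" using cz a c(1) z by (simp add: R.l_distr)
      then show ?thesis using c(5) z by (auto simp: nonzerodivisors_def)
    qed
    then have "?f' y \<oplus>\<^bsub>R\<^esub> ?c \<in> nonzerodivisors R" using c(1) d(1) a by (auto simp: nonzerodivisors_def)
    then show ?case using f' c(1) d(1) cc cf ci by (intro exI[of _ ?f'] exI[of _ ?c]) auto
  qed
  from this[of n] obtain f c where f: "functional R M f" "c \<in> carrier R" "\<And>i. i < n \<Longrightarrow> c \<otimes>\<^bsub>R\<^esub> g i y = \<zero>\<^bsub>R\<^esub>"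
    "f y \<oplus>\<^bsub>R\<^esub> c \<in> nonzerodivisors R" by auto
  have gy: "i < n \<Longrightarrow> g i y \<in> carrier R" for i using functionalD(1)[OF g y] .
  have "c \<odot>\<^bsub>M\<^esub> y = c \<odot>\<^bsub>M\<^esub> (\<Oplus>\<^bsub>M\<^esub>i\<in>{..<n}. g i y \<odot>\<^bsub>M\<^esub> e i)" by (rule arg_cong[OF xg[OF y]])
  also have "\<dots> = (\<Oplus>\<^bsub>M\<^esub>i\<in>{..<n}. c \<odot>\<^bsub>M\<^esub> (g i y \<odot>\<^bsub>M\<^esub> e i))"
    by (rule finsum_smult_ldistr) (use f gy e in auto)
  also have "\<dots> = (\<Oplus>\<^bsub>M\<^esub>i\<in>{..<n}. \<zero>\<^bsub>M\<^esub>)"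
    by (rule M.finsum_cong') (use f gy e in \<open>auto simp flip: smult_assoc1\<close>)
  finally show ?thesis using f by auto
qed

text \<open>Induction on \<open>X\<close>, starting from the zero map with \<open>u = 1\<close>. The
  obstruction to treating a new element \<open>x\<close> is the error \<open>u x - \<rho> x\<close>,
  which lies in the submodule; a map of rank one with values in the multiples of this error corrects
  it.\<close>

lemma pp_ring_retraction:
  fixes R :: "'r ring"
  assumes pp: "pp_ring R" and F: "free_module R M n" and E: "module R (M\<lparr>carrier := E\<rparr>)" and EM: "E \<subseteq> carrier M"
    and X: "finite X" "X \<subseteq> E"
  shows "\<exists>u\<in>nonzerodivisors R. \<exists>\<rho>. linear_map R M (M\<lparr>carrier := E\<rparr>) \<rho> \<and> (\<forall>x\<in>X. \<rho> x = u \<odot>\<^bsub>M\<^esub> x)"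
  using X
proof (induction X rule: finite_induct)
  case empty
  interpret module R M using F by (simp add: free_module_def)
  interpret E: module R "M\<lparr>carrier := E\<rparr>" by fact
  have "linear_map R M (M\<lparr>carrier := E\<rparr>) (\<lambda>_. \<zero>\<^bsub>M\<^esub>)"
    using E.M.zero_closed by (auto simp: semilinear_map_def)
  then show ?case using nonzerodivisor_one[OF R.cring_axioms] by auto
next
  case (insert x X)
  interpret module R M using F by (simp add: free_module_def)
  interpret E: module R "M\<lparr>carrier := E\<rparr>" by fact
  have Ec: "a \<oplus>\<^bsub>M\<^esub> b \<in> E" "r \<odot>\<^bsub>M\<^esub> a \<in> E" if "a \<in> E" "b \<in> E" "r \<in> carrier R" for a b r
    using E.M.add.m_closed[of a b] E.smult_closed[of r a] that by simp_all
  have El: "a \<in> E \<Longrightarrow> a \<in> carrier M" for a using EM by blast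
  from insert obtain u \<rho> where u: "u \<in> nonzerodivisors R" and \<rho>: "linear_map R M (M\<lparr>carrier := E\<rparr>) \<rho>"
    and \<rho>X: "\<And>x. x \<in> X \<Longrightarrow> \<rho> x = u \<odot>\<^bsub>M\<^esub> x" by auto
  note \<rho>' = semilinear_mapD[OF \<rho>, simplified]
  have uc: "u \<in> carrier R" using u by (simp add: nonzerodivisors_def)
  have x: "x \<in> E" "x \<in> carrier M" using insert.prems EM by auto
  define h where "h z = u \<odot>\<^bsub>M\<^esub> z \<oplus>\<^bsub>M\<^esub> (\<ominus>\<^bsub>R\<^esub> \<one>\<^bsub>R\<^esub>) \<odot>\<^bsub>M\<^esub> \<rho> z" for z
  have hc: "z \<in> carrier M \<Longrightarrow> h z \<in> carrier M" for z using uc \<rho>'(1) El by (simp add: h_def)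
  have h_add: "h (z \<oplus>\<^bsub>M\<^esub> z') = h z \<oplus>\<^bsub>M\<^esub> h z'" if "z \<in> carrier M" "z' \<in> carrier M" for z z'
    using that uc \<rho>' El by (simp add: h_def smult_r_distr M.a_ac)
  have h_smult: "h (r \<odot>\<^bsub>M\<^esub> z) = r \<odot>\<^bsub>M\<^esub> h z" if "z \<in> carrier M" "r \<in> carrier R" for z r
  proof -
    have rz: "\<rho> z \<in> carrier M" using that \<rho>' El by simp
    have "u \<odot>\<^bsub>M\<^esub> (r \<odot>\<^bsub>M\<^esub> z) = r \<odot>\<^bsub>M\<^esub> (u \<odot>\<^bsub>M\<^esub> z)" using that uc by (simp flip: smult_assoc1 add: R.m_comm)
    moreover have "(\<ominus>\<^bsub>R\<^esub> \<one>\<^bsub>R\<^esub>) \<odot>\<^bsub>M\<^esub> (r \<odot>\<^bsub>M\<^esub> \<rho> z) = r \<odot>\<^bsub>M\<^esub> ((\<ominus>\<^bsub>R\<^esub> \<one>\<^bsub>R\<^esub>) \<odot>\<^bsub>M\<^esub> \<rho> z)"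
      using that rz smult_assoc1[of "\<ominus>\<^bsub>R\<^esub> \<one>\<^bsub>R\<^esub>" r "\<rho> z"] smult_assoc1[of r "\<ominus>\<^bsub>R\<^esub> \<one>\<^bsub>R\<^esub>" "\<rho> z"] R.m_comm[of r "\<ominus>\<^bsub>R\<^esub> \<one>\<^bsub>R\<^esub>"] by simp
    ultimately show ?thesis using that uc rz by (simp add: h_def \<rho>' smult_r_distr)
  qed
  have hX: "h z = \<zero>\<^bsub>M\<^esub>" if "z \<in> X" for z
  proof -
    have z: "z \<in> carrier M" using that insert.prems El by auto
    have "h z = (u \<oplus>\<^bsub>R\<^esub> (\<ominus>\<^bsub>R\<^esub> \<one>\<^bsub>R\<^esub>) \<otimes>\<^bsub>R\<^esub> u) \<odot>\<^bsub>M\<^esub> z"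
      using z uc \<rho>X[OF that] by (simp add: h_def smult_l_distr smult_assoc1)
    also have "\<dots> = \<zero>\<^bsub>M\<^esub>" using z uc by (simp add: R.l_minus R.r_neg)
    finally show ?thesis .
  qed
  let ?y = "h x"
  have yE: "?y \<in> E"
  proof -
    have "\<ominus>\<^bsub>R\<^esub> \<one>\<^bsub>R\<^esub> \<in> carrier R" by simp
    then show ?thesis unfolding h_def using Ec x(1) \<rho>'(1)[OF x(2)] uc by blast
  qed
  have yc: "?y \<in> carrier M" using hc x by blast
  obtain f c where f: "functional R M f" and c: "c \<in> carrier R" "c \<odot>\<^bsub>M\<^esub> ?y = \<zero>\<^bsub>M\<^esub>" "f ?y \<oplus>\<^bsub>R\<^esub> c \<in> nonzerodivisors R"
    using pp_ring_separating_functional[OF pp F yc] by blast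
  note f' = functionalD[OF f]
  let ?b = "f ?y \<oplus>\<^bsub>R\<^esub> c"
  have b: "?b \<in> carrier R" using f' yc c by simp
  \<comment> \<open>The added term vanishes on \<open>X\<close> because \<open>h\<close> does. At
    \<open>x\<close> the identity \<open>c y = 0\<close> turns \<open>f y\<close> times
    \<open>y\<close> into \<open>b\<close> times \<open>y\<close>, so the value is
    \<open>b (\<rho> x + y) = b u x\<close>.\<close>
  define \<rho>2 where "\<rho>2 z = ?b \<odot>\<^bsub>M\<^esub> \<rho> z \<oplus>\<^bsub>M\<^esub> f (h z) \<odot>\<^bsub>M\<^esub> ?y" for z
  have fh: "z \<in> carrier M \<Longrightarrow> f (h z) \<in> carrier R" for z using f' hc by simp
  have "linear_map R M (M\<lparr>carrier := E\<rparr>) \<rho>2"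
    unfolding semilinear_map_def
  proof (intro conjI ballI)
    show "\<rho>2 \<in> carrier M \<rightarrow> carrier (M\<lparr>carrier := E\<rparr>)"
      using Ec \<rho>'(1) yE fh b by (auto simp: \<rho>2_def)
    fix z assume z: "z \<in> carrier M"
    have rz: "\<rho> z \<in> carrier M" using z \<rho>' El by simp
    show "\<rho>2 (z \<oplus>\<^bsub>M\<^esub> z') = \<rho>2 z \<oplus>\<^bsub>M\<lparr>carrier := E\<rparr>\<^esub> \<rho>2 z'" if z': "z' \<in> carrier M" for z'
    proof -
      have rz': "\<rho> z' \<in> carrier M" using z' \<rho>' El by simp
      show ?thesis using z z' b rz rz' yc fh hc
        by (simp add: \<rho>2_def \<rho>' h_add f' smult_r_distr smult_l_distr M.a_ac del: R.add.m_closed)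
    qed
    show "\<rho>2 (r \<odot>\<^bsub>M\<^esub> z) = r \<odot>\<^bsub>M\<lparr>carrier := E\<rparr>\<^esub> \<rho>2 z" if r: "r \<in> carrier R" for r
    proof -
      have "?b \<odot>\<^bsub>M\<^esub> (r \<odot>\<^bsub>M\<^esub> \<rho> z) = r \<odot>\<^bsub>M\<^esub> (?b \<odot>\<^bsub>M\<^esub> \<rho> z)"
        using smult_assoc1[OF b r rz] smult_assoc1[OF r b rz] R.m_comm[OF b r] by simp
      then show ?thesis using z b rz yc fh[OF z] hc[OF z] r
        by (simp add: \<rho>2_def \<rho>' h_smult f' smult_r_distr smult_assoc1)
    qed
  qed
  moreover have "\<rho>2 z = (?b \<otimes>\<^bsub>R\<^esub> u) \<odot>\<^bsub>M\<^esub> z" if z: "z \<in> insert x X" for z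
  proof (cases "z = x")
    case True
    have rx: "\<rho> x \<in> carrier M" using x \<rho>' El by simp
    have "f ?y \<odot>\<^bsub>M\<^esub> ?y = f ?y \<odot>\<^bsub>M\<^esub> ?y \<oplus>\<^bsub>M\<^esub> c \<odot>\<^bsub>M\<^esub> ?y" using c yc fh[OF x(2)] by simp
    also have "\<dots> = ?b \<odot>\<^bsub>M\<^esub> ?y" using c yc fh[OF x(2)] by (simp add: smult_l_distr)
    finally have 1: "\<rho>2 x = ?b \<odot>\<^bsub>M\<^esub> (\<rho> x \<oplus>\<^bsub>M\<^esub> ?y)"
      using b rx yc by (simp add: \<rho>2_def smult_r_distr)
    have "\<rho> x \<oplus>\<^bsub>M\<^esub> ?y = u \<odot>\<^bsub>M\<^esub> x \<oplus>\<^bsub>M\<^esub> (\<one>\<^bsub>R\<^esub> \<odot>\<^bsub>M\<^esub> \<rho> x \<oplus>\<^bsub>M\<^esub> (\<ominus>\<^bsub>R\<^esub> \<one>\<^bsub>R\<^esub>) \<odot>\<^bsub>M\<^esub> \<rho> x)"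
      using rx x uc by (simp add: h_def M.a_ac)
    also have "\<dots> = u \<odot>\<^bsub>M\<^esub> x"
      using rx x uc smult_l_distr[of "\<one>\<^bsub>R\<^esub>" "\<ominus>\<^bsub>R\<^esub> \<one>\<^bsub>R\<^esub>" "\<rho> x"] by (simp add: R.r_neg)
    finally show ?thesis using 1 True b uc x by (simp add: smult_assoc1)
  next
    case False
    then have zX: "z \<in> X" using z by simp
    have zc: "z \<in> carrier M" using zX insert.prems El by auto
    have "f \<zero>\<^bsub>M\<^esub> = \<zero>\<^bsub>R\<^esub>" using f'(3)[of "\<zero>\<^bsub>R\<^esub>" "\<zero>\<^bsub>M\<^esub>"] f'(1) by simp
    then show ?thesis using hX[OF zX] \<rho>X[OF zX] b uc zc yc by (simp add: \<rho>2_def smult_assoc1)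
  qed
  moreover have "?b \<otimes>\<^bsub>R\<^esub> u \<in> nonzerodivisors R" using c u nonzerodivisor_mult[OF R.cring_axioms] by blast
  ultimately show ?case by blast
qed

text \<open>Agreement is required on carriers only, since the functions are arbitrary elsewhere;
  hence the composite maps enter as separate parameters \<open>h\<close> and
  \<open>\<xi>\<close>.\<close>

lemma sym_map_comp:
  assumes B: "symmetric_algebra B M" and B': "symmetric_algebra B' M'" and B'': "symmetric_algebra B'' M''"
    and \<phi>: "\<phi> \<in> ring_hom B B'" and \<psi>: "\<psi> \<in> ring_hom B' B''"
    and f: "semilinear_map \<phi> B M M' f" and g: "semilinear_map \<psi> B' M' M'' g"
    and h: "semilinear_map \<xi> B M M'' h" and \<xi>: "\<xi> \<in> ring_hom B B''"
    and eq: "\<And>x. x \<in> carrier M \<Longrightarrow> h x = g (f x)" "\<And>b. b \<in> carrier B \<Longrightarrow> \<xi> b = \<psi> (\<phi> b)"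
    and s: "s \<in> carrier (sym_algebra B M)"
  shows "sym_map B' M' B'' M'' \<psi> g (sym_map B M B' M' \<phi> f s) = sym_map B M B'' M'' \<xi> h s"
proof -
  interpret X: symmetric_algebra B M by fact
  interpret Y: symmetric_algebra B' M' by fact
  interpret Z: symmetric_algebra B'' M'' by fact
  note F = sym_map[OF B B' \<phi> f] and G = sym_map[OF B' B'' \<psi> g] and H = sym_map[OF B B'' \<xi> h]
  have "(sym_map B' M' B'' M'' \<psi> g \<circ> sym_map B M B' M' \<phi> f) s = sym_map B M B'' M'' \<xi> h s"
  proof (rule X.sym_hom_eqI[OF Z.S.ring_axioms ring_hom_trans[OF F(1) G(1)] H(1) _ _ s])
    show "(sym_map B' M' B'' M'' \<psi> g \<circ> sym_map B M B' M' \<phi> f) (X.cst b) = sym_map B M B'' M'' \<xi> h (X.cst b)"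
      if "b \<in> carrier B" for b using that F(2) G(2) H(2) eq ring_hom_closed[OF \<phi>] by simp
    show "(sym_map B' M' B'' M'' \<psi> g \<circ> sym_map B M B' M' \<phi> f) (X.gen x) = sym_map B M B'' M'' \<xi> h (X.gen x)"
      if "x \<in> carrier M" for x using that F(3) G(3) H(3) eq semilinear_mapD(1)[OF f] by simp
  qed
  then show ?thesis by simp
qed

lemma id_ring_hom: "ring B \<Longrightarrow> (\<lambda>b. b) \<in> ring_hom B B"
proof -
  assume "ring B" then interpret ring B .
  show ?thesis by (rule ring_hom_memI) auto
qed

text \<open>The map \<open>\<rho>\<close> induces \<open>S(M) \<rightarrow> S(E)\<close>, so its
  restriction to \<open>E\<close> kills \<open>s\<close>. On monomials of degree \<open>d\<close> in
  the entries of \<open>s\<close> it acts as \<open>u^d\<close>. These factors depend on the degree;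
  homogeneity of the relations separates the degrees, and a single power of \<open>u\<close> then
  annihilates all parts.\<close>

lemma kernel_subset_torsion:
  fixes R :: "'r ring"
  assumes pp: "pp_ring R" and F: "free_module R M n" and E: "module R (M\<lparr>carrier := E\<rparr>)" and EM: "E \<subseteq> carrier M"
    and s: "s \<in> carrier (sym_algebra R (M\<lparr>carrier := E\<rparr>))"
    and s0: "sym_map R (M\<lparr>carrier := E\<rparr>) R M (\<lambda>r. r) (\<lambda>x. x) s = \<zero>\<^bsub>sym_algebra R M\<^esub>"
  shows "s \<in> torsion R (sym_algebra R (M\<lparr>carrier := E\<rparr>))"
proof -
  let ?E = "M\<lparr>carrier := E\<rparr>"
  have M: "module R M" using F by (simp add: free_module_def)
  interpret M: symmetric_algebra R M by (rule symmetric_algebra.intro[OF M])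
  interpret E: symmetric_algebra R ?E by (rule symmetric_algebra.intro[OF E])
  interpret EP: polynomial_ring R E by unfold_locales
  have Ecar: "carrier ?E = E" by simp
  obtain f where f: "f \<in> carrier E.P" "s = E.I +>\<^bsub>E.P\<^esub> f" using E.cls_surj[OF s] by blast
  have f': "f \<in> carrier EP.Pol" using f(1) by simp
  let ?W = "{w. f w \<noteq> \<zero>\<^bsub>R\<^esub>}"
  have W: "finite ?W" using E.P.finite_supp[OF f(1)] .
  have WE: "w \<in> ?W \<Longrightarrow> set_mset w \<subseteq> E" for w using subsetD[OF E.P.supp_subset[OF f(1)], of w] by simp
  \<comment> \<open>Only the finitely many elements of \<open>E\<close> occurring as variables in
    the chosen representative have to be scaled by the retraction.\<close>
  let ?X = "\<Union>w\<in>?W. set_mset w"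
  have X: "finite ?X" "?X \<subseteq> E" using W WE by auto
  obtain u \<rho> where u: "u \<in> nonzerodivisors R" and \<rho>: "linear_map R M ?E \<rho>" and \<rho>X: "\<And>x. x \<in> ?X \<Longrightarrow> \<rho> x = u \<odot>\<^bsub>M\<^esub> x"
    using pp_ring_retraction[OF pp F E EM X] by blast
  have uc: "u \<in> carrier R" using u by (simp add: nonzerodivisors_def)
  have id: "(\<lambda>r. r) \<in> ring_hom R R" by (rule id_ring_hom) (rule M.R.ring_axioms)
  have inc: "linear_map R ?E M (\<lambda>x. x)" using EM by (auto simp: semilinear_map_def)
  have \<rho>E: "linear_map R ?E ?E \<rho>"
    unfolding semilinear_map_def
  proof (intro conjI ballI)
    show "\<rho> \<in> carrier ?E \<rightarrow> carrier ?E" using semilinear_mapD(1)[OF \<rho>] EM by auto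
    fix x assume x: "x \<in> carrier ?E"
    then have xM: "x \<in> carrier M" using EM by auto
    show "\<rho> (x \<oplus>\<^bsub>?E\<^esub> y) = \<rho> x \<oplus>\<^bsub>?E\<^esub> \<rho> y" if "y \<in> carrier ?E" for y
      using semilinear_mapD(2)[OF \<rho> xM subsetD[OF EM]] that by simp
    show "\<rho> (r \<odot>\<^bsub>?E\<^esub> x) = r \<odot>\<^bsub>?E\<^esub> \<rho> x" if "r \<in> carrier R" for r
      using semilinear_mapD(3)[OF \<rho> that xM] by simp
  qed
  let ?T = "sym_map R ?E R ?E (\<lambda>r. r) \<rho>"
  note T = sym_map[OF E.symmetric_algebra_axioms E.symmetric_algebra_axioms id \<rho>E]
  note Sr = sym_map[OF M.symmetric_algebra_axioms E.symmetric_algebra_axioms id \<rho>]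
  interpret T: ring_hom_ring E.S E.S ?T by unfold_locales (rule T)
  interpret Sr: ring_hom_ring M.S E.S "sym_map R M R ?E (\<lambda>r. r) \<rho>" by unfold_locales (rule Sr)
  have Ts: "?T s = \<zero>\<^bsub>E.S\<^esub>"
    using sym_map_comp[OF E.symmetric_algebra_axioms M.symmetric_algebra_axioms E.symmetric_algebra_axioms id id inc \<rho> \<rho>E id _ _ s]
      s0 Sr.hom_zero by simp
  have gE: "E.gen \<in> E \<rightarrow> carrier E.S" using E.gen_closed by auto
  have Tw: "?T (mset_prod E.S E.gen w) = E.cst (u [^]\<^bsub>R\<^esub> size w) \<otimes>\<^bsub>E.S\<^esub> mset_prod E.S E.gen w"
    if "set_mset w \<subseteq> ?X" for w
    using that
  proof (induction w)
    case empty
    then show ?case using E.cst.hom_one by simp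
  next
    case (add x w)
    have w: "set_mset w \<subseteq> E" "x \<in> E" using add.prems X(2) by auto
    have wc: "mset_prod E.S E.gen w \<in> carrier E.S" "E.gen x \<in> carrier E.S" "E.cst u \<in> carrier E.S" "E.cst (u [^]\<^bsub>R\<^esub> size w) \<in> carrier E.S"
      using E.mset_prod_gen_closed[of w] w E.gen_closed uc by auto
    have gx: "?T (E.gen x) = E.cst u \<otimes>\<^bsub>E.S\<^esub> E.gen x"
      using T(3)[of x] w \<rho>X[of x] add.prems E.gen_smult[OF uc, of x] by simp
    have "E.cst (u [^]\<^bsub>R\<^esub> size (add_mset x w)) = E.cst (u [^]\<^bsub>R\<^esub> size w) \<otimes>\<^bsub>E.S\<^esub> E.cst u" using uc by simp
    then show ?case using add wc w gx
      by (simp add: E.S.mset_prod_add_mset[OF gE] E.S.m_ac)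
  qed
  define v where "v w = u [^]\<^bsub>R\<^esub> size w \<otimes>\<^bsub>R\<^esub> f w" for w
  have fc: "f w \<in> carrier R" for w using E.P.coeff_closed[OF f(1)] .
  have vc: "v \<in> carrier E.P"
  proof (rule E.P.carrierI[OF _ W])
    show "v w \<in> carrier R" for w unfolding v_def using uc fc by simp
    show "?W \<subseteq> carrier (free_comm_monoid (carrier ?E))" by (rule E.P.supp_subset[OF f(1)])
    show "v w = \<zero>\<^bsub>R\<^esub>" if "w \<notin> ?W" for w using that uc unfolding v_def by simp
  qed
  have "?T (E.I +>\<^bsub>E.P\<^esub> f) = E.I +>\<^bsub>E.P\<^esub> v"
  proof -
    have mc: "(\<lambda>w. monomial R (f w) w) \<in> ?W \<rightarrow> carrier E.P" using fc WE by auto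
    have mv: "(\<lambda>w. monomial R (v w) w) \<in> ?W \<rightarrow> carrier E.P" using E.P.coeff_closed[OF vc] WE by auto
    have "E.I +>\<^bsub>E.P\<^esub> f = E.I +>\<^bsub>E.P\<^esub> (\<Oplus>\<^bsub>E.P\<^esub>w\<in>?W. monomial R (f w) w)"
      by (rule arg_cong[OF E.P.MA_expand[OF f(1) W order_refl E.P.supp_subset[OF f(1)]]])
    also have "\<dots> = (\<Oplus>\<^bsub>E.S\<^esub>w\<in>?W. E.I +>\<^bsub>E.P\<^esub> monomial R (f w) w)"
      unfolding E.cls.hom_finsum[OF mc] comp_def ..
    finally have "?T (E.I +>\<^bsub>E.P\<^esub> f) = ?T (\<Oplus>\<^bsub>E.S\<^esub>w\<in>?W. E.I +>\<^bsub>E.P\<^esub> monomial R (f w) w)" by (rule arg_cong)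
    also have "\<dots> = (\<Oplus>\<^bsub>E.S\<^esub>w\<in>?W. ?T (E.I +>\<^bsub>E.P\<^esub> monomial R (f w) w))"
    proof -
      have "(\<lambda>w. E.I +>\<^bsub>E.P\<^esub> monomial R (f w) w) \<in> ?W \<rightarrow> carrier E.S"
        by (rule Pi_I) (rule E.cls.hom_closed[OF funcset_mem[OF mc]])
      from T.hom_finsum[OF this] show ?thesis unfolding comp_def .
    qed
    also have "\<dots> = (\<Oplus>\<^bsub>E.S\<^esub>w\<in>?W. E.I +>\<^bsub>E.P\<^esub> monomial R (v w) w)"
    proof (rule E.S.finsum_cong')
      show "(\<lambda>w. E.I +>\<^bsub>E.P\<^esub> monomial R (v w) w) \<in> ?W \<rightarrow> carrier E.S"
        by (rule Pi_I) (rule E.cls.hom_closed[OF funcset_mem[OF mv]])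
      fix w assume w: "w \<in> ?W"
      have wX: "set_mset w \<subseteq> ?X" "set_mset w \<subseteq> carrier ?E" using w WE[OF w] by auto
      have mcl: "mset_prod E.S E.gen w \<in> carrier E.S" using E.mset_prod_gen_closed[OF wX(2)] .
      have "E.cst (v w) = E.cst (u [^]\<^bsub>R\<^esub> size w) \<otimes>\<^bsub>E.S\<^esub> E.cst (f w)" using fc uc by (simp add: v_def)
      then show "?T (E.I +>\<^bsub>E.P\<^esub> monomial R (f w) w) = E.I +>\<^bsub>E.P\<^esub> monomial R (v w) w"
        using E.cls_monomial[OF fc wX(2), of w] E.cls_monomial[OF E.P.coeff_closed[OF vc] wX(2), of w]
          Tw[OF wX(1)] T(2)[OF fc] mcl E.cst.hom_closed[OF fc] E.cst.hom_closed[of "u [^]\<^bsub>R\<^esub> size w"] uc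
        by (simp add: E.S.m_ac)
    qed simp
    also have "\<dots> = E.I +>\<^bsub>E.P\<^esub> v"
    proof -
      have "{g. v g \<noteq> \<zero>\<^bsub>R\<^esub>} \<subseteq> ?W" using uc by (auto simp: v_def)
      then have "v = (\<Oplus>\<^bsub>E.P\<^esub>w\<in>?W. monomial R (v w) w)"
        by (rule E.P.MA_expand[OF vc W _ E.P.supp_subset[OF f(1)]])
      then have "E.I +>\<^bsub>E.P\<^esub> v = E.I +>\<^bsub>E.P\<^esub> (\<Oplus>\<^bsub>E.P\<^esub>w\<in>?W. monomial R (v w) w)" by (rule arg_cong)
      also have "\<dots> = (\<Oplus>\<^bsub>E.S\<^esub>w\<in>?W. E.I +>\<^bsub>E.P\<^esub> monomial R (v w) w)"
        unfolding E.cls.hom_finsum[OF mv] comp_def ..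
      finally show ?thesis ..
    qed
    finally show ?thesis .
  qed
  then have vI: "v \<in> E.I" using Ts f E.cls_eq_zero_iff[OF vc] by simp
  define D where "D = Max (insert 0 (size ` ?W))"
  have D: "size w \<le> D" if "f w \<noteq> \<zero>\<^bsub>R\<^esub>" for w unfolding D_def using that W by (intro Max_ge) auto
  \<comment> \<open>The missing factor \<open>u [^] (D - d)\<close> raises the scaling in degree
    \<open>d\<close> to the common exponent \<open>D\<close>.\<close>
  have part: "EP.con (u [^]\<^bsub>R\<^esub> D) \<otimes>\<^bsub>E.P\<^esub> E.deg_part {d} f \<in> E.I" if d: "d \<le> D" for d
  proof -
    have "EP.con (u [^]\<^bsub>R\<^esub> (D - d)) \<otimes>\<^bsub>E.P\<^esub> E.deg_part {d} v \<in> E.I"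
      by (rule E.I.I_l_closed[OF E.deg_part_sym_ideal[OF vI]]) (use uc EP.con_closed in simp)
    moreover have "EP.con (u [^]\<^bsub>R\<^esub> (D - d)) \<otimes>\<^bsub>E.P\<^esub> E.deg_part {d} v = EP.con (u [^]\<^bsub>R\<^esub> D) \<otimes>\<^bsub>E.P\<^esub> E.deg_part {d} f"
    proof
      fix w
      have dv: "E.deg_part {d} v \<in> carrier EP.Pol" "E.deg_part {d} f \<in> carrier EP.Pol"
        using E.deg_part_closed[OF vc, of "{d}"] E.deg_part_closed[OF f(1), of "{d}"] by simp_all
      have "u [^]\<^bsub>R\<^esub> (D - d) \<otimes>\<^bsub>R\<^esub> (u [^]\<^bsub>R\<^esub> d \<otimes>\<^bsub>R\<^esub> f w) = u [^]\<^bsub>R\<^esub> D \<otimes>\<^bsub>R\<^esub> f w"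
        using uc fc d by (simp flip: M.R.m_assoc add: M.R.nat_pow_mult)
      then show "(EP.con (u [^]\<^bsub>R\<^esub> (D - d)) \<otimes>\<^bsub>E.P\<^esub> E.deg_part {d} v) w = (EP.con (u [^]\<^bsub>R\<^esub> D) \<otimes>\<^bsub>E.P\<^esub> E.deg_part {d} f) w"
        using EP.con_mult_apply[OF _ dv(1), of "u [^]\<^bsub>R\<^esub> (D - d)" w] EP.con_mult_apply[OF _ dv(2), of "u [^]\<^bsub>R\<^esub> D" w] uc
        by (auto simp: E.deg_part_def v_def)
    qed
    ultimately show ?thesis by simp
  qed
  have dpc: "E.deg_part {d} f \<in> carrier E.P" for d by (rule E.deg_part_closed[OF f(1)])
  have "f = (\<Oplus>\<^bsub>E.P\<^esub>d\<in>{..D}. E.deg_part {d} f)"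
  proof
    fix w
    have "(\<Oplus>\<^bsub>E.P\<^esub>d\<in>{..D}. E.deg_part {d} f) w = (\<Oplus>\<^bsub>R\<^esub>d\<in>{..D}. E.deg_part {d} f w)"
      by (rule E.P.finsum_apply) (use dpc in auto)
    also have "\<dots> = (\<Oplus>\<^bsub>R\<^esub>d\<in>{..D}. if size w = d then f w else \<zero>\<^bsub>R\<^esub>)"
      by (simp add: E.deg_part_def)
    also have "\<dots> = f w"
    proof (cases "size w \<le> D")
      case True
      show ?thesis by (rule M.R.finsum_singleton) (use True fc in auto)
    next
      case False
      then have "f w = \<zero>\<^bsub>R\<^esub>" using D by blast
      then have "(if size w = d then f w else \<zero>\<^bsub>R\<^esub>) = \<zero>\<^bsub>R\<^esub>" for d by simp
      then show ?thesis using \<open>f w = \<zero>\<^bsub>R\<^esub>\<close> by (simp only: M.R.finsum_zero)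
    qed
    finally show "f w = (\<Oplus>\<^bsub>E.P\<^esub>d\<in>{..D}. E.deg_part {d} f) w" by simp
  qed
  then have "EP.con (u [^]\<^bsub>R\<^esub> D) \<otimes>\<^bsub>E.P\<^esub> f = EP.con (u [^]\<^bsub>R\<^esub> D) \<otimes>\<^bsub>E.P\<^esub> (\<Oplus>\<^bsub>E.P\<^esub>d\<in>{..D}. E.deg_part {d} f)" by (rule arg_cong)
  also have "\<dots> = (\<Oplus>\<^bsub>E.P\<^esub>d\<in>{..D}. EP.con (u [^]\<^bsub>R\<^esub> D) \<otimes>\<^bsub>E.P\<^esub> E.deg_part {d} f)"
    by (rule E.P.MA.finsum_rdistr) (use uc dpc f EP.con_closed[of "u [^]\<^bsub>R\<^esub> D"] in auto)
  also have "\<dots> \<in> E.I" by (rule E.I.finsum_in_ideal) (use part in auto)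
  finally have "EP.con (u [^]\<^bsub>R\<^esub> D) \<otimes>\<^bsub>E.P\<^esub> f \<in> E.I" .
  moreover have cc: "EP.con (u [^]\<^bsub>R\<^esub> D) \<in> carrier E.P" using uc by simp
  ultimately have "E.I +>\<^bsub>E.P\<^esub> (EP.con (u [^]\<^bsub>R\<^esub> D) \<otimes>\<^bsub>E.P\<^esub> f) = \<zero>\<^bsub>E.S\<^esub>"
    using E.cls_eq_zero_iff[OF E.P.MA.m_closed[OF cc f(1)]] by blast
  then have "(E.I +>\<^bsub>E.P\<^esub> EP.con (u [^]\<^bsub>R\<^esub> D)) \<otimes>\<^bsub>E.S\<^esub> (E.I +>\<^bsub>E.P\<^esub> f) = \<zero>\<^bsub>E.S\<^esub>"
    unfolding E.cls.hom_mult[OF cc f(1)] .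
  then have "u [^]\<^bsub>R\<^esub> D \<odot>\<^bsub>E.S\<^esub> s = \<zero>\<^bsub>E.S\<^esub>" using f(2) by (simp add: E.S_smult sym_const_def)
  then show ?thesis using s nonzerodivisor_pow[OF M.R.cring_axioms u, of D] unfolding torsion_def by blast
qed

text \<open>Coordinates embed the symmetric algebra into a polynomial ring by \<open>\<Psi>\<close>,
  with left inverse \<open>\<Phi>\<close>; there a nonzerodivisor of \<open>R\<close> acts
  coefficientwise, hence injectively.\<close>

lemma torsion_free_module:
  fixes R :: "'r ring"
  assumes F: "free_module R M n" and b: "b \<in> nonzerodivisors R" and s: "s \<in> carrier (sym_algebra R M)"
    and bs: "sym_const R M b \<otimes>\<^bsub>sym_algebra R M\<^esub> s = \<zero>\<^bsub>sym_algebra R M\<^esub>"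
  shows "s = \<zero>\<^bsub>sym_algebra R M\<^esub>"
proof -
  obtain e c where M: "module R M" and e: "\<And>i. i < n \<Longrightarrow> e i \<in> carrier M" and c: "\<And>i. i < n \<Longrightarrow> functional R M (c i)"
    and xc: "\<And>x. x \<in> carrier M \<Longrightarrow> x = (\<Oplus>\<^bsub>M\<^esub>i\<in>{..<n}. c i x \<odot>\<^bsub>M\<^esub> e i)"
    using free_module_coordinates[OF F] by blast
  interpret M: symmetric_algebra R M by (rule symmetric_algebra.intro[OF M])
  interpret Q: polynomial_ring R "{..<n}" by unfold_locales
  note c' = functionalD[OF c]
  let ?g = "\<lambda>x. \<Oplus>\<^bsub>Q.Pol\<^esub>i\<in>{..<n}. Q.con (c i x) \<otimes>\<^bsub>Q.Pol\<^esub> Q.var i"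
  have tc: "(\<lambda>i. Q.con (c i x) \<otimes>\<^bsub>Q.Pol\<^esub> Q.var i) \<in> {..<n} \<rightarrow> carrier Q.Pol" if "x \<in> carrier M" for x
    using that c'(1) by auto
  have g: "?g \<in> carrier M \<rightarrow> carrier Q.Pol" using tc by (auto intro!: Q.P.MA.finsum_closed)
  have g_add: "?g (x \<oplus>\<^bsub>M\<^esub> y) = ?g x \<oplus>\<^bsub>Q.Pol\<^esub> ?g y" if xy: "x \<in> carrier M" "y \<in> carrier M" for x y
  proof -
    have "?g x \<oplus>\<^bsub>Q.Pol\<^esub> ?g y = (\<Oplus>\<^bsub>Q.Pol\<^esub>i\<in>{..<n}. Q.con (c i x) \<otimes>\<^bsub>Q.Pol\<^esub> Q.var i \<oplus>\<^bsub>Q.Pol\<^esub> Q.con (c i y) \<otimes>\<^bsub>Q.Pol\<^esub> Q.var i)"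
      by (rule Q.P.MA.finsum_addf[symmetric]) (use tc xy in auto)
    also have "\<dots> = ?g (x \<oplus>\<^bsub>M\<^esub> y)"
      by (rule Q.P.MA.finsum_cong') (use xy c' in \<open>auto simp: Q.P.monomial_add Q.P.MA.l_distr\<close>)
    finally show ?thesis by simp
  qed
  have g_smult: "?g (r \<odot>\<^bsub>M\<^esub> x) = Q.con r \<otimes>\<^bsub>Q.Pol\<^esub> ?g x" if rx: "r \<in> carrier R" "x \<in> carrier M" for r x
  proof -
    have rc: "Q.con r \<in> carrier Q.Pol" using rx by simp
    have "Q.con r \<otimes>\<^bsub>Q.Pol\<^esub> ?g x = (\<Oplus>\<^bsub>Q.Pol\<^esub>i\<in>{..<n}. Q.con r \<otimes>\<^bsub>Q.Pol\<^esub> (Q.con (c i x) \<otimes>\<^bsub>Q.Pol\<^esub> Q.var i))"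
      by (rule Q.P.MA.finsum_rdistr) (use tc rx rc in auto)
    also have "\<dots> = ?g (r \<odot>\<^bsub>M\<^esub> x)"
      by (rule Q.P.MA.finsum_cong') (use rx c' in \<open>auto simp: Q.P.monomial_mult\<close>)
    finally show ?thesis by simp
  qed
  obtain \<Psi> where \<Psi>: "\<Psi> \<in> ring_hom M.S Q.Pol" "\<And>r. r \<in> carrier R \<Longrightarrow> \<Psi> (M.cst r) = Q.con r"
    "\<And>x. x \<in> carrier M \<Longrightarrow> \<Psi> (M.gen x) = ?g x"
    using M.sym_lift[OF Q.P.cring_MA Q.con_hom g g_add g_smult] by blast
  have ge: "(\<lambda>i. M.gen (e i)) \<in> {..<n} \<rightarrow> carrier M.S" using e by auto
  let ?\<Phi> = "monoid_algebra_eval R M.S M.cst (mset_prod M.S (\<lambda>i. M.gen (e i)))"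
  note \<Phi> = Q.poly_eval_hom[OF M.cring_S M.cst_hom ge] Q.poly_eval_con[OF M.cring_S M.cst_hom ge] Q.poly_eval_var[OF M.cring_S M.cst_hom ge]
  interpret \<Psi>: ring_hom_ring M.S Q.Pol \<Psi> by unfold_locales (rule \<Psi>)
  interpret \<Phi>: ring_hom_ring Q.Pol M.S ?\<Phi> by unfold_locales (rule \<Phi>)
  have gen_sum: "M.gen (\<Oplus>\<^bsub>M\<^esub>i\<in>S. F i) = (\<Oplus>\<^bsub>M.S\<^esub>i\<in>S. M.gen (F i))" if "finite S" "F \<in> S \<rightarrow> carrier M" for S :: "nat set" and F
    using that
  proof (induction S rule: finite_induct)
    case (insert i S)
    have "M.gen (F i \<oplus>\<^bsub>M\<^esub> (\<Oplus>\<^bsub>M\<^esub>i\<in>S. F i)) = M.gen (F i) \<oplus>\<^bsub>M.S\<^esub> M.gen (\<Oplus>\<^bsub>M\<^esub>i\<in>S. F i)"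
      using insert.prems by (intro M.gen_add) auto
    moreover have "(\<lambda>i. M.gen (F i)) \<in> S \<rightarrow> carrier M.S" "M.gen (F i) \<in> carrier M.S"
      using insert.prems M.gen_closed by (simp_all add: Pi_iff)
    ultimately show ?case using insert by simp
  qed (simp add: M.gen_zero)
  have "(?\<Phi> \<circ> \<Psi>) s = (\<lambda>s. s) s"
  proof (rule M.sym_hom_eqI[OF M.S.ring_axioms ring_hom_trans[OF \<Psi>(1) \<Phi>(1)] id_ring_hom[OF M.S.ring_axioms] _ _ s])
    show "(?\<Phi> \<circ> \<Psi>) (M.cst r) = M.cst r" if "r \<in> carrier R" for r using that \<Psi> \<Phi> by simp
    show "(?\<Phi> \<circ> \<Psi>) (M.gen x) = M.gen x" if x: "x \<in> carrier M" for x
    proof -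
      have cx: "i < n \<Longrightarrow> c i x \<in> carrier R" for i using c'(1) x by blast
      have "(?\<Phi> \<circ> \<Psi>) (M.gen x) = ?\<Phi> (?g x)" using \<Psi>(3) x by simp
      also have "\<dots> = (\<Oplus>\<^bsub>M.S\<^esub>i\<in>{..<n}. ?\<Phi> (Q.con (c i x) \<otimes>\<^bsub>Q.Pol\<^esub> Q.var i))"
        by (subst \<Phi>.hom_finsum[OF tc[OF x]]) (simp add: comp_def)
      also have "\<dots> = (\<Oplus>\<^bsub>M.S\<^esub>i\<in>{..<n}. M.gen (c i x \<odot>\<^bsub>M\<^esub> e i))"
        by (rule M.S.finsum_cong') (use cx e in \<open>auto simp: \<Phi>(2,3) M.gen_smult\<close>)
      also have "\<dots> = M.gen (\<Oplus>\<^bsub>M\<^esub>i\<in>{..<n}. c i x \<odot>\<^bsub>M\<^esub> e i)"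
        by (rule gen_sum[symmetric]) (use cx e in auto)
      also have "\<dots> = M.gen x" by (rule arg_cong[OF xc[OF x, symmetric]])
      finally show ?thesis .
    qed
  qed
  then have \<Phi>\<Psi>: "?\<Phi> (\<Psi> s) = s" by simp
  have bc: "b \<in> carrier R" using b by (simp add: nonzerodivisors_def)
  have D: "z = \<zero>\<^bsub>R\<^esub>" if "z \<in> carrier R" "b \<otimes>\<^bsub>R\<^esub> z = \<zero>\<^bsub>R\<^esub>" for z
    using b that unfolding nonzerodivisors_def by blast
  have \<Psi>s: "\<Psi> s \<in> carrier Q.Pol" by (rule \<Psi>.hom_closed[OF s])
  have "\<Psi> (M.cst b \<otimes>\<^bsub>M.S\<^esub> s) = Q.con b \<otimes>\<^bsub>Q.Pol\<^esub> \<Psi> s"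
    using \<Psi>.hom_mult[OF M.cst.hom_closed[OF bc] s] \<Psi>(2)[OF bc] by simp
  then have 0: "Q.con b \<otimes>\<^bsub>Q.Pol\<^esub> \<Psi> s = \<zero>\<^bsub>Q.Pol\<^esub>" using bs by simp
  have "\<Psi> s w = \<zero>\<^bsub>R\<^esub>" for w
  proof (rule D)
    show "\<Psi> s w \<in> carrier R" using \<Psi>s by simp
    show "b \<otimes>\<^bsub>R\<^esub> \<Psi> s w = \<zero>\<^bsub>R\<^esub>" using Q.con_mult_apply[OF bc \<Psi>s, of w] 0 by (simp add: Q.P.MA_simps)
  qed
  then have "\<Psi> s = \<zero>\<^bsub>Q.Pol\<^esub>" by (auto simp: Q.P.MA_simps)
  then show ?thesis using \<Phi>\<Psi> \<Phi>.hom_zero by simp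
qed

section \<open>Smooth algebras\<close>

lemma (in ring) ideal_power_one: "ideal I R \<Longrightarrow> I \<subseteq> ideal_power R I (Suc 0)"
proof
  fix i assume I: "ideal I R" and i: "i \<in> I"
  have "i \<otimes> \<one> \<in> I \<cdot> carrier R" using i by (intro ideal_prod.prod) auto
  then show "i \<in> ideal_power R I (Suc 0)" using ideal.Icarr[OF I i] by simp
qed

lemma (in ring) ideal_power_subset: "ideal I R \<Longrightarrow> ideal_power R I (Suc m) \<subseteq> I"
  using ideal_prod_inter[of I "ideal_power R I m"] ideal_power_ideal by auto

lemma (in ring) ideal_power_antimono:
  assumes "ideal I R" "m \<le> m'" shows "ideal_power R I m' \<subseteq> ideal_power R I m"
  using assms(2)
proof (induction rule: dec_induct)
  case (step l)
  then show ?case using ideal_power_antimono_Suc[OF assms(1), of l] by blast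
qed simp

section \<open>Sections modulo powers of the kernel\<close>

text \<open>Smoothness tests only algebras whose carriers lie in the type of the given ring, whereas
  a quotient ring consists of cosets. A choice of representatives moves the quotient back into that
  type.\<close>

lemma quotient_copy:
  fixes P :: "'u ring"
  assumes P: "cring P" and Q: "ideal Q P"
  obtains C :: "'u ring" and q where "cring C" "q \<in> ring_hom P C" "q ` carrier P = carrier C"
    "\<And>x y. x \<in> carrier P \<Longrightarrow> y \<in> carrier P \<Longrightarrow> q x = q y \<longleftrightarrow> x \<ominus>\<^bsub>P\<^esub> y \<in> Q"
proof -
  interpret P: cring P by fact
  interpret Q: ideal Q P by fact
  interpret K: cring "P Quot Q" by (rule Q.quotient_is_cring[OF P])
  define rep where "rep X = (SOME x. x \<in> carrier P \<and> X = Q +>\<^bsub>P\<^esub> x)" for X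
  have rep: "X = Q +>\<^bsub>P\<^esub> rep X" if "X \<in> carrier (P Quot Q)" for X
  proof -
    have "\<exists>x. x \<in> carrier P \<and> X = Q +>\<^bsub>P\<^esub> x" using Q.quot_surj[OF that] by blast
    from someI_ex[OF this] show ?thesis by (simp add: rep_def)
  qed
  have inj: "inj_on rep (carrier (P Quot Q))" by (rule inj_onI) (metis rep)
  let ?C = "image_ring rep (P Quot Q)"
  have iso: "rep \<in> ring_iso (P Quot Q) ?C" by (rule inj_imp_image_ring_iso[OF inj])
  have "cring ?C" using K.ring_iso_imp_img_cring[OF iso] by (simp add: image_ring_def image_group_def monoid.defs)
  moreover have "rep \<circ> (+>\<^bsub>P\<^esub>) Q \<in> ring_hom P ?C"
    by (rule ring_hom_trans[OF Q.rcos_ring_hom]) (use iso in \<open>simp add: ring_iso_def\<close>)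
  moreover have "(rep \<circ> (+>\<^bsub>P\<^esub>) Q) ` carrier P = carrier ?C"
  proof -
    have "(+>\<^bsub>P\<^esub>) Q ` carrier P = carrier (P Quot Q)" using Q.quot_surj ring_hom_closed[OF Q.rcos_ring_hom] by blast
    then show ?thesis unfolding image_comp[symmetric] by (simp add: image_ring_carrier)
  qed
  moreover have "(rep \<circ> (+>\<^bsub>P\<^esub>) Q) x = (rep \<circ> (+>\<^bsub>P\<^esub>) Q) y \<longleftrightarrow> x \<ominus>\<^bsub>P\<^esub> y \<in> Q"
    if "x \<in> carrier P" "y \<in> carrier P" for x y
  proof -
    have "Q +>\<^bsub>P\<^esub> x \<in> carrier (P Quot Q)" "Q +>\<^bsub>P\<^esub> y \<in> carrier (P Quot Q)"
      using that ring_hom_closed[OF Q.rcos_ring_hom] by blast+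
    then have "rep (Q +>\<^bsub>P\<^esub> x) = rep (Q +>\<^bsub>P\<^esub> y) \<longleftrightarrow> Q +>\<^bsub>P\<^esub> x = Q +>\<^bsub>P\<^esub> y" using inj by (simp add: inj_on_eq_iff)
    then show ?thesis using Q.quot_eq_iff[OF that] by simp
  qed
  ultimately show ?thesis using that by blast
qed

text \<open>A set-theoretic section of \<open>\<phi>\<close> that becomes an algebra homomorphism
  modulo \<open>Q\<close>. Values in \<open>P\<close> itself are kept because they are used as
  coefficients and in Taylor expansions.\<close>

definition section_mod ::
    "'k ring \<Rightarrow> 'u ring \<Rightarrow> ('k \<Rightarrow> 'u) \<Rightarrow> 'p ring \<Rightarrow> ('k \<Rightarrow> 'p) \<Rightarrow> ('p \<Rightarrow> 'u) \<Rightarrow> 'p set \<Rightarrow> ('u \<Rightarrow> 'p) \<Rightarrow> bool"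
  where "section_mod k U \<iota> P \<rho> \<phi> Q s \<longleftrightarrow>
    (\<forall>r\<in>carrier U. s r \<in> carrier P \<and> \<phi> (s r) = r) \<and>
    (\<forall>r\<in>carrier U. \<forall>t\<in>carrier U. s (r \<oplus>\<^bsub>U\<^esub> t) \<ominus>\<^bsub>P\<^esub> (s r \<oplus>\<^bsub>P\<^esub> s t) \<in> Q) \<and>
    (\<forall>r\<in>carrier U. \<forall>t\<in>carrier U. s (r \<otimes>\<^bsub>U\<^esub> t) \<ominus>\<^bsub>P\<^esub> s r \<otimes>\<^bsub>P\<^esub> s t \<in> Q) \<and>
    s \<one>\<^bsub>U\<^esub> \<ominus>\<^bsub>P\<^esub> \<one>\<^bsub>P\<^esub> \<in> Q \<and> (\<forall>a\<in>carrier k. s (\<iota> a) \<ominus>\<^bsub>P\<^esub> \<rho> a \<in> Q)"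

text \<open>Infinitesimal lifting along \<open>P / I^(m+2) \<rightarrow> P / I^(m+1)\<close>: the
  given \<open>s\<close> is a homomorphism into the smaller quotient, its lift goes into the larger
  one, and representatives of the lifted values form the new section.\<close>

lemma smooth_section_Suc:
  fixes U P :: "'u ring"
  assumes k: "ring k" and smooth: "smooth_algebra k U \<iota>" and P: "comm_algebra k P \<rho>" and \<phi>: "\<phi> \<in> algebra_hom k P \<rho> U \<iota>"
    and s: "section_mod k U \<iota> P \<rho> \<phi> (ideal_power P (a_kernel P U \<phi>) (Suc m)) s"
  shows "\<exists>s. section_mod k U \<iota> P \<rho> \<phi> (ideal_power P (a_kernel P U \<phi>) (Suc (Suc m))) s"
proof -
  have U: "cring U" "\<iota> \<in> ring_hom k U" using smooth by (auto simp: smooth_algebra_def finite_type_algebra_def comm_algebra_def)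
  have Pc: "cring P" "\<rho> \<in> ring_hom k P" using P by (auto simp: comm_algebra_def)
  have \<phi>h: "\<phi> \<in> ring_hom P U" "\<And>a. a \<in> carrier k \<Longrightarrow> \<phi> (\<rho> a) = \<iota> a" using \<phi> by (auto simp: algebra_hom_def)
  interpret k: ring k by fact
  interpret U: cring U by fact
  interpret P: cring P by fact
  interpret \<phi>: ring_hom_ring P U \<phi> by unfold_locales (rule \<phi>h)
  let ?I = "a_kernel P U \<phi>"
  let ?Q = "ideal_power P ?I (Suc (Suc m))" and ?M = "ideal_power P ?I (Suc m)"
  have I: "ideal ?I P" by (rule \<phi>.kernel_is_ideal)
  interpret Q: ideal ?Q P by (rule P.ideal_power_ideal[OF I])
  interpret M: ideal ?M P by (rule P.ideal_power_ideal[OF I])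
  have QM: "?Q \<subseteq> ?M" by (rule P.ideal_power_antimono_Suc[OF I])
  have MI: "?M \<subseteq> ?I" by (rule P.ideal_power_subset[OF I])
  \<comment> \<open>The kernel of the test extension has square zero because \<open>I^(m+1)\<close>
    is contained in \<open>I\<close>, so that
    \<open>I^(m+1) I^(m+1) \<subseteq> I I^(m+1) = I^(m+2)\<close>.\<close>
  have MM: "a \<otimes>\<^bsub>P\<^esub> b \<in> ?Q" if "a \<in> ?M" "b \<in> ?M" for a b
    unfolding ideal_power.simps(2)[of P ?I "Suc m"] using that MI by (intro ideal_prod.prod) auto
  obtain C :: "'u ring" and q where C: "cring C" and q: "q \<in> ring_hom P C" and qs: "q ` carrier P = carrier C"
    and qeq: "\<And>x y. x \<in> carrier P \<Longrightarrow> y \<in> carrier P \<Longrightarrow> q x = q y \<longleftrightarrow> x \<ominus>\<^bsub>P\<^esub> y \<in> ?Q"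
    by (rule quotient_copy[OF Pc(1) Q.ideal_axioms]) (rule that, assumption+)
  interpret C: cring C by fact
  interpret q: ring_hom_ring P C q by unfold_locales (rule q)
  let ?N = "q ` ?M"
  have "C.subideal (carrier C) ?N"
    unfolding C.subideal_def
  proof (intro conjI ballI)
    show "?N \<subseteq> carrier C" by auto
    show "\<zero>\<^bsub>C\<^esub> \<in> ?N" using M.zero_closed q.hom_zero by force
    fix a assume "a \<in> ?N"
    then obtain x where x: "x \<in> ?M" "a = q x" by blast
    show "a \<oplus>\<^bsub>C\<^esub> b \<in> ?N" if "b \<in> ?N" for b
    proof -
      from that obtain y where y: "y \<in> ?M" "b = q y" by blast
      have "a \<oplus>\<^bsub>C\<^esub> b = q (x \<oplus>\<^bsub>P\<^esub> y)" using x y by (simp del: ideal_power.simps)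
      then show ?thesis using M.a_closed[OF x(1) y(1)] by blast
    qed
    show "r \<otimes>\<^bsub>C\<^esub> a \<in> ?N" if "r \<in> carrier C" for r
    proof -
      from that obtain y where y: "y \<in> carrier P" "r = q y" using qs by blast
      have "r \<otimes>\<^bsub>C\<^esub> a = q (y \<otimes>\<^bsub>P\<^esub> x)" using x y by (simp del: ideal_power.simps)
      then show ?thesis using M.I_l_closed[OF x(1) y(1)] by blast
    qed
  qed
  then have N: "ideal ?N C" by (simp only: C.subideal_carrier_iff)
  interpret N: ideal ?N C by (rule N)
  have sq: "x \<otimes>\<^bsub>C\<^esub> y = \<zero>\<^bsub>C\<^esub>" if "x \<in> ?N" "y \<in> ?N" for x y
  proof -
    from that obtain a b where ab: "a \<in> ?M" "x = q a" "b \<in> ?M" "y = q b" by blast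
    have c: "a \<in> carrier P" "b \<in> carrier P" using ab M.Icarr by blast+
    have "a \<otimes>\<^bsub>P\<^esub> b \<ominus>\<^bsub>P\<^esub> \<zero>\<^bsub>P\<^esub> \<in> ?Q" using MM[OF ab(1,3)] c by (simp add: a_minus_def del: ideal_power.simps)
    then have "q (a \<otimes>\<^bsub>P\<^esub> b) = q \<zero>\<^bsub>P\<^esub>" using qeq[of "a \<otimes>\<^bsub>P\<^esub> b" "\<zero>\<^bsub>P\<^esub>"] c by (simp del: ideal_power.simps)
    then show ?thesis using ab c by (simp del: ideal_power.simps)
  qed
  have sc: "r \<in> carrier U \<Longrightarrow> s r \<in> carrier P" "r \<in> carrier U \<Longrightarrow> \<phi> (s r) = r" for r using s by (auto simp: section_mod_def)
  have eqN: "?N +>\<^bsub>C\<^esub> q x = ?N +>\<^bsub>C\<^esub> q y" if "x \<in> carrier P" "y \<in> carrier P" "x \<ominus>\<^bsub>P\<^esub> y \<in> ?M" for x y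
  proof -
    have "q x \<ominus>\<^bsub>C\<^esub> q y = q (x \<ominus>\<^bsub>P\<^esub> y)" using that by (simp add: a_minus_def)
    then have "q x \<ominus>\<^bsub>C\<^esub> q y \<in> ?N" using that(3) by blast
    then show ?thesis using N.quot_eq_iff[of "q x" "q y"] that by (simp del: ideal_power.simps)
  qed
  interpret cN: ring_hom_ring C "C Quot ?N" "(+>\<^bsub>C\<^esub>) ?N" by (rule N.rcos_ring_hom_ring)
  let ?g = "\<lambda>r. ?N +>\<^bsub>C\<^esub> q (s r)" and ?\<gamma> = "\<lambda>a. q (\<rho> a)"
  have g: "?g \<in> algebra_hom k U \<iota> (C Quot ?N) (\<lambda>a. ?N +>\<^bsub>C\<^esub> ?\<gamma> a)"
    unfolding algebra_hom_def
  proof (intro CollectI conjI ballI)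
    show "?g \<in> ring_hom U (C Quot ?N)"
    proof (rule ring_hom_memI)
      fix r assume r: "r \<in> carrier U"
      show "?g r \<in> carrier (C Quot ?N)" using sc[OF r] by (intro cN.hom_closed q.hom_closed)
      fix t assume t: "t \<in> carrier U"
      have qc: "q (s r) \<in> carrier C" "q (s t) \<in> carrier C" using sc r t by auto
      have "?g (r \<otimes>\<^bsub>U\<^esub> t) = ?N +>\<^bsub>C\<^esub> q (s r \<otimes>\<^bsub>P\<^esub> s t)"
        by (rule eqN) (use s sc r t in \<open>auto simp: section_mod_def simp del: ideal_power.simps\<close>)
      then show "?g (r \<otimes>\<^bsub>U\<^esub> t) = ?g r \<otimes>\<^bsub>C Quot ?N\<^esub> ?g t"
        using cN.hom_mult[OF qc] sc r t by (simp del: ideal_power.simps)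
      have "?g (r \<oplus>\<^bsub>U\<^esub> t) = ?N +>\<^bsub>C\<^esub> q (s r \<oplus>\<^bsub>P\<^esub> s t)"
        by (rule eqN) (use s sc r t in \<open>auto simp: section_mod_def simp del: ideal_power.simps\<close>)
      then show "?g (r \<oplus>\<^bsub>U\<^esub> t) = ?g r \<oplus>\<^bsub>C Quot ?N\<^esub> ?g t"
        using cN.hom_add[OF qc] sc r t by (simp del: ideal_power.simps)
    next
      have "?g \<one>\<^bsub>U\<^esub> = ?N +>\<^bsub>C\<^esub> q \<one>\<^bsub>P\<^esub>"
        by (rule eqN) (use s sc in \<open>auto simp: section_mod_def simp del: ideal_power.simps\<close>)
      then show "?g \<one>\<^bsub>U\<^esub> = \<one>\<^bsub>C Quot ?N\<^esub>" using cN.hom_one by (simp del: ideal_power.simps)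
    qed
    fix a assume a: "a \<in> carrier k"
    show "?g (\<iota> a) = ?N +>\<^bsub>C\<^esub> ?\<gamma> a"
      by (rule eqN) (use s sc a ring_hom_closed[OF U(2) a] ring_hom_closed[OF Pc(2) a] in \<open>auto simp: section_mod_def simp del: ideal_power.simps\<close>)
  qed
  have comm: "comm_algebra k C ?\<gamma>"
    using C ring_hom_trans[OF Pc(2) q] by (simp add: comm_algebra_def comp_def)
  have sqb: "\<forall>x\<in>?N. \<forall>y\<in>?N. x \<otimes>\<^bsub>C\<^esub> y = \<zero>\<^bsub>C\<^esub>" using sq by blast
  note lift = mp[OF spec[OF spec[OF spec[OF conjunct2[OF smooth[unfolded smooth_algebra_def]], of C], of ?\<gamma>], of ?N]]
  from bspec[OF lift[OF conjI[OF comm conjI[OF N sqb]]] g]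
  obtain h where h: "h \<in> algebra_hom k U \<iota> C ?\<gamma>" and h': "\<forall>r\<in>carrier U. ?N +>\<^bsub>C\<^esub> h r = ?g r"
    by (elim bexE) (rule that)
  have hh: "h \<in> ring_hom U C" "\<And>a. a \<in> carrier k \<Longrightarrow> h (\<iota> a) = ?\<gamma> a" using h by (auto simp: algebra_hom_def)
  have hc: "r \<in> carrier U \<Longrightarrow> h r \<in> carrier C" for r using ring_hom_closed[OF hh(1)] .
  define s' where "s' r = inv_into (carrier P) q (h r)" for r
  have s': "s' r \<in> carrier P" "q (s' r) = h r" if "r \<in> carrier U" for r
    using hc[OF that] inv_into_into[of "h r" q "carrier P"] f_inv_into_f[of "h r" q "carrier P"] qs by (simp_all add: s'_def)
  have "section_mod k U \<iota> P \<rho> \<phi> ?Q s'"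
    unfolding section_mod_def
  proof (intro conjI ballI)
    show "s' r \<in> carrier P" if "r \<in> carrier U" for r using s' that by blast
    \<comment> \<open>Modulo \<open>I^(m+2)\<close> the old and the new section differ by an element
      of \<open>I^(m+1)\<close>; both powers are contained in the kernel of
      \<open>\<phi>\<close>.\<close>
    show "\<phi> (s' r) = r" if r: "r \<in> carrier U" for r
    proof -
      have "?N +>\<^bsub>C\<^esub> q (s' r) = ?N +>\<^bsub>C\<^esub> q (s r)" using bspec[OF h' r] s'(2)[OF r] by simp
      then have "q (s' r) \<ominus>\<^bsub>C\<^esub> q (s r) \<in> ?N" using N.quot_eq_iff[of "q (s' r)" "q (s r)"] s'(1)[OF r] sc(1)[OF r] by (simp del: ideal_power.simps)
      then obtain y where y: "y \<in> ?M" "q (s' r) \<ominus>\<^bsub>C\<^esub> q (s r) = q y" by blast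
      have yc: "y \<in> carrier P" using y(1) by (rule M.Icarr)
      have "q (s' r \<ominus>\<^bsub>P\<^esub> s r) = q y" using y(2) s'(1)[OF r] sc(1)[OF r] by (simp add: a_minus_def)
      then have "(s' r \<ominus>\<^bsub>P\<^esub> s r) \<ominus>\<^bsub>P\<^esub> y \<in> ?Q" using qeq[of "s' r \<ominus>\<^bsub>P\<^esub> s r" y] s'(1)[OF r] sc(1)[OF r] yc by (simp del: ideal_power.simps)
      then have "(s' r \<ominus>\<^bsub>P\<^esub> s r) \<ominus>\<^bsub>P\<^esub> y \<in> ?I" by (rule subsetD[OF MI subsetD[OF QM]])
      from conjunct2[OF this[unfolded mem_a_kernel]] conjunct2[OF subsetD[OF MI y(1), unfolded mem_a_kernel]]
      have "\<phi> (s' r) \<ominus>\<^bsub>U\<^esub> \<phi> (s r) = \<zero>\<^bsub>U\<^esub>" using s'(1)[OF r] sc(1)[OF r] yc by (simp add: a_minus_def)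
      then show ?thesis using sc[OF r] s'(1)[OF r] r by simp
    qed
    fix r assume r: "r \<in> carrier U"
    fix t assume t: "t \<in> carrier U"
    note c = s'(1)[OF r] s'(1)[OF t]
    have "q (s' (r \<oplus>\<^bsub>U\<^esub> t)) = q (s' r \<oplus>\<^bsub>P\<^esub> s' t)" using s' r t ring_hom_add[OF hh(1) r t] by simp
    then show "s' (r \<oplus>\<^bsub>U\<^esub> t) \<ominus>\<^bsub>P\<^esub> (s' r \<oplus>\<^bsub>P\<^esub> s' t) \<in> ?Q"
      using qeq[OF s'(1)[OF U.a_closed[OF r t]] P.a_closed[OF c]] by blast
    have "q (s' (r \<otimes>\<^bsub>U\<^esub> t)) = q (s' r \<otimes>\<^bsub>P\<^esub> s' t)" using s' r t ring_hom_mult[OF hh(1) r t] by simp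
    then show "s' (r \<otimes>\<^bsub>U\<^esub> t) \<ominus>\<^bsub>P\<^esub> s' r \<otimes>\<^bsub>P\<^esub> s' t \<in> ?Q"
      using qeq[OF s'(1)[OF U.m_closed[OF r t]] P.m_closed[OF c]] by blast
  next
    have "q (s' \<one>\<^bsub>U\<^esub>) = q \<one>\<^bsub>P\<^esub>" using s' ring_hom_one[OF hh(1)] by simp
    then show "s' \<one>\<^bsub>U\<^esub> \<ominus>\<^bsub>P\<^esub> \<one>\<^bsub>P\<^esub> \<in> ?Q" using qeq[OF s'(1)[OF U.one_closed] P.one_closed] by blast
    fix a assume a: "a \<in> carrier k"
    have "q (s' (\<iota> a)) = q (\<rho> a)" using s' hh(2)[OF a] ring_hom_closed[OF U(2) a] by simp
    then show "s' (\<iota> a) \<ominus>\<^bsub>P\<^esub> \<rho> a \<in> ?Q"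
      using qeq[OF s'(1)[OF ring_hom_closed[OF U(2) a]] ring_hom_closed[OF Pc(2) a]] by blast
  qed
  then show ?thesis by blast
qed

lemma smooth_section:
  fixes U P :: "'u ring"
  assumes k: "ring k" and smooth: "smooth_algebra k U \<iota>" and P: "comm_algebra k P \<rho>" and \<phi>: "\<phi> \<in> algebra_hom k P \<rho> U \<iota>"
    and surj: "\<phi> ` carrier P = carrier U"
  shows "\<exists>s. section_mod k U \<iota> P \<rho> \<phi> (ideal_power P (a_kernel P U \<phi>) (Suc m)) s"
proof (induction m)
  case 0
  have U: "cring U" "\<iota> \<in> ring_hom k U" using smooth by (auto simp: smooth_algebra_def finite_type_algebra_def comm_algebra_def)
  have Pc: "cring P" "\<rho> \<in> ring_hom k P" using P by (auto simp: comm_algebra_def)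
  have \<phi>h: "\<phi> \<in> ring_hom P U" "\<And>a. a \<in> carrier k \<Longrightarrow> \<phi> (\<rho> a) = \<iota> a" using \<phi> by (auto simp: algebra_hom_def)
  interpret U: cring U by fact
  interpret P: cring P by fact
  interpret \<phi>: ring_hom_ring P U \<phi> by unfold_locales (rule \<phi>h)
  \<comment> \<open>Modulo the first power of the kernel any set-theoretic section is a
    homomorphism.\<close>
  define s where "s = inv_into (carrier P) \<phi>"
  have s: "s r \<in> carrier P" "\<phi> (s r) = r" if "r \<in> carrier U" for r
    using that inv_into_into[of r \<phi> "carrier P"] f_inv_into_f[of r \<phi> "carrier P"] surj by (simp_all add: s_def)
  have in_pow: "x \<ominus>\<^bsub>P\<^esub> y \<in> ideal_power P (a_kernel P U \<phi>) (Suc 0)" if "x \<in> carrier P" "y \<in> carrier P" "\<phi> x = \<phi> y" for x y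
  proof -
    have "\<phi> (x \<ominus>\<^bsub>P\<^esub> y) = \<zero>\<^bsub>U\<^esub>" using that by (simp add: a_minus_def U.r_neg)
    then have "x \<ominus>\<^bsub>P\<^esub> y \<in> a_kernel P U \<phi>" unfolding mem_a_kernel by (intro conjI P.minus_closed that)
    then show ?thesis by (rule subsetD[OF P.ideal_power_one[OF \<phi>.kernel_is_ideal]])
  qed
  have "section_mod k U \<iota> P \<rho> \<phi> (ideal_power P (a_kernel P U \<phi>) (Suc 0)) s"
    unfolding section_mod_def
  proof (intro conjI ballI)
    fix r assume r: "r \<in> carrier U"
    show "s r \<in> carrier P" "\<phi> (s r) = r" by (fact s[OF r])+
    fix t assume t: "t \<in> carrier U"
    note rt = s[OF r] s[OF t] s[OF U.a_closed[OF r t]] s[OF U.m_closed[OF r t]]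
    show "s (r \<oplus>\<^bsub>U\<^esub> t) \<ominus>\<^bsub>P\<^esub> (s r \<oplus>\<^bsub>P\<^esub> s t) \<in> ideal_power P (a_kernel P U \<phi>) (Suc 0)"
      by (rule in_pow) (use rt in \<open>simp_all del: ideal_power.simps\<close>)
    show "s (r \<otimes>\<^bsub>U\<^esub> t) \<ominus>\<^bsub>P\<^esub> s r \<otimes>\<^bsub>P\<^esub> s t \<in> ideal_power P (a_kernel P U \<phi>) (Suc 0)"
      by (rule in_pow) (use rt in \<open>simp_all del: ideal_power.simps\<close>)
  next
    show "s \<one>\<^bsub>U\<^esub> \<ominus>\<^bsub>P\<^esub> \<one>\<^bsub>P\<^esub> \<in> ideal_power P (a_kernel P U \<phi>) (Suc 0)"
      by (rule in_pow) (use s[OF U.one_closed] in simp_all)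
    fix a assume a: "a \<in> carrier k"
    show "s (\<iota> a) \<ominus>\<^bsub>P\<^esub> \<rho> a \<in> ideal_power P (a_kernel P U \<phi>) (Suc 0)"
      by (rule in_pow) (use s[OF ring_hom_closed[OF U(2) a]] ring_hom_closed[OF Pc(2) a] \<phi>h(2)[OF a] in simp_all)
  qed
  then show ?case by blast
next
  case (Suc m)
  then show ?case using smooth_section_Suc[OF k smooth P \<phi>] by blast
qed

subsection \<open>Lifting relations along a smooth quotient\<close>

declare ideal_power.simps [simp del]

text \<open>The approximate lift \<open>l\<close> induces a homomorphism on \<open>S(FU)\<close>
  only after the coefficients in \<open>I^(m+1)\<close> are factored out of \<open>S(FP)\<close>. On
  the side of \<open>EP\<close> not even this is at hand: the errors lie in
  \<open>I^(m+1) FP\<close>, not in \<open>I^(m+1) EP\<close>. A polynomial over \<open>EP\<close>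
  is therefore assembled monomial by monomial, and the homomorphism on the ambient side controls its
  image.\<close>

lemma kernel_lift:
  fixes P :: "'p ring" and U :: "'u ring" and A :: "'a ring"
  assumes alg: "symmetric_algebra U EU" "symmetric_algebra U FU" "symmetric_algebra P EP" "symmetric_algebra P FP" "symmetric_algebra A L"
    and iU: "linear_map U EU FU iU" and iP: "linear_map P EP FP iP"
    and \<pi>U: "\<pi>U \<in> ring_hom U A" and \<pi>P: "\<pi>P \<in> ring_hom P A"
    and qU: "semilinear_map \<pi>U U EU L qU" and qP: "semilinear_map \<pi>P P EP L qP"
    and I: "ideal I P" and I\<pi>: "\<And>a. a \<in> I \<Longrightarrow> \<pi>P a = \<zero>\<^bsub>A\<^esub>"
    and IF: "\<And>a x. a \<in> I \<Longrightarrow> x \<in> carrier FP \<Longrightarrow> \<exists>z\<in>carrier EP. iP z = a \<odot>\<^bsub>FP\<^esub> x \<and> qP z = \<zero>\<^bsub>L\<^esub>"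
    and sec: "\<And>m. \<exists>s l. s \<in> carrier U \<rightarrow> carrier P \<and> (\<forall>r\<in>carrier U. \<pi>P (s r) = \<pi>U r) \<and>
       (\<forall>r\<in>carrier U. \<forall>t\<in>carrier U. s (r \<oplus>\<^bsub>U\<^esub> t) \<ominus>\<^bsub>P\<^esub> (s r \<oplus>\<^bsub>P\<^esub> s t) \<in> ideal_power P I (Suc m)) \<and>
       (\<forall>r\<in>carrier U. \<forall>t\<in>carrier U. s (r \<otimes>\<^bsub>U\<^esub> t) \<ominus>\<^bsub>P\<^esub> s r \<otimes>\<^bsub>P\<^esub> s t \<in> ideal_power P I (Suc m)) \<and>
       s \<one>\<^bsub>U\<^esub> \<ominus>\<^bsub>P\<^esub> \<one>\<^bsub>P\<^esub> \<in> ideal_power P I (Suc m) \<and>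
       l \<in> carrier FU \<rightarrow> carrier FP \<and>
       (\<forall>x\<in>carrier EU. \<exists>z\<in>carrier EP. iP z = l (iU x) \<and> qP z = qU x) \<and>
       (\<forall>x\<in>carrier FU. \<forall>y\<in>carrier FU. \<exists>d\<in>smult_span FP (ideal_power P I (Suc m)) (carrier FP).
          l (x \<oplus>\<^bsub>FU\<^esub> y) = (l x \<oplus>\<^bsub>FP\<^esub> l y) \<oplus>\<^bsub>FP\<^esub> d) \<and>
       (\<forall>r\<in>carrier U. \<forall>x\<in>carrier FU. \<exists>d\<in>smult_span FP (ideal_power P I (Suc m)) (carrier FP).
          l (r \<odot>\<^bsub>FU\<^esub> x) = s r \<odot>\<^bsub>FP\<^esub> l x \<oplus>\<^bsub>FP\<^esub> d)"
    and s: "\<sigma> \<in> carrier (sym_algebra U EU)" and s0: "sym_map U EU U FU (\<lambda>r. r) iU \<sigma> = \<zero>\<^bsub>sym_algebra U FU\<^esub>"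
  shows "\<exists>\<sigma>'\<in>carrier (sym_algebra P EP). sym_map P EP P FP (\<lambda>r. r) iP \<sigma>' = \<zero>\<^bsub>sym_algebra P FP\<^esub> \<and>
    sym_map P EP A L \<pi>P qP \<sigma>' = sym_map U EU A L \<pi>U qU \<sigma>"
proof -
  interpret EU: symmetric_algebra U EU by fact
  interpret FU: symmetric_algebra U FU by fact
  interpret EP: symmetric_algebra P EP by fact
  interpret FP: symmetric_algebra P FP by fact
  interpret L: symmetric_algebra A L by fact
  interpret I: ideal I P by fact
  have idU: "(\<lambda>r. r) \<in> ring_hom U U" by (rule id_ring_hom[OF EU.R.ring_axioms])
  have idP: "(\<lambda>r. r) \<in> ring_hom P P" by (rule id_ring_hom[OF EP.R.ring_axioms])
  let ?SU = "sym_map U EU U FU (\<lambda>r. r) iU" and ?SP = "sym_map P EP P FP (\<lambda>r. r) iP"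
  let ?BU = "sym_map U EU A L \<pi>U qU" and ?BP = "sym_map P EP A L \<pi>P qP"
  note SU = sym_map[OF alg(1,2) idU iU] and SP = sym_map[OF alg(3,4) idP iP]
    and BU = sym_map[OF alg(1,5) \<pi>U qU] and BP = sym_map[OF alg(3,5) \<pi>P qP]
  interpret SU: ring_hom_ring EU.S FU.S ?SU by unfold_locales (rule SU)
  interpret SP: ring_hom_ring EP.S FP.S ?SP by unfold_locales (rule SP)
  interpret BU: ring_hom_ring EU.S L.S ?BU by unfold_locales (rule BU)
  interpret BP: ring_hom_ring EP.S L.S ?BP by unfold_locales (rule BP)
  note iU' = semilinear_mapD[OF iU] and iP' = semilinear_mapD[OF iP]
  obtain f where f: "f \<in> carrier EU.P" "\<sigma> = EU.I +>\<^bsub>EU.P\<^esub> f" using EU.cls_surj[OF s] by blast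
  \<comment> \<open>The bound \<open>m\<close> on the degree of a representative decides the
    precision: modulo the power \<open>m + 1\<close> every monomial of degree at most
    \<open>m\<close> has one more factor from \<open>I\<close> at its disposal than its
    degree.\<close>
  define m where "m = Max (insert 0 (size ` {w. f w \<noteq> \<zero>\<^bsub>U\<^esub>}))"
  have m: "size w \<le> m" if "f w \<noteq> \<zero>\<^bsub>U\<^esub>" for w unfolding m_def using that EU.P.finite_supp[OF f(1)] by (intro Max_ge) auto
  have "f w = \<zero>\<^bsub>U\<^esub>" if "\<not> size w \<le> m" for w using m that by blast
  then have fm: "EU.deg_part {..m} f = f" by (auto simp: EU.deg_part_def fun_eq_iff)
  let ?Im = "ideal_power P I (Suc m)"
  have Imi: "ideal ?Im P" by (rule EP.R.ideal_power_ideal[OF I])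
  interpret Im: ideal ?Im P by (rule Imi)
  obtain s l where sc: "s \<in> carrier U \<rightarrow> carrier P"
    and s\<pi>0: "\<forall>r\<in>carrier U. \<pi>P (s r) = \<pi>U r"
    and s_add0: "\<forall>r\<in>carrier U. \<forall>t\<in>carrier U. s (r \<oplus>\<^bsub>U\<^esub> t) \<ominus>\<^bsub>P\<^esub> (s r \<oplus>\<^bsub>P\<^esub> s t) \<in> ?Im"
    and s_mult0: "\<forall>r\<in>carrier U. \<forall>t\<in>carrier U. s (r \<otimes>\<^bsub>U\<^esub> t) \<ominus>\<^bsub>P\<^esub> s r \<otimes>\<^bsub>P\<^esub> s t \<in> ?Im"
    and s_one: "s \<one>\<^bsub>U\<^esub> \<ominus>\<^bsub>P\<^esub> \<one>\<^bsub>P\<^esub> \<in> ?Im"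
    and lc: "l \<in> carrier FU \<rightarrow> carrier FP"
    and lE0: "\<forall>x\<in>carrier EU. \<exists>z\<in>carrier EP. iP z = l (iU x) \<and> qP z = qU x"
    and l_add0: "\<forall>x\<in>carrier FU. \<forall>y\<in>carrier FU. \<exists>d\<in>smult_span FP ?Im (carrier FP).
          l (x \<oplus>\<^bsub>FU\<^esub> y) = (l x \<oplus>\<^bsub>FP\<^esub> l y) \<oplus>\<^bsub>FP\<^esub> d"
    and l_smult0: "\<forall>r\<in>carrier U. \<forall>x\<in>carrier FU. \<exists>d\<in>smult_span FP ?Im (carrier FP).
          l (r \<odot>\<^bsub>FU\<^esub> x) = s r \<odot>\<^bsub>FP\<^esub> l x \<oplus>\<^bsub>FP\<^esub> d"
    using sec[of m] by (elim exE conjE) (rule that, assumption+)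
  note s\<pi> = bspec[OF s\<pi>0] and s_add = bspec[OF bspec[OF s_add0]] and s_mult = bspec[OF bspec[OF s_mult0]]
    and lE = bspec[OF lE0] and l_add = bspec[OF bspec[OF l_add0]] and l_smult = bspec[OF bspec[OF l_smult0]]
  have sc': "r \<in> carrier U \<Longrightarrow> s r \<in> carrier P" for r by (rule funcset_mem[OF sc])
  have lc': "x \<in> carrier FU \<Longrightarrow> l x \<in> carrier FP" for x using lc by blast
  \<comment> \<open>Polynomials with all coefficients in \<open>I^(m+1)\<close>. Modulo the ideal
    \<open>?J\<close> of their classes the errors of \<open>s\<close> and \<open>l\<close>
    disappear, and the universal property of \<open>S(FU)\<close> becomes applicable.\<close>
  let ?JP = "{p \<in> carrier FP.P. \<forall>w. p w \<in> ?Im}"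
  let ?J = "(+>\<^bsub>FP.P\<^esub>) FP.I ` ?JP"
  have J0_mult: "q \<otimes>\<^bsub>FP.P\<^esub> p \<in> ?JP" if p: "p \<in> ?JP" and q: "q \<in> carrier FP.P" for p q
  proof -
    have pc: "p \<in> carrier FP.P" "\<And>w. p w \<in> ?Im" using p by auto
    have "(q \<otimes>\<^bsub>FP.P\<^esub> p) w \<in> ?Im" for w
      unfolding FP.P.mult_formula[OF q pc(1) FP.P.finite_supp[OF q] order_refl FP.P.supp_subset[OF q]
          FP.P.finite_supp[OF pc(1)] order_refl FP.P.supp_subset[OF pc(1)]]
      by (rule Im.finsum_in_ideal) (use FP.P.finite_supp[OF q] FP.P.finite_supp[OF pc(1)] FP.P.coeff_closed[OF q] Im.I_l_closed[OF pc(2)] in \<open>auto\<close>)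
    then show ?thesis using FP.P.mult_closed[OF q pc(1)] by blast
  qed
  have J: "ideal ?J FP.S"
    unfolding FP.S.subideal_carrier_iff[symmetric] FP.S.subideal_def
  proof (intro conjI ballI)
    show "?J \<subseteq> carrier FP.S" by auto
    have "\<zero>\<^bsub>FP.P\<^esub> \<in> ?JP" using FP.P.MA.zero_closed Im.zero_closed by (simp add: FP.P.MA_simps)
    then show "\<zero>\<^bsub>FP.S\<^esub> \<in> ?J" using FP.cls.hom_zero by (metis (no_types, lifting) image_eqI)
    fix a assume "a \<in> ?J"
    then obtain p where p: "p \<in> ?JP" "a = FP.I +>\<^bsub>FP.P\<^esub> p" by blast
    show "a \<oplus>\<^bsub>FP.S\<^esub> b \<in> ?J" if "b \<in> ?J" for b
    proof -
      from that obtain q where q: "q \<in> ?JP" "b = FP.I +>\<^bsub>FP.P\<^esub> q" by blast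
      have pq: "p \<in> carrier FP.P" "q \<in> carrier FP.P" "\<And>w. p w \<in> ?Im" "\<And>w. q w \<in> ?Im" using p q by auto
      have "(p \<oplus>\<^bsub>FP.P\<^esub> q) w \<in> ?Im" for w using Im.a_closed[OF pq(3,4)] by (simp only: FP.P.MA_simps)
      then have "p \<oplus>\<^bsub>FP.P\<^esub> q \<in> ?JP" using FP.P.add_closed[OF pq(1,2)] by blast
      moreover have "a \<oplus>\<^bsub>FP.S\<^esub> b = FP.I +>\<^bsub>FP.P\<^esub> (p \<oplus>\<^bsub>FP.P\<^esub> q)" using FP.cls.hom_add[OF pq(1,2)] p(2) q(2) by simp
      ultimately show ?thesis by blast
    qed
    show "r \<otimes>\<^bsub>FP.S\<^esub> a \<in> ?J" if r: "r \<in> carrier FP.S" for r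
    proof -
      obtain q where q: "q \<in> carrier FP.P" "r = FP.I +>\<^bsub>FP.P\<^esub> q" using FP.cls_surj[OF r] by blast
      have pc: "p \<in> carrier FP.P" using p by auto
      have "r \<otimes>\<^bsub>FP.S\<^esub> a = FP.I +>\<^bsub>FP.P\<^esub> (q \<otimes>\<^bsub>FP.P\<^esub> p)" using FP.cls.hom_mult[OF q(1) pc] p(2) q(2) by simp
      then show ?thesis using J0_mult[OF p(1) q(1)] by blast
    qed
  qed
  interpret J: ideal ?J FP.S by (rule J)
  have J_cst: "FP.cst a \<in> ?J" if a: "a \<in> ?Im" for a
  proof -
    have "monomial P a {#} \<in> ?JP" using Im.Icarr[OF a] a Im.zero_closed by (simp add: monomial_def[of _ _ "{#}"] del: FP.P.monomial_closed) (use FP.P.monomial_closed[OF Im.Icarr[OF a], of "{#}"] in \<open>simp add: monomial_def\<close>)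
    then show ?thesis unfolding sym_const_def by blast
  qed
  have J_gen: "d \<in> carrier FP \<and> FP.gen d \<in> ?J" if d: "d \<in> smult_span FP ?Im (carrier FP)" for d
    using d unfolding smult_span_def
  proof (induction rule: generate.induct)
    case one
    then show ?case using FP.gen_zero J.zero_closed by simp
  next
    case (incl h)
    then obtain a x where h: "h = a \<odot>\<^bsub>FP\<^esub> x" "a \<in> ?Im" "x \<in> carrier FP" by blast
    have "FP.gen h = FP.cst a \<otimes>\<^bsub>FP.S\<^esub> FP.gen x" using h FP.gen_smult Im.Icarr[OF h(2)] by simp
    then show ?case using J.I_r_closed[OF J_cst[OF h(2)], of "FP.gen x"] h Im.Icarr[OF h(2)] by simp
  next
    case (inv h)
    then obtain a x where h: "h = a \<odot>\<^bsub>FP\<^esub> x" "a \<in> ?Im" "x \<in> carrier FP" by blast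
    have ac: "a \<in> carrier P" by (rule Im.Icarr[OF h(2)])
    have e: "inv\<^bsub>add_monoid FP\<^esub> h = (\<ominus>\<^bsub>P\<^esub> a) \<odot>\<^bsub>FP\<^esub> x" using h ac FP.smult_l_minus[of a x] by (simp add: a_inv_def)
    have "FP.gen (inv\<^bsub>add_monoid FP\<^esub> h) = FP.cst (\<ominus>\<^bsub>P\<^esub> a) \<otimes>\<^bsub>FP.S\<^esub> FP.gen x" unfolding e using h ac by (intro FP.gen_smult) auto
    moreover have "\<ominus>\<^bsub>P\<^esub> a \<in> ?Im" by (rule Im.a_inv_closed[OF h(2)])
    ultimately show ?case using J.I_r_closed[OF J_cst, of "\<ominus>\<^bsub>P\<^esub> a" "FP.gen x"] h ac e by simp
  next
    case (eng h1 h2)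
    then show ?case using FP.gen_add[of h1 h2] J.a_closed by simp
  qed
  let ?Q = "FP.S Quot ?J"
  let ?c = "(+>\<^bsub>FP.S\<^esub>) ?J"
  interpret Q: cring ?Q by (rule J.quotient_is_cring[OF FP.cring_S])
  interpret c: ring_hom_ring FP.S ?Q ?c by (rule J.rcos_ring_hom_ring)
  have c0: "a \<in> ?J \<Longrightarrow> ?c a = \<zero>\<^bsub>?Q\<^esub>" for a
    using J.quot_eq_zero_iff[of a] J.Icarr[of a] J.quot_zero by metis
  have c_cst: "?c (FP.cst a) = ?c (FP.cst b)" if ab: "a \<in> carrier P" "b \<in> carrier P" "a \<ominus>\<^bsub>P\<^esub> b \<in> ?Im" for a b
  proof -
    have "FP.cst a \<ominus>\<^bsub>FP.S\<^esub> FP.cst b = FP.cst (a \<ominus>\<^bsub>P\<^esub> b)" using ab(1,2) by (simp add: a_minus_def)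
    then show ?thesis
      using J.quot_eq_iff[OF FP.cst.hom_closed[OF ab(1)] FP.cst.hom_closed[OF ab(2)]] J_cst[OF ab(3)] by (simp only:)
  qed
  let ?h = "\<lambda>r. ?c (FP.cst (s r))" and ?g = "\<lambda>x. ?c (FP.gen (l x))"
  have h: "?h \<in> ring_hom U ?Q"
  proof (rule ring_hom_memI)
    fix r assume r: "r \<in> carrier U"
    show "?h r \<in> carrier ?Q" using sc'[OF r] by simp
    fix t assume t: "t \<in> carrier U"
    show "?h (r \<otimes>\<^bsub>U\<^esub> t) = ?h r \<otimes>\<^bsub>?Q\<^esub> ?h t"
      using c_cst[OF sc' _ s_mult[OF r t]] sc' r t by simp
    show "?h (r \<oplus>\<^bsub>U\<^esub> t) = ?h r \<oplus>\<^bsub>?Q\<^esub> ?h t"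
      using c_cst[OF sc' _ s_add[OF r t]] sc' r t by simp
  next
    show "?h \<one>\<^bsub>U\<^esub> = \<one>\<^bsub>?Q\<^esub>" using c_cst[OF sc' _ s_one] by simp
  qed
  have g: "?g \<in> carrier FU \<rightarrow> carrier ?Q" using lc' by simp
  have g_add: "?g (x \<oplus>\<^bsub>FU\<^esub> y) = ?g x \<oplus>\<^bsub>?Q\<^esub> ?g y" if xy: "x \<in> carrier FU" "y \<in> carrier FU" for x y
  proof -
    obtain d where d: "d \<in> smult_span FP ?Im (carrier FP)" "l (x \<oplus>\<^bsub>FU\<^esub> y) = (l x \<oplus>\<^bsub>FP\<^esub> l y) \<oplus>\<^bsub>FP\<^esub> d" using l_add[OF xy] by blast
    have dd: "d \<in> carrier FP" "FP.gen d \<in> ?J" using J_gen[OF d(1)] by auto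
    have "FP.gen (l (x \<oplus>\<^bsub>FU\<^esub> y)) = (FP.gen (l x) \<oplus>\<^bsub>FP.S\<^esub> FP.gen (l y)) \<oplus>\<^bsub>FP.S\<^esub> FP.gen d"
      using d(2) dd(1) lc' xy by (simp add: FP.gen_add)
    then have "?g (x \<oplus>\<^bsub>FU\<^esub> y) = (?g x \<oplus>\<^bsub>?Q\<^esub> ?g y) \<oplus>\<^bsub>?Q\<^esub> ?c (FP.gen d)" using dd(1) lc' xy by simp
    then show ?thesis using c0[OF dd(2)] lc' xy by simp
  qed
  have g_smult: "?g (r \<odot>\<^bsub>FU\<^esub> x) = ?h r \<otimes>\<^bsub>?Q\<^esub> ?g x" if rx: "r \<in> carrier U" "x \<in> carrier FU" for r x
  proof -
    obtain d where d: "d \<in> smult_span FP ?Im (carrier FP)" "l (r \<odot>\<^bsub>FU\<^esub> x) = s r \<odot>\<^bsub>FP\<^esub> l x \<oplus>\<^bsub>FP\<^esub> d" using l_smult[OF rx] by blast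
    have dd: "d \<in> carrier FP" "FP.gen d \<in> ?J" using J_gen[OF d(1)] by auto
    have "FP.gen (l (r \<odot>\<^bsub>FU\<^esub> x)) = FP.cst (s r) \<otimes>\<^bsub>FP.S\<^esub> FP.gen (l x) \<oplus>\<^bsub>FP.S\<^esub> FP.gen d"
      using d(2) dd(1) lc' rx sc' by (simp add: FP.gen_add FP.gen_smult)
    then have "?g (r \<odot>\<^bsub>FU\<^esub> x) = (?h r \<otimes>\<^bsub>?Q\<^esub> ?g x) \<oplus>\<^bsub>?Q\<^esub> ?c (FP.gen d)" using dd(1) lc' rx sc' by simp
    then show ?thesis using c0[OF dd(2)] lc' rx sc' by simp
  qed
  obtain T where T: "T \<in> ring_hom FU.S ?Q" "\<And>r. r \<in> carrier U \<Longrightarrow> T (FU.cst r) = ?h r" "\<And>x. x \<in> carrier FU \<Longrightarrow> T (FU.gen x) = ?g x"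
    using FU.sym_lift[OF Q.cring_axioms h g g_add g_smult] by blast
  interpret T: ring_hom_ring FU.S ?Q T by unfold_locales (rule T)
  \<comment> \<open>A candidate \<open>p\<close> for a lift of \<open>\<sigma>\<close>: it agrees
    with \<open>\<sigma>\<close> exactly in \<open>S(L)\<close>, but in \<open>S(FP)\<close> only
    modulo \<open>?J\<close>. The degree bound is a property of the representative and has to be
    carried along.\<close>
  define ok where "ok D p \<sigma> \<longleftrightarrow> p \<in> carrier EP.P \<and> (\<forall>w. p w \<noteq> \<zero>\<^bsub>P\<^esub> \<longrightarrow> size w \<le> D) \<and>
    ?BP (EP.I +>\<^bsub>EP.P\<^esub> p) = ?BU \<sigma> \<and> ?c (?SP (EP.I +>\<^bsub>EP.P\<^esub> p)) = T (?SU \<sigma>)" for D :: nat and p \<sigma>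
  have mono: "\<exists>p. ok (size w) p (EU.I +>\<^bsub>EU.P\<^esub> monomial U r w)" if r: "r \<in> carrier U" and w: "set_mset w \<subseteq> carrier EU" for r w
  proof -
    have "\<exists>v. set_mset v \<subseteq> carrier EP \<and> size v = size w \<and> ?BP (mset_prod EP.S EP.gen v) = ?BU (mset_prod EU.S EU.gen w) \<and>
       ?c (?SP (mset_prod EP.S EP.gen v)) = T (?SU (mset_prod EU.S EU.gen w))"
      using w
    proof (induction w)
      case empty
      show ?case by (rule exI[of _ "{#}"]) simp
    next
      case (add x w)
      then obtain v where v: "set_mset v \<subseteq> carrier EP" "size v = size w" "?BP (mset_prod EP.S EP.gen v) = ?BU (mset_prod EU.S EU.gen w)"
         "?c (?SP (mset_prod EP.S EP.gen v)) = T (?SU (mset_prod EU.S EU.gen w))" by auto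
      have x: "x \<in> carrier EU" "set_mset w \<subseteq> carrier EU" using add.prems by auto
      obtain z where z: "z \<in> carrier EP" "iP z = l (iU x)" "qP z = qU x" using lE[OF x(1)] by blast
      have gE: "EP.gen \<in> carrier EP \<rightarrow> carrier EP.S" "EU.gen \<in> carrier EU \<rightarrow> carrier EU.S" by auto
      have c: "mset_prod EP.S EP.gen v \<in> carrier EP.S" "EP.gen z \<in> carrier EP.S" "mset_prod EU.S EU.gen w \<in> carrier EU.S" "EU.gen x \<in> carrier EU.S"
        using v(1) z(1) x by auto
      have e: "mset_prod EP.S EP.gen (add_mset z v) = EP.gen z \<otimes>\<^bsub>EP.S\<^esub> mset_prod EP.S EP.gen v"
        "mset_prod EU.S EU.gen (add_mset x w) = EU.gen x \<otimes>\<^bsub>EU.S\<^esub> mset_prod EU.S EU.gen w"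
        using EP.S.mset_prod_add_mset[OF gE(1) z(1) v(1)] EU.S.mset_prod_add_mset[OF gE(2) x] .
      have "?c (?SP (EP.gen z)) = T (?SU (EU.gen x))" using SP(3)[OF z(1)] SU(3)[OF x(1)] T(3)[OF iU'(1)[OF x(1)]] z(2) by simp
      moreover have "?BP (EP.gen z) = ?BU (EU.gen x)" using BP(3)[OF z(1)] BU(3)[OF x(1)] z(3) by simp
      ultimately show ?case using v z c unfolding e by (intro exI[of _ "add_mset z v"]) (simp add: e)
    qed
    then obtain v where v: "set_mset v \<subseteq> carrier EP" "size v = size w" "?BP (mset_prod EP.S EP.gen v) = ?BU (mset_prod EU.S EU.gen w)"
       "?c (?SP (mset_prod EP.S EP.gen v)) = T (?SU (mset_prod EU.S EU.gen w))" by blast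
    have c: "mset_prod EP.S EP.gen v \<in> carrier EP.S" "mset_prod EU.S EU.gen w \<in> carrier EU.S" "EP.cst (s r) \<in> carrier EP.S" "EU.cst r \<in> carrier EU.S"
      using v(1) w sc'[OF r] r by auto
    have "?BP (EP.cst (s r)) = ?BU (EU.cst r)" using BP(2)[OF sc'[OF r]] BU(2)[OF r] s\<pi>[OF r] by simp
    moreover have "?c (?SP (EP.cst (s r))) = T (?SU (EU.cst r))" using SP(2)[OF sc'[OF r]] SU(2)[OF r] T(2)[OF r] by simp
    ultimately have "ok (size w) (monomial P (s r) v) (EU.I +>\<^bsub>EU.P\<^esub> monomial U r w)"
      using v c sc'[OF r] EP.cls_monomial[OF sc'[OF r] v(1)] EU.cls_monomial[OF r w]
      by (simp add: ok_def) (simp add: monomial_def)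
    then show ?thesis by blast
  qed
  have ok_mono: "ok D' p \<sigma>" if "ok D p \<sigma>" "D \<le> D'" for D D' p \<sigma> using that by (auto simp: ok_def)
  have ok_zero: "ok D \<zero>\<^bsub>EP.P\<^esub> \<zero>\<^bsub>EU.S\<^esub>" for D
    using EP.cls.hom_zero by (simp add: ok_def) (simp add: EP.P.MA_simps)
  have ok_add: "ok D (p \<oplus>\<^bsub>EP.P\<^esub> p') (\<sigma> \<oplus>\<^bsub>EU.S\<^esub> \<sigma>')" if o: "ok D p \<sigma>" "ok D p' \<sigma>'" and \<sigma>: "\<sigma> \<in> carrier EU.S" "\<sigma>' \<in> carrier EU.S" for D p p' \<sigma> \<sigma>'
  proof -
    have pc: "p \<in> carrier EP.P" "p' \<in> carrier EP.P" using o by (auto simp: ok_def)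
    have cc: "EP.I +>\<^bsub>EP.P\<^esub> p \<in> carrier EP.S" "EP.I +>\<^bsub>EP.P\<^esub> p' \<in> carrier EP.S" using pc by auto
    have "size w \<le> D" if "(p \<oplus>\<^bsub>EP.P\<^esub> p') w \<noteq> \<zero>\<^bsub>P\<^esub>" for w
      using that o by (cases "p w = \<zero>\<^bsub>P\<^esub>") (auto simp: ok_def EP.P.MA_simps)
    then show ?thesis using o pc cc \<sigma> by (simp add: ok_def)
  qed
  \<comment> \<open>The induction adds monomials of arbitrary size, so the degree bound is imposed
    by truncation and not expected of each summand.\<close>
  have "\<exists>p. ok D p (EU.I +>\<^bsub>EU.P\<^esub> EU.deg_part {..D} f)" if "f \<in> carrier EU.P" for D f
    using that
  proof (induction rule: EU.P.MA_induct)
    case zero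
    then show ?case using ok_zero EU.cls.hom_zero by auto
  next
    case (add r w q)
    have w: "set_mset w \<subseteq> carrier EU" using add by simp
    obtain p where p: "ok D p (EU.I +>\<^bsub>EU.P\<^esub> EU.deg_part {..D} q)" using add by blast
    have mc: "monomial U r w \<in> carrier EU.P" using add by simp
    obtain p' where p': "ok D p' (EU.I +>\<^bsub>EU.P\<^esub> EU.deg_part {..D} (monomial U r w))"
    proof (cases "size w \<le> D")
      case True
      from mono[OF add(1) w] obtain p' where "ok (size w) p' (EU.I +>\<^bsub>EU.P\<^esub> monomial U r w)" by blast
      from that[of p'] ok_mono[OF this True] True show ?thesis by (simp add: EU.deg_part_monomial)
    next
      case False
      then show ?thesis using ok_zero EU.cls.hom_zero that by (auto simp: EU.deg_part_monomial)
    qed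
    have "ok D (p' \<oplus>\<^bsub>EP.P\<^esub> p) ((EU.I +>\<^bsub>EU.P\<^esub> EU.deg_part {..D} (monomial U r w)) \<oplus>\<^bsub>EU.S\<^esub> (EU.I +>\<^bsub>EU.P\<^esub> EU.deg_part {..D} q))"
      by (rule ok_add[OF p' p]) (use mc add in auto)
    then show ?case using mc add by (auto simp: EU.deg_part_add)
  qed
  from this[OF f(1), of m] obtain p where p: "ok m p \<sigma>" using fm f(2) by auto
  let ?\<tau> = "EP.I +>\<^bsub>EP.P\<^esub> p"
  have pc: "p \<in> carrier EP.P" and pm: "\<And>w. p w \<noteq> \<zero>\<^bsub>P\<^esub> \<Longrightarrow> size w \<le> m" and pB: "?BP ?\<tau> = ?BU \<sigma>" and pS: "?c (?SP ?\<tau>) = T (?SU \<sigma>)"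
    using p by (auto simp: ok_def)
  have \<tau>c: "?\<tau> \<in> carrier EP.S" using pc by simp
  have "?c (?SP ?\<tau>) = \<zero>\<^bsub>?Q\<^esub>" using pS s0 by simp
  then have "?SP ?\<tau> \<in> ?J" using J.quot_eq_zero_iff[OF SP.hom_closed[OF \<tau>c]] by (simp only: J.quot_zero)
  then obtain r where r: "r \<in> ?JP" "?SP ?\<tau> = FP.I +>\<^bsub>FP.P\<^esub> r" by blast
  have rc: "r \<in> carrier FP.P" and rI: "\<And>w. r w \<in> ?Im" using r(1) by auto
  text \<open>The image of \<open>p\<close> has degree at most \<open>m\<close>, so the part of \<open>r\<close> of higher degree is irrelevant.\<close>
  let ?pF = "monoid_algebra_map P P (\<lambda>r. r) (image_mset iP) p"
  have hom: "image_mset iP \<in> hom (free_comm_monoid (carrier EP)) (free_comm_monoid (carrier FP))"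
    by (auto simp: hom_def free_comm_monoid_def intro!: iP'(1))
  note mam = monoid_algebra_map[OF EP.P.comm_monoid_algebra_axioms FP.P.comm_monoid_algebra_axioms idP hom]
  have mam1: "monoid_algebra_map P P (\<lambda>r. r) (image_mset iP) \<in> ring_hom EP.P FP.P" by (rule mam) simp
  have pFc: "?pF \<in> carrier FP.P" using ring_hom_closed[OF mam1 pc] .
  have SPp: "?SP ?\<tau> = FP.I +>\<^bsub>FP.P\<^esub> ?pF"
    by (rule SP(4)[OF pc])
  have pFdeg: "FP.deg_part {..m} ?pF = ?pF"
  proof
    fix w
    have "?pF w = \<zero>\<^bsub>P\<^esub>" if "\<not> size w \<le> m"
    proof -
      have "{g. p g \<noteq> \<zero>\<^bsub>P\<^esub> \<and> image_mset iP g = w} = {}" using pm that by auto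
      then show ?thesis unfolding monoid_algebra_map_def by (simp only: EP.R.finsum_empty)
    qed
    then show "FP.deg_part {..m} ?pF w = ?pF w" by (auto simp: FP.deg_part_def)
  qed
  have "?pF \<ominus>\<^bsub>FP.P\<^esub> r \<in> FP.I" using r(2) SPp FP.I.quot_eq_iff[OF pFc rc] by simp
  then have "FP.deg_part {..m} (?pF \<ominus>\<^bsub>FP.P\<^esub> r) \<in> FP.I" by (rule FP.deg_part_sym_ideal)
  then have "?pF \<ominus>\<^bsub>FP.P\<^esub> FP.deg_part {..m} r \<in> FP.I" using FP.deg_part_minus[OF pFc rc, of "{..m}"] pFdeg by simp
  then have SP\<tau>: "?SP ?\<tau> = FP.I +>\<^bsub>FP.P\<^esub> FP.deg_part {..m} r" using SPp FP.I.quot_eq_iff[OF pFc FP.deg_part_closed[OF rc]] by simp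
  \<comment> \<open>Each generator of \<open>FP\<close> uses up one factor from \<open>I\<close>,
    which turns it into an element of \<open>EP\<close> mapping to zero in \<open>L\<close>. The
    additional factor is for the empty monomial: the remaining scalar then also vanishes in
    \<open>A\<close>.\<close>
  have low: "\<exists>g\<in>carrier EP.S. ?SP g = FP.cst a \<otimes>\<^bsub>FP.S\<^esub> mset_prod FP.S FP.gen w \<and> ?BP g = \<zero>\<^bsub>L.S\<^esub>"
    if "a \<in> ideal_power P I (Suc (size w))" "set_mset w \<subseteq> carrier FP" for a w
    using that
  proof (induction w arbitrary: a)
    case empty
    have aI: "a \<in> I" using EP.R.ideal_power_subset[OF I, of 0] empty by auto
    have "?BP (EP.cst a) = \<zero>\<^bsub>L.S\<^esub>" using BP(2)[OF I.Icarr[OF aI]] I\<pi>[OF aI] by simp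
    then show ?case using SP(2)[OF I.Icarr[OF aI]] I.Icarr[OF aI] by (intro bexI[of _ "EP.cst a"]) auto
  next
    case (add x w)
    have x: "x \<in> carrier FP" "set_mset w \<subseteq> carrier FP" using add.prems by auto
    have gF: "FP.gen \<in> carrier FP \<rightarrow> carrier FP.S" by auto
    have wc: "mset_prod FP.S FP.gen w \<in> carrier FP.S" "FP.gen x \<in> carrier FP.S" using x by auto
    have e: "mset_prod FP.S FP.gen (add_mset x w) = FP.gen x \<otimes>\<^bsub>FP.S\<^esub> mset_prod FP.S FP.gen w"
      by (rule FP.S.mset_prod_add_mset[OF gF x])
    have "a \<in> I \<cdot>\<^bsub>P\<^esub> ideal_power P I (Suc (size w))" using add.prems(1) by (simp add: ideal_power.simps)
    then have "a \<in> carrier P \<and> (\<exists>g\<in>carrier EP.S. ?SP g = FP.cst a \<otimes>\<^bsub>FP.S\<^esub> mset_prod FP.S FP.gen (add_mset x w) \<and> ?BP g = \<zero>\<^bsub>L.S\<^esub>)"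
    proof (induction rule: ideal_prod.induct)
      case (prod b c)
      obtain g where g: "g \<in> carrier EP.S" "?SP g = FP.cst c \<otimes>\<^bsub>FP.S\<^esub> mset_prod FP.S FP.gen w" "?BP g = \<zero>\<^bsub>L.S\<^esub>"
        using add.IH[OF prod(2) x(2)] by blast
      obtain z where z: "z \<in> carrier EP" "iP z = b \<odot>\<^bsub>FP\<^esub> x" "qP z = \<zero>\<^bsub>L\<^esub>" using IF[OF prod(1) x(1)] by blast
      have bc: "b \<in> carrier P" "c \<in> carrier P" using I.Icarr[OF prod(1)] ideal.Icarr[OF EP.R.ideal_power_ideal[OF I] prod(2)] .
      have "?SP (EP.gen z) = FP.cst b \<otimes>\<^bsub>FP.S\<^esub> FP.gen x" using SP(3)[OF z(1)] z(2) FP.gen_smult[OF bc(1) x(1)] by simp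
      moreover have "?BP (EP.gen z) = \<zero>\<^bsub>L.S\<^esub>" using BP(3)[OF z(1)] z(3) L.gen_zero by simp
      ultimately show ?case using g z bc wc
        by (intro conjI bexI[of _ "EP.gen z \<otimes>\<^bsub>EP.S\<^esub> g"]) (simp_all add: e FP.S.m_ac)
    next
      case (sum b c)
      then obtain g h where gh: "g \<in> carrier EP.S" "?SP g = FP.cst b \<otimes>\<^bsub>FP.S\<^esub> mset_prod FP.S FP.gen (add_mset x w)" "?BP g = \<zero>\<^bsub>L.S\<^esub>"
        "h \<in> carrier EP.S" "?SP h = FP.cst c \<otimes>\<^bsub>FP.S\<^esub> mset_prod FP.S FP.gen (add_mset x w)" "?BP h = \<zero>\<^bsub>L.S\<^esub>" by blast
      then show ?case using sum wc
        by (intro conjI bexI[of _ "g \<oplus>\<^bsub>EP.S\<^esub> h"]) (simp_all add: e FP.S.l_distr)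
    qed
    then show ?case by blast
  qed
  have "\<exists>g\<in>carrier EP.S. ?SP g = FP.I +>\<^bsub>FP.P\<^esub> FP.deg_part {..m} r \<and> ?BP g = \<zero>\<^bsub>L.S\<^esub>"
  proof -
    have "finite S \<Longrightarrow> (\<And>w. w \<in> S \<Longrightarrow> set_mset w \<subseteq> carrier FP) \<Longrightarrow> \<exists>g\<in>carrier EP.S. ?SP g = FP.I +>\<^bsub>FP.P\<^esub> (\<Oplus>\<^bsub>FP.P\<^esub>w\<in>S. monomial P (FP.deg_part {..m} r w) w) \<and> ?BP g = \<zero>\<^bsub>L.S\<^esub>" for S
    proof (induction S rule: finite_induct)
      case empty
      then show ?case using FP.cls.hom_zero by (intro bexI[of _ "\<zero>\<^bsub>EP.S\<^esub>"]) auto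
    next
      case (insert w S)
      then obtain g where g: "g \<in> carrier EP.S" "?SP g = FP.I +>\<^bsub>FP.P\<^esub> (\<Oplus>\<^bsub>FP.P\<^esub>w\<in>S. monomial P (FP.deg_part {..m} r w) w)" "?BP g = \<zero>\<^bsub>L.S\<^esub>" by auto
      let ?a = "FP.deg_part {..m} r w"
      have ww: "set_mset w \<subseteq> carrier FP" using insert.prems by simp
      have drc: "FP.deg_part {..m} r v \<in> carrier P" for v using FP.P.coeff_closed[OF FP.deg_part_closed[OF rc]] .
      have "?a \<in> ideal_power P I (Suc (size w))"
      proof (cases "size w \<le> m")
        case True
        then show ?thesis using rI[of w] EP.R.ideal_power_antimono[OF I, of "Suc (size w)" "Suc m"] by (auto simp: FP.deg_part_def)
      next
        case False
        then show ?thesis using additive_subgroup.zero_closed[OF ideal.axioms(1)[OF EP.R.ideal_power_ideal[OF I]]] by (simp add: FP.deg_part_def)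
      qed
      then obtain h where h: "h \<in> carrier EP.S" "?SP h = FP.cst ?a \<otimes>\<^bsub>FP.S\<^esub> mset_prod FP.S FP.gen w" "?BP h = \<zero>\<^bsub>L.S\<^esub>"
        using low[OF _ ww] by blast
      have Sc: "(\<lambda>w. monomial P (FP.deg_part {..m} r w) w) \<in> S \<rightarrow> carrier FP.P" using drc insert.prems by auto
      have ac: "monomial P ?a w \<in> carrier FP.P" using drc ww by simp
      have fc: "(\<Oplus>\<^bsub>FP.P\<^esub>w\<in>S. monomial P (FP.deg_part {..m} r w) w) \<in> carrier FP.P" by (rule FP.P.MA.finsum_closed[OF Sc])
      have "(\<Oplus>\<^bsub>FP.P\<^esub>w\<in>insert w S. monomial P (FP.deg_part {..m} r w) w) = monomial P ?a w \<oplus>\<^bsub>FP.P\<^esub> (\<Oplus>\<^bsub>FP.P\<^esub>w\<in>S. monomial P (FP.deg_part {..m} r w) w)"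
        by (rule FP.P.MA.finsum_insert) (use insert.hyps Sc ac in auto)
      then have "FP.I +>\<^bsub>FP.P\<^esub> (\<Oplus>\<^bsub>FP.P\<^esub>w\<in>insert w S. monomial P (FP.deg_part {..m} r w) w) = ?SP h \<oplus>\<^bsub>FP.S\<^esub> ?SP g"
        using FP.cls.hom_add[OF ac fc] FP.cls_monomial[OF drc ww] h(2) g(2) by simp
      then show ?case using g h by (intro bexI[of _ "h \<oplus>\<^bsub>EP.S\<^esub> g"]) auto
    qed
    note fs = this
    have dc: "FP.deg_part {..m} r \<in> carrier FP.P" using rc by simp
    let ?W = "{w. FP.deg_part {..m} r w \<noteq> \<zero>\<^bsub>P\<^esub>}"
    have W: "w \<in> ?W \<Longrightarrow> set_mset w \<subseteq> carrier FP" for w using subsetD[OF FP.P.supp_subset[OF dc], of w] by simp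
    have exp: "FP.deg_part {..m} r = (\<Oplus>\<^bsub>FP.P\<^esub>w\<in>?W. monomial P (FP.deg_part {..m} r w) w)"
      by (rule FP.P.MA_expand[OF dc FP.P.finite_supp[OF dc] order_refl FP.P.supp_subset[OF dc]])
    show ?thesis using fs[OF FP.P.finite_supp[OF dc] W] unfolding exp[symmetric] .
  qed
  then obtain g where g: "g \<in> carrier EP.S" "?SP g = FP.I +>\<^bsub>FP.P\<^esub> FP.deg_part {..m} r" "?BP g = \<zero>\<^bsub>L.S\<^esub>" by blast
  \<comment> \<open>The error of the candidate in \<open>S(FP)\<close> is the image of
    \<open>g\<close>, and \<open>g\<close> vanishes in \<open>S(L)\<close>; subtracting it repairs
    the first map without disturbing the second.\<close>
  have "?SP (?\<tau> \<ominus>\<^bsub>EP.S\<^esub> g) = \<zero>\<^bsub>FP.S\<^esub>"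
    using g \<tau>c SP\<tau> SP.hom_closed[OF g(1)] by (simp add: a_minus_def FP.S.r_neg)
  moreover have "?BP (?\<tau> \<ominus>\<^bsub>EP.S\<^esub> g) = ?BU \<sigma>"
    using g \<tau>c pB BU.hom_closed[OF s] by (simp add: a_minus_def)
  ultimately show ?thesis using g \<tau>c by (intro bexI[of _ "?\<tau> \<ominus>\<^bsub>EP.S\<^esub> g"]) auto
qed

section \<open>Quotient modules, deformations and tensor products\<close>

lemma submodule_torsion:
  fixes R :: "'r ring" (structure)
  assumes "module R M" shows "submodule (torsion R M) R M"
proof -
  interpret module R M by fact
  show ?thesis
  proof (rule submoduleI)
    show "torsion R M \<subseteq> carrier M" by (auto simp: torsion_def)
    show "\<zero>\<^bsub>M\<^esub> \<in> torsion R M"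
      unfolding torsion_def using nonzerodivisor_one[OF R.cring_axioms] by (intro CollectI conjI bexI[of _ "\<one>"]) simp_all
    have smult: "a \<odot>\<^bsub>M\<^esub> x \<in> torsion R M" if a: "a \<in> carrier R" and x: "x \<in> torsion R M" for a x
    proof -
      from x obtain b where b: "b \<in> nonzerodivisors R" "b \<odot>\<^bsub>M\<^esub> x = \<zero>\<^bsub>M\<^esub>" "x \<in> carrier M" by (auto simp: torsion_def)
      have bc: "b \<in> carrier R" using b by (simp add: nonzerodivisors_def)
      have "b \<odot>\<^bsub>M\<^esub> (a \<odot>\<^bsub>M\<^esub> x) = a \<odot>\<^bsub>M\<^esub> (b \<odot>\<^bsub>M\<^esub> x)"
        using smult_assoc1[OF bc a b(3)] smult_assoc1[OF a bc b(3)] R.m_comm[OF a bc] by simp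
      then show ?thesis using a b by (auto simp: torsion_def)
    qed
    then show "a \<odot>\<^bsub>M\<^esub> x \<in> torsion R M" if "a \<in> carrier R" "x \<in> torsion R M" for a x using that .
    show "\<ominus>\<^bsub>M\<^esub> x \<in> torsion R M" if x: "x \<in> torsion R M" for x
    proof -
      have xc: "x \<in> carrier M" using x by (simp add: torsion_def)
      have "(\<ominus> \<one>) \<odot>\<^bsub>M\<^esub> x = \<ominus>\<^bsub>M\<^esub> x" using smult_l_minus[of \<one> x] xc by simp
      then show ?thesis using smult[OF _ x, of "\<ominus> \<one>"] by simp
    qed
    fix x y assume "x \<in> torsion R M" "y \<in> torsion R M"
    then obtain b c where b: "b \<in> nonzerodivisors R" "b \<odot>\<^bsub>M\<^esub> x = \<zero>\<^bsub>M\<^esub>" "x \<in> carrier M"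
      and c: "c \<in> nonzerodivisors R" "c \<odot>\<^bsub>M\<^esub> y = \<zero>\<^bsub>M\<^esub>" "y \<in> carrier M" by (auto simp: torsion_def)
    have bc: "b \<in> carrier R" "c \<in> carrier R" using b c by (auto simp: nonzerodivisors_def)
    have "(b \<otimes> c) \<odot>\<^bsub>M\<^esub> x = \<zero>\<^bsub>M\<^esub>" using bc b R.m_comm[OF bc] smult_assoc1[of c b x] by simp
    moreover have "(b \<otimes> c) \<odot>\<^bsub>M\<^esub> y = \<zero>\<^bsub>M\<^esub>" using bc c smult_assoc1[of b c y] by simp
    ultimately have "(b \<otimes> c) \<odot>\<^bsub>M\<^esub> (x \<oplus>\<^bsub>M\<^esub> y) = \<zero>\<^bsub>M\<^esub>" using bc b c by (simp add: smult_r_distr)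
    then show "x \<oplus>\<^bsub>M\<^esub> y \<in> torsion R M" using b c nonzerodivisor_mult[OF R.cring_axioms b(1) c(1)] by (auto simp: torsion_def)
  qed
qed

lemma module_quotient_module:
  fixes R :: "'r ring" and M :: "('r, 'b) module"
  assumes M: "module R M" and N: "submodule N R M"
  shows "module R (quotient_module M N)"
proof -
  interpret module R M by fact
  interpret N: submodule N R M by fact
  have sub: "abelian_subgroup N M"
    by (rule abelian_subgroupI2) (use a_comm_group N.subgroup_axioms in auto)
  interpret N: abelian_subgroup N M by (rule sub)
  let ?q = "\<lambda>x. N +>\<^bsub>M\<^esub> x"
  have ops: "carrier (quotient_module M N) = a_rcosets\<^bsub>M\<^esub> N" "\<zero>\<^bsub>quotient_module M N\<^esub> = N"
    "X \<oplus>\<^bsub>quotient_module M N\<^esub> Y = X <+>\<^bsub>M\<^esub> Y" for X Y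
    by (simp_all add: quotient_module_def)
  have surj: "\<exists>x\<in>carrier M. X = ?q x" if "X \<in> carrier (quotient_module M N)" for X
    using that by (auto simp: ops A_RCOSETS_def')
  have qc: "?q x \<in> carrier (quotient_module M N)" if "x \<in> carrier M" for x
    using that by (auto simp: ops A_RCOSETS_def')
  have qadd: "?q x \<oplus>\<^bsub>quotient_module M N\<^esub> ?q y = ?q (x \<oplus>\<^bsub>M\<^esub> y)" if "x \<in> carrier M" "y \<in> carrier M" for x y
    using that by (simp add: ops N.a_rcos_sum)
  have qsmult: "a \<odot>\<^bsub>quotient_module M N\<^esub> ?q x = ?q (a \<odot>\<^bsub>M\<^esub> x)" if a: "a \<in> carrier R" and x: "x \<in> carrier M" for a x
  proof -
    have "?q (a \<odot>\<^bsub>M\<^esub> y) = ?q (a \<odot>\<^bsub>M\<^esub> x)" if y: "y \<in> ?q x" for y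
    proof -
      obtain h where h: "h \<in> N" "y = h \<oplus>\<^bsub>M\<^esub> x" using y by (auto simp: a_r_coset_def')
      have hc: "h \<in> carrier M" using h N.a_subset by auto
      have "a \<odot>\<^bsub>M\<^esub> y = a \<odot>\<^bsub>M\<^esub> h \<oplus>\<^bsub>M\<^esub> a \<odot>\<^bsub>M\<^esub> x" using h hc a x by (simp add: smult_r_distr)
      then have "a \<odot>\<^bsub>M\<^esub> y \<in> ?q (a \<odot>\<^bsub>M\<^esub> x)" using N.smult_closed[OF a h(1)] by (auto simp: a_r_coset_def')
      then show ?thesis using N.a_repr_independence' a x by blast
    qed
    moreover have "x \<in> ?q x" using N.a_rcos_self[OF x] .
    ultimately have "(\<lambda>y. ?q (a \<odot>\<^bsub>M\<^esub> y)) ` ?q x = {?q (a \<odot>\<^bsub>M\<^esub> x)}" by blast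
    then show ?thesis by (simp add: quotient_module_def coset_map_def)
  qed
  have q0: "\<zero>\<^bsub>quotient_module M N\<^esub> = ?q \<zero>\<^bsub>M\<^esub>"
    using N.a_rcos_const[OF N.zero_closed] by (simp add: ops)
  have "abelian_group (quotient_module M N)"
  proof (rule abelian_groupI)
    show "\<zero>\<^bsub>quotient_module M N\<^esub> \<in> carrier (quotient_module M N)" unfolding q0 by (rule qc) simp
    fix X assume "X \<in> carrier (quotient_module M N)"
    then obtain x where x: "x \<in> carrier M" "X = ?q x" using surj by blast
    show "\<zero>\<^bsub>quotient_module M N\<^esub> \<oplus>\<^bsub>quotient_module M N\<^esub> X = X" unfolding q0 x(2) using x(1) by (simp add: qadd)
    show "\<exists>Y\<in>carrier (quotient_module M N). Y \<oplus>\<^bsub>quotient_module M N\<^esub> X = \<zero>\<^bsub>quotient_module M N\<^esub>"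
      unfolding q0 x(2) using x(1) by (intro bexI[of _ "?q (\<ominus>\<^bsub>M\<^esub> x)"]) (simp_all add: qadd qc M.l_neg)
    fix Y assume "Y \<in> carrier (quotient_module M N)"
    then obtain y where y: "y \<in> carrier M" "Y = ?q y" using surj by blast
    show "X \<oplus>\<^bsub>quotient_module M N\<^esub> Y \<in> carrier (quotient_module M N)" unfolding x(2) y(2) using x(1) y(1) by (simp add: qadd qc)
    show "X \<oplus>\<^bsub>quotient_module M N\<^esub> Y = Y \<oplus>\<^bsub>quotient_module M N\<^esub> X"
      unfolding x(2) y(2) using x(1) y(1) by (simp add: qadd M.a_comm)
    fix Z assume "Z \<in> carrier (quotient_module M N)"
    then obtain z where z: "z \<in> carrier M" "Z = ?q z" using surj by blast
    show "X \<oplus>\<^bsub>quotient_module M N\<^esub> Y \<oplus>\<^bsub>quotient_module M N\<^esub> Z = X \<oplus>\<^bsub>quotient_module M N\<^esub> (Y \<oplus>\<^bsub>quotient_module M N\<^esub> Z)"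
      unfolding x(2) y(2) z(2) using x(1) y(1) z(1) by (simp add: qadd M.a_assoc)
  qed
  then show ?thesis
  proof (rule moduleI[OF R.cring_axioms])
    fix a X assume a: "a \<in> carrier R" and X: "X \<in> carrier (quotient_module M N)"
    obtain x where x: "x \<in> carrier M" "X = ?q x" using surj[OF X] by blast
    show "a \<odot>\<^bsub>quotient_module M N\<^esub> X \<in> carrier (quotient_module M N)" using qsmult[OF a x(1)] x qc a by simp
    fix b assume b: "b \<in> carrier R"
    show "(a \<oplus>\<^bsub>R\<^esub> b) \<odot>\<^bsub>quotient_module M N\<^esub> X = a \<odot>\<^bsub>quotient_module M N\<^esub> X \<oplus>\<^bsub>quotient_module M N\<^esub> b \<odot>\<^bsub>quotient_module M N\<^esub> X"
      using x a b by (simp add: qsmult qadd smult_l_distr)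
    show "a \<otimes>\<^bsub>R\<^esub> b \<odot>\<^bsub>quotient_module M N\<^esub> X = a \<odot>\<^bsub>quotient_module M N\<^esub> (b \<odot>\<^bsub>quotient_module M N\<^esub> X)"
      using x a b by (simp add: qsmult smult_assoc1)
  next
    fix a X Y assume a: "a \<in> carrier R" and X: "X \<in> carrier (quotient_module M N)" and Y: "Y \<in> carrier (quotient_module M N)"
    obtain x y where x: "x \<in> carrier M" "X = ?q x" and y: "y \<in> carrier M" "Y = ?q y" using surj[OF X] surj[OF Y] by blast
    show "a \<odot>\<^bsub>quotient_module M N\<^esub> (X \<oplus>\<^bsub>quotient_module M N\<^esub> Y) = a \<odot>\<^bsub>quotient_module M N\<^esub> X \<oplus>\<^bsub>quotient_module M N\<^esub> a \<odot>\<^bsub>quotient_module M N\<^esub> Y"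
      using x y a by (simp add: qsmult qadd smult_r_distr)
  next
    fix X assume X: "X \<in> carrier (quotient_module M N)"
    obtain x where x: "x \<in> carrier M" "X = ?q x" using surj[OF X] by blast
    then show "\<one>\<^bsub>R\<^esub> \<odot>\<^bsub>quotient_module M N\<^esub> X = X" using qsmult[OF R.one_closed x(1)] by simp
  qed
qed

lemma semilinear_zero:
  assumes M: "module R M" and N: "module S N" and \<phi>: "\<phi> \<in> ring_hom R S" and f: "semilinear_map \<phi> R M N f"
  shows "f \<zero>\<^bsub>M\<^esub> = \<zero>\<^bsub>N\<^esub>"
proof -
  interpret M: module R M by fact
  interpret N: module S N by fact
  have "f (\<zero>\<^bsub>R\<^esub> \<odot>\<^bsub>M\<^esub> \<zero>\<^bsub>M\<^esub>) = \<phi> \<zero>\<^bsub>R\<^esub> \<odot>\<^bsub>N\<^esub> f \<zero>\<^bsub>M\<^esub>" by (rule semilinear_mapD(3)[OF f]) auto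
  then show ?thesis using ring_hom_zero[OF \<phi> M.R.ring_axioms N.R.ring_axioms] semilinear_mapD(1)[OF f M.M.zero_closed] by simp
qed

lemma deformation_module:
  fixes A :: "'a ring" and L :: "('a, 'l) module" and F :: "('a, 'f) module" and R :: "'u ring" and M :: "('u, 'b) module"
  assumes L: "module A L" and F: "module A F" and M: "module R M" and \<pi>: "\<pi> \<in> ring_hom R A"
    and j: "linear_map A L F j" and inj: "inj_on j (carrier L)" and p: "semilinear_map \<pi> R M F p"
  shows "module R (deformation L j M p)" and "semilinear_map \<pi> R (deformation L j M p) L (deformation_proj L j p)"
    and "carrier (deformation L j M p) \<subseteq> carrier M"
    and "x \<in> carrier (deformation L j M p) \<Longrightarrow> j (deformation_proj L j p x) = p x"
proof -
  interpret L: module A L by fact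
  interpret F: module A F by fact
  interpret M: module R M by fact
  note j' = semilinear_mapD[OF j] and p' = semilinear_mapD[OF p]
  have j0: "j \<zero>\<^bsub>L\<^esub> = \<zero>\<^bsub>F\<^esub>" by (rule semilinear_zero[OF L F id_ring_hom[OF L.R.ring_axioms] j])
  have p0: "p \<zero>\<^bsub>M\<^esub> = \<zero>\<^bsub>F\<^esub>" by (rule semilinear_zero[OF M F \<pi> p])
  let ?E = "{x \<in> carrier M. p x \<in> j ` carrier L}"
  have add: "x \<oplus>\<^bsub>M\<^esub> y \<in> ?E" if "x \<in> ?E" "y \<in> ?E" for x y
  proof -
    from that obtain a b where ab: "a \<in> carrier L" "b \<in> carrier L" "p x = j a" "p y = j b" and xy: "x \<in> carrier M" "y \<in> carrier M" by blast
    have "p (x \<oplus>\<^bsub>M\<^esub> y) = j (a \<oplus>\<^bsub>L\<^esub> b)" using p'(2)[OF xy] j'(2)[OF ab(1,2)] ab by simp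
    then show ?thesis using ab xy by blast
  qed
  have smult: "r \<odot>\<^bsub>M\<^esub> x \<in> ?E" if r: "r \<in> carrier R" and "x \<in> ?E" for r x
  proof -
    from that obtain a where a: "a \<in> carrier L" "p x = j a" and x: "x \<in> carrier M" by blast
    have "p (r \<odot>\<^bsub>M\<^esub> x) = j (\<pi> r \<odot>\<^bsub>L\<^esub> a)" using p'(3)[OF r x] j'(3)[OF ring_hom_closed[OF \<pi> r] a(1)] a by simp
    then show ?thesis using a x r ring_hom_closed[OF \<pi> r] by blast
  qed
  have "submodule ?E R M"
  proof (rule M.submoduleI)
    show "\<zero>\<^bsub>M\<^esub> \<in> ?E" using p0 j0 by (metis (mono_tags, lifting) L.M.zero_closed M.M.zero_closed image_eqI mem_Collect_eq)
    show "\<ominus>\<^bsub>M\<^esub> x \<in> ?E" if x: "x \<in> ?E" for x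
    proof -
      have "(\<ominus>\<^bsub>R\<^esub> \<one>\<^bsub>R\<^esub>) \<odot>\<^bsub>M\<^esub> x = \<ominus>\<^bsub>M\<^esub> x" using M.smult_l_minus[of "\<one>\<^bsub>R\<^esub>" x] x by simp
      then show ?thesis using smult[OF _ x, of "\<ominus>\<^bsub>R\<^esub> \<one>\<^bsub>R\<^esub>"] by simp
    qed
  qed (use add smult in blast)+
  from submodule.submodule_is_module[OF this M] show mE: "module R (deformation L j M p)" by (simp add: deformation_def)
  show "carrier (deformation L j M p) \<subseteq> carrier M" by (auto simp: deformation_def)
  have jp: "deformation_proj L j p x \<in> carrier L \<and> j (deformation_proj L j p x) = p x" if "x \<in> carrier (deformation L j M p)" for x
    using that f_inv_into_f[of "p x" j "carrier L"] inv_into_into[of "p x" j "carrier L"] by (simp add: deformation_def deformation_proj_def)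
  then show "x \<in> carrier (deformation L j M p) \<Longrightarrow> j (deformation_proj L j p x) = p x" by blast
  have uniq: "a = b" if "a \<in> carrier L" "b \<in> carrier L" "j a = j b" for a b using inj that by (auto dest: inj_onD)
  show "semilinear_map \<pi> R (deformation L j M p) L (deformation_proj L j p)"
    unfolding semilinear_map_def
  proof (intro conjI ballI)
    show "deformation_proj L j p \<in> carrier (deformation L j M p) \<rightarrow> carrier L" using jp by blast
    fix x assume x: "x \<in> carrier (deformation L j M p)"
    have xM: "x \<in> carrier M" using x by (simp add: deformation_def)
    show "deformation_proj L j p (x \<oplus>\<^bsub>deformation L j M p\<^esub> y) = deformation_proj L j p x \<oplus>\<^bsub>L\<^esub> deformation_proj L j p y"
      if y: "y \<in> carrier (deformation L j M p)" for y
    proof (rule uniq)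
      have yM: "y \<in> carrier M" using y by (simp add: deformation_def)
      have s: "x \<oplus>\<^bsub>deformation L j M p\<^esub> y \<in> carrier (deformation L j M p)" "x \<oplus>\<^bsub>deformation L j M p\<^esub> y = x \<oplus>\<^bsub>M\<^esub> y"
        using add x y by (simp_all add: deformation_def)
      show "deformation_proj L j p (x \<oplus>\<^bsub>deformation L j M p\<^esub> y) \<in> carrier L" using jp[OF s(1)] by blast
      show "deformation_proj L j p x \<oplus>\<^bsub>L\<^esub> deformation_proj L j p y \<in> carrier L" using jp[OF x] jp[OF y] by simp
      show "j (deformation_proj L j p (x \<oplus>\<^bsub>deformation L j M p\<^esub> y)) = j (deformation_proj L j p x \<oplus>\<^bsub>L\<^esub> deformation_proj L j p y)"
        using jp[OF s(1)] jp[OF x] jp[OF y] p'(2)[OF xM yM] s(2) by (simp add: j'(2))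
    qed
    show "deformation_proj L j p (r \<odot>\<^bsub>deformation L j M p\<^esub> x) = \<pi> r \<odot>\<^bsub>L\<^esub> deformation_proj L j p x"
      if r: "r \<in> carrier R" for r
    proof (rule uniq)
      have s: "r \<odot>\<^bsub>deformation L j M p\<^esub> x \<in> carrier (deformation L j M p)" "r \<odot>\<^bsub>deformation L j M p\<^esub> x = r \<odot>\<^bsub>M\<^esub> x"
        using smult[OF r] x by (simp_all add: deformation_def)
      have \<pi>r: "\<pi> r \<in> carrier A" using ring_hom_closed[OF \<pi> r] .
      show "deformation_proj L j p (r \<odot>\<^bsub>deformation L j M p\<^esub> x) \<in> carrier L" using jp[OF s(1)] by blast
      show "\<pi> r \<odot>\<^bsub>L\<^esub> deformation_proj L j p x \<in> carrier L" using jp[OF x] \<pi>r by simp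
      show "j (deformation_proj L j p (r \<odot>\<^bsub>deformation L j M p\<^esub> x)) = j (\<pi> r \<odot>\<^bsub>L\<^esub> deformation_proj L j p x)"
        using jp[OF s(1)] jp[OF x] p'(3)[OF r xM] s(2) \<pi>r by (simp add: j'(3))
    qed
  qed
qed

section \<open>Tensor products along surjections\<close>

lemma comm_monoid_DirProd:
  assumes "comm_monoid G" "comm_monoid H" shows "comm_monoid (G \<times>\<times> H)"
proof -
  interpret G: comm_monoid G by fact
  interpret H: comm_monoid H by fact
  show ?thesis by (rule comm_monoidI) (auto simp: DirProd_def G.m_ac H.m_ac)
qed

lemma of_integer_hom:
  assumes "cring C" shows "of_integer C \<in> ring_hom \<Z> C"
proof -
  interpret cring C by fact
  show ?thesis by (rule ring_hom_memI) auto
qed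

text \<open>With both structure maps onto, \<open>B \<otimes>\<^sub>S C\<close> is \<open>B\<close>
  modulo the image under \<open>f\<close> of the kernel of \<open>g\<close>. Balancing moves every
  second factor to the left, so \<open>b \<otimes> 1\<close> already gives everything; the kernel is
  found by mapping the tensor product to that quotient.\<close>

lemma tensor_ring_quotient:
  fixes S :: "('s, 'l) ring_scheme" and B :: "('b, 'm) ring_scheme" and C :: "('c, 'n) ring_scheme"
  assumes S: "cring S" and B: "cring B" and C: "cring C"
    and f: "f \<in> ring_hom S B" and fs: "f ` carrier S = carrier B"
    and g: "g \<in> ring_hom S C" and gs: "g ` carrier S = carrier C"
  defines "T \<equiv> tensor_ring S B f C g" and "\<Psi> \<equiv> \<lambda>b. pure_tensor S B f C g b \<one>\<^bsub>C\<^esub>"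
  shows "cring T" and "\<Psi> \<in> ring_hom B T" and "\<Psi> ` carrier B = carrier T"
    and "b \<in> carrier B \<Longrightarrow> s \<in> carrier S \<Longrightarrow> pure_tensor S B f C g b (g s) = \<Psi> (b \<otimes>\<^bsub>B\<^esub> f s)"
    and "b \<in> carrier B \<Longrightarrow> \<Psi> b = \<zero>\<^bsub>T\<^esub> \<longleftrightarrow> (\<exists>s\<in>carrier S. g s = \<zero>\<^bsub>C\<^esub> \<and> f s = b)"
proof -
  interpret S: cring S by fact
  interpret B: cring B by fact
  interpret C: cring C by fact
  interpret f: ring_hom_ring S B f by unfold_locales (rule f)
  interpret g: ring_hom_ring S C g by unfold_locales (rule g)
  let ?G = "B \<times>\<times> C"
  interpret M: comm_monoid_algebra \<Z> ?G
    by (intro comm_monoid_algebra.intro int_is_cring comm_monoid_DirProd B.comm_monoid_axioms C.comm_monoid_axioms)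
  have Gs: "x \<in> carrier ?G \<longleftrightarrow> fst x \<in> carrier B \<and> snd x \<in> carrier C"
    "(b, c) \<otimes>\<^bsub>?G\<^esub> (b', c') = (b \<otimes>\<^bsub>B\<^esub> b', c \<otimes>\<^bsub>C\<^esub> c')" "\<one>\<^bsub>?G\<^esub> = (\<one>\<^bsub>B\<^esub>, \<one>\<^bsub>C\<^esub>)" for x b c b' c'
    by (simp_all add: DirProd_def mem_Times_iff)
  let ?R = "pair_ring B C"
  let ?m = "\<lambda>b c. monomial \<Z> 1 (b, c)"
  have mc: "?m b c \<in> carrier ?R" if "b \<in> carrier B" "c \<in> carrier C" for b c
    using M.monomial_closed[of 1 "(b, c)"] that by (simp add: Gs)
  let ?rel1 = "{?m (b \<oplus>\<^bsub>B\<^esub> b') c \<ominus>\<^bsub>?R\<^esub> (?m b c \<oplus>\<^bsub>?R\<^esub> ?m b' c) | b b' c. b \<in> carrier B \<and> b' \<in> carrier B \<and> c \<in> carrier C}"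
  let ?rel2 = "{?m b (c \<oplus>\<^bsub>C\<^esub> c') \<ominus>\<^bsub>?R\<^esub> (?m b c \<oplus>\<^bsub>?R\<^esub> ?m b c') | b c c'. b \<in> carrier B \<and> c \<in> carrier C \<and> c' \<in> carrier C}"
  let ?rel3 = "{?m (f s \<otimes>\<^bsub>B\<^esub> b) c \<ominus>\<^bsub>?R\<^esub> ?m b (g s \<otimes>\<^bsub>C\<^esub> c) | s b c. s \<in> carrier S \<and> b \<in> carrier B \<and> c \<in> carrier C}"
  let ?rel = "?rel1 \<union> ?rel2 \<union> ?rel3"
  let ?I = "tensor_ideal S B f C g"
  have I_eq: "?I = genideal ?R ?rel" by (simp only: tensor_ideal_def)
  have relc: "?rel \<subseteq> carrier ?R"
  proof (intro Un_least subsetI)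
    fix x assume "x \<in> ?rel1"
    then show "x \<in> carrier ?R" using mc by (elim CollectE exE conjE) (simp only:, intro M.MA.minus_closed M.MA.a_closed mc B.a_closed)
  next
    fix x assume "x \<in> ?rel2"
    then show "x \<in> carrier ?R" using mc by (elim CollectE exE conjE) (simp only:, intro M.MA.minus_closed M.MA.a_closed mc C.a_closed)
  next
    fix x assume "x \<in> ?rel3"
    then show "x \<in> carrier ?R" using mc by (elim CollectE exE conjE) (simp only:, intro M.MA.minus_closed mc B.m_closed C.m_closed f.hom_closed g.hom_closed)
  qed
  have relI: "?rel \<subseteq> ?I" unfolding I_eq by (rule M.MA.genideal_self[OF relc])
  interpret I: ideal ?I ?R unfolding I_eq by (rule M.MA.genideal_ideal[OF relc])
  interpret T: cring T unfolding T_def tensor_ring_def by (rule I.quotient_is_cring[OF M.cring_MA])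
  let ?q = "(+>\<^bsub>?R\<^esub>) ?I"
  interpret q: ring_hom_ring ?R T ?q unfolding T_def tensor_ring_def by (rule I.rcos_ring_hom_ring)
  have p_def: "pure_tensor S B f C g b c = ?q (?m b c)" for b c by (simp add: pure_tensor_def)
  have q_eq: "?q x = ?q y" if "x \<in> carrier ?R" "y \<in> carrier ?R" "x \<ominus>\<^bsub>?R\<^esub> y \<in> ?rel" for x y
    using I.quot_eq_iff[OF that(1,2)] that(3) relI by blast
  have pB: "?q (?m (b \<oplus>\<^bsub>B\<^esub> b') c) = ?q (?m b c) \<oplus>\<^bsub>T\<^esub> ?q (?m b' c)" if "b \<in> carrier B" "b' \<in> carrier B" "c \<in> carrier C" for b b' c
  proof -
    have "?q (?m (b \<oplus>\<^bsub>B\<^esub> b') c) = ?q (?m b c \<oplus>\<^bsub>?R\<^esub> ?m b' c)" by (rule q_eq) (use that mc in \<open>auto\<close>)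
    then show ?thesis using mc that by simp
  qed
  have pC: "?q (?m b (c \<oplus>\<^bsub>C\<^esub> c')) = ?q (?m b c) \<oplus>\<^bsub>T\<^esub> ?q (?m b c')" if "b \<in> carrier B" "c' \<in> carrier C" "c \<in> carrier C" for b c' c
  proof -
    have "?q (?m b (c \<oplus>\<^bsub>C\<^esub> c')) = ?q (?m b c \<oplus>\<^bsub>?R\<^esub> ?m b c')" by (rule q_eq) (use that mc in \<open>auto\<close>)
    then show ?thesis using mc that by simp
  qed
  have pS: "?q (?m (f s \<otimes>\<^bsub>B\<^esub> b) c) = ?q (?m b (g s \<otimes>\<^bsub>C\<^esub> c))" if "s \<in> carrier S" "b \<in> carrier B" "c \<in> carrier C" for s b c
    by (rule q_eq) (use that mc in \<open>auto\<close>)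
  show "cring T" by (rule T.cring_axioms)
  have \<Psi>: "\<Psi> b = ?q (?m b \<one>\<^bsub>C\<^esub>)" for b by (simp add: \<Psi>_def p_def)
  show \<Psi>h: "\<Psi> \<in> ring_hom B T"
  proof (rule ring_hom_memI)
    fix b assume b: "b \<in> carrier B"
    show "\<Psi> b \<in> carrier T" using b mc by (simp add: \<Psi>)
    fix b' assume b': "b' \<in> carrier B"
    show "\<Psi> (b \<oplus>\<^bsub>B\<^esub> b') = \<Psi> b \<oplus>\<^bsub>T\<^esub> \<Psi> b'" using pB b b' by (simp add: \<Psi>)
    have "?m (b \<otimes>\<^bsub>B\<^esub> b') \<one>\<^bsub>C\<^esub> = ?m b \<one>\<^bsub>C\<^esub> \<otimes>\<^bsub>?R\<^esub> ?m b' \<one>\<^bsub>C\<^esub>"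
      using M.monomial_mult[of 1 1 "(b, \<one>\<^bsub>C\<^esub>)" "(b', \<one>\<^bsub>C\<^esub>)"] b b' by (simp add: Gs)
    then show "\<Psi> (b \<otimes>\<^bsub>B\<^esub> b') = \<Psi> b \<otimes>\<^bsub>T\<^esub> \<Psi> b'" using b b' mc by (simp add: \<Psi>)
  next
    have "?m \<one>\<^bsub>B\<^esub> \<one>\<^bsub>C\<^esub> = \<one>\<^bsub>?R\<^esub>" using M.MA_simps(3) by (simp add: Gs)
    then show "\<Psi> \<one>\<^bsub>B\<^esub> = \<one>\<^bsub>T\<^esub>" using q.hom_one by (simp add: \<Psi>)
  qed
  interpret \<Psi>: ring_hom_ring B T \<Psi> by unfold_locales (rule \<Psi>h)
  have pure: "pure_tensor S B f C g b (g s) = \<Psi> (b \<otimes>\<^bsub>B\<^esub> f s)" if "b \<in> carrier B" "s \<in> carrier S" for b s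
    using pS[of s b "\<one>\<^bsub>C\<^esub>"] that by (simp add: \<Psi> p_def B.m_comm)
  then show "b \<in> carrier B \<Longrightarrow> s \<in> carrier S \<Longrightarrow> pure_tensor S B f C g b (g s) = \<Psi> (b \<otimes>\<^bsub>B\<^esub> f s)" .
  have pure_in: "?q (?m b c) \<in> \<Psi> ` carrier B" if bc: "b \<in> carrier B" "c \<in> carrier C" for b c
  proof -
    obtain s where s: "s \<in> carrier S" "c = g s" using gs bc(2) by blast
    have "?q (?m b c) = \<Psi> (b \<otimes>\<^bsub>B\<^esub> f s)" using pure[OF bc(1) s(1)] s(2) p_def[of b c] by simp
    then show ?thesis using imageI[OF B.m_closed[OF bc(1) f.hom_closed[OF s(1)]], of \<Psi>] by simp
  qed
  have img_add: "x \<oplus>\<^bsub>T\<^esub> y \<in> \<Psi> ` carrier B" if "x \<in> \<Psi> ` carrier B" "y \<in> \<Psi> ` carrier B" for x y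
  proof -
    from that obtain a b where "a \<in> carrier B" "b \<in> carrier B" "x = \<Psi> a" "y = \<Psi> b" by blast
    then show ?thesis using B.a_closed by (auto simp flip: \<Psi>.hom_add intro!: imageI)
  qed
  have img_minus: "\<ominus>\<^bsub>T\<^esub> x \<in> \<Psi> ` carrier B" if "x \<in> \<Psi> ` carrier B" for x
  proof -
    from that obtain a where "a \<in> carrier B" "x = \<Psi> a" by blast
    then show ?thesis using B.a_inv_closed by (auto simp flip: \<Psi>.hom_a_inv intro!: imageI)
  qed
  \<comment> \<open>Coefficients are integers, so every monomial arises from zero by repeatedly
    adding or subtracting one pure tensor, in either direction.\<close>
  have zmono: "?q (monomial \<Z> z (b, c)) \<in> \<Psi> ` carrier B" if bc: "b \<in> carrier B" "c \<in> carrier C" for z b c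
  proof -
    have mzc: "monomial \<Z> z (b, c) \<in> carrier ?R" for z using M.monomial_closed[of z "(b, c)"] bc by (simp add: Gs)
    have step: "?q (monomial \<Z> (x + y) (b, c)) = ?q (monomial \<Z> x (b, c)) \<oplus>\<^bsub>T\<^esub> ?q (monomial \<Z> y (b, c))" for x y
      using M.monomial_add[of x y "(b, c)"] mzc by simp
    have zero: "?q (monomial \<Z> 0 (b, c)) = \<zero>\<^bsub>T\<^esub>" using M.monomial_zero[of "(b, c)"] q.hom_zero by simp
    have m1: "?q (monomial \<Z> (-1) (b, c)) = \<ominus>\<^bsub>T\<^esub> ?q (?m b c)"
      using step[of "-1" 1] zero mzc by (intro T.minus_equality[symmetric]) auto
    show ?thesis
    proof (induction z rule: int_induct[where k = 0])
      case base
      have "\<zero>\<^bsub>T\<^esub> = \<Psi> \<zero>\<^bsub>B\<^esub>" by simp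
      then show ?case unfolding zero by (rule image_eqI) simp
    next
      case (step1 i)
      then show ?case using step[of i 1] img_add pure_in[OF bc] by simp
    next
      case (step2 i)
      then show ?case using step[of i "-1"] m1 img_add img_minus pure_in[OF bc] by simp
    qed
  qed
  show "\<Psi> ` carrier B = carrier T"
  proof
    show "\<Psi> ` carrier B \<subseteq> carrier T" by auto
    show "carrier T \<subseteq> \<Psi> ` carrier B"
    proof
      fix X assume "X \<in> carrier T"
      then obtain p where p: "p \<in> carrier ?R" "X = ?q p" using I.quot_surj unfolding T_def tensor_ring_def by blast
      have "?q p \<in> \<Psi> ` carrier B" using p(1)
      proof (induction rule: M.MA_induct)
        case zero
        have "?q \<zero>\<^bsub>?R\<^esub> = \<Psi> \<zero>\<^bsub>B\<^esub>" by simp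
        then show ?case by (metis B.zero_closed imageI)
      next
        case (add r x t)
        obtain b c where x: "x = (b, c)" by (cases x)
        have bc: "b \<in> carrier B" "c \<in> carrier C" using add(2) x by (auto simp: Gs)
        have "?q (monomial \<Z> r x \<oplus>\<^bsub>?R\<^esub> t) = ?q (monomial \<Z> r x) \<oplus>\<^bsub>T\<^esub> ?q t"
          by (rule q.hom_add) (use add in auto)
        then show ?case using img_add[OF zmono[OF bc, of r] add.IH] x by simp
      qed
      then show "X \<in> \<Psi> ` carrier B" using p by simp
    qed
  qed
  show "\<Psi> b = \<zero>\<^bsub>T\<^esub> \<longleftrightarrow> (\<exists>s\<in>carrier S. g s = \<zero>\<^bsub>C\<^esub> \<and> f s = b)" if b: "b \<in> carrier B" for b
  proof
    assume "\<exists>s\<in>carrier S. g s = \<zero>\<^bsub>C\<^esub> \<and> f s = b"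
    then obtain s where s: "s \<in> carrier S" "g s = \<zero>\<^bsub>C\<^esub>" "f s = b" by blast
    have "\<Psi> b = ?q (?m \<one>\<^bsub>B\<^esub> \<zero>\<^bsub>C\<^esub>)" using pure[OF B.one_closed s(1)] s b by (simp add: p_def)
    moreover have "?q (?m \<one>\<^bsub>B\<^esub> \<zero>\<^bsub>C\<^esub>) = \<zero>\<^bsub>T\<^esub>"
      using pC[of "\<one>\<^bsub>B\<^esub>" "\<zero>\<^bsub>C\<^esub>" "\<zero>\<^bsub>C\<^esub>"] mc[of "\<one>\<^bsub>B\<^esub>" "\<zero>\<^bsub>C\<^esub>"] T.add.l_cancel_one[of "?q (?m \<one>\<^bsub>B\<^esub> \<zero>\<^bsub>C\<^esub>)" "?q (?m \<one>\<^bsub>B\<^esub> \<zero>\<^bsub>C\<^esub>)"] by simp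
    ultimately show "\<Psi> b = \<zero>\<^bsub>T\<^esub>" by simp
  next
    assume \<Psi>b: "\<Psi> b = \<zero>\<^bsub>T\<^esub>"
    \<comment> \<open>The expected kernel. It is closed under multiplication by \<open>B\<close>
      because \<open>f\<close> is onto.\<close>
    let ?K = "f ` {s \<in> carrier S. g s = \<zero>\<^bsub>C\<^esub>}"
    have "B.subideal (carrier B) ?K"
      unfolding B.subideal_def
    proof (intro conjI ballI)
      show "?K \<subseteq> carrier B" by auto
      show "\<zero>\<^bsub>B\<^esub> \<in> ?K" by (rule image_eqI[of _ _ "\<zero>\<^bsub>S\<^esub>"]) auto
      fix x assume "x \<in> ?K"
      then obtain s where s: "s \<in> carrier S" "g s = \<zero>\<^bsub>C\<^esub>" "x = f s" by auto
      show "x \<oplus>\<^bsub>B\<^esub> y \<in> ?K" if "y \<in> ?K" for y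
      proof -
        from that obtain t where t: "t \<in> carrier S" "g t = \<zero>\<^bsub>C\<^esub>" "y = f t" by auto
        show ?thesis by (rule image_eqI[of _ _ "s \<oplus>\<^bsub>S\<^esub> t"]) (use s t in \<open>auto\<close>)
      qed
      show "r \<otimes>\<^bsub>B\<^esub> x \<in> ?K" if "r \<in> carrier B" for r
      proof -
        from that fs obtain t where t: "t \<in> carrier S" "r = f t" by blast
        show ?thesis by (rule image_eqI[of _ _ "t \<otimes>\<^bsub>S\<^esub> s"]) (use s t in \<open>auto\<close>)
      qed
    qed
    then have K: "ideal ?K B" by (simp add: B.subideal_carrier_iff)
    interpret K: ideal ?K B by (rule K)
    let ?Q = "B Quot ?K"
    let ?k = "(+>\<^bsub>B\<^esub>) ?K"
    interpret Q: cring ?Q by (rule K.quotient_is_cring[OF B])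
    interpret k: ring_hom_ring B ?Q ?k by (rule K.rcos_ring_hom_ring)
    define \<sigma> where "\<sigma> c = inv_into (carrier S) g c" for c
    have \<sigma>: "\<sigma> c \<in> carrier S" "g (\<sigma> c) = c" if "c \<in> carrier C" for c
      using that gs by (auto simp: \<sigma>_def inv_into_into f_inv_into_f)
    have k_eq: "?k (f s) = ?k (f t)" if st: "s \<in> carrier S" "t \<in> carrier S" "g s = g t" for s t
    proof -
      have "g (s \<ominus>\<^bsub>S\<^esub> t) = \<zero>\<^bsub>C\<^esub>" using st by (simp add: a_minus_def C.r_neg)
      then have "s \<ominus>\<^bsub>S\<^esub> t \<in> {s \<in> carrier S. g s = \<zero>\<^bsub>C\<^esub>}" using S.minus_closed[OF st(1,2)] by blast
      then have "f s \<ominus>\<^bsub>B\<^esub> f t \<in> ?K" using st by (intro image_eqI[of _ _ "s \<ominus>\<^bsub>S\<^esub> t"]) (auto simp: a_minus_def)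
      then show ?thesis using K.quot_eq_iff[of "f s" "f t"] st by simp
    qed
    \<comment> \<open>A pure tensor is sent to the class of \<open>b\<close> times \<open>f\<close>
      of a lift of \<open>c\<close>. The chosen lifts need not be multiplicative, but modulo
      \<open>?K\<close> any lift gives the same class, and hence \<open>\<mu>\<close> is
      multiplicative.\<close>
    define \<mu> where "\<mu> x = ?k (fst x \<otimes>\<^bsub>B\<^esub> f (\<sigma> (snd x)))" for x
    have \<mu>': "\<mu> (b, c) = ?k b \<otimes>\<^bsub>?Q\<^esub> ?k (f (\<sigma> c))" if "b \<in> carrier B" "c \<in> carrier C" for b c
      using that \<sigma> by (simp add: \<mu>_def)
    have \<mu>s: "\<mu> (b, g s) = ?k b \<otimes>\<^bsub>?Q\<^esub> ?k (f s)" if "b \<in> carrier B" "s \<in> carrier S" for b s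
      using that \<mu>'[of b "g s"] k_eq[of "\<sigma> (g s)" s] \<sigma>[of "g s"] by simp
    have \<mu>c: "\<mu> \<in> carrier ?G \<rightarrow> carrier ?Q" using \<sigma> by (auto simp: \<mu>_def Gs intro!: k.hom_closed)
    have \<mu>m: "\<mu> (x \<otimes>\<^bsub>?G\<^esub> y) = \<mu> x \<otimes>\<^bsub>?Q\<^esub> \<mu> y" if "x \<in> carrier ?G" "y \<in> carrier ?G" for x y
    proof -
      obtain b c b' c' where x: "x = (b, c)" "y = (b', c')" by (cases x, cases y)
      have bc: "b \<in> carrier B" "c \<in> carrier C" "b' \<in> carrier B" "c' \<in> carrier C" using that x by (auto simp: Gs)
      obtain s t where st: "s \<in> carrier S" "c = g s" "t \<in> carrier S" "c' = g t" using bc gs by blast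
      have "\<mu> (b \<otimes>\<^bsub>B\<^esub> b', g (s \<otimes>\<^bsub>S\<^esub> t)) = ?k (b \<otimes>\<^bsub>B\<^esub> b') \<otimes>\<^bsub>?Q\<^esub> ?k (f (s \<otimes>\<^bsub>S\<^esub> t))"
        by (rule \<mu>s) (use bc st in auto)
      then show ?thesis using x bc st \<mu>s by (simp add: Gs Q.m_ac)
    qed
    have \<mu>1: "\<mu> \<one>\<^bsub>?G\<^esub> = \<one>\<^bsub>?Q\<^esub>" using \<mu>s[of "\<one>\<^bsub>B\<^esub>" "\<one>\<^bsub>S\<^esub>"] by (simp add: Gs)
    let ?ev = "monoid_algebra_eval \<Z> ?Q (of_integer ?Q) \<mu>"
    have ev: "?ev \<in> ring_hom ?R ?Q" by (rule M.eval_ring_hom[OF Q.cring_axioms of_integer_hom[OF Q.cring_axioms] \<mu>c \<mu>m \<mu>1])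
    interpret ev: ring_hom_ring ?R ?Q ?ev by unfold_locales (rule ev)
    have evm: "?ev (?m b c) = \<mu> (b, c)" if "b \<in> carrier B" "c \<in> carrier C" for b c
    proof -
      have "\<mu> (b, c) \<in> carrier ?Q" using funcset_mem[OF \<mu>c, of "(b, c)"] that by (simp add: Gs)
      then show ?thesis
        using M.eval_monomial[OF Q.cring_axioms of_integer_hom[OF Q.cring_axioms] \<mu>c \<mu>m \<mu>1, of 1 "(b, c)"] that
        by (simp add: Gs)
    qed
    have ev0: "?ev (x \<ominus>\<^bsub>?R\<^esub> y) = \<zero>\<^bsub>?Q\<^esub>" if "x \<in> carrier ?R" "y \<in> carrier ?R" "?ev x = ?ev y" for x y
      using that by (simp add: a_minus_def Q.r_neg)
    have ev_rel: "?ev x = \<zero>\<^bsub>?Q\<^esub>" if "x \<in> ?rel" for x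
      using that
    proof (elim UnE CollectE exE conjE)
      fix b b' c assume bc: "b \<in> carrier B" "b' \<in> carrier B" "c \<in> carrier C" and x: "x = ?m (b \<oplus>\<^bsub>B\<^esub> b') c \<ominus>\<^bsub>?R\<^esub> (?m b c \<oplus>\<^bsub>?R\<^esub> ?m b' c)"
      obtain s where s: "s \<in> carrier S" "c = g s" using bc gs by blast
      show ?thesis unfolding x by (rule ev0) (use bc mc s in \<open>simp_all add: evm \<mu>s Q.l_distr\<close>)
    next
      fix b c c' assume bc: "b \<in> carrier B" "c \<in> carrier C" "c' \<in> carrier C" and x: "x = ?m b (c \<oplus>\<^bsub>C\<^esub> c') \<ominus>\<^bsub>?R\<^esub> (?m b c \<oplus>\<^bsub>?R\<^esub> ?m b c')"
      obtain s t where s: "s \<in> carrier S" "c = g s" "t \<in> carrier S" "c' = g t" using bc gs by blast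
      have "\<mu> (b, g (s \<oplus>\<^bsub>S\<^esub> t)) = ?k b \<otimes>\<^bsub>?Q\<^esub> ?k (f (s \<oplus>\<^bsub>S\<^esub> t))" by (rule \<mu>s) (use bc s in auto)
      then show ?thesis unfolding x by (intro ev0) (use bc mc s in \<open>simp_all add: evm \<mu>s Q.r_distr\<close>)
    next
      fix s b c assume bc: "s \<in> carrier S" "b \<in> carrier B" "c \<in> carrier C" and x: "x = ?m (f s \<otimes>\<^bsub>B\<^esub> b) c \<ominus>\<^bsub>?R\<^esub> ?m b (g s \<otimes>\<^bsub>C\<^esub> c)"
      obtain t where t: "t \<in> carrier S" "c = g t" using bc gs by blast
      have "\<mu> (b, g (s \<otimes>\<^bsub>S\<^esub> t)) = ?k b \<otimes>\<^bsub>?Q\<^esub> ?k (f (s \<otimes>\<^bsub>S\<^esub> t))" by (rule \<mu>s) (use bc t in auto)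
      then show ?thesis unfolding x by (intro ev0) (use bc mc t in \<open>simp_all add: evm \<mu>s Q.m_ac\<close>)
    qed
    have "?rel \<subseteq> a_kernel ?R ?Q ?ev"
    proof
      fix x assume x: "x \<in> ?rel"
      show "x \<in> a_kernel ?R ?Q ?ev"
        by (rule mem_a_kernel[of x ?R ?Q ?ev, THEN iffD2], rule conjI[OF subsetD[OF relc x] ev_rel[OF x]])
    qed
    then have "?I \<subseteq> a_kernel ?R ?Q ?ev" unfolding I_eq by (intro M.MA.genideal_minimal ev.kernel_is_ideal)
    then have evI: "?ev x = \<zero>\<^bsub>?Q\<^esub>" if "x \<in> ?I" for x using conjunct2[OF mem_a_kernel[THEN iffD1, OF subsetD[OF _ that]]] by simp
    from I.quot_lift[OF Q.ring_axioms ev evI] obtain \<Theta> where \<Theta>: "\<Theta> \<in> ring_hom T ?Q" "\<And>x. x \<in> carrier ?R \<Longrightarrow> \<Theta> (?q x) = ?ev x"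
      unfolding T_def tensor_ring_def by blast
    have "\<Theta> (\<Psi> b) = ?k b"
      using \<Theta>(2)[OF mc[OF b C.one_closed]] evm[OF b C.one_closed] \<mu>s[OF b S.one_closed] b by (simp add: \<Psi>)
    then have "?k b = \<zero>\<^bsub>?Q\<^esub>" using \<Psi>b ring_hom_zero[OF \<Theta>(1) T.ring_axioms Q.ring_axioms] by simp
    then have "b \<in> ?K" using K.quot_eq_zero_iff[OF b] K.quot_zero by metis
    then show "\<exists>s\<in>carrier S. g s = \<zero>\<^bsub>C\<^esub> \<and> f s = b" by auto
  qed
qed

section \<open>Polynomial covers\<close>

lemma coverD:
  assumes "U \<in> covers k A \<alpha>"
  shows "finite_type_algebra k (cov_ring U) (cov_str U)" "cring (cov_ring U)" "cov_str U \<in> ring_hom k (cov_ring U)"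
    "cov_proj U \<in> ring_hom (cov_ring U) A" "a \<in> carrier k \<Longrightarrow> cov_proj U (cov_str U a) = \<alpha> a"
    "cov_proj U ` carrier (cov_ring U) = carrier A"
  using assms by (auto simp: covers_def finite_type_algebra_def comm_algebra_def algebra_hom_def)

lemma cover_mapsD:
  assumes "\<phi> \<in> cover_maps k U Y"
  shows "\<phi> \<in> ring_hom (cov_ring U) (cov_ring Y)" "a \<in> carrier k \<Longrightarrow> \<phi> (cov_str U a) = cov_str Y a"
    "\<phi> ` carrier (cov_ring U) = carrier (cov_ring Y)"
    "r \<in> carrier (cov_ring U) \<Longrightarrow> cov_proj Y (\<phi> r) = cov_proj U r"
    "\<phi> \<in> algebra_hom k (cov_ring U) (cov_str U) (cov_ring Y) (cov_str Y)"
  using assms by (auto simp: cover_maps_def algebra_hom_def)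

lemma generate_ring_image_subset:
  assumes R: "ring R" and S: "ring S" and h: "h \<in> ring_hom R S" and H: "H \<subseteq> carrier R"
  shows "h ` generate_ring R H \<subseteq> generate_ring S (h ` H)"
proof -
  interpret R: ring R by fact
  interpret S: ring S by fact
  interpret h: ring_hom_ring R S h by unfold_locales (rule h)
  have "h x \<in> generate_ring S (h ` H)" if "x \<in> generate_ring R H" for x
    using that
  proof induction
    case one
    then show ?case using generate_ring.one[of S] by simp
  next
    case (incl x)
    then show ?case by (intro generate_ring.incl) simp
  next
    case (a_inv x)
    then show ?case using R.generate_ring_in_carrier[OF H] generate_ring.a_inv by (simp add: h.hom_a_inv)
  next
    case (eng_add x y)
    then show ?case using R.generate_ring_in_carrier[OF H] generate_ring.eng_add by simp
  next
    case (eng_mult x y)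
    then show ?case using R.generate_ring_in_carrier[OF H] generate_ring.eng_mult by simp
  qed
  then show ?thesis by blast
qed

text \<open>Injective only among lists of equal length, since the code of the empty list may
  coincide with that of a longer one; this is why \<open>el\<close> below stores the length as
  well.\<close>

fun encode_list :: "('u \<times> 'u \<Rightarrow> 'u) \<Rightarrow> 'u list \<Rightarrow> 'u" where
  "encode_list pr [] = pr (undefined, undefined)"
| "encode_list pr (x # xs) = pr (x, encode_list pr xs)"

lemma encode_list_inject:
  assumes pr: "inj pr"
  shows "length xs = length ys \<Longrightarrow> encode_list pr xs = encode_list pr ys \<Longrightarrow> xs = ys"
proof (induction xs ys rule: list_induct2')
  case (4 x xs y ys)
  then show ?case using injD[OF pr] by auto
qed auto

text \<open>An infinite type admits an injective pairing, and with it codes for lists and for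
  monomials. A polynomial is encoded by its finite set of pairs of monomial and coefficient; the set
  is stored as some list enumerating it, and only the underlying set is needed to recover the
  polynomial.\<close>

lemma monoid_algebra_embedding:
  fixes k :: "'k ring" and N :: nat
  assumes univ: "large_universe TYPE('u) k"
  shows "\<exists>enc :: (nat multiset \<Rightarrow> 'k) \<Rightarrow> 'u. inj_on enc (carrier (monoid_algebra k (free_comm_monoid {..<N})))"
proof -
  have inf: "infinite (UNIV :: 'u set)" using univ by (simp add: large_universe_def)
  obtain g :: "'k \<Rightarrow> 'u" where g: "inj_on g (carrier k)" using univ by (auto simp: large_universe_def)
  obtain \<nu> :: "nat \<Rightarrow> 'u" where \<nu>: "inj \<nu>" using infinite_countable_subset[OF inf] by blast
  have "(card_of ((UNIV :: 'u set) \<times> (UNIV :: 'u set)), card_of (UNIV :: 'u set)) \<in> ordIso" by (rule card_of_Times_same_infinite[OF inf])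
  then obtain pr :: "'u \<times> 'u \<Rightarrow> 'u" where "bij_betw pr (UNIV \<times> UNIV) UNIV" using card_of_ordIso by blast
  then have pr: "inj pr" by (simp add: bij_betw_def)
  define el where "el xs = pr (\<nu> (length xs), encode_list pr xs)" for xs
  have el: "xs = ys" if "el xs = el ys" for xs ys
  proof -
    have "(\<nu> (length xs), encode_list pr xs) = (\<nu> (length ys), encode_list pr ys)"
      by (rule injD[OF pr]) (use that in \<open>simp add: el_def\<close>)
    then show ?thesis using encode_list_inject[OF pr] injD[OF \<nu>] by blast
  qed
  define ew where "ew w = el (map \<nu> (sorted_list_of_multiset w))" for w
  have ew: "v = w" if "ew v = ew w" for v w
  proof -
    have "map \<nu> (sorted_list_of_multiset v) = map \<nu> (sorted_list_of_multiset w)" using el that by (simp add: ew_def)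
    then have "sorted_list_of_multiset v = sorted_list_of_multiset w" using \<nu> by (simp add: inj_map_eq_map)
    then show ?thesis by (metis mset_sorted_list_of_multiset)
  qed
  define supp where "supp f = {w. f w \<noteq> \<zero>\<^bsub>k\<^esub>}" for f :: "nat multiset \<Rightarrow> 'k"
  define code where "code f = (\<lambda>w. pr (ew w, g (f w))) ` supp f" for f
  define enc where "enc f = el (SOME xs. set xs = code f)" for f
  let ?C = "carrier (monoid_algebra k (free_comm_monoid {..<N}))"
  have fC: "finite (supp f)" "f w \<in> carrier k" if "f \<in> ?C" "w \<in> supp f" for f w
    using that by (auto simp: monoid_algebra_def supp_def)
  have "set (SOME xs. set xs = code f) = code f" if "f \<in> ?C" for f
  proof (rule someI_ex[of "\<lambda>xs. set xs = code f"])
    have "finite (code f)" using that by (auto simp: monoid_algebra_def supp_def code_def)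
    then show "\<exists>xs. set xs = code f" by (rule finite_list)
  qed
  then have code_eq: "code f = code f'" if "f \<in> ?C" "f' \<in> ?C" "enc f = enc f'" for f f'
    using that el unfolding enc_def by metis
  have sub: "w \<in> supp f' \<and> f w = f' w" if f: "f \<in> ?C" "f' \<in> ?C" "enc f = enc f'" and w: "w \<in> supp f" for f f' w
  proof -
    have "pr (ew w, g (f w)) \<in> code f'" using w code_eq[OF f] by (auto simp: code_def)
    then obtain v where v: "v \<in> supp f'" "pr (ew w, g (f w)) = pr (ew v, g (f' v))" by (auto simp: code_def)
    then have "(ew w, g (f w)) = (ew v, g (f' v))" using injD[OF pr] by blast
    then have "w = v" "g (f w) = g (f' v)" using ew by auto
    then show ?thesis using v(1) inj_onD[OF g _ fC(2)[OF f(1) w] fC(2)[OF f(2) v(1)]] by simp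
  qed
  have "inj_on enc ?C"
  proof (rule inj_onI)
    fix f f' assume f: "f \<in> ?C" "f' \<in> ?C" "enc f = enc f'"
    show "f = f'"
    proof
      fix w
      show "f w = f' w"
      proof (cases "w \<in> supp f")
        case True
        then show ?thesis using sub[OF f] by blast
      next
        case w: False
        then have "w \<notin> supp f'" using sub[OF f(2,1) f(3)[symmetric]] by blast
        then show ?thesis using w unfolding supp_def by simp
      qed
    qed
  qed
  then show ?thesis by blast
qed

text \<open>The variables of the polynomial ring map to pairs of generators with the same image in \<open>A\<close>.\<close>

lemma polynomial_cover:
  fixes k :: "'k ring" and V W :: "('k, 'u, 'a) cover"
  assumes k: "cring k" and A: "cring A" and univ: "large_universe TYPE('u) k"
    and V: "V \<in> covers k A \<alpha>" and W: "W \<in> covers k A \<alpha>"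
  obtains N :: nat and P :: "('k, 'u, 'a) cover" and f where "P \<in> covers k A \<alpha>"
    "f \<in> ring_iso (monoid_algebra k (free_comm_monoid {..<N})) (cov_ring P)"
    "cover_maps k P V \<noteq> {}" "cover_maps k P W \<noteq> {}"
proof -
  let ?V = "cov_ring V" and ?W = "cov_ring W"
  interpret k: cring k by fact
  interpret A: cring A by fact
  interpret V: cring ?V using coverD(2)[OF V] .
  interpret W: cring ?W using coverD(2)[OF W] .
  note VD = coverD[OF V] and WD = coverD[OF W]
  obtain G where G: "finite G" "G \<subseteq> carrier ?V" "generate_ring ?V (cov_str V ` carrier k \<union> G) = carrier ?V"
    using VD(1) unfolding finite_type_algebra_def by blast
  obtain H where H: "finite H" "H \<subseteq> carrier ?W" "generate_ring ?W (cov_str W ` carrier k \<union> H) = carrier ?W"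
    using WD(1) unfolding finite_type_algebra_def by blast
  have "\<forall>x\<in>G. \<exists>y. y \<in> carrier ?W \<and> cov_proj W y = cov_proj V x"
  proof
    fix x assume "x \<in> G"
    then have "cov_proj V x \<in> cov_proj W ` carrier ?W" using G(2) ring_hom_closed[OF VD(4)] WD(6) by auto
    then show "\<exists>y. y \<in> carrier ?W \<and> cov_proj W y = cov_proj V x" by (elim imageE) auto
  qed
  from bchoice[OF this] obtain c where c: "\<And>x. x \<in> G \<Longrightarrow> c x \<in> carrier ?W \<and> cov_proj W (c x) = cov_proj V x" by blast
  have "\<forall>x\<in>H. \<exists>y. y \<in> carrier ?V \<and> cov_proj V y = cov_proj W x"
  proof
    fix x assume "x \<in> H"
    then have "cov_proj W x \<in> cov_proj V ` carrier ?V" using H(2) ring_hom_closed[OF WD(4)] VD(6) by auto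
    then show "\<exists>y. y \<in> carrier ?V \<and> cov_proj V y = cov_proj W x" by (elim imageE) auto
  qed
  from bchoice[OF this] obtain d where d: "\<And>x. x \<in> H \<Longrightarrow> d x \<in> carrier ?V \<and> cov_proj V (d x) = cov_proj W x" by blast
  \<comment> \<open>The partner of a generator is an arbitrary element of the other ring with the
    same image in \<open>A\<close>. First components include the generators of \<open>V\<close>,
    second ones those of \<open>W\<close>, so one set of variables maps onto generators of
    both.\<close>
  let ?D = "(\<lambda>x. (x, c x)) ` G \<union> (\<lambda>x. (d x, x)) ` H"
  have D: "fst z \<in> carrier ?V \<and> snd z \<in> carrier ?W \<and> cov_proj V (fst z) = cov_proj W (snd z)" if "z \<in> ?D" for z
    using that c d G(2) H(2) by auto
  define N where "N = card ?D"
  have "finite ?D" using G(1) H(1) by simp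
  from ex_bij_betw_nat_finite[OF this] obtain b where b: "bij_betw b {..<N} ?D"
    unfolding N_def atLeast0LessThan by blast
  have bD: "b i \<in> ?D" if "i < N" for i using bij_betwE[OF b] that by auto
  let ?v = "\<lambda>i. fst (b i)" and ?w = "\<lambda>i. snd (b i)"
  interpret P: polynomial_ring k "{..<N}" by unfold_locales
  have v: "?v \<in> {..<N} \<rightarrow> carrier ?V" and w: "?w \<in> {..<N} \<rightarrow> carrier ?W" using D[OF bD] by auto
  define \<Phi> where "\<Phi> = monoid_algebra_eval k ?V (cov_str V) (mset_prod ?V ?v)"
  define \<Theta> where "\<Theta> = monoid_algebra_eval k ?W (cov_str W) (mset_prod ?W ?w)"
  note \<Phi> = P.poly_eval_hom[OF VD(2,3) v, folded \<Phi>_def] P.poly_eval_con[OF VD(2,3) v, folded \<Phi>_def] P.poly_eval_var[OF VD(2,3) v, folded \<Phi>_def]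
  note \<Theta> = P.poly_eval_hom[OF WD(2,3) w, folded \<Theta>_def] P.poly_eval_con[OF WD(2,3) w, folded \<Theta>_def] P.poly_eval_var[OF WD(2,3) w, folded \<Theta>_def]
  let ?gens = "(\<lambda>c. P.con c) ` carrier k \<union> (\<lambda>i. P.var i) ` {..<N}"
  have gens: "?gens \<subseteq> carrier P.Pol" by auto
  have hom_surj: "\<Xi> ` carrier P.Pol = carrier Y"
    if \<Xi>: "\<Xi> \<in> ring_hom P.Pol Y" and Y: "ring Y" "X \<subseteq> \<Xi> ` ?gens" "generate_ring Y X = carrier Y" for \<Xi> Y X
  proof
    interpret Y: ring Y by fact
    interpret \<Xi>: ring_hom_ring P.Pol Y \<Xi> by unfold_locales (rule \<Xi>)
    show "\<Xi> ` carrier P.Pol \<subseteq> carrier Y" by auto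
    have sub: "subring (\<Xi> ` carrier P.Pol) Y" by (rule \<Xi>.img_is_subring[OF P.P.MA.carrier_is_subring])
    have X: "X \<subseteq> \<Xi> ` carrier P.Pol" using that(3) image_mono[OF gens] by (rule order_trans)
    have "X \<subseteq> carrier Y" using X \<Xi>.hom_closed by blast
    then have "generate_ring Y X \<subseteq> \<Xi> ` carrier P.Pol" by (rule Y.generate_ring_min_subring1[OF _ sub X])
    then show "carrier Y \<subseteq> \<Xi> ` carrier P.Pol" using that(4) by simp
  qed
  have conin: "P.con a \<in> ?gens" if "a \<in> carrier k" for a using that by blast
  have varin: "\<exists>i\<in>{..<N}. b i = z" if "z \<in> ?D" for z using b that unfolding bij_betw_def by (metis imageE)
  have \<Phi>s: "\<Phi> ` carrier P.Pol = carrier ?V"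
  proof (rule hom_surj[OF \<Phi>(1) V.ring_axioms _ G(3)])
    show "cov_str V ` carrier k \<union> G \<subseteq> \<Phi> ` ?gens"
    proof (intro Un_least subsetI)
      fix x assume "x \<in> cov_str V ` carrier k"
      then obtain a where "a \<in> carrier k" "x = cov_str V a" by blast
      then show "x \<in> \<Phi> ` ?gens" using \<Phi>(2)[of a] conin[of a] by (metis image_eqI)
    next
      fix x assume "x \<in> G"
      then obtain i where i: "i \<in> {..<N}" "b i = (x, c x)" using varin by blast
      have "P.var i \<in> ?gens" using i(1) by blast
      moreover have "\<Phi> (P.var i) = x" using \<Phi>(3)[OF i(1)] i(2) by simp
      ultimately show "x \<in> \<Phi> ` ?gens" by blast
    qed
  qed
  have \<Theta>s: "\<Theta> ` carrier P.Pol = carrier ?W"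
  proof (rule hom_surj[OF \<Theta>(1) W.ring_axioms _ H(3)])
    show "cov_str W ` carrier k \<union> H \<subseteq> \<Theta> ` ?gens"
    proof (intro Un_least subsetI)
      fix x assume "x \<in> cov_str W ` carrier k"
      then obtain a where "a \<in> carrier k" "x = cov_str W a" by blast
      then show "x \<in> \<Theta> ` ?gens" using \<Theta>(2)[of a] conin[of a] by (metis image_eqI)
    next
      fix x assume "x \<in> H"
      then obtain i where i: "i \<in> {..<N}" "b i = (d x, x)" using varin by blast
      have "P.var i \<in> ?gens" using i(1) by blast
      moreover have "\<Theta> (P.var i) = x" using \<Theta>(3)[OF i(1)] i(2) by simp
      ultimately show "x \<in> \<Theta> ` ?gens" by blast
    qed
  qed
  have VW: "cov_proj V (\<Phi> x) = cov_proj W (\<Theta> x)" if x: "x \<in> carrier P.Pol" for x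
  proof -
    have "(cov_proj V \<circ> \<Phi>) x = (cov_proj W \<circ> \<Theta>) x"
    proof (rule P.poly_hom_eqI[OF A ring_hom_trans[OF \<Phi>(1) VD(4)] ring_hom_trans[OF \<Theta>(1) WD(4)] _ _ x])
      fix a assume "a \<in> carrier k"
      then show "(cov_proj V \<circ> \<Phi>) (P.con a) = (cov_proj W \<circ> \<Theta>) (P.con a)" using \<Phi>(2) \<Theta>(2) VD(5) WD(5) by simp
    next
      fix i assume "i \<in> {..<N}"
      then show "(cov_proj V \<circ> \<Phi>) (P.var i) = (cov_proj W \<circ> \<Theta>) (P.var i)" using \<Phi>(3) \<Theta>(3) D[OF bD] by simp
    qed
    then show ?thesis by simp
  qed
  obtain f :: "(nat multiset \<Rightarrow> 'k) \<Rightarrow> 'u" where inj: "inj_on f (carrier P.Pol)"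
    using monoid_algebra_embedding[OF univ] by blast
  \<comment> \<open>Covers have their carriers in the type \<open>'u\<close>, so the polynomial ring
    is replaced by its image under the encoding.\<close>
  define Q where "Q = image_ring f P.Pol"
  have f: "f \<in> ring_iso P.Pol Q" unfolding Q_def by (rule inj_imp_image_ring_iso[OF inj])
  have fh: "f \<in> ring_hom P.Pol Q" and fs: "f ` carrier P.Pol = carrier Q" using f by (auto simp: ring_iso_def bij_betw_def)
  have "cring (Q\<lparr>zero := f \<zero>\<^bsub>P.Pol\<^esub>\<rparr>)" by (rule P.P.MA.ring_iso_imp_img_cring[OF f])
  moreover have "Q\<lparr>zero := f \<zero>\<^bsub>P.Pol\<^esub>\<rparr> = Q" by (simp add: Q_def image_ring_def image_group_def monoid.defs)
  ultimately have Q: "cring Q" by simp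
  interpret Q: cring Q by (rule Q)
  define e where "e = inv_into (carrier P.Pol) f"
  have e: "e \<in> ring_iso Q P.Pol" unfolding e_def by (rule ring_iso_set_sym[OF P.P.MA.ring_axioms f])
  have ef: "e (f x) = x" if "x \<in> carrier P.Pol" for x unfolding e_def by (rule inv_into_f_f[OF inj that])
  have eh: "e \<in> ring_hom Q P.Pol" and es: "e ` carrier Q = carrier P.Pol" using e by (auto simp: ring_iso_def bij_betw_def)
  define C where "C = \<lparr>cov_ring = Q, cov_str = f \<circ> (\<lambda>c. P.con c), cov_proj = cov_proj V \<circ> (\<Phi> \<circ> e)\<rparr>"
  have C: "cov_ring C = Q" "cov_str C = f \<circ> (\<lambda>c. P.con c)" "cov_proj C = cov_proj V \<circ> (\<Phi> \<circ> e)" by (simp_all add: C_def)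
  have strh: "f \<circ> (\<lambda>c. P.con c) \<in> ring_hom k Q" by (rule ring_hom_trans[OF P.con_hom fh])
  have CV: "C \<in> covers k A \<alpha>"
    unfolding covers_def mem_Collect_eq C finite_type_algebra_def comm_algebra_def algebra_hom_def
  proof (intro conjI ballI)
    show "cring Q" by (rule Q)
    show "f \<circ> (\<lambda>c. P.con c) \<in> ring_hom k Q" by (rule strh)
    show "cov_proj V \<circ> (\<Phi> \<circ> e) \<in> ring_hom Q A" by (rule ring_hom_trans[OF ring_hom_trans[OF eh \<Phi>(1)] VD(4)])
    show "(cov_proj V \<circ> (\<Phi> \<circ> e)) ((f \<circ> (\<lambda>c. P.con c)) a) = \<alpha> a" if "a \<in> carrier k" for a
      using that ef[OF P.con_closed[OF that]] \<Phi>(2)[OF that] VD(5) by simp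
    show "(cov_proj V \<circ> (\<Phi> \<circ> e)) ` carrier Q = carrier A" unfolding image_comp[symmetric] es \<Phi>s VD(6) ..
    show "\<exists>U. finite U \<and> U \<subseteq> carrier Q \<and> generate_ring Q ((f \<circ> (\<lambda>c. P.con c)) ` carrier k \<union> U) = carrier Q"
    proof (intro exI[of _ "f ` (\<lambda>i. P.var i) ` {..<N}"] conjI)
      show "finite (f ` (\<lambda>i. P.var i) ` {..<N})" by simp
      have vc: "(\<lambda>i. P.var i) ` {..<N} \<subseteq> carrier P.Pol" using gens by blast
      show *: "f ` (\<lambda>i. P.var i) ` {..<N} \<subseteq> carrier Q" using vc fs by blast
      have eq: "(f \<circ> (\<lambda>c. P.con c)) ` carrier k \<union> f ` (\<lambda>i. P.var i) ` {..<N} = f ` ?gens"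
        by (simp only: image_Un image_comp[symmetric])
      show "generate_ring Q ((f \<circ> (\<lambda>c. P.con c)) ` carrier k \<union> f ` (\<lambda>i. P.var i) ` {..<N}) = carrier Q"
        unfolding eq
      proof
        have "f ` ?gens \<subseteq> carrier Q" using gens fs by blast
        then show "generate_ring Q (f ` ?gens) \<subseteq> carrier Q" by (rule Q.generate_ring_incl)
        have "f ` generate_ring P.Pol ?gens \<subseteq> generate_ring Q (f ` ?gens)"
          by (rule generate_ring_image_subset[OF P.P.MA.ring_axioms Q.ring_axioms fh gens])
        then show "carrier Q \<subseteq> generate_ring Q (f ` ?gens)" unfolding P.generate_ring_Pol fs .
      qed
    qed
  qed
  have "\<Phi> \<circ> e \<in> cover_maps k C V"
    unfolding cover_maps_def mem_Collect_eq C algebra_hom_def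
  proof (intro conjI ballI)
    show "\<Phi> \<circ> e \<in> ring_hom Q ?V" by (rule ring_hom_trans[OF eh \<Phi>(1)])
    show "(\<Phi> \<circ> e) ((f \<circ> (\<lambda>c. P.con c)) a) = cov_str V a" if "a \<in> carrier k" for a
      using that ef[OF P.con_closed[OF that]] \<Phi>(2)[OF that] by simp
    show "(\<Phi> \<circ> e) ` carrier Q = carrier ?V" unfolding image_comp[symmetric] es by (rule \<Phi>s)
  qed simp
  moreover have "\<Theta> \<circ> e \<in> cover_maps k C W"
    unfolding cover_maps_def mem_Collect_eq C algebra_hom_def
  proof (intro conjI ballI)
    show "\<Theta> \<circ> e \<in> ring_hom Q ?W" by (rule ring_hom_trans[OF eh \<Theta>(1)])
    show "(\<Theta> \<circ> e) ((f \<circ> (\<lambda>c. P.con c)) a) = cov_str W a" if "a \<in> carrier k" for a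
      using that ef[OF P.con_closed[OF that]] \<Theta>(2)[OF that] by simp
    show "(\<Theta> \<circ> e) ` carrier Q = carrier ?W" unfolding image_comp[symmetric] es by (rule \<Theta>s)
    show "cov_proj W ((\<Theta> \<circ> e) r) = (cov_proj V \<circ> (\<Phi> \<circ> e)) r" if "r \<in> carrier Q" for r
      using VW[OF ring_hom_closed[OF eh that]] by simp
  qed
  ultimately show ?thesis using that[OF CV, of f N] f C(1) by auto
qed

section \<open>Annihilators in polynomial and in smooth covers\<close>

lemma pp_ring_polynomial_cover:
  assumes k: "field k" and f: "f \<in> ring_iso (monoid_algebra k (free_comm_monoid {..<N::nat})) R" and R: "cring R"
  shows "pp_ring R"
proof -
  interpret k: field k by fact
  interpret P: polynomial_domain k "{..<N}" by unfold_locales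
  interpret D: domain P.Pol by (rule P.domain_Pol)
  interpret R: cring R by fact
  have h: "f \<in> ring_hom P.Pol R" using f by (simp add: ring_iso_def)
  have "domain (R\<lparr>zero := f \<zero>\<^bsub>P.Pol\<^esub>\<rparr>)" by (rule D.ring_iso_imp_img_domain[OF f])
  moreover have "f \<zero>\<^bsub>P.Pol\<^esub> = \<zero>\<^bsub>R\<^esub>" by (rule ring_hom_zero[OF h P.P.MA.ring_axioms R.ring_axioms])
  ultimately have "domain R" by simp
  then show ?thesis by (rule pp_ring_domain)
qed

lemma ideal_power_image:
  assumes R: "ring R" and S: "ring S" and h: "h \<in> ring_hom R S" and I: "ideal I R" and J: "ideal J S" and IJ: "h ` I \<subseteq> J"
  shows "h ` ideal_power R I m \<subseteq> ideal_power S J m"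
proof -
  interpret R: ring R by fact
  interpret S: ring S by fact
  interpret h: ring_hom_ring R S h by unfold_locales (rule h)
  show ?thesis
  proof (induction m)
    case 0
    then show ?case by (auto simp: ideal_power.simps)
  next
    case (Suc m)
    have "h x \<in> J \<cdot>\<^bsub>S\<^esub> ideal_power S J m" if "x \<in> I \<cdot>\<^bsub>R\<^esub> ideal_power R I m" for x
      using that
    proof (induction rule: ideal_prod.induct)
      case (prod i j)
      have "i \<in> carrier R" "j \<in> carrier R" using prod ideal.Icarr[OF I] ideal.Icarr[OF R.ideal_power_ideal[OF I]] by auto
      moreover have "h i \<in> J" "h j \<in> ideal_power S J m" using prod IJ Suc.IH by auto
      ultimately show ?case using ideal_prod.prod[of "h i" J "h j" "ideal_power S J m" S] by simp
    next
      case (sum a b)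
      have c: "a \<in> carrier R" "b \<in> carrier R"
        using sum.hyps ideal.Icarr[OF R.ideal_prod_is_ideal[OF I R.ideal_power_ideal[OF I]]] by auto
      show ?case unfolding h.hom_add[OF c] by (rule ideal_prod.sum[OF sum.IH])
    qed
    then show ?case by (auto simp: ideal_power.simps)
  qed
qed

text \<open>Smoothness yields sections into the copy of the polynomial ring inside
  \<open>'u\<close>, while the argument about orders of vanishing looks at monomials. Hence the
  sections are carried along the isomorphism \<open>g\<close> to the genuine polynomial
  ring.\<close>

lemma smooth_pp_ring:
  fixes k :: "'k ring" and U :: "('k, 'u, 'a) cover"
  assumes k: "field k" and A: "cring A" and univ: "large_universe TYPE('u) k" and U: "U \<in> covers k A \<alpha>"
    and smooth: "smooth_algebra k (cov_ring U) (cov_str U)"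
  shows "pp_ring (cov_ring U)"
proof -
  interpret k: field k by fact
  \<comment> \<open>Both covers are taken to be \<open>U\<close>, as only a presentation of
    \<open>U\<close> by a polynomial ring is wanted.\<close>
  obtain N :: nat and C :: "('k, 'u, 'a) cover" and f \<phi> where C: "C \<in> covers k A \<alpha>"
    and f: "f \<in> ring_iso (monoid_algebra k (free_comm_monoid {..<N})) (cov_ring C)" and \<phi>: "\<phi> \<in> cover_maps k C U"
    by (rule polynomial_cover[OF k.cring_axioms A univ U U]) blast
  interpret P: polynomial_ring k "{..<N}" by unfold_locales
  let ?U = "cov_ring U" and ?C = "cov_ring C"
  interpret U: cring ?U using coverD(2)[OF U] .
  interpret C: cring ?C using coverD(2)[OF C] .
  define g where "g = inv_into (carrier P.Pol) f"
  have g: "g \<in> ring_iso ?C P.Pol" unfolding g_def by (rule ring_iso_set_sym[OF P.P.MA.ring_axioms f])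
  have fh: "f \<in> ring_hom P.Pol ?C" and fs: "f ` carrier P.Pol = carrier ?C" using f by (auto simp: ring_iso_def bij_betw_def)
  have fg: "f (g x) = x" if "x \<in> carrier ?C" for x
  proof -
    have "x \<in> f ` carrier P.Pol" using that fs by simp
    then show ?thesis unfolding g_def by (rule f_inv_into_f)
  qed
  have gh: "g \<in> ring_hom ?C P.Pol" using g by (simp add: ring_iso_def)
  note \<phi>D = cover_mapsD[OF \<phi>]
  let ?\<psi> = "\<phi> \<circ> f"
  have \<psi>: "?\<psi> \<in> ring_hom P.Pol ?U" by (rule ring_hom_trans[OF fh \<phi>D(1)])
  have \<psi>s: "?\<psi> ` carrier P.Pol = carrier ?U" unfolding image_comp[symmetric] fs by (rule \<phi>D(3))
  interpret \<phi>: ring_hom_ring ?C ?U \<phi> by unfold_locales (rule \<phi>D(1))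
  interpret g: ring_hom_ring ?C P.Pol g by unfold_locales (rule gh)
  interpret \<psi>: ring_hom_ring P.Pol ?U ?\<psi> by unfold_locales (rule \<psi>)
  let ?I = "a_kernel ?C ?U \<phi>" and ?J = "a_kernel P.Pol ?U ?\<psi>"
  have I: "ideal ?I ?C" by (rule \<phi>.kernel_is_ideal)
  have J: "ideal ?J P.Pol" by (rule \<psi>.kernel_is_ideal)
  have gIJ: "g ` ?I \<subseteq> ?J"
  proof
    fix y assume "y \<in> g ` ?I"
    then obtain x where x: "x \<in> carrier ?C" "\<phi> x = \<zero>\<^bsub>?U\<^esub>" "y = g x" using mem_a_kernel[of _ ?C ?U \<phi>] by (elim imageE) blast
    have "?\<psi> (g x) = \<zero>\<^bsub>?U\<^esub>" using fg[OF x(1)] x(2) by simp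
    then show "y \<in> ?J" unfolding x(3) using mem_a_kernel[of "g x" P.Pol ?U ?\<psi>] g.hom_closed[OF x(1)] by blast
  qed
  have sec: "\<exists>s\<in>carrier ?U \<rightarrow> carrier P.Pol. (\<forall>r\<in>carrier ?U. ?\<psi> (s r) = r) \<and>
      s \<zero>\<^bsub>?U\<^esub> \<in> ideal_power P.Pol ?J m \<and>
      (\<forall>r\<in>carrier ?U. \<forall>t\<in>carrier ?U. s (r \<otimes>\<^bsub>?U\<^esub> t) \<ominus>\<^bsub>P.Pol\<^esub> s r \<otimes>\<^bsub>P.Pol\<^esub> s t \<in> ideal_power P.Pol ?J m)" for m
  proof -
    have comm: "comm_algebra k ?C (cov_str C)" using coverD(1)[OF C] by (simp add: finite_type_algebra_def)
    obtain s where s: "section_mod k ?U (cov_str U) ?C (cov_str C) \<phi> (ideal_power ?C ?I (Suc m)) s"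
      using smooth_section[OF k.ring_axioms smooth comm \<phi>D(5,3)] by blast
    have sc: "s r \<in> carrier ?C" "\<phi> (s r) = r" if "r \<in> carrier ?U" for r using s that by (simp_all add: section_mod_def)
    have Q: "ideal (ideal_power ?C ?I (Suc m)) ?C" by (rule C.ideal_power_ideal[OF I])
    interpret Q: ideal "ideal_power ?C ?I (Suc m)" ?C by (rule Q)
    have gQ: "g x \<in> ideal_power P.Pol ?J m" if "x \<in> ideal_power ?C ?I (Suc m)" for x
    proof -
      have "x \<in> ideal_power ?C ?I m" using C.ideal_power_antimono_Suc[OF I] that by blast
      then show ?thesis using ideal_power_image[OF C.ring_axioms P.P.MA.ring_axioms gh I J gIJ] by blast
    qed
    \<comment> \<open>A section need not preserve zero, but its failure to be additive at
      \<open>0 + 0\<close> is exactly minus its value at zero.\<close>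
    have "s (\<zero>\<^bsub>?U\<^esub> \<oplus>\<^bsub>?U\<^esub> \<zero>\<^bsub>?U\<^esub>) \<ominus>\<^bsub>?C\<^esub> (s \<zero>\<^bsub>?U\<^esub> \<oplus>\<^bsub>?C\<^esub> s \<zero>\<^bsub>?U\<^esub>) \<in> ideal_power ?C ?I (Suc m)"
      using s U.zero_closed unfolding section_mod_def by blast
    moreover have "s (\<zero>\<^bsub>?U\<^esub> \<oplus>\<^bsub>?U\<^esub> \<zero>\<^bsub>?U\<^esub>) \<ominus>\<^bsub>?C\<^esub> (s \<zero>\<^bsub>?U\<^esub> \<oplus>\<^bsub>?C\<^esub> s \<zero>\<^bsub>?U\<^esub>) = \<ominus>\<^bsub>?C\<^esub> s \<zero>\<^bsub>?U\<^esub>"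
      using sc(1)[OF U.zero_closed] by (simp add: a_minus_def C.minus_add C.r_neg2)
    ultimately have "\<ominus>\<^bsub>?C\<^esub> s \<zero>\<^bsub>?U\<^esub> \<in> ideal_power ?C ?I (Suc m)" by (simp only:)
    from Q.a_inv_closed[OF this] have s0: "s \<zero>\<^bsub>?U\<^esub> \<in> ideal_power ?C ?I (Suc m)"
      unfolding C.minus_minus[OF sc(1)[OF U.zero_closed]] .
    show ?thesis
    proof (intro bexI[of _ "g \<circ> s"] conjI ballI)
      show "g \<circ> s \<in> carrier ?U \<rightarrow> carrier P.Pol" using sc by auto
      show "?\<psi> ((g \<circ> s) r) = r" if "r \<in> carrier ?U" for r using fg sc[OF that] by simp
      show "(g \<circ> s) \<zero>\<^bsub>?U\<^esub> \<in> ideal_power P.Pol ?J m" using gQ[OF s0] by simp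
      fix r t assume rt: "r \<in> carrier ?U" "t \<in> carrier ?U"
      have "s (r \<otimes>\<^bsub>?U\<^esub> t) \<ominus>\<^bsub>?C\<^esub> s r \<otimes>\<^bsub>?C\<^esub> s t \<in> ideal_power ?C ?I (Suc m)"
        using s rt unfolding section_mod_def by blast
      from gQ[OF this]
      show "(g \<circ> s) (r \<otimes>\<^bsub>?U\<^esub> t) \<ominus>\<^bsub>P.Pol\<^esub> (g \<circ> s) r \<otimes>\<^bsub>P.Pol\<^esub> (g \<circ> s) t \<in> ideal_power P.Pol ?J m"
        using sc(1)[OF rt(1)] sc(1)[OF rt(2)] sc(1)[OF U.m_closed[OF rt]] by (simp add: a_minus_def)
    qed
  qed
  have N: "noetherian_ring ?U" by (rule finite_type_noetherian[OF k coverD(1)[OF U]])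
  show ?thesis
    by (rule pp_ringI_noetherian[OF U.cring_axioms N], rule coprime_annihilators[OF k U.cring_axioms N \<psi> \<psi>s sec])
qed

section \<open>Comparing embedded Aluffi algebras\<close>

lemma semilinear_finsum:
  assumes M: "module R M" and N: "module S N" and \<phi>: "\<phi> \<in> ring_hom R S" and f: "semilinear_map \<phi> R M N f"
    and "finite I" "c \<in> I \<rightarrow> carrier R" "e \<in> I \<rightarrow> carrier M"
  shows "f (\<Oplus>\<^bsub>M\<^esub>i\<in>I. c i \<odot>\<^bsub>M\<^esub> e i) = (\<Oplus>\<^bsub>N\<^esub>i\<in>I. \<phi> (c i) \<odot>\<^bsub>N\<^esub> f (e i))"
  using assms(5-7)
proof (induction I rule: finite_induct)
  case empty
  interpret M: module R M by fact
  interpret N: module S N by fact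
  show ?case using semilinear_zero[OF M N \<phi> f] by simp
next
  case (insert i I)
  interpret M: module R M by fact
  interpret N: module S N by fact
  note f' = semilinear_mapD[OF f]
  have c: "c i \<in> carrier R" "e i \<in> carrier M" using insert.prems by auto
  have m: "(\<lambda>i. c i \<odot>\<^bsub>M\<^esub> e i) \<in> I \<rightarrow> carrier M" using insert.prems by auto
  have n: "(\<lambda>i. \<phi> (c i) \<odot>\<^bsub>N\<^esub> f (e i)) \<in> I \<rightarrow> carrier N"
    using insert.prems ring_hom_closed[OF \<phi>] f'(1) by (auto intro!: N.smult_closed)
  have ci: "c i \<odot>\<^bsub>M\<^esub> e i \<in> carrier M" using c by simp
  have fi: "f (c i \<odot>\<^bsub>M\<^esub> e i) = \<phi> (c i) \<odot>\<^bsub>N\<^esub> f (e i)" by (rule f'(3)[OF c])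
  have "\<phi> (c i) \<odot>\<^bsub>N\<^esub> f (e i) \<in> carrier N" using c ring_hom_closed[OF \<phi>] f'(1) by simp
  then show ?case
    using M.finsum_insert[OF insert.hyps m ci] N.finsum_insert[OF insert.hyps n] f'(2)[OF ci M.finsum_closed[OF m]] fi insert
    by simp
qed

lemma smult_span_finsum:
  assumes M: "module R M" and "finite I" "a \<in> I \<rightarrow> J" "e \<in> I \<rightarrow> carrier M" and J: "J \<subseteq> carrier R"
  shows "(\<Oplus>\<^bsub>M\<^esub>i\<in>I. a i \<odot>\<^bsub>M\<^esub> e i) \<in> smult_span M J (carrier M)"
  using assms(2-4)
proof (induction I rule: finite_induct)
  case empty
  interpret M: module R M by fact
  show ?case using generate.one[of "add_monoid M"] by (simp add: smult_span_def)
next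
  case (insert i I)
  interpret M: module R M by fact
  have m: "(\<lambda>i. a i \<odot>\<^bsub>M\<^esub> e i) \<in> I \<rightarrow> carrier M" using insert.prems J by (auto intro!: M.smult_closed)
  have ai: "a i \<in> J" "e i \<in> carrier M" using insert.prems by auto
  then have ci: "a i \<odot>\<^bsub>M\<^esub> e i \<in> carrier M" using J by (intro M.smult_closed) auto
  have "a i \<odot>\<^bsub>M\<^esub> e i \<in> smult_span M J (carrier M)" unfolding smult_span_def using ai by (intro generate.incl) blast
  moreover have "(\<Oplus>\<^bsub>M\<^esub>i\<in>I. a i \<odot>\<^bsub>M\<^esub> e i) \<in> smult_span M J (carrier M)" using insert by simp
  ultimately show ?case
    using M.finsum_insert[OF insert.hyps m ci] generate.eng[of "a i \<odot>\<^bsub>M\<^esub> e i" "add_monoid M"] by (simp add: smult_span_def)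
qed

lemma factor_ring_hom:
  assumes S: "ring S" and A: "ring A" and B: "ring B" and f: "f \<in> ring_hom S A" and fs: "f ` carrier S = carrier A"
    and g: "g \<in> ring_hom S B" and ker: "\<And>x. x \<in> carrier S \<Longrightarrow> f x = \<zero>\<^bsub>A\<^esub> \<Longrightarrow> g x = \<zero>\<^bsub>B\<^esub>"
  shows "\<exists>T\<in>ring_hom A B. \<forall>x\<in>carrier S. T (f x) = g x"
proof -
  interpret S: ring S by fact
  interpret A: ring A by fact
  interpret B: ring B by fact
  interpret f: ring_hom_ring S A f by unfold_locales (rule f)
  interpret g: ring_hom_ring S B g by unfold_locales (rule g)
  have eq: "g x = g y" if x: "x \<in> carrier S" and y: "y \<in> carrier S" and xy: "f x = f y" for x y
  proof -
    have "f (x \<ominus>\<^bsub>S\<^esub> y) = \<zero>\<^bsub>A\<^esub>" using x y xy by (simp add: a_minus_def A.r_neg)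
    from ker[OF S.minus_closed[OF x y] this] have "g x \<ominus>\<^bsub>B\<^esub> g y = \<zero>\<^bsub>B\<^esub>" using x y by (simp add: a_minus_def)
    then show ?thesis using x y by simp
  qed
  define T where "T z = g (inv_into (carrier S) f z)" for z
  have T: "T (f x) = g x" if x: "x \<in> carrier S" for x
    unfolding T_def by (rule eq) (use x inv_into_into[of "f x" f "carrier S"] f_inv_into_f[of "f x" f "carrier S"] in auto)
  have "T \<in> ring_hom A B"
  proof (rule ring_hom_memI)
    fix a assume "a \<in> carrier A"
    then have "a \<in> f ` carrier S" using fs by simp
    then obtain x where x: "x \<in> carrier S" "a = f x" by (elim imageE) simp
    show "T a \<in> carrier B" using T[OF x(1)] x by simp
    fix b assume "b \<in> carrier A"
    then have "b \<in> f ` carrier S" using fs by simp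
    then obtain y where y: "y \<in> carrier S" "b = f y" by (elim imageE) simp
    have "T (f (x \<otimes>\<^bsub>S\<^esub> y)) = g (x \<otimes>\<^bsub>S\<^esub> y)" "T (f (x \<oplus>\<^bsub>S\<^esub> y)) = g (x \<oplus>\<^bsub>S\<^esub> y)"
      by (rule T[OF S.m_closed[OF x(1) y(1)]], rule T[OF S.a_closed[OF x(1) y(1)]])
    then show "T (a \<otimes>\<^bsub>A\<^esub> b) = T a \<otimes>\<^bsub>B\<^esub> T b" "T (a \<oplus>\<^bsub>A\<^esub> b) = T a \<oplus>\<^bsub>B\<^esub> T b"
      using x y T[OF x(1)] T[OF y(1)] by simp_all
  next
    show "T \<one>\<^bsub>A\<^esub> = \<one>\<^bsub>B\<^esub>" using T[OF S.one_closed] by simp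
  qed
  then show ?thesis using T by blast
qed

section \<open>The embedded Aluffi algebra as a quotient of the symmetric algebra of
  \<open>L\<close>\<close>

text \<open>The module \<open>L\<close> takes the place of \<open>E / \<tau>\<^sub>A(E)\<close>,
  represented by its embedding \<open>j\<close> into \<open>F\<close>.\<close>

locale aluffi_setup =
  fixes k :: "'k ring" and A :: "'a ring" and \<alpha> :: "'k \<Rightarrow> 'a"
    and L :: "('a, 'l) module" and F :: "('a, 'f) module" and n :: nat and j :: "'l \<Rightarrow> 'f"
    and FF :: "('k, 'u, 'a) cover \<Rightarrow> ('u, 'b) module" and p :: "('k, 'u, 'a) cover \<Rightarrow> 'b \<Rightarrow> 'f"
  assumes k: "field k" and A: "cring A" and univ: "large_universe TYPE('u) k"
    and L: "module A L" and F: "free_module A F n" and j: "linear_map A L F j" and inj: "inj_on j (carrier L)"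
    and amb: "\<And>Y. Y \<in> covers k A \<alpha> \<Longrightarrow> ambient_lift A F n Y (FF Y) (p Y)"
begin

abbreviation "def_mod V \<equiv> deformation L j (FF V) (p V)"
abbreviation "def_proj V \<equiv> deformation_proj L j (p V)"
abbreviation "SL \<equiv> sym_algebra A L"
abbreviation "SE V \<equiv> sym_algebra (cov_ring V) (def_mod V)"
abbreviation "SF V \<equiv> sym_algebra (cov_ring V) (FF V)"
abbreviation "base V \<equiv> sym_to_base A L j V (FF V) (p V)"
abbreviation "incl V \<equiv> sym_map (cov_ring V) (def_mod V) (cov_ring V) (FF V) (\<lambda>r. r) (\<lambda>x. x)"
abbreviation "Al V \<equiv> embedded_aluffi A L j V (FF V) (p V)"
abbreviation "str V \<equiv> embedded_aluffi_str A L j V (FF V) (p V)"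
abbreviation "tens V \<equiv> aluffi_tensor A L j V (FF V) (p V)"
abbreviation "proj V \<equiv> rees_proj (cov_ring V) (def_mod V)"
abbreviation "can V x \<equiv> tens V x \<one>\<^bsub>rees_algebra (cov_ring V) (def_mod V)\<^esub>"
abbreviation "lifts Y V \<equiv> natural_lifts Y (FF Y) (p Y) (FF V) (p V)"
abbreviation "system \<equiv> aluffi_system k A \<alpha> L j FF p"

text \<open>The kernels \<open>K(V)\<close> and, in the next line, \<open>K'(V)\<close>. Both are
  subsets of the one ring \<open>S\<^sub>A(L)\<close>, so that kernels belonging to different covers
  can be compared by inclusion.\<close>

definition "tors_img V = base V ` torsion (cov_ring V) (SE V)"
definition "ker_img V = base V ` {s \<in> carrier (SE V). incl V s = \<zero>\<^bsub>SF V\<^esub>}"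

lemma module_F: "module A F" using F by (simp add: free_module_def)

lemma SL: "symmetric_algebra A L" by (rule symmetric_algebra.intro[OF L])

context
  fixes V :: "('k, 'u, 'a) cover" assumes V: "V \<in> covers k A \<alpha>"
begin

lemma ambD:
  shows "free_module (cov_ring V) (FF V) n" "module (cov_ring V) (FF V)"
    "semilinear_map (cov_proj V) (cov_ring V) (FF V) F (p V)" "p V ` carrier (FF V) = carrier F"
  using amb[OF V] by (auto simp: ambient_lift_def free_module_def)

lemmas def_mod = deformation_module[OF L module_F ambD(2) coverD(4)[OF V] j inj ambD(3)]

lemma SE: "symmetric_algebra (cov_ring V) (def_mod V)" by (rule symmetric_algebra.intro[OF def_mod(1)])
lemma SF: "symmetric_algebra (cov_ring V) (FF V)" by (rule symmetric_algebra.intro[OF ambD(2)])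

lemmas base = sym_map[OF SE SL coverD(4)[OF V] def_mod(2), folded sym_to_base_def]

lemma id_hom: "(\<lambda>r. r) \<in> ring_hom (cov_ring V) (cov_ring V)"
  by (rule id_ring_hom) (rule cring.axioms(1)[OF coverD(2)[OF V]])

lemma incl_linear: "linear_map (cov_ring V) (def_mod V) (FF V) (\<lambda>x. x)"
  by (auto simp: semilinear_map_def deformation_def)

lemmas incl = sym_map[OF SE SF id_hom incl_linear]

lemma in_def_mod: "x \<in> carrier (FF V) \<Longrightarrow> l \<in> carrier L \<Longrightarrow> p V x = j l \<Longrightarrow> x \<in> carrier (def_mod V)"
  by (auto simp: deformation_def)

lemma def_proj_eq: "l \<in> carrier L \<Longrightarrow> p V x = j l \<Longrightarrow> def_proj V x = l"
  unfolding deformation_proj_def using inj by simp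

lemma base_surj: "base V ` carrier (SE V) = carrier SL"
proof
  interpret SE: symmetric_algebra "cov_ring V" "def_mod V" by (rule SE)
  interpret SL: symmetric_algebra A L by (rule SL)
  interpret b: ring_hom_ring SE.S SL.S "base V" by unfold_locales (rule base(1))
  show "base V ` carrier (SE V) \<subseteq> carrier SL" by auto
  show "carrier SL \<subseteq> base V ` carrier (SE V)"
  proof
    fix s assume "s \<in> carrier SL"
    then show "s \<in> base V ` carrier (SE V)"
    proof (induction rule: SL.sym_induct)
      case (const a)
      then have "a \<in> cov_proj V ` carrier (cov_ring V)" using coverD(6)[OF V] by simp
      then obtain r where r: "r \<in> carrier (cov_ring V)" "a = cov_proj V r" by (elim imageE) simp
      then show ?case using base(2)[OF r(1)] SE.cst.hom_closed[OF r(1)] by (metis imageI)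
    next
      case (gen l)
      have "j l \<in> p V ` carrier (FF V)" using semilinear_mapD(1)[OF j gen] ambD(4) by simp
      then obtain x where x: "x \<in> carrier (FF V)" "p V x = j l" by (elim imageE) simp
      have "x \<in> carrier (def_mod V)" by (rule in_def_mod[OF x(1) gen x(2)])
      then show ?case using base(3)[of x] SE.gen_closed[of x] def_proj_eq[OF gen x(2)] by (metis imageI)
    next
      case (add s t)
      then obtain x y where "x \<in> carrier (SE V)" "s = base V x" "y \<in> carrier (SE V)" "t = base V y" by blast
      then show ?case using b.hom_add[of x y] SE.S.a_closed[of x y] by (metis imageI)
    next
      case (mult s t)
      then obtain x y where "x \<in> carrier (SE V)" "s = base V x" "y \<in> carrier (SE V)" "t = base V y" by blast
      then show ?case using b.hom_mult[of x y] SE.S.m_closed[of x y] by (metis imageI)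
    qed
  qed
qed

lemma torsion_ideal: "ideal (torsion (cov_ring V) (SE V)) (SE V)"
proof -
  interpret SE: symmetric_algebra "cov_ring V" "def_mod V" by (rule SE)
  let ?nz = "nonzerodivisors (cov_ring V)"
  have mem: "x \<in> torsion (cov_ring V) (SE V) \<longleftrightarrow>
      x \<in> carrier (SE V) \<and> (\<exists>b\<in>?nz. SE.cst b \<otimes>\<^bsub>SE.S\<^esub> x = \<zero>\<^bsub>SE.S\<^esub>)" for x
    by (simp add: torsion_def SE.S_smult)
  have nzc: "b \<in> ?nz \<Longrightarrow> b \<in> carrier (cov_ring V)" for b by (simp add: nonzerodivisors_def)
  have nzm: "b \<in> ?nz \<Longrightarrow> c \<in> ?nz \<Longrightarrow> b \<otimes>\<^bsub>cov_ring V\<^esub> c \<in> ?nz" for b c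
    by (rule nonzerodivisor_mult[OF SE.R.cring_axioms])
  show ?thesis
    unfolding SE.S.subideal_carrier_iff[symmetric] SE.S.subideal_def
  proof (intro conjI ballI)
    show "torsion (cov_ring V) (SE V) \<subseteq> carrier SE.S" using mem by blast
    have "SE.cst \<one>\<^bsub>cov_ring V\<^esub> \<otimes>\<^bsub>SE.S\<^esub> \<zero>\<^bsub>SE.S\<^esub> = \<zero>\<^bsub>SE.S\<^esub>" by simp
    then show "\<zero>\<^bsub>SE.S\<^esub> \<in> torsion (cov_ring V) (SE V)"
      unfolding mem using nonzerodivisor_one[OF SE.R.cring_axioms] by blast
    fix x assume "x \<in> torsion (cov_ring V) (SE V)"
    then obtain b where x: "x \<in> carrier SE.S" and b: "b \<in> ?nz" "SE.cst b \<otimes>\<^bsub>SE.S\<^esub> x = \<zero>\<^bsub>SE.S\<^esub>" unfolding mem by blast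
    have bc: "SE.cst b \<in> carrier SE.S" using nzc[OF b(1)] by simp
    show "x \<oplus>\<^bsub>SE.S\<^esub> y \<in> torsion (cov_ring V) (SE V)" if "y \<in> torsion (cov_ring V) (SE V)" for y
    proof -
      from that obtain c where y: "y \<in> carrier SE.S" and c: "c \<in> ?nz" "SE.cst c \<otimes>\<^bsub>SE.S\<^esub> y = \<zero>\<^bsub>SE.S\<^esub>" unfolding mem by blast
      have cc: "SE.cst c \<in> carrier SE.S" using nzc[OF c(1)] by simp
      have "SE.cst (b \<otimes>\<^bsub>cov_ring V\<^esub> c) \<otimes>\<^bsub>SE.S\<^esub> (x \<oplus>\<^bsub>SE.S\<^esub> y)
        = SE.cst c \<otimes>\<^bsub>SE.S\<^esub> (SE.cst b \<otimes>\<^bsub>SE.S\<^esub> x) \<oplus>\<^bsub>SE.S\<^esub> SE.cst b \<otimes>\<^bsub>SE.S\<^esub> (SE.cst c \<otimes>\<^bsub>SE.S\<^esub> y)"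
        using nzc[OF b(1)] nzc[OF c(1)] bc cc x y by (simp add: SE.S.r_distr SE.S.m_ac)
      then have "SE.cst (b \<otimes>\<^bsub>cov_ring V\<^esub> c) \<otimes>\<^bsub>SE.S\<^esub> (x \<oplus>\<^bsub>SE.S\<^esub> y) = \<zero>\<^bsub>SE.S\<^esub>" unfolding b(2) c(2) using bc cc by simp
      then show ?thesis unfolding mem using nzm[OF b(1) c(1)] SE.S.a_closed[OF x y] by blast
    qed
    show "r \<otimes>\<^bsub>SE.S\<^esub> x \<in> torsion (cov_ring V) (SE V)" if r: "r \<in> carrier SE.S" for r
    proof -
      have "SE.cst b \<otimes>\<^bsub>SE.S\<^esub> (r \<otimes>\<^bsub>SE.S\<^esub> x) = r \<otimes>\<^bsub>SE.S\<^esub> (SE.cst b \<otimes>\<^bsub>SE.S\<^esub> x)" using bc r x by (simp add: SE.S.m_ac)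
      then have "SE.cst b \<otimes>\<^bsub>SE.S\<^esub> (r \<otimes>\<^bsub>SE.S\<^esub> x) = \<zero>\<^bsub>SE.S\<^esub>" unfolding b(2) using r by simp
      then show ?thesis unfolding mem using b(1) SE.S.m_closed[OF r x] by blast
    qed
  qed
qed

lemma rees:
  shows "cring (rees_algebra (cov_ring V) (def_mod V))"
    and "proj V \<in> ring_hom (SE V) (rees_algebra (cov_ring V) (def_mod V))"
    and "proj V ` carrier (SE V) = carrier (rees_algebra (cov_ring V) (def_mod V))"
    and "s \<in> carrier (SE V) \<Longrightarrow> proj V s = \<zero>\<^bsub>rees_algebra (cov_ring V) (def_mod V)\<^esub> \<longleftrightarrow> s \<in> torsion (cov_ring V) (SE V)"
proof -
  interpret SE: symmetric_algebra "cov_ring V" "def_mod V" by (rule SE)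
  interpret T: ideal "torsion (cov_ring V) (SE V)" SE.S by (rule torsion_ideal)
  have p: "proj V = (+>\<^bsub>SE.S\<^esub>) (torsion (cov_ring V) (SE V))" by (simp add: fun_eq_iff rees_proj_def)
  show "cring (rees_algebra (cov_ring V) (def_mod V))" unfolding rees_algebra_def by (rule T.quotient_is_cring[OF SE.cring_S])
  show h: "proj V \<in> ring_hom (SE V) (rees_algebra (cov_ring V) (def_mod V))" unfolding rees_algebra_def p by (rule T.rcos_ring_hom)
  show "proj V ` carrier (SE V) = carrier (rees_algebra (cov_ring V) (def_mod V))"
  proof
    show "proj V ` carrier (SE V) \<subseteq> carrier (rees_algebra (cov_ring V) (def_mod V))" using ring_hom_closed[OF h] by blast
    show "carrier (rees_algebra (cov_ring V) (def_mod V)) \<subseteq> proj V ` carrier (SE V)"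
      unfolding rees_algebra_def p using T.quot_surj by blast
  qed
  show "s \<in> carrier (SE V) \<Longrightarrow> proj V s = \<zero>\<^bsub>rees_algebra (cov_ring V) (def_mod V)\<^esub> \<longleftrightarrow> s \<in> torsion (cov_ring V) (SE V)"
    unfolding rees_algebra_def p T.quot_zero by (rule T.quot_eq_zero_iff)
qed

text \<open>The algebra \<open>S(E\<^sub>V)\<close> maps onto both tensor factors, so the tensor
  product is \<open>S\<^sub>A(L)\<close> modulo the image of the torsion, with \<open>can V\<close>
  as quotient map. The comparison of covers takes place through these maps.\<close>

lemma Al_facts:
  shows cring_Al: "cring (Al V)" and can_hom: "can V \<in> ring_hom SL (Al V)" and can_surj: "can V ` carrier SL = carrier (Al V)"
    and tens_eq: "x \<in> carrier SL \<Longrightarrow> s \<in> carrier (SE V) \<Longrightarrow> tens V x (proj V s) = can V (x \<otimes>\<^bsub>SL\<^esub> base V s)"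
    and can_zero_iff: "x \<in> carrier SL \<Longrightarrow> can V x = \<zero>\<^bsub>Al V\<^esub> \<longleftrightarrow> x \<in> tors_img V"
proof -
  interpret SE: symmetric_algebra "cov_ring V" "def_mod V" by (rule SE)
  interpret SL: symmetric_algebra A L by (rule SL)
  have Al: "Al V = tensor_ring (SE V) SL (base V) (rees_algebra (cov_ring V) (def_mod V)) (proj V)"
    by (simp add: embedded_aluffi_def Let_def)
  have te: "tens V = pure_tensor (SE V) SL (base V) (rees_algebra (cov_ring V) (def_mod V)) (proj V)"
    by (simp add: aluffi_tensor_def Let_def)
  note t = tensor_ring_quotient[OF SE.cring_S SL.cring_S rees(1) base(1) base_surj rees(2,3), folded Al te]
  show "cring (Al V)" by (rule t(1))
  show "can V \<in> ring_hom SL (Al V)" by (rule t(2))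
  show "can V ` carrier SL = carrier (Al V)" by (rule t(3))
  show "x \<in> carrier SL \<Longrightarrow> s \<in> carrier (SE V) \<Longrightarrow> tens V x (proj V s) = can V (x \<otimes>\<^bsub>SL\<^esub> base V s)" by (rule t(4))
  show "can V x = \<zero>\<^bsub>Al V\<^esub> \<longleftrightarrow> x \<in> tors_img V" if x: "x \<in> carrier SL"
  proof -
    have "torsion (cov_ring V) (SE V) \<subseteq> carrier (SE V)" by (auto simp: torsion_def)
    then show ?thesis unfolding t(5)[OF x] tors_img_def using rees(4) by blast
  qed
qed

lemma str_eq: "a \<in> carrier A \<Longrightarrow> str V a = can V (sym_const A L a)"
proof -
  interpret SL: symmetric_algebra A L by (rule SL)
  show "a \<in> carrier A \<Longrightarrow> str V a = can V (sym_const A L a)"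
    by (simp add: embedded_aluffi_str_def SL.S_smult)
qed

text \<open>An element of \<open>S(E\<^sub>V)\<close> killed by a nonzerodivisor has an image in
  \<open>S(F\<^sub>V)\<close> killed by the same element, and the symmetric algebra of a free module
  is torsion-free.\<close>

lemma tors_img_subset: "tors_img V \<subseteq> ker_img V"
proof -
  interpret SE: symmetric_algebra "cov_ring V" "def_mod V" by (rule SE)
  interpret SF: symmetric_algebra "cov_ring V" "FF V" by (rule SF)
  interpret i: ring_hom_ring SE.S SF.S "incl V" by unfold_locales (rule incl(1))
  have "incl V s = \<zero>\<^bsub>SF.S\<^esub>" if s: "s \<in> torsion (cov_ring V) (SE V)" for s
  proof -
    from s obtain b where b: "b \<in> nonzerodivisors (cov_ring V)" "SE.cst b \<otimes>\<^bsub>SE.S\<^esub> s = \<zero>\<^bsub>SE.S\<^esub>" and sc: "s \<in> carrier SE.S"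
      by (auto simp: torsion_def SE.S_smult)
    have bc: "b \<in> carrier (cov_ring V)" using b(1) by (simp add: nonzerodivisors_def)
    have "SF.cst b \<otimes>\<^bsub>SF.S\<^esub> incl V s = incl V (SE.cst b \<otimes>\<^bsub>SE.S\<^esub> s)"
      using i.hom_mult[OF SE.cst.hom_closed[OF bc] sc] incl(2)[OF bc] by simp
    then have "SF.cst b \<otimes>\<^bsub>SF.S\<^esub> incl V s = \<zero>\<^bsub>SF.S\<^esub>" unfolding b(2) by simp
    then show ?thesis by (rule torsion_free_module[OF ambD(1) b(1) i.hom_closed[OF sc]])
  qed
  then show ?thesis unfolding tors_img_def ker_img_def by (auto simp: torsion_def)
qed

lemma ker_img_subset: "pp_ring (cov_ring V) \<Longrightarrow> ker_img V \<subseteq> tors_img V"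
proof -
  assume pp: "pp_ring (cov_ring V)"
  \<comment> \<open>Brings the deformation into the form of a record with restricted carrier, in
    which the statement about submodules of free modules is phrased.\<close>
  have d: "def_mod V = FF V\<lparr>carrier := carrier (def_mod V)\<rparr>" by (simp add: deformation_def)
  have "s \<in> torsion (cov_ring V) (SE V)" if "s \<in> carrier (SE V)" "incl V s = \<zero>\<^bsub>SF V\<^esub>" for s
    using kernel_subset_torsion[OF pp ambD(1), of "carrier (def_mod V)" s, folded d] def_mod(1,3) that by blast
  then show ?thesis unfolding tors_img_def ker_img_def by blast
qed

end

text \<open>A lift to the ambient free modules which is linear up to the failure of \<open>s\<close> to be additive and
  multiplicative.\<close>

lemma coordinate_lift:
  assumes Y: "Y \<in> covers k A \<alpha>" and V: "V \<in> covers k A \<alpha>"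
    and s: "s \<in> carrier (cov_ring Y) \<rightarrow> carrier (cov_ring V)"
    and s\<pi>: "\<And>r. r \<in> carrier (cov_ring Y) \<Longrightarrow> cov_proj V (s r) = cov_proj Y r"
  obtains c :: "nat \<Rightarrow> 'b \<Rightarrow> 'u" and e :: "nat \<Rightarrow> 'b" where "\<And>i. i < n \<Longrightarrow> functional (cov_ring Y) (FF Y) (c i)"
    "\<And>i. i < n \<Longrightarrow> e i \<in> carrier (FF V)"
    "\<And>x. x \<in> carrier (FF Y) \<Longrightarrow> p V (\<Oplus>\<^bsub>FF V\<^esub>i\<in>{..<n}. s (c i x) \<odot>\<^bsub>FF V\<^esub> e i) = p Y x"
proof -
  note YD = ambD[OF Y] and VD = ambD[OF V]
  interpret F: module A F by (rule module_F)
  obtain b c where b: "\<And>i. i < n \<Longrightarrow> b i \<in> carrier (FF Y)" and c: "\<And>i. i < n \<Longrightarrow> functional (cov_ring Y) (FF Y) (c i)"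
    and x: "\<And>x. x \<in> carrier (FF Y) \<Longrightarrow> x = (\<Oplus>\<^bsub>FF Y\<^esub>i\<in>{..<n}. c i x \<odot>\<^bsub>FF Y\<^esub> b i)"
    by (rule free_module_coordinates[OF YD(1)]) (rule that, assumption+)
  \<comment> \<open>Lifts of the images in \<open>F\<close> of a basis over \<open>Y\<close>. They
    need not form a basis over \<open>V\<close>; only their images under \<open>p V\<close>
    matter.\<close>
  define e where "e i = inv_into (carrier (FF V)) (p V) (p Y (b i))" for i
  have e: "e i \<in> carrier (FF V)" "p V (e i) = p Y (b i)" if "i < n" for i
  proof -
    have "p Y (b i) \<in> p V ` carrier (FF V)" using semilinear_mapD(1)[OF YD(3) b[OF that]] VD(4) by simp
    then show "e i \<in> carrier (FF V)" "p V (e i) = p Y (b i)" unfolding e_def by (rule inv_into_into, rule f_inv_into_f)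
  qed
  show ?thesis
  proof (rule that[of c e, OF c e(1)])
    fix x assume xc: "x \<in> carrier (FF Y)"
    have cx: "c i x \<in> carrier (cov_ring Y)" if "i < n" for i using functionalD(1)[OF c[OF that] xc] .
    have "p V (\<Oplus>\<^bsub>FF V\<^esub>i\<in>{..<n}. s (c i x) \<odot>\<^bsub>FF V\<^esub> e i) = (\<Oplus>\<^bsub>F\<^esub>i\<in>{..<n}. cov_proj V (s (c i x)) \<odot>\<^bsub>F\<^esub> p V (e i))"
      by (rule semilinear_finsum[OF VD(2) module_F coverD(4)[OF V] VD(3)]) (use cx e(1) funcset_mem[OF s] in auto)
    also have "\<dots> = (\<Oplus>\<^bsub>F\<^esub>i\<in>{..<n}. cov_proj Y (c i x) \<odot>\<^bsub>F\<^esub> p Y (b i))"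
    proof (rule F.M.finsum_cong')
      show "(\<lambda>i. cov_proj Y (c i x) \<odot>\<^bsub>F\<^esub> p Y (b i)) \<in> {..<n} \<rightarrow> carrier F"
        using cx b semilinear_mapD(1)[OF YD(3)] ring_hom_closed[OF coverD(4)[OF Y]] by (auto intro!: F.smult_closed)
    qed (use cx s\<pi> e(2) in auto)
    also have "\<dots> = p Y (\<Oplus>\<^bsub>FF Y\<^esub>i\<in>{..<n}. c i x \<odot>\<^bsub>FF Y\<^esub> b i)"
      by (rule semilinear_finsum[OF YD(2) module_F coverD(4)[OF Y] YD(3), symmetric]) (use cx b in auto)
    also have "\<dots> = p Y x" by (rule arg_cong[OF x[OF xc, symmetric]])
    finally show "p V (\<Oplus>\<^bsub>FF V\<^esub>i\<in>{..<n}. s (c i x) \<odot>\<^bsub>FF V\<^esub> e i) = p Y x" .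
  qed
qed

text \<open>Without such a lift there would be no transition maps along \<open>\<phi>\<close>, and
  the families in the limit would be subject to no condition there.\<close>

lemma natural_lift_exists:
  assumes Y: "Y \<in> covers k A \<alpha>" and V: "V \<in> covers k A \<alpha>" and \<phi>: "\<phi> \<in> cover_maps k Y V"
  shows "lifts Y V \<phi> \<noteq> {}"
proof -
  note \<phi>D = cover_mapsD[OF \<phi>]
  interpret M: module "cov_ring V" "FF V" by (rule ambD(2)[OF V])
  have s: "\<phi> \<in> carrier (cov_ring Y) \<rightarrow> carrier (cov_ring V)" using ring_hom_closed[OF \<phi>D(1)] by blast
  obtain c :: "nat \<Rightarrow> 'b \<Rightarrow> 'u" and e :: "nat \<Rightarrow> 'b" where c: "\<And>i. i < n \<Longrightarrow> functional (cov_ring Y) (FF Y) (c i)"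
    and e: "\<And>i. i < n \<Longrightarrow> e i \<in> carrier (FF V)"
    and p: "\<And>x. x \<in> carrier (FF Y) \<Longrightarrow> p V (\<Oplus>\<^bsub>FF V\<^esub>i\<in>{..<n}. \<phi> (c i x) \<odot>\<^bsub>FF V\<^esub> e i) = p Y x"
    by (rule coordinate_lift[OF Y V s \<phi>D(4)]) (assumption, rule that, assumption+)
  define f where "f x = (\<Oplus>\<^bsub>FF V\<^esub>i\<in>{..<n}. \<phi> (c i x) \<odot>\<^bsub>FF V\<^esub> e i)" for x
  have cc: "\<phi> (c i x) \<in> carrier (cov_ring V)" if "i < n" "x \<in> carrier (FF Y)" for i x
    using ring_hom_closed[OF \<phi>D(1) functionalD(1)[OF c[OF that(1)] that(2)]] .
  have tc: "(\<lambda>i. \<phi> (c i x) \<odot>\<^bsub>FF V\<^esub> e i) \<in> {..<n} \<rightarrow> carrier (FF V)" if "x \<in> carrier (FF Y)" for x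
    using cc that e by (auto intro!: M.smult_closed)
  have "semilinear_map \<phi> (cov_ring Y) (FF Y) (FF V) f"
    unfolding semilinear_map_def
  proof (intro conjI ballI)
    show "f \<in> carrier (FF Y) \<rightarrow> carrier (FF V)" unfolding f_def using M.finsum_closed[OF tc] by blast
    fix x assume x: "x \<in> carrier (FF Y)"
    show "f (x \<oplus>\<^bsub>FF Y\<^esub> y) = f x \<oplus>\<^bsub>FF V\<^esub> f y" if y: "y \<in> carrier (FF Y)" for y
    proof -
      have "f (x \<oplus>\<^bsub>FF Y\<^esub> y) = (\<Oplus>\<^bsub>FF V\<^esub>i\<in>{..<n}. \<phi> (c i x) \<odot>\<^bsub>FF V\<^esub> e i \<oplus>\<^bsub>FF V\<^esub> \<phi> (c i y) \<odot>\<^bsub>FF V\<^esub> e i)"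
        unfolding f_def
      proof (rule M.finsum_cong')
        fix i assume "i \<in> {..<n}"
        then have i: "i < n" by simp
        show "\<phi> (c i (x \<oplus>\<^bsub>FF Y\<^esub> y)) \<odot>\<^bsub>FF V\<^esub> e i = \<phi> (c i x) \<odot>\<^bsub>FF V\<^esub> e i \<oplus>\<^bsub>FF V\<^esub> \<phi> (c i y) \<odot>\<^bsub>FF V\<^esub> e i"
          using functionalD(1)[OF c[OF i] x] functionalD(1)[OF c[OF i] y] functionalD(2)[OF c[OF i] x y]
            ring_hom_add[OF \<phi>D(1)] M.smult_l_distr[OF cc[OF i x] cc[OF i y] e[OF i]] by simp
      qed (use tc[OF x] tc[OF y] in auto)
      then show ?thesis unfolding f_def using M.finsum_addf[OF tc[OF x] tc[OF y]] by simp
    qed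
    show "f (r \<odot>\<^bsub>FF Y\<^esub> x) = \<phi> r \<odot>\<^bsub>FF V\<^esub> f x" if r: "r \<in> carrier (cov_ring Y)" for r
    proof -
      have r': "\<phi> r \<in> carrier (cov_ring V)" by (rule ring_hom_closed[OF \<phi>D(1) r])
      have "f (r \<odot>\<^bsub>FF Y\<^esub> x) = (\<Oplus>\<^bsub>FF V\<^esub>i\<in>{..<n}. \<phi> r \<odot>\<^bsub>FF V\<^esub> (\<phi> (c i x) \<odot>\<^bsub>FF V\<^esub> e i))"
        unfolding f_def
      proof (rule M.finsum_cong')
        fix i assume "i \<in> {..<n}"
        then have i: "i < n" by simp
        show "\<phi> (c i (r \<odot>\<^bsub>FF Y\<^esub> x)) \<odot>\<^bsub>FF V\<^esub> e i = \<phi> r \<odot>\<^bsub>FF V\<^esub> (\<phi> (c i x) \<odot>\<^bsub>FF V\<^esub> e i)"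
          using functionalD(1)[OF c[OF i] x] functionalD(3)[OF c[OF i] r x] r
            ring_hom_mult[OF \<phi>D(1)] M.smult_assoc1[OF r' cc[OF i x] e[OF i]] by simp
      qed (use tc[OF x] r' in auto)
      then show ?thesis unfolding f_def using M.finsum_smult_ldistr[OF _ r', of "{..<n}"] tc[OF x] by simp
    qed
  qed
  then have "f \<in> lifts Y V \<phi>" using p by (simp add: natural_lifts_def f_def)
  then show ?thesis by blast
qed

section \<open>Transition maps between embedded Aluffi algebras\<close>

context
  fixes Y V :: "('k, 'u, 'a) cover" and \<phi> :: "'u \<Rightarrow> 'u" and f :: "'b \<Rightarrow> 'b"
  assumes Y: "Y \<in> covers k A \<alpha>" and V: "V \<in> covers k A \<alpha>" and \<phi>: "\<phi> \<in> cover_maps k Y V" and f: "f \<in> lifts Y V \<phi>"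
begin

lemma lift_semilinear:
  shows "semilinear_map \<phi> (cov_ring Y) (FF Y) (FF V) f" "semilinear_map \<phi> (cov_ring Y) (def_mod Y) (def_mod V) f"
    "x \<in> carrier (FF Y) \<Longrightarrow> p V (f x) = p Y x"
proof -
  show f1: "semilinear_map \<phi> (cov_ring Y) (FF Y) (FF V) f" and f2: "x \<in> carrier (FF Y) \<Longrightarrow> p V (f x) = p Y x" for x
    using f by (auto simp: natural_lifts_def)
  show "semilinear_map \<phi> (cov_ring Y) (def_mod Y) (def_mod V) f"
    using semilinear_mapD[OF f1] f2 by (auto simp: semilinear_map_def deformation_def)
qed

lemma base_sym_map:
  assumes s: "s \<in> carrier (SE Y)"
  shows "base V (sym_map (cov_ring Y) (def_mod Y) (cov_ring V) (def_mod V) \<phi> f s) = base Y s"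
  unfolding sym_to_base_def
proof (rule sym_map_comp[OF SE[OF Y] SE[OF V] SL cover_mapsD(1)[OF \<phi>] coverD(4)[OF V] lift_semilinear(2)
      def_mod(2)[OF V] def_mod(2)[OF Y] coverD(4)[OF Y] _ _ s])
  fix x assume "x \<in> carrier (def_mod Y)"
  then have "x \<in> carrier (FF Y)" using def_mod(3)[OF Y] by blast
  then show "def_proj Y x = def_proj V (f x)" using lift_semilinear(3) by (simp add: deformation_proj_def)
next
  fix b assume "b \<in> carrier (cov_ring Y)"
  then show "cov_proj Y b = cov_proj V (\<phi> b)" using cover_mapsD(4)[OF \<phi>] by simp
qed

text \<open>Functoriality of the symmetric algebra along the inclusions of the deformations into the
  ambient modules carries a kernel element to a kernel element, and \<open>base\<close> is
  unchanged. Nonzerodivisors do not occur in this argument.\<close>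

lemma ker_img_mono: "ker_img Y \<subseteq> ker_img V"
proof
  fix x assume "x \<in> ker_img Y"
  then obtain s where s: "s \<in> carrier (SE Y)" "incl Y s = \<zero>\<^bsub>SF Y\<^esub>" "x = base Y s" unfolding ker_img_def by blast
  let ?t = "sym_map (cov_ring Y) (def_mod Y) (cov_ring V) (def_mod V) \<phi> f s"
  note \<phi>h = cover_mapsD(1)[OF \<phi>]
  note m = sym_map[OF SE[OF Y] SE[OF V] \<phi>h lift_semilinear(2)] and mF = sym_map[OF SF[OF Y] SF[OF V] \<phi>h lift_semilinear(1)]
  interpret SFY: symmetric_algebra "cov_ring Y" "FF Y" by (rule SF[OF Y])
  interpret SFV: symmetric_algebra "cov_ring V" "FF V" by (rule SF[OF V])
  have fE: "semilinear_map \<phi> (cov_ring Y) (def_mod Y) (FF V) f"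
    using lift_semilinear(2) by (auto simp: semilinear_map_def deformation_def)
  have "incl V ?t = sym_map (cov_ring Y) (def_mod Y) (cov_ring V) (FF V) \<phi> f s"
    by (rule sym_map_comp[OF SE[OF Y] SE[OF V] SF[OF V] \<phi>h id_hom[OF V] lift_semilinear(2) incl_linear[OF V] fE \<phi>h _ _ s(1)]) simp_all
  also have "\<dots> = sym_map (cov_ring Y) (FF Y) (cov_ring V) (FF V) \<phi> f (incl Y s)"
    by (rule sym_map_comp[OF SE[OF Y] SF[OF Y] SF[OF V] id_hom[OF Y] \<phi>h incl_linear[OF Y] lift_semilinear(1) fE \<phi>h _ _ s(1), symmetric]) simp_all
  also have "\<dots> = \<zero>\<^bsub>SF V\<^esub>" unfolding s(2) by (rule ring_hom_zero[OF mF(1) SFY.S.ring_axioms SFV.S.ring_axioms])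
  finally have "incl V ?t = \<zero>\<^bsub>SF V\<^esub>" .
  moreover have "?t \<in> carrier (SE V)" by (rule ring_hom_closed[OF m(1) s(1)])
  moreover have "x = base V ?t" using base_sym_map[OF s(1)] s(3) by simp
  ultimately show "x \<in> ker_img V" unfolding ker_img_def by blast
qed

text \<open>The defining formula at \<open>s = 1\<close>: a transition map is induced by the
  identity of \<open>S\<^sub>A(L)\<close>. In particular any two of them between the same covers
  agree on the carrier, whatever \<open>\<phi>\<close> and \<open>f\<close> are.\<close>

lemma induced_maps_can:
  assumes T: "T \<in> induced_maps A L j FF p Y V \<phi> f" and x: "x \<in> carrier SL"
  shows "T (can Y x) = can V x"
proof -
  interpret SL: symmetric_algebra A L by (rule SL)
  interpret SEY: symmetric_algebra "cov_ring Y" "def_mod Y" by (rule SE[OF Y])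
  interpret SEV: symmetric_algebra "cov_ring V" "def_mod V" by (rule SE[OF V])
  let ?m = "sym_map (cov_ring Y) (def_mod Y) (cov_ring V) (def_mod V) \<phi> f"
  note m = sym_map[OF SE[OF Y] SE[OF V] cover_mapsD(1)[OF \<phi>] lift_semilinear(2)]
  have 1: "proj Y \<one>\<^bsub>SE Y\<^esub> = \<one>\<^bsub>rees_algebra (cov_ring Y) (def_mod Y)\<^esub>" "proj V \<one>\<^bsub>SE V\<^esub> = \<one>\<^bsub>rees_algebra (cov_ring V) (def_mod V)\<^esub>"
    "?m \<one>\<^bsub>SE Y\<^esub> = \<one>\<^bsub>SE V\<^esub>"
    using ring_hom_one[OF rees(2)[OF Y]] ring_hom_one[OF rees(2)[OF V]] ring_hom_one[OF m(1)] .
  have "T (tens Y x (proj Y \<one>\<^bsub>SE Y\<^esub>)) = tens V x (proj V (?m \<one>\<^bsub>SE Y\<^esub>))"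
    using T x SEY.S.one_closed unfolding induced_maps_def Let_def by blast
  then show ?thesis unfolding 1 .
qed

text \<open>Inclusion of the kernels lets \<open>can V\<close> factor through \<open>can Y\<close>.
  The formula on tensors follows, because \<open>tens\<close> is expressed by \<open>can\<close> and
  \<open>base\<close>, and \<open>base\<close> is compatible with the lift.\<close>

lemma induced_map_exists:
  assumes K: "tors_img Y \<subseteq> tors_img V"
  shows "induced_maps A L j FF p Y V \<phi> f \<noteq> {}"
proof -
  interpret SL: symmetric_algebra A L by (rule SL)
  interpret AY: cring "Al Y" by (rule cring_Al[OF Y])
  interpret AV: cring "Al V" by (rule cring_Al[OF V])
  let ?m = "sym_map (cov_ring Y) (def_mod Y) (cov_ring V) (def_mod V) \<phi> f"
  note m = sym_map[OF SE[OF Y] SE[OF V] cover_mapsD(1)[OF \<phi>] lift_semilinear(2)]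
  have ker: "can V x = \<zero>\<^bsub>Al V\<^esub>" if "x \<in> carrier SL" "can Y x = \<zero>\<^bsub>Al Y\<^esub>" for x
    using that can_zero_iff[OF Y that(1)] can_zero_iff[OF V that(1)] K by blast
  have "\<exists>T\<in>ring_hom (Al Y) (Al V). \<forall>x\<in>carrier SL. T (can Y x) = can V x"
    by (rule factor_ring_hom[OF SL.S.ring_axioms AY.ring_axioms AV.ring_axioms can_hom[OF Y] can_surj[OF Y] can_hom[OF V]])
      (rule ker)
  then obtain T where T: "T \<in> ring_hom (Al Y) (Al V)" and Tc: "\<forall>x\<in>carrier SL. T (can Y x) = can V x" by (elim bexE) (rule that)
  have "T \<in> induced_maps A L j FF p Y V \<phi> f"
    unfolding induced_maps_def Let_def algebra_hom_def
  proof (intro CollectI conjI ballI)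
    show "T \<in> ring_hom (Al Y) (Al V)" by (rule T)
    show "T (str Y a) = str V a" if "a \<in> carrier A" for a
      unfolding str_eq[OF Y that] str_eq[OF V that] using bspec[OF Tc SL.cst.hom_closed[OF that]] .
    fix x s assume x: "x \<in> carrier SL" and s: "s \<in> carrier (SE Y)"
    have b: "base Y s \<in> carrier SL" by (rule ring_hom_closed[OF base(1)[OF Y] s])
    show "T (tens Y x (proj Y s)) = tens V x (proj V (?m s))"
      unfolding tens_eq[OF Y x s] tens_eq[OF V x ring_hom_closed[OF m(1) s]] base_sym_map[OF s]
      by (rule bspec[OF Tc SL.S.m_closed[OF x b]])
  qed
  then show ?thesis by blast
qed

end

text \<open>For every cover \<open>Y\<close> above \<open>V\<close> the kernels satisfy
  \<open>K(Y) \<subseteq> K'(Y) \<subseteq> K'(V) \<subseteq> K(V)\<close>; the last inclusion is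
  where the annihilators of \<open>V\<close> enter.\<close>

lemma pp_ring_system:
  assumes V: "V \<in> covers k A \<alpha>" and pp: "pp_ring (cov_ring V)"
  shows "V \<in> system"
  unfolding aluffi_system_def
proof (intro CollectI conjI ballI)
  show "V \<in> covers k A \<alpha>" by (rule V)
  fix Y \<phi> f assume Y: "Y \<in> covers k A \<alpha>" and \<phi>: "\<phi> \<in> cover_maps k Y V" and f: "f \<in> lifts Y V \<phi>"
  show "induced_maps A L j FF p Y V \<phi> f \<noteq> {}"
    by (rule induced_map_exists[OF Y V \<phi> f])
      (use tors_img_subset[OF Y] ker_img_mono[OF Y V \<phi> f] ker_img_subset[OF V pp] in blast)
qed

lemma transition_exists:
  assumes Y: "Y \<in> covers k A \<alpha>" and V: "V \<in> system" and \<phi>: "cover_maps k Y V \<noteq> {}"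
  shows "\<exists>t. t \<in> transition_maps k A L j FF p Y V"
proof -
  obtain \<phi> where \<phi>: "\<phi> \<in> cover_maps k Y V" using \<phi> by blast
  have Vc: "V \<in> covers k A \<alpha>" using V by (simp add: aluffi_system_def)
  obtain f where f: "f \<in> lifts Y V \<phi>" using natural_lift_exists[OF Y Vc \<phi>] by blast
  have "induced_maps A L j FF p Y V \<phi> f \<noteq> {}" using V Y \<phi> f unfolding aluffi_system_def by blast
  then show ?thesis unfolding transition_maps_def using \<phi> f by blast
qed

lemma transition_can:
  assumes Y: "Y \<in> covers k A \<alpha>" and V: "V \<in> covers k A \<alpha>" and t: "t \<in> transition_maps k A L j FF p Y V" and x: "x \<in> carrier SL"
  shows "t (can Y x) = can V x"
proof -
  obtain \<phi> f where "\<phi> \<in> cover_maps k Y V" "f \<in> lifts Y V \<phi>" "t \<in> induced_maps A L j FF p Y V \<phi> f"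
    using t unfolding transition_maps_def by blast
  then show ?thesis using induced_maps_can[OF Y V _ _ _ x] by blast
qed

section \<open>Smooth covers and the limit\<close>

text \<open>Reduces to the general lifting of relations. The approximate section \<open>s\<close> of
  rings is supplied by smoothness and extended to the ambient modules through coordinates, so that
  the errors of the module map are inherited from those of \<open>s\<close>.\<close>

lemma smooth_ker_img:
  assumes U: "U \<in> covers k A \<alpha>" and smooth: "smooth_algebra k (cov_ring U) (cov_str U)"
    and P: "P \<in> covers k A \<alpha>" and \<phi>: "\<phi> \<in> cover_maps k P U"
  shows "ker_img U \<subseteq> ker_img P"
proof
  fix x assume "x \<in> ker_img U"
  then obtain \<sigma> where \<sigma>: "\<sigma> \<in> carrier (SE U)" "incl U \<sigma> = \<zero>\<^bsub>SF U\<^esub>" "x = base U \<sigma>" unfolding ker_img_def by blast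
  interpret k: field k by (rule k)
  let ?U = "cov_ring U" and ?P = "cov_ring P" and ?FU = "FF U" and ?FP = "FF P"
  note \<phi>D = cover_mapsD[OF \<phi>]
  interpret U: cring ?U by (rule coverD(2)[OF U])
  interpret P: cring ?P by (rule coverD(2)[OF P])
  interpret F: module A F by (rule module_F)
  interpret LL: module A L by (rule L)
  interpret FP: module ?P ?FP by (rule ambD(2)[OF P])
  interpret \<phi>: ring_hom_ring ?P ?U \<phi> by unfold_locales (rule \<phi>D(1))
  let ?I = "a_kernel ?P ?U \<phi>"
  have I: "ideal ?I ?P" by (rule \<phi>.kernel_is_ideal)
  have j0: "j \<zero>\<^bsub>L\<^esub> = \<zero>\<^bsub>F\<^esub>" by (rule semilinear_zero[OF L module_F id_ring_hom[OF F.R.ring_axioms] j])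
  have \<pi>U0: "cov_proj U \<zero>\<^bsub>?U\<^esub> = \<zero>\<^bsub>A\<^esub>" by (rule ring_hom_zero[OF coverD(4)[OF U] U.ring_axioms F.R.ring_axioms])
  have I\<pi>: "cov_proj P a = \<zero>\<^bsub>A\<^esub>" if "a \<in> ?I" for a
    using \<phi>D(4)[of a] that \<pi>U0 unfolding mem_a_kernel by simp
  have IF: "\<exists>z\<in>carrier (def_mod P). z = a \<odot>\<^bsub>?FP\<^esub> y \<and> def_proj P z = \<zero>\<^bsub>L\<^esub>" if a: "a \<in> ?I" and y: "y \<in> carrier ?FP" for a y
  proof -
    have ac: "a \<in> carrier ?P" using a unfolding mem_a_kernel by simp
    have "p P (a \<odot>\<^bsub>?FP\<^esub> y) = j \<zero>\<^bsub>L\<^esub>"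
      using semilinear_mapD(3)[OF ambD(3)[OF P] ac y] I\<pi>[OF a] semilinear_mapD(1)[OF ambD(3)[OF P] y] j0 by simp
    then show ?thesis
      using in_def_mod[OF P FP.smult_closed[OF ac y] LL.zero_closed] def_proj_eq[OF P LL.zero_closed] by blast
  qed
  have sec: "\<exists>s l. s \<in> carrier ?U \<rightarrow> carrier ?P \<and> (\<forall>r\<in>carrier ?U. cov_proj P (s r) = cov_proj U r) \<and>
       (\<forall>r\<in>carrier ?U. \<forall>t\<in>carrier ?U. s (r \<oplus>\<^bsub>?U\<^esub> t) \<ominus>\<^bsub>?P\<^esub> (s r \<oplus>\<^bsub>?P\<^esub> s t) \<in> ideal_power ?P ?I (Suc m)) \<and>
       (\<forall>r\<in>carrier ?U. \<forall>t\<in>carrier ?U. s (r \<otimes>\<^bsub>?U\<^esub> t) \<ominus>\<^bsub>?P\<^esub> s r \<otimes>\<^bsub>?P\<^esub> s t \<in> ideal_power ?P ?I (Suc m)) \<and>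
       s \<one>\<^bsub>?U\<^esub> \<ominus>\<^bsub>?P\<^esub> \<one>\<^bsub>?P\<^esub> \<in> ideal_power ?P ?I (Suc m) \<and>
       l \<in> carrier ?FU \<rightarrow> carrier ?FP \<and>
       (\<forall>x\<in>carrier (def_mod U). \<exists>z\<in>carrier (def_mod P). z = l x \<and> def_proj P z = def_proj U x) \<and>
       (\<forall>x\<in>carrier ?FU. \<forall>y\<in>carrier ?FU. \<exists>d\<in>smult_span ?FP (ideal_power ?P ?I (Suc m)) (carrier ?FP).
          l (x \<oplus>\<^bsub>?FU\<^esub> y) = (l x \<oplus>\<^bsub>?FP\<^esub> l y) \<oplus>\<^bsub>?FP\<^esub> d) \<and>
       (\<forall>r\<in>carrier ?U. \<forall>x\<in>carrier ?FU. \<exists>d\<in>smult_span ?FP (ideal_power ?P ?I (Suc m)) (carrier ?FP).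
          l (r \<odot>\<^bsub>?FU\<^esub> x) = s r \<odot>\<^bsub>?FP\<^esub> l x \<oplus>\<^bsub>?FP\<^esub> d)" for m
  proof -
    let ?Q = "ideal_power ?P ?I (Suc m)"
    interpret Q: ideal ?Q ?P by (rule P.ideal_power_ideal[OF I])
    have Qc: "?Q \<subseteq> carrier ?P" using Q.Icarr by blast
    have comm: "comm_algebra k ?P (cov_str P)" using coverD(1)[OF P] by (simp add: finite_type_algebra_def)
    obtain s where s: "section_mod k ?U (cov_str U) ?P (cov_str P) \<phi> ?Q s"
      using smooth_section[OF k.ring_axioms smooth comm \<phi>D(5,3)] by blast
    have sc: "s r \<in> carrier ?P" "\<phi> (s r) = r" if "r \<in> carrier ?U" for r using s that by (simp_all add: section_mod_def)
    have sf: "s \<in> carrier ?U \<rightarrow> carrier ?P" using sc(1) by blast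
    have s\<pi>: "cov_proj P (s r) = cov_proj U r" if "r \<in> carrier ?U" for r using \<phi>D(4)[OF sc(1)[OF that]] sc(2)[OF that] by simp
    have s_add: "s (r \<oplus>\<^bsub>?U\<^esub> t) \<ominus>\<^bsub>?P\<^esub> (s r \<oplus>\<^bsub>?P\<^esub> s t) \<in> ?Q" if "r \<in> carrier ?U" "t \<in> carrier ?U" for r t
      using s that unfolding section_mod_def by blast
    have s_mult: "s (r \<otimes>\<^bsub>?U\<^esub> t) \<ominus>\<^bsub>?P\<^esub> s r \<otimes>\<^bsub>?P\<^esub> s t \<in> ?Q" if "r \<in> carrier ?U" "t \<in> carrier ?U" for r t
      using s that unfolding section_mod_def by blast
    have s_one: "s \<one>\<^bsub>?U\<^esub> \<ominus>\<^bsub>?P\<^esub> \<one>\<^bsub>?P\<^esub> \<in> ?Q" using s unfolding section_mod_def by blast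
    obtain c :: "nat \<Rightarrow> 'b \<Rightarrow> 'u" and e :: "nat \<Rightarrow> 'b" where c: "\<And>i. i < n \<Longrightarrow> functional ?U ?FU (c i)"
      and e: "\<And>i. i < n \<Longrightarrow> e i \<in> carrier ?FP"
      and p: "\<And>x. x \<in> carrier ?FU \<Longrightarrow> p P (\<Oplus>\<^bsub>?FP\<^esub>i\<in>{..<n}. s (c i x) \<odot>\<^bsub>?FP\<^esub> e i) = p U x"
      by (rule coordinate_lift[OF U P sf s\<pi>]) (assumption, rule that, assumption+)
    \<comment> \<open>Applying \<open>s\<close> to each coordinate makes \<open>l\<close> compatible
      with the projections to \<open>F\<close>, exactly and not merely approximately; this is why
      deformations are carried into deformations.\<close>
    define l where "l x = (\<Oplus>\<^bsub>?FP\<^esub>i\<in>{..<n}. s (c i x) \<odot>\<^bsub>?FP\<^esub> e i)" for x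
    have cc: "c i x \<in> carrier ?U" if "i < n" "x \<in> carrier ?FU" for i x using functionalD(1)[OF c[OF that(1)] that(2)] .
    have tc: "(\<lambda>i. s (c i x) \<odot>\<^bsub>?FP\<^esub> e i) \<in> {..<n} \<rightarrow> carrier ?FP" if "x \<in> carrier ?FU" for x
      using cc that e sc(1) by (auto intro!: FP.smult_closed)
    have lc: "l x \<in> carrier ?FP" if "x \<in> carrier ?FU" for x unfolding l_def by (rule FP.finsum_closed[OF tc[OF that]])
    \<comment> \<open>Two combinations of the \<open>e i\<close> differ by the combination with the
      differences of coefficients. For \<open>l\<close> these are the errors of \<open>s\<close>, so
      the error of \<open>l\<close> lies in \<open>I^(m+1)\<close> times the ambient module.\<close>
    have split: "(\<Oplus>\<^bsub>?FP\<^esub>i\<in>{..<n}. a i \<odot>\<^bsub>?FP\<^esub> e i) =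
        (\<Oplus>\<^bsub>?FP\<^esub>i\<in>{..<n}. b i \<odot>\<^bsub>?FP\<^esub> e i) \<oplus>\<^bsub>?FP\<^esub> (\<Oplus>\<^bsub>?FP\<^esub>i\<in>{..<n}. (a i \<ominus>\<^bsub>?P\<^esub> b i) \<odot>\<^bsub>?FP\<^esub> e i)"
      if a: "\<And>i. i < n \<Longrightarrow> a i \<in> carrier ?P" and b: "\<And>i. i < n \<Longrightarrow> b i \<in> carrier ?P" for a b
    proof -
      have bc: "(\<lambda>i. b i \<odot>\<^bsub>?FP\<^esub> e i) \<in> {..<n} \<rightarrow> carrier ?FP" using b e by (auto intro!: FP.smult_closed)
      have dc: "(\<lambda>i. (a i \<ominus>\<^bsub>?P\<^esub> b i) \<odot>\<^bsub>?FP\<^esub> e i) \<in> {..<n} \<rightarrow> carrier ?FP"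
        using a b e by (auto intro!: FP.smult_closed)
      have "(\<Oplus>\<^bsub>?FP\<^esub>i\<in>{..<n}. a i \<odot>\<^bsub>?FP\<^esub> e i) = (\<Oplus>\<^bsub>?FP\<^esub>i\<in>{..<n}. b i \<odot>\<^bsub>?FP\<^esub> e i \<oplus>\<^bsub>?FP\<^esub> (a i \<ominus>\<^bsub>?P\<^esub> b i) \<odot>\<^bsub>?FP\<^esub> e i)"
      proof (rule FP.finsum_cong')
        fix i assume "i \<in> {..<n}"
        then have i: "i < n" by simp
        have "b i \<oplus>\<^bsub>?P\<^esub> (a i \<ominus>\<^bsub>?P\<^esub> b i) = a i" using a[OF i] b[OF i] by (simp add: a_minus_def P.a_lcomm P.r_neg)
        then show "a i \<odot>\<^bsub>?FP\<^esub> e i = b i \<odot>\<^bsub>?FP\<^esub> e i \<oplus>\<^bsub>?FP\<^esub> (a i \<ominus>\<^bsub>?P\<^esub> b i) \<odot>\<^bsub>?FP\<^esub> e i"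
          using FP.smult_l_distr[OF b[OF i] P.minus_closed[OF a[OF i] b[OF i]] e[OF i]] by simp
      qed (use bc dc in auto)
      then show ?thesis using FP.finsum_addf[OF bc dc] by simp
    qed
    have span: "(\<Oplus>\<^bsub>?FP\<^esub>i\<in>{..<n}. a i \<odot>\<^bsub>?FP\<^esub> e i) \<in> smult_span ?FP ?Q (carrier ?FP)" if "\<And>i. i < n \<Longrightarrow> a i \<in> ?Q" for a
      by (rule smult_span_finsum[OF ambD(2)[OF P] _ _ _ Qc]) (use that e in auto)
    show ?thesis
    proof (intro exI conjI ballI)
      show "s \<in> carrier ?U \<rightarrow> carrier ?P" by (rule sf)
      show "cov_proj P (s r) = cov_proj U r" if "r \<in> carrier ?U" for r by (rule s\<pi>[OF that])
      show "s (r \<oplus>\<^bsub>?U\<^esub> t) \<ominus>\<^bsub>?P\<^esub> (s r \<oplus>\<^bsub>?P\<^esub> s t) \<in> ?Q" if "r \<in> carrier ?U" "t \<in> carrier ?U" for r t by (rule s_add[OF that])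
      show "s (r \<otimes>\<^bsub>?U\<^esub> t) \<ominus>\<^bsub>?P\<^esub> s r \<otimes>\<^bsub>?P\<^esub> s t \<in> ?Q" if "r \<in> carrier ?U" "t \<in> carrier ?U" for r t by (rule s_mult[OF that])
      show "s \<one>\<^bsub>?U\<^esub> \<ominus>\<^bsub>?P\<^esub> \<one>\<^bsub>?P\<^esub> \<in> ?Q" by (rule s_one)
      show "l \<in> carrier ?FU \<rightarrow> carrier ?FP" using lc by blast
      show "\<exists>z\<in>carrier (def_mod P). z = l x \<and> def_proj P z = def_proj U x" if x: "x \<in> carrier (def_mod U)" for x
      proof -
        have xF: "x \<in> carrier ?FU" using def_mod(3)[OF U] x by blast
        have dl: "def_proj U x \<in> carrier L" by (rule semilinear_mapD(1)[OF def_mod(2)[OF U] x])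
        have "p P (l x) = j (def_proj U x)" using p[OF xF] def_mod(4)[OF U x] by (simp add: l_def)
        then show ?thesis using in_def_mod[OF P lc[OF xF] dl] def_proj_eq[OF P dl] by blast
      qed
      show "\<exists>d\<in>smult_span ?FP ?Q (carrier ?FP). l (x \<oplus>\<^bsub>?FU\<^esub> y) = (l x \<oplus>\<^bsub>?FP\<^esub> l y) \<oplus>\<^bsub>?FP\<^esub> d"
        if x: "x \<in> carrier ?FU" and y: "y \<in> carrier ?FU" for x y
      proof -
        let ?a = "\<lambda>i. s (c i (x \<oplus>\<^bsub>?FU\<^esub> y))" and ?b = "\<lambda>i. s (c i x) \<oplus>\<^bsub>?P\<^esub> s (c i y)"
        have ca: "c i (x \<oplus>\<^bsub>?FU\<^esub> y) = c i x \<oplus>\<^bsub>?U\<^esub> c i y" if "i < n" for i by (rule functionalD(2)[OF c[OF that] x y])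
        have a: "?a i \<in> carrier ?P" if "i < n" for i
          unfolding ca[OF that] by (rule sc(1)[OF U.a_closed[OF cc[OF that x] cc[OF that y]]])
        have b: "?b i \<in> carrier ?P" if "i < n" for i using sc(1)[OF cc[OF that x]] sc(1)[OF cc[OF that y]] by (rule P.a_closed)
        have "(\<Oplus>\<^bsub>?FP\<^esub>i\<in>{..<n}. ?b i \<odot>\<^bsub>?FP\<^esub> e i) = (\<Oplus>\<^bsub>?FP\<^esub>i\<in>{..<n}. s (c i x) \<odot>\<^bsub>?FP\<^esub> e i \<oplus>\<^bsub>?FP\<^esub> s (c i y) \<odot>\<^bsub>?FP\<^esub> e i)"
        proof (rule FP.finsum_cong')
          fix i assume "i \<in> {..<n}"
          then have i: "i < n" by simp
          show "?b i \<odot>\<^bsub>?FP\<^esub> e i = s (c i x) \<odot>\<^bsub>?FP\<^esub> e i \<oplus>\<^bsub>?FP\<^esub> s (c i y) \<odot>\<^bsub>?FP\<^esub> e i"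
            by (rule FP.smult_l_distr[OF sc(1)[OF cc[OF i x]] sc(1)[OF cc[OF i y]] e[OF i]])
        qed (use tc[OF x] tc[OF y] in auto)
        also have "\<dots> = l x \<oplus>\<^bsub>?FP\<^esub> l y" unfolding l_def by (rule FP.finsum_addf[OF tc[OF x] tc[OF y]])
        finally have bl: "(\<Oplus>\<^bsub>?FP\<^esub>i\<in>{..<n}. ?b i \<odot>\<^bsub>?FP\<^esub> e i) = l x \<oplus>\<^bsub>?FP\<^esub> l y" .
        have "?a i \<ominus>\<^bsub>?P\<^esub> ?b i \<in> ?Q" if "i < n" for i unfolding ca[OF that] by (rule s_add[OF cc[OF that x] cc[OF that y]])
        from span[OF this] split[of ?a ?b, OF a b] bl show ?thesis unfolding l_def[of "x \<oplus>\<^bsub>?FU\<^esub> y"] by (intro bexI) simp_all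
      qed
      show "\<exists>d\<in>smult_span ?FP ?Q (carrier ?FP). l (r \<odot>\<^bsub>?FU\<^esub> x) = s r \<odot>\<^bsub>?FP\<^esub> l x \<oplus>\<^bsub>?FP\<^esub> d"
        if r: "r \<in> carrier ?U" and x: "x \<in> carrier ?FU" for r x
      proof -
        let ?a = "\<lambda>i. s (c i (r \<odot>\<^bsub>?FU\<^esub> x))" and ?b = "\<lambda>i. s r \<otimes>\<^bsub>?P\<^esub> s (c i x)"
        have ca: "c i (r \<odot>\<^bsub>?FU\<^esub> x) = r \<otimes>\<^bsub>?U\<^esub> c i x" if "i < n" for i by (rule functionalD(3)[OF c[OF that] r x])
        have a: "?a i \<in> carrier ?P" if "i < n" for i
          unfolding ca[OF that] by (rule sc(1)[OF U.m_closed[OF r cc[OF that x]]])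
        have b: "?b i \<in> carrier ?P" if "i < n" for i using sc(1)[OF r] sc(1)[OF cc[OF that x]] by (rule P.m_closed)
        have "(\<Oplus>\<^bsub>?FP\<^esub>i\<in>{..<n}. ?b i \<odot>\<^bsub>?FP\<^esub> e i) = (\<Oplus>\<^bsub>?FP\<^esub>i\<in>{..<n}. s r \<odot>\<^bsub>?FP\<^esub> (s (c i x) \<odot>\<^bsub>?FP\<^esub> e i))"
        proof (rule FP.finsum_cong')
          fix i assume "i \<in> {..<n}"
          then have i: "i < n" by simp
          show "?b i \<odot>\<^bsub>?FP\<^esub> e i = s r \<odot>\<^bsub>?FP\<^esub> (s (c i x) \<odot>\<^bsub>?FP\<^esub> e i)"
            by (rule FP.smult_assoc1[OF sc(1)[OF r] sc(1)[OF cc[OF i x]] e[OF i]])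
        qed (use tc[OF x] sc(1)[OF r] in auto)
        also have "\<dots> = s r \<odot>\<^bsub>?FP\<^esub> l x" unfolding l_def
          by (rule FP.finsum_smult_ldistr[symmetric]) (use tc[OF x] sc(1)[OF r] in auto)
        finally have bl: "(\<Oplus>\<^bsub>?FP\<^esub>i\<in>{..<n}. ?b i \<odot>\<^bsub>?FP\<^esub> e i) = s r \<odot>\<^bsub>?FP\<^esub> l x" .
        have "?a i \<ominus>\<^bsub>?P\<^esub> ?b i \<in> ?Q" if "i < n" for i unfolding ca[OF that] by (rule s_mult[OF r cc[OF that x]])
        from span[OF this] split[of ?a ?b, OF a b] bl show ?thesis unfolding l_def[of "r \<odot>\<^bsub>?FU\<^esub> x"] by (intro bexI) simp_all
      qed
    qed
  qed
  obtain \<tau> where \<tau>: "\<tau> \<in> carrier (SE P)" "incl P \<tau> = \<zero>\<^bsub>SF P\<^esub>" "base P \<tau> = base U \<sigma>"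
    using kernel_lift[OF SE[OF U] SF[OF U] SE[OF P] SF[OF P] SL incl_linear[OF U] incl_linear[OF P] coverD(4)[OF U] coverD(4)[OF P]
        def_mod(2)[OF U] def_mod(2)[OF P] I I\<pi> IF sec \<sigma>(1,2)] unfolding sym_to_base_def by blast
  have "base P \<tau> \<in> ker_img P" unfolding ker_img_def using \<tau>(1,2) by blast
  then show "x \<in> ker_img P" using \<tau>(3) \<sigma>(3) by simp
qed

text \<open>An element of \<open>S\<^sub>A(L)\<close> defines a compatible family over all covers in
  the system, which makes the projection onto. It is one-to-one because every other component
  factors through a polynomial ring whose algebra already embeds into that of
  \<open>U\<close>.\<close>

lemma smooth_limit:
  assumes U: "U \<in> covers k A \<alpha>" and smooth: "smooth_algebra k (cov_ring U) (cov_str U)"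
  shows "(\<lambda>x. x U) \<in> algebra_iso A (absolute_aluffi k A \<alpha> L j FF p) (absolute_aluffi_str k A \<alpha> L j FF p) (Al U) (str U)"
proof -
  interpret k: field k by (rule k)
  let ?A = "absolute_aluffi k A \<alpha> L j FF p" and ?s = "absolute_aluffi_str k A \<alpha> L j FF p"
  let ?t = "transition_maps k A L j FF p"
  have sysc: "V \<in> covers k A \<alpha>" if "V \<in> system" for V using that by (simp add: aluffi_system_def)
  \<comment> \<open>Only members of the index set occur as components of the limit, so without this
    the projection at \<open>U\<close> would carry no information.\<close>
  have Usys: "U \<in> system" by (rule pp_ring_system[OF U smooth_pp_ring[OF k A univ U smooth]])
  have carr: "carrier ?A = {x \<in> (\<Pi>\<^sub>E i\<in>system. carrier (Al i)). \<forall>i\<in>system. \<forall>i'\<in>system. \<forall>t\<in>?t i i'. t (x i) = x i'}"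
    and one: "\<one>\<^bsub>?A\<^esub> = (\<lambda>i\<in>system. \<one>\<^bsub>Al i\<^esub>)" and mult: "x \<otimes>\<^bsub>?A\<^esub> y = (\<lambda>i\<in>system. x i \<otimes>\<^bsub>Al i\<^esub> y i)"
    and add: "x \<oplus>\<^bsub>?A\<^esub> y = (\<lambda>i\<in>system. x i \<oplus>\<^bsub>Al i\<^esub> y i)" for x y
    by (simp_all add: absolute_aluffi_def inverse_limit_def)
  have comp: "x V \<in> carrier (Al V)" if "x \<in> carrier ?A" "V \<in> system" for x V using that unfolding carr by blast
  have trans: "t (x V) = x W" if "x \<in> carrier ?A" "V \<in> system" "W \<in> system" "t \<in> ?t V W" for x V W t
    using that unfolding carr by blast
  have inj: "x = y" if x: "x \<in> carrier ?A" and y: "y \<in> carrier ?A" and xy: "x U = y U" for x y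
  proof
    fix V
    show "x V = y V"
    proof (cases "V \<in> system")
      case False
      then show ?thesis using x y unfolding carr by (auto simp: PiE_def extensional_def)
    next
      case V: True
      \<comment> \<open>No map between \<open>U\<close> and \<open>V\<close> is available in
        general; \<open>P\<close> lies above both.\<close>
      obtain N :: nat and P f where P: "P \<in> covers k A \<alpha>"
        and f: "f \<in> ring_iso (monoid_algebra k (free_comm_monoid {..<N})) (cov_ring P)"
        and PU: "cover_maps k P U \<noteq> {}" and PV: "cover_maps k P V \<noteq> {}"
        by (rule polynomial_cover[OF k.cring_axioms A univ U sysc[OF V]]) (rule that, assumption+)
      have pp: "pp_ring (cov_ring P)" by (rule pp_ring_polynomial_cover[OF k f coverD(2)[OF P]])
      have Psys: "P \<in> system" by (rule pp_ring_system[OF P pp])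
      obtain \<phi> where \<phi>: "\<phi> \<in> cover_maps k P U" using PU by blast
      \<comment> \<open>The chain
        \<open>K(U) \<subseteq> K'(U) \<subseteq> K'(P) \<subseteq> K(P)\<close>, whose middle
        inclusion goes against the direction of \<open>\<phi>\<close> and rests on
        smoothness.\<close>
      have K: "tors_img U \<subseteq> tors_img P"
        using tors_img_subset[OF U] smooth_ker_img[OF U smooth P \<phi>] ker_img_subset[OF P pp] by blast
      obtain t where t: "t \<in> ?t P U" using transition_exists[OF P Usys PU] by blast
      obtain t' where t': "t' \<in> ?t P V" using transition_exists[OF P V PV] by blast
      interpret SL: symmetric_algebra A L by (rule SL)
      interpret AP: cring "Al P" by (rule cring_Al[OF P])
      interpret AU: cring "Al U" by (rule cring_Al[OF U])
      interpret cP: ring_hom_ring SL.S "Al P" "can P" by unfold_locales (rule can_hom[OF P])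
      interpret cU: ring_hom_ring SL.S "Al U" "can U" by unfold_locales (rule can_hom[OF U])
      have "x P \<in> can P ` carrier SL" "y P \<in> can P ` carrier SL" using comp[OF x Psys] comp[OF y Psys] can_surj[OF P] by simp_all
      then obtain a b where a: "a \<in> carrier SL" "x P = can P a" and b: "b \<in> carrier SL" "y P = can P b" by (elim imageE) (rule that)
      have "can U a = x U" "can U b = y U"
        using trans[OF x Psys Usys t] trans[OF y Psys Usys t] transition_can[OF P U t a(1)] transition_can[OF P U t b(1)] a(2) b(2) by simp_all
      then have "can U a = can U b" using xy by simp
      then have "can U (a \<ominus>\<^bsub>SL\<^esub> b) = \<zero>\<^bsub>Al U\<^esub>"
        using a(1) b(1) AU.r_neg[OF cU.hom_closed[OF b(1)]] by (simp add: a_minus_def)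
      then have "a \<ominus>\<^bsub>SL\<^esub> b \<in> tors_img U" using can_zero_iff[OF U SL.S.minus_closed[OF a(1) b(1)]] by blast
      then have "can P (a \<ominus>\<^bsub>SL\<^esub> b) = \<zero>\<^bsub>Al P\<^esub>" using can_zero_iff[OF P SL.S.minus_closed[OF a(1) b(1)]] K by blast
      then have "can P a \<ominus>\<^bsub>Al P\<^esub> can P b = \<zero>\<^bsub>Al P\<^esub>" using a(1) b(1) by (simp add: a_minus_def)
      then have "x P = y P" unfolding a(2) b(2) using AP.r_right_minus_eq[OF cP.hom_closed[OF a(1)] cP.hom_closed[OF b(1)]] by blast
      then show ?thesis using trans[OF x Psys V t'] trans[OF y Psys V t'] by simp
    qed
  qed
  have surj: "\<exists>x\<in>carrier ?A. x U = z" if z: "z \<in> carrier (Al U)" for z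
  proof -
    have "z \<in> can U ` carrier SL" using z can_surj[OF U] by simp
    then obtain s where s: "s \<in> carrier SL" "z = can U s" by (elim imageE) (rule that)
    have "(\<lambda>V\<in>system. can V s) \<in> carrier ?A"
      unfolding carr
    proof (intro CollectI conjI ballI)
      show "(\<lambda>V\<in>system. can V s) \<in> (\<Pi>\<^sub>E i\<in>system. carrier (Al i))"
        using ring_hom_closed[OF can_hom[OF sysc] s(1)] by auto
      show "t ((\<lambda>V\<in>system. can V s) V) = (\<lambda>V\<in>system. can V s) W" if "V \<in> system" "W \<in> system" "t \<in> ?t V W" for V W t
        using transition_can[OF sysc[OF that(1)] sysc[OF that(2)] that(3) s(1)] that(1,2) by simp
    qed
    moreover have "(\<lambda>V\<in>system. can V s) U = z" using Usys s(2) by simp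
    ultimately show ?thesis by blast
  qed
  have "(\<lambda>x. x U) \<in> ring_hom ?A (Al U)"
    by (rule ring_hom_memI) (use Usys comp in \<open>simp_all add: one mult add\<close>)
  moreover have "bij_betw (\<lambda>x. x U) (carrier ?A) (carrier (Al U))"
    unfolding bij_betw_def
  proof
    show "inj_on (\<lambda>x. x U) (carrier ?A)" by (rule inj_onI) (rule inj)
    show "(\<lambda>x. x U) ` carrier ?A = carrier (Al U)" using comp[OF _ Usys] surj by (auto simp: image_iff)
  qed
  moreover have "?s a U = str U a" for a using Usys by (simp add: absolute_aluffi_str_def)
  ultimately show ?thesis by (simp add: algebra_iso_def algebra_hom_def ring_iso_def)
qed

end

theorem theorem2p6:
  fixes k :: "'k ring" and A :: "'a ring" and \<alpha> :: "'k \<Rightarrow> 'a"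
    and E :: "('a, 'e) module" and F :: "('a, 'f) module" and n :: nat
    and j :: "'e set \<Rightarrow> 'f"
    and R :: "'u ring" and \<iota> :: "'k \<Rightarrow> 'u" and \<pi> :: "'u \<Rightarrow> 'a"
    and FF :: "('k, 'u, 'a) cover \<Rightarrow> ('u, 'b) module"
    and p :: "('k, 'u, 'a) cover \<Rightarrow> 'b \<Rightarrow> 'f"
  defines "L \<equiv> torsionfree_quotient A E"
    and "U \<equiv> \<lparr>cov_ring = R, cov_str = \<iota>, cov_proj = \<pi>\<rparr>"
  assumes "perfect_field k" and "finite_type_algebra k A \<alpha>"
    and "large_universe TYPE('u) k"
    and "fin_gen_module A E" and "free_module A F n"
    and "linear_map A L F j" and "inj_on j (carrier L)"
    and "\<And>Y. Y \<in> covers k A \<alpha> \<Longrightarrow> ambient_lift A F n Y (FF Y) (p Y)"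
    and "smooth_algebra k R \<iota>" and "\<pi> \<in> algebra_hom k R \<iota> A \<alpha>"
    and "\<pi> ` carrier R = carrier A"
  shows "(\<lambda>x. x U) \<in> algebra_iso A
    (absolute_aluffi k A \<alpha> L j FF p) (absolute_aluffi_str k A \<alpha> L j FF p)
    (embedded_aluffi A L j U (FF U) (p U)) (embedded_aluffi_str A L j U (FF U) (p U))"
proof -
  have E: "module A E" using assms(6) by (simp add: fin_gen_module_def)
  have L: "module A L" unfolding L_def by (rule module_quotient_module[OF E submodule_torsion[OF E]])
  interpret aluffi_setup k A \<alpha> L F n j FF p
  proof (rule aluffi_setup.intro)
    show "field k" using assms(3) by (simp add: perfect_field_def)
    show "cring A" using assms(4) by (simp add: finite_type_algebra_def comm_algebra_def)
    show "module A L" by (rule L)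
  qed (fact assms)+
  have "U \<in> covers k A \<alpha>" using assms(11-13) by (simp add: covers_def U_def smooth_algebra_def)
  moreover have "smooth_algebra k (cov_ring U) (cov_str U)" using assms(11) by (simp add: U_def)
  ultimately show ?thesis by (rule smooth_limit)
qed

end
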